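(* Let $k$ be an algebraically closed field, $G$ a connected affine algebraic group over $k$, $N$ a closed, normal $k$-subgroup scheme of $G$, $Q$ a finite dimensional rational $N$-module, and $V$ a $G$-submodule of $Q$ with $\operatorname{soc}^NQ\subseteq V$. Assume that $(Q,V)$ is a strongly $G$-stable pair, afforded by a morphism $\alpha:G\to GL_k(Q)$. Let $J_V$ be the annihilator of $V$ in $\operatorname{End}_N(Q)$, $U:=1_Q+J_V$, and let $G^\diamond=G^\diamond(Q,V,\alpha)$ be the associated extension of $G$ by $U$. The following statements are equivalent: (1) The action of $N$ on $Q$ extends to a rational $G$-action, agreeing with the action of $G$ on $V$. (2) The exact sequence $1\to U\to G^\diamond\to G\to 1$ of algebraic groups is split by a homomorphism $G\to G^\diamond$ extending the map $\iota:N\to N^\diamond\subseteq G^\diamond$ given at the level of $S$-points by $\iota_S(n)=(1,n)$, $n\in N(S)$, $S$ a commutative $k$-algebra. (3) The exact sequence $1\to U\to G^\diamond/\iota(N)\to G/N\to 1$ of algebraic groups is split.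
   Context: The characteristic of $k$ is arbitrary. Algebraic group means reduced algebraic $k$-group scheme. Let $\rho:N\to GL_k(Q)$ define the $N$-action; $\operatorname{soc}^NQ$ is the $N$-socle. A "$G$-submodule $V$ of $Q$" is a rational $G$-module $V$ whose restriction $V|_N$ is an $N$-submodule of $Q$. The pair $(Q,V)$ is strongly $G$-stable, afforded by $\alpha$, if $\alpha:G\to GL_k(Q)$ is a morphism of $k$-schemes such that, for all commutative $k$-algebras $S$ and all $g\in G(S)$, $n\in N(S)$, $v\in V\otimes_kS$: (i) $\alpha(g)\rho(n)=\rho(gng^{-1})\alpha(g)$ and $\alpha(1)=1$; (ii) $\alpha(gn)=\alpha(g)\rho(n)$; (iii) $\alpha(g)v=gv$. Since $\operatorname{soc}^NQ\subseteq V$, the ideal $J_V$ is nilpotent and $U=1_Q+J_V$ is a closed unipotent subgroup of $GL_k(Q)$; it is stable under conjugation by all $\alpha(g)$ and contains all $\gamma(g,h):=\alpha(g)\alpha(h)\alpha(gh)^{-1}$. The group $G^\diamond(Q,V,\alpha)$ is the affine algebraic group with underlying $k$-scheme $U\times G$, identity $(1,1)$, and multiplication $(x,g)(y,h)=(x\cdot\alpha(g)y\alpha(g)^{-1}\cdot\gamma(g,h),\,gh)$. The map $G^\diamond\to G$ is $(u,g)\mapsto g$, the map $U\to G^\diamond$ is $u\mapsto(u,1)$, and $N^\diamond$ is the preimage of $N$ in $G^\diamond$. The map $\iota:N\to G^\diamond$ is an isomorphism of $N$ onto a closed normal $k$-subgroup scheme $\iota(N)$ of $G^\diamond$. Splittings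 are in the category of algebraic groups, i.e. by homomorphisms of algebraic groups. *)

theory Defs
  imports "HOL-Algebra.Algebra" "HOL-Analysis.Abstract_Topology"
begin

text \<open>
  Schemes over \<open>K\<close> are treated as functors of points. The commutative \<open>K\<close>-algebras \<open>S\<close> range over
  all algebras (locale \<^locale>\<open>algebra\<close>) whose carrier is a subset of a type \<open>'s\<close> that plays
  the role of a universe. If \<open>'s\<close> is large enough to receive an injection of the
  (infinite) field \<open>K\<close>, it contains a copy of every finitely generated \<open>K\<close>-algebra, so that
  Yoneda's lemma is available for all functors represented by finitely generated algebras.
\<close>

section \<open>Linear algebra\<close>

definition linear_maps ::
  "('r, 'x) ring_scheme \<Rightarrow> ('r, 'm) module \<Rightarrow> ('r, 'n) module \<Rightarrow> ('m \<Rightarrow> 'n) set" where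
  "linear_maps R M N = {f \<in> carrier M \<rightarrow>\<^sub>E carrier N.
     (\<forall>x\<in>carrier M. \<forall>y\<in>carrier M. f (x \<oplus>\<^bsub>M\<^esub> y) = f x \<oplus>\<^bsub>N\<^esub> f y) \<and>
     (\<forall>r\<in>carrier R. \<forall>x\<in>carrier M. f (r \<odot>\<^bsub>M\<^esub> x) = r \<odot>\<^bsub>N\<^esub> f x)}"

definition mod_span :: "('r, 'x) ring_scheme \<Rightarrow> ('r, 'm) module \<Rightarrow> 'm set \<Rightarrow> 'm set" where
  "mod_span R M E = \<Inter>{W. submodule W R M \<and> E \<subseteq> W}"

definition finite_dimensional :: "'k ring \<Rightarrow> ('k, 'q) module \<Rightarrow> bool" where
  "finite_dimensional K Q \<longleftrightarrow>
     module K Q \<and> (\<exists>E. finite E \<and> E \<subseteq> carrier Q \<and> mod_span K Q E = carrier Q)"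

text \<open>The (noncommutative) \<open>R\<close>-algebra of \<open>R\<close>-linear endomorphisms of \<open>M\<close>.\<close>

definition End_alg :: "('r, 'x) ring_scheme \<Rightarrow> ('r, 'm) module \<Rightarrow> ('r, 'm \<Rightarrow> 'm) module" where
  "End_alg R M =
    \<lparr>carrier = linear_maps R M M,
     monoid.mult = compose (carrier M),
     monoid.one = (\<lambda>x\<in>carrier M. x),
     ring.zero = (\<lambda>x\<in>carrier M. \<zero>\<^bsub>M\<^esub>),
     ring.add = (\<lambda>f g. \<lambda>x\<in>carrier M. f x \<oplus>\<^bsub>M\<^esub> g x),
     module.smult = (\<lambda>r f. \<lambda>x\<in>carrier M. r \<odot>\<^bsub>M\<^esub> f x)\<rparr>"

text \<open>
  The tensor product \<open>M \<otimes>\<^sub>R N\<close> is the free abelian group on \<open>M \<times> N\<close> modulo the subgroup generated by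
  the bilinearity relations; its elements are cosets.
\<close>

type_synonym ('m, 'n) tens = "(('m \<times> 'n) \<Rightarrow>\<^sub>0 int) set"

definition tensor_rel ::
  "('r, 'x) ring_scheme \<Rightarrow> ('r, 'm, 'y) module_scheme \<Rightarrow> ('r, 'n, 'z) module_scheme \<Rightarrow> ('m, 'n) tens" where
  "tensor_rel R M N = generate (free_Abelian_group (carrier M \<times> carrier N))
    ({frag_of (x \<oplus>\<^bsub>M\<^esub> x', y) - frag_of (x, y) - frag_of (x', y) | x x' y.
        x \<in> carrier M \<and> x' \<in> carrier M \<and> y \<in> carrier N} \<union>
     {frag_of (x, y \<oplus>\<^bsub>N\<^esub> y') - frag_of (x, y) - frag_of (x, y') | x y y'.
        x \<in> carrier M \<and> y \<in> carrier N \<and> y' \<in> carrier N} \<union>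
     {frag_of (r \<odot>\<^bsub>M\<^esub> x, y) - frag_of (x, r \<odot>\<^bsub>N\<^esub> y) | r x y.
        r \<in> carrier R \<and> x \<in> carrier M \<and> y \<in> carrier N})"

definition tensor_group ::
  "('r, 'x) ring_scheme \<Rightarrow> ('r, 'm, 'y) module_scheme \<Rightarrow> ('r, 'n, 'z) module_scheme \<Rightarrow> ('m, 'n) tens monoid" where
  "tensor_group R M N = free_Abelian_group (carrier M \<times> carrier N) Mod tensor_rel R M N"

text \<open>
  \<open>tensor_map R M' N' f g\<close> is \<open>f \<otimes> g : M \<otimes>\<^sub>R N \<rightarrow> M' \<otimes>\<^sub>R N'\<close>; the argument is a coset, and the union below
  consists of one and the same coset repeated.
\<close>

definition tensor_map ::
  "('r, 'x) ring_scheme \<Rightarrow> ('r, 'm, 'y) module_scheme \<Rightarrow> ('r, 'n, 'z) module_scheme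
    \<Rightarrow> ('a \<Rightarrow> 'm) \<Rightarrow> ('b \<Rightarrow> 'n) \<Rightarrow> ('a, 'b) tens \<Rightarrow> ('m, 'n) tens" where
  "tensor_map R M' N' f g C = (\<Union>c\<in>C.
     tensor_rel R M' N' #>\<^bsub>free_Abelian_group (carrier M' \<times> carrier N')\<^esub>
       frag_extend (\<lambda>(x, y). frag_of (f x, g y)) c)"

text \<open>The \<open>S\<close>-module \<open>Q \<otimes>\<^sub>K S\<close>; it is only used as a module, so \<open>mult\<close> and \<open>one\<close> are irrelevant.\<close>

definition base_change ::
  "'k ring \<Rightarrow> ('k, 'q) module \<Rightarrow> ('k, 's) module \<Rightarrow> ('s, ('q, 's) tens) module" where
  "base_change K Q S =
    \<lparr>carrier = carrier (tensor_group K Q S),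
     monoid.mult = undefined, monoid.one = undefined,
     ring.zero = \<one>\<^bsub>tensor_group K Q S\<^esub>,
     ring.add = monoid.mult (tensor_group K Q S),
     module.smult = (\<lambda>s. tensor_map K Q S id (\<lambda>t. s \<otimes>\<^bsub>S\<^esub> t))\<rparr>"

text \<open>\<open>f \<otimes> 1\<close> on \<open>Q \<otimes>\<^sub>K S\<close>, for an endomorphism \<open>f\<close> of \<open>Q\<close>.\<close>

definition end_base_change ::
  "'k ring \<Rightarrow> ('k, 'q) module \<Rightarrow> ('k, 's) module \<Rightarrow> ('q \<Rightarrow> 'q) \<Rightarrow> ('q, 's) tens \<Rightarrow> ('q, 's) tens" where
  "end_base_change K Q S f = restrict (tensor_map K Q S f id) (carrier (base_change K Q S))"

text \<open>A submodule \<open>W\<close> of \<open>Q\<close> as a module, and the canonical map \<open>W \<otimes>\<^sub>K S \<rightarrow> Q \<otimes>\<^sub>K S\<close>.\<close>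

abbreviation sub_mod :: "('k, 'q) module \<Rightarrow> 'q set \<Rightarrow> ('k, 'q) module" where
  "sub_mod Q W \<equiv> Q\<lparr>carrier := W\<rparr>"

abbreviation sub_incl ::
  "'k ring \<Rightarrow> ('k, 'q) module \<Rightarrow> ('k, 's) module \<Rightarrow> ('q, 's) tens \<Rightarrow> ('q, 's) tens" where
  "sub_incl K Q S \<equiv> tensor_map K Q S id id"

section \<open>Algebras\<close>

definition alg_hom :: "'k ring \<Rightarrow> ('k, 's) module \<Rightarrow> ('k, 't) module \<Rightarrow> ('s \<Rightarrow> 't) set" where
  "alg_hom K S T = {\<phi> \<in> ring_hom S T. \<phi> \<in> extensional (carrier S) \<and>
     (\<forall>c\<in>carrier K. \<forall>x\<in>carrier S. \<phi> (c \<odot>\<^bsub>S\<^esub> x) = c \<odot>\<^bsub>T\<^esub> \<phi> x)}"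

definition finitely_generated_algebra :: "'k ring \<Rightarrow> ('k, 's) module \<Rightarrow> bool" where
  "finitely_generated_algebra K A \<longleftrightarrow> algebra K A \<and>
     (\<exists>E. finite E \<and> E \<subseteq> carrier A \<and>
       (\<forall>B. subring B A \<and> submodule B K A \<and> E \<subseteq> B \<longrightarrow> B = carrier A))"

definition reduced_ring :: "('s, 'x) ring_scheme \<Rightarrow> bool" where
  "reduced_ring A \<longleftrightarrow> (\<forall>x\<in>carrier A. \<forall>n::nat. x [^]\<^bsub>A\<^esub> n = \<zero>\<^bsub>A\<^esub> \<longrightarrow> x = \<zero>\<^bsub>A\<^esub>)"

definition spec :: "('s, 'x) ring_scheme \<Rightarrow> 's set set" where
  "spec A = {P. primeideal P A}"

definition spec_topology :: "('s, 'x) ring_scheme \<Rightarrow> 's set topology" where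
  "spec_topology A =
     topology (\<lambda>W. \<exists>E\<subseteq>carrier A. W = {P \<in> spec A. \<not> E \<subseteq> P})"

lemma spec_prod:
  assumes P: "P \<in> spec A" and E1: "E1 \<subseteq> carrier A" and E2: "E2 \<subseteq> carrier A"
  shows "{a \<otimes>\<^bsub>A\<^esub> b | a b. a \<in> E1 \<and> b \<in> E2} \<subseteq> P \<longleftrightarrow> E1 \<subseteq> P \<or> E2 \<subseteq> P"
proof -
  interpret P: primeideal P A using P by (simp add: spec_def)
  show ?thesis
  proof
    assume L: "{a \<otimes>\<^bsub>A\<^esub> b | a b. a \<in> E1 \<and> b \<in> E2} \<subseteq> P"
    show "E1 \<subseteq> P \<or> E2 \<subseteq> P"
    proof (rule ccontr)
      assume "\<not> (E1 \<subseteq> P \<or> E2 \<subseteq> P)"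
      then obtain a b where ab: "a \<in> E1" "b \<in> E2" "a \<notin> P" "b \<notin> P" by blast
      then have "a \<otimes>\<^bsub>A\<^esub> b \<in> P" using L by blast
      moreover have "a \<in> carrier A" "b \<in> carrier A" using ab E1 E2 by auto
      ultimately show False using P.I_prime ab by metis
    qed
  next
    assume R: "E1 \<subseteq> P \<or> E2 \<subseteq> P"
    show "{a \<otimes>\<^bsub>A\<^esub> b | a b. a \<in> E1 \<and> b \<in> E2} \<subseteq> P"
    proof
      fix z assume "z \<in> {a \<otimes>\<^bsub>A\<^esub> b | a b. a \<in> E1 \<and> b \<in> E2}"
      then obtain a b where z: "z = a \<otimes>\<^bsub>A\<^esub> b" and ab: "a \<in> E1" "b \<in> E2" by blast
      then have "a \<in> carrier A" "b \<in> carrier A" using E1 E2 by auto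
      then show "z \<in> P" unfolding z
        using R ab P.I_l_closed P.I_r_closed by (metis subsetD)
    qed
  qed
qed

lemma istopology_spec:
  assumes "cring A"
  shows "istopology (\<lambda>W. \<exists>E\<subseteq>carrier A. W = {P \<in> spec A. \<not> E \<subseteq> P})"
proof -
  interpret cring A by fact
  show ?thesis unfolding istopology_def
  proof (intro conjI allI impI)
    fix W1 W2
    assume a1: "\<exists>E\<subseteq>carrier A. W1 = {P \<in> spec A. \<not> E \<subseteq> P}"
      and a2: "\<exists>E\<subseteq>carrier A. W2 = {P \<in> spec A. \<not> E \<subseteq> P}"
    from a1 obtain E1 where E1: "E1 \<subseteq> carrier A" and W1: "W1 = {P \<in> spec A. \<not> E1 \<subseteq> P}"
      by iprover
    from a2 obtain E2 where E2: "E2 \<subseteq> carrier A" and W2: "W2 = {P \<in> spec A. \<not> E2 \<subseteq> P}"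
      by iprover
    show "\<exists>E\<subseteq>carrier A. W1 \<inter> W2 = {P \<in> spec A. \<not> E \<subseteq> P}"
    proof (intro exI conjI)
      show "{a \<otimes>\<^bsub>A\<^esub> b | a b. a \<in> E1 \<and> b \<in> E2} \<subseteq> carrier A"
      proof
        fix z assume "z \<in> {a \<otimes>\<^bsub>A\<^esub> b | a b. a \<in> E1 \<and> b \<in> E2}"
        then obtain a b where "z = a \<otimes>\<^bsub>A\<^esub> b" "a \<in> E1" "b \<in> E2" by blast
        with subsetD[OF E1] subsetD[OF E2] show "z \<in> carrier A" by simp
      qed
      show "W1 \<inter> W2 = {P \<in> spec A. \<not> {a \<otimes>\<^bsub>A\<^esub> b | a b. a \<in> E1 \<and> b \<in> E2} \<subseteq> P}"
      proof (rule Set.set_eqI)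
        fix P
        show "P \<in> W1 \<inter> W2 \<longleftrightarrow> P \<in> {P \<in> spec A. \<not> {a \<otimes>\<^bsub>A\<^esub> b | a b. a \<in> E1 \<and> b \<in> E2} \<subseteq> P}"
          unfolding W1 W2 Int_iff mem_Collect_eq
          using spec_prod[OF _ E1 E2, of P] by iprover
      qed
    qed
  next
    fix \<W>
    assume "\<forall>W\<in>\<W>. \<exists>E\<subseteq>carrier A. W = {P \<in> spec A. \<not> E \<subseteq> P}"
    then obtain F where F: "\<forall>W\<in>\<W>. F W \<subseteq> carrier A \<and> W = {P \<in> spec A. \<not> F W \<subseteq> P}"
      by (rule bchoice[THEN exE])
    have mem: "P \<in> W \<longleftrightarrow> P \<in> spec A \<and> \<not> F W \<subseteq> P" if "W \<in> \<W>" for W P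
    proof -
      have "W = {P \<in> spec A. \<not> F W \<subseteq> P}" using F that by blast
      then have "P \<in> W \<longleftrightarrow> P \<in> {P \<in> spec A. \<not> F W \<subseteq> P}" by (rule arg_cong)
      then show ?thesis by simp
    qed
    show "\<exists>E\<subseteq>carrier A. \<Union>\<W> = {P \<in> spec A. \<not> E \<subseteq> P}"
    proof (intro exI conjI)
      show "\<Union>(F ` \<W>) \<subseteq> carrier A" using F by (simp add: UN_subset_iff)
      show "\<Union>\<W> = {P \<in> spec A. \<not> \<Union>(F ` \<W>) \<subseteq> P}"
      proof (rule Set.set_eqI)
        fix P
        have "P \<in> \<Union>\<W> \<longleftrightarrow> (\<exists>W\<in>\<W>. P \<in> spec A \<and> \<not> F W \<subseteq> P)"
          unfolding Union_iff using mem by (intro bex_cong) simp_all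
        also have "\<dots> \<longleftrightarrow> P \<in> {P \<in> spec A. \<not> \<Union>(F ` \<W>) \<subseteq> P}"
          by (simp add: UN_subset_iff)
        finally show "P \<in> \<Union>\<W> \<longleftrightarrow> P \<in> {P \<in> spec A. \<not> \<Union>(F ` \<W>) \<subseteq> P}" .
      qed
    qed
  qed
qed

text \<open>\<open>A\<close> as a \<open>B\<close>-module via \<open>\<phi> : B \<rightarrow> A\<close>.\<close>

definition restrict_scalars :: "('s, 'x) ring_scheme \<Rightarrow> ('b \<Rightarrow> 's) \<Rightarrow> ('b, 's) module" where
  "restrict_scalars A \<phi> =
    \<lparr>carrier = carrier A, monoid.mult = monoid.mult A, monoid.one = \<one>\<^bsub>A\<^esub>, ring.zero = \<zero>\<^bsub>A\<^esub>, ring.add = ring.add A,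
     module.smult = (\<lambda>b x. \<phi> b \<otimes>\<^bsub>A\<^esub> x)\<rparr>"

text \<open>
  It is enough to let the test modules range over modules with carrier in the type of \<open>B\<close>: flatness may
  be tested on inclusions of ideals of \<open>B\<close>, faithfulness on cyclic modules \<open>B / I\<close>.
\<close>

definition faithfully_flat :: "('k, 's) module \<Rightarrow> ('k, 's) module \<Rightarrow> ('s \<Rightarrow> 's) \<Rightarrow> bool" where
  "faithfully_flat B A \<phi> \<longleftrightarrow>
     (\<forall>(M :: ('s, 's) module) (M' :: ('s, 's) module) f.
        module B M \<and> module B M' \<and> f \<in> linear_maps B M M' \<and> inj_on f (carrier M) \<longrightarrow>
        inj_on (tensor_map B M' (restrict_scalars A \<phi>) f id)
          (carrier (tensor_group B M (restrict_scalars A \<phi>)))) \<and>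
     (\<forall>M :: ('s, 's) module.
        module B M \<and> carrier M \<noteq> {\<zero>\<^bsub>M\<^esub>} \<longrightarrow>
        carrier (tensor_group B M (restrict_scalars A \<phi>)) \<noteq> {\<one>\<^bsub>tensor_group B M (restrict_scalars A \<phi>)\<^esub>})"

section \<open>Group functors and affine group schemes\<close>

text \<open>\<open>pts G S\<close> is the group \<open>G(S)\<close>, and \<open>res G S T \<phi>\<close> is \<open>G(\<phi>) : G(S) \<rightarrow> G(T)\<close>.\<close>

record ('k, 's, 'g) kgroup =
  pts :: "('k, 's) module \<Rightarrow> 'g monoid"
  res :: "('k, 's) module \<Rightarrow> ('k, 's) module \<Rightarrow> ('s \<Rightarrow> 's) \<Rightarrow> 'g \<Rightarrow> 'g"

definition group_functor :: "'k ring \<Rightarrow> ('k, 's, 'g) kgroup \<Rightarrow> bool" where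
  "group_functor K G \<longleftrightarrow>
     (\<forall>S. algebra K S \<longrightarrow> group (pts G S)) \<and>
     (\<forall>S T \<phi>. algebra K S \<and> algebra K T \<and> \<phi> \<in> alg_hom K S T \<longrightarrow>
        res G S T \<phi> \<in> hom (pts G S) (pts G T)) \<and>
     (\<forall>S. algebra K S \<longrightarrow> (\<forall>g\<in>carrier (pts G S). res G S S (\<lambda>x\<in>carrier S. x) g = g)) \<and>
     (\<forall>S T R \<phi> \<psi>. algebra K S \<and> algebra K T \<and> algebra K R \<and>
        \<phi> \<in> alg_hom K S T \<and> \<psi> \<in> alg_hom K T R \<longrightarrow>
        (\<forall>g\<in>carrier (pts G S).
           res G S R (compose (carrier S) \<psi> \<phi>) g = res G T R \<psi> (res G S T \<phi> g)))"

text \<open>Morphisms of \<open>K\<close>-schemes are natural transformations of the functors of points.\<close>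

definition scheme_morphism ::
  "'k ring \<Rightarrow> ('k, 's, 'g) kgroup \<Rightarrow> ('k, 's, 'h) kgroup \<Rightarrow> (('k, 's) module \<Rightarrow> 'g \<Rightarrow> 'h) \<Rightarrow> bool" where
  "scheme_morphism K G H f \<longleftrightarrow>
     (\<forall>S. algebra K S \<longrightarrow> f S \<in> carrier (pts G S) \<rightarrow> carrier (pts H S)) \<and>
     (\<forall>S T \<phi>. algebra K S \<and> algebra K T \<and> \<phi> \<in> alg_hom K S T \<longrightarrow>
        (\<forall>g\<in>carrier (pts G S). f T (res G S T \<phi> g) = res H S T \<phi> (f S g)))"

definition group_morphism ::
  "'k ring \<Rightarrow> ('k, 's, 'g) kgroup \<Rightarrow> ('k, 's, 'h) kgroup \<Rightarrow> (('k, 's) module \<Rightarrow> 'g \<Rightarrow> 'h) \<Rightarrow> bool" where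
  "group_morphism K G H f \<longleftrightarrow> scheme_morphism K G H f \<and>
     (\<forall>S. algebra K S \<longrightarrow> f S \<in> hom (pts G S) (pts H S))"

text \<open>\<open>G\<close> is represented by \<open>A\<close> with universal element \<open>u \<in> G(A)\<close>.\<close>

definition represents :: "'k ring \<Rightarrow> ('k, 's, 'g) kgroup \<Rightarrow> ('k, 's) module \<Rightarrow> 'g \<Rightarrow> bool" where
  "represents K G A u \<longleftrightarrow> algebra K A \<and> u \<in> carrier (pts G A) \<and>
     (\<forall>S. algebra K S \<longrightarrow>
        bij_betw (\<lambda>\<phi>. res G A S \<phi> u) (alg_hom K A S) (carrier (pts G S)))"

definition affine_algebraic_group :: "'k ring \<Rightarrow> ('k, 's, 'g) kgroup \<Rightarrow> bool" where
  "affine_algebraic_group K G \<longleftrightarrow> group_functor K G \<and>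
     (\<exists>A u. represents K G A u \<and> finitely_generated_algebra K A \<and> reduced_ring A)"

definition connected_group :: "'k ring \<Rightarrow> ('k, 's, 'g) kgroup \<Rightarrow> bool" where
  "connected_group K G \<longleftrightarrow> (\<exists>A u. represents K G A u \<and> connected_space (spec_topology A))"

text \<open>\<open>K[G]\<close> as the set of morphisms from \<open>G\<close> to the affine line, \<open>S \<mapsto> S\<close>.\<close>

definition regular_functions ::
  "'k ring \<Rightarrow> ('k, 's, 'g) kgroup \<Rightarrow> (('k, 's) module \<Rightarrow> 'g \<Rightarrow> 's) set" where
  "regular_functions K G = {f.
     (\<forall>S. algebra K S \<longrightarrow> f S \<in> carrier (pts G S) \<rightarrow> carrier S) \<and>
     (\<forall>S T \<phi>. algebra K S \<and> algebra K T \<and> \<phi> \<in> alg_hom K S T \<longrightarrow>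
        (\<forall>g\<in>carrier (pts G S). f T (res G S T \<phi> g) = \<phi> (f S g)))}"

text \<open>Closed subschemes need not be reduced: arbitrary sets \<open>F\<close> of equations are allowed.\<close>

definition closed_normal_subgroup ::
  "'k ring \<Rightarrow> ('k, 's, 'g) kgroup \<Rightarrow> (('k, 's) module \<Rightarrow> 'g set) \<Rightarrow> bool" where
  "closed_normal_subgroup K G N \<longleftrightarrow>
     (\<forall>S. algebra K S \<longrightarrow> N S \<lhd> pts G S) \<and>
     (\<exists>F\<subseteq>regular_functions K G. \<forall>S. algebra K S \<longrightarrow>
        N S = {g \<in> carrier (pts G S). \<forall>f\<in>F. f S g = \<zero>\<^bsub>S\<^esub>})"

definition subgroup_functor ::
  "('k, 's, 'g) kgroup \<Rightarrow> (('k, 's) module \<Rightarrow> 'g set) \<Rightarrow> ('k, 's, 'g) kgroup" where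
  "subgroup_functor G N = \<lparr>pts = (\<lambda>S. (pts G S)\<lparr>carrier := N S\<rparr>), res = res G\<rparr>"

text \<open>
  \<open>\<pi> : G \<rightarrow> H\<close> is faithfully flat; the comorphism \<open>K[H] \<rightarrow> K[G]\<close> is the algebra map \<open>\<phi>\<close> that
  corresponds to the image under \<open>\<pi>\<close> of the universal element of \<open>G\<close>.
\<close>

definition faithfully_flat_morphism ::
  "'k ring \<Rightarrow> ('k, 's, 'g) kgroup \<Rightarrow> ('k, 's, 'h) kgroup \<Rightarrow> (('k, 's) module \<Rightarrow> 'g \<Rightarrow> 'h) \<Rightarrow> bool" where
  "faithfully_flat_morphism K G H \<pi> \<longleftrightarrow>
     (\<exists>A u B w \<phi>. represents K G A u \<and> represents K H B w \<and> \<phi> \<in> alg_hom K B A \<and>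
        \<pi> A u = res H B A \<phi> w \<and> faithfully_flat B A \<phi>)"

text \<open>
  \<open>\<pi> : G \<rightarrow> H\<close> is a quotient of \<open>G\<close> by the normal subgroup scheme \<open>N\<close>, i.e. \<open>H = G/N\<close>: a faithfully flat
  homomorphism of algebraic groups with (scheme theoretic) kernel \<open>N\<close>. This determines \<open>(H, \<pi>)\<close> up to
  unique isomorphism.
\<close>

definition is_quotient ::
  "'k ring \<Rightarrow> ('k, 's, 'g) kgroup \<Rightarrow> (('k, 's) module \<Rightarrow> 'g set) \<Rightarrow> ('k, 's, 'h) kgroup
    \<Rightarrow> (('k, 's) module \<Rightarrow> 'g \<Rightarrow> 'h) \<Rightarrow> bool" where
  "is_quotient K G N H \<pi> \<longleftrightarrow>
     affine_algebraic_group K H \<and> group_morphism K G H \<pi> \<and>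
     (\<forall>S. algebra K S \<longrightarrow> kernel (pts G S) (pts H S) (\<pi> S) = N S) \<and>
     faithfully_flat_morphism K G H \<pi>"

section \<open>Rational modules\<close>

text \<open>
  \<open>GL\<^sub>K(Q)\<close>, with \<open>S\<close>-points the units of \<open>End\<^sub>S(Q \<otimes>\<^sub>K S)\<close>. The base change of \<open>a\<close> along \<open>\<phi> : S \<rightarrow> T\<close>
  is the unique \<open>T\<close>-linear endomorphism of \<open>Q \<otimes>\<^sub>K T\<close> compatible with \<open>a\<close>.
\<close>

definition GL :: "'k ring \<Rightarrow> ('k, 'q) module \<Rightarrow> ('k, 's, ('q, 's) tens \<Rightarrow> ('q, 's) tens) kgroup" where
  "GL K Q =
    \<lparr>pts = (\<lambda>S. units_of (End_alg S (base_change K Q S))),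
     res = (\<lambda>S T \<phi> a. THE b. b \<in> carrier (End_alg T (base_change K Q T)) \<and>
        (\<forall>x\<in>carrier (base_change K Q S).
           b (tensor_map K Q T id \<phi> x) = tensor_map K Q T id \<phi> (a x)))\<rparr>"

text \<open>For a submodule \<open>W\<close> of the \<open>N\<close>-module \<open>(Q, \<rho>)\<close>, being an \<open>N\<close>-submodule.\<close>

definition N_submodule ::
  "'k ring \<Rightarrow> (('k, 's) module \<Rightarrow> 'g set) \<Rightarrow> ('k, 'q) module
    \<Rightarrow> (('k, 's) module \<Rightarrow> 'g \<Rightarrow> ('q, 's) tens \<Rightarrow> ('q, 's) tens) \<Rightarrow> 'q set \<Rightarrow> bool" where
  "N_submodule K N Q \<rho> W \<longleftrightarrow> submodule W K Q \<and>
     (\<forall>S. algebra K S \<longrightarrow> (\<forall>n\<in>N S. \<forall>x\<in>carrier (base_change K (sub_mod Q W) S).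
        \<rho> S n (sub_incl K Q S x) \<in> sub_incl K Q S ` carrier (base_change K (sub_mod Q W) S)))"

definition simple_N_submodule ::
  "'k ring \<Rightarrow> (('k, 's) module \<Rightarrow> 'g set) \<Rightarrow> ('k, 'q) module
    \<Rightarrow> (('k, 's) module \<Rightarrow> 'g \<Rightarrow> ('q, 's) tens \<Rightarrow> ('q, 's) tens) \<Rightarrow> 'q set \<Rightarrow> bool" where
  "simple_N_submodule K N Q \<rho> W \<longleftrightarrow> N_submodule K N Q \<rho> W \<and> W \<noteq> {\<zero>\<^bsub>Q\<^esub>} \<and>
     (\<forall>W'. N_submodule K N Q \<rho> W' \<and> W' \<subseteq> W \<longrightarrow> W' = {\<zero>\<^bsub>Q\<^esub>} \<or> W' = W)"

definition socle ::
  "'k ring \<Rightarrow> (('k, 's) module \<Rightarrow> 'g set) \<Rightarrow> ('k, 'q) module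
    \<Rightarrow> (('k, 's) module \<Rightarrow> 'g \<Rightarrow> ('q, 's) tens \<Rightarrow> ('q, 's) tens) \<Rightarrow> 'q set" where
  "socle K N Q \<rho> = mod_span K Q (\<Union>{W. simple_N_submodule K N Q \<rho> W})"

text \<open>
  A \<open>G\<close>-submodule of the \<open>N\<close>-module \<open>(Q, \<rho>)\<close>: a subspace \<open>V\<close> with a rational \<open>G\<close>-module structure \<open>\<sigma>\<close>
  whose restriction to \<open>N\<close> makes it an \<open>N\<close>-submodule of \<open>Q\<close>.
\<close>

definition G_submodule ::
  "'k ring \<Rightarrow> ('k, 's, 'g) kgroup \<Rightarrow> (('k, 's) module \<Rightarrow> 'g set) \<Rightarrow> ('k, 'q) module
    \<Rightarrow> (('k, 's) module \<Rightarrow> 'g \<Rightarrow> ('q, 's) tens \<Rightarrow> ('q, 's) tens) \<Rightarrow> 'q set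
    \<Rightarrow> (('k, 's) module \<Rightarrow> 'g \<Rightarrow> ('q, 's) tens \<Rightarrow> ('q, 's) tens) \<Rightarrow> bool" where
  "G_submodule K G N Q \<rho> V \<sigma> \<longleftrightarrow> submodule V K Q \<and> group_morphism K G (GL K (sub_mod Q V)) \<sigma> \<and>
     (\<forall>S. algebra K S \<longrightarrow> (\<forall>n\<in>N S. \<forall>v\<in>carrier (base_change K (sub_mod Q V) S).
        \<rho> S n (sub_incl K Q S v) = sub_incl K Q S (\<sigma> S n v)))"

text \<open>\<open>\<alpha> S g\<close> agrees on \<open>V \<otimes>\<^sub>K S\<close> with the action \<open>\<sigma>\<close> of \<open>G\<close> on \<open>V\<close>.\<close>

definition agrees_on ::
  "'k ring \<Rightarrow> ('k, 's, 'g) kgroup \<Rightarrow> ('k, 'q) module \<Rightarrow> 'q set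
    \<Rightarrow> (('k, 's) module \<Rightarrow> 'g \<Rightarrow> ('q, 's) tens \<Rightarrow> ('q, 's) tens)
    \<Rightarrow> (('k, 's) module \<Rightarrow> 'g \<Rightarrow> ('q, 's) tens \<Rightarrow> ('q, 's) tens) \<Rightarrow> bool" where
  "agrees_on K G Q V \<sigma> \<alpha> \<longleftrightarrow>
     (\<forall>S. algebra K S \<longrightarrow> (\<forall>g\<in>carrier (pts G S). \<forall>v\<in>carrier (base_change K (sub_mod Q V) S).
        \<alpha> S g (sub_incl K Q S v) = sub_incl K Q S (\<sigma> S g v)))"

definition strongly_stable ::
  "'k ring \<Rightarrow> ('k, 's, 'g) kgroup \<Rightarrow> (('k, 's) module \<Rightarrow> 'g set) \<Rightarrow> ('k, 'q) module
    \<Rightarrow> (('k, 's) module \<Rightarrow> 'g \<Rightarrow> ('q, 's) tens \<Rightarrow> ('q, 's) tens) \<Rightarrow> 'q set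
    \<Rightarrow> (('k, 's) module \<Rightarrow> 'g \<Rightarrow> ('q, 's) tens \<Rightarrow> ('q, 's) tens)
    \<Rightarrow> (('k, 's) module \<Rightarrow> 'g \<Rightarrow> ('q, 's) tens \<Rightarrow> ('q, 's) tens) \<Rightarrow> bool" where
  "strongly_stable K G N Q \<rho> V \<sigma> \<alpha> \<longleftrightarrow> scheme_morphism K G (GL K Q) \<alpha> \<and>
     (\<forall>S. algebra K S \<longrightarrow>
        (\<forall>g\<in>carrier (pts G S). \<forall>n\<in>N S.
           \<alpha> S g \<otimes>\<^bsub>pts (GL K Q) S\<^esub> \<rho> S n =
             \<rho> S (g \<otimes>\<^bsub>pts G S\<^esub> n \<otimes>\<^bsub>pts G S\<^esub> inv\<^bsub>pts G S\<^esub> g) \<otimes>\<^bsub>pts (GL K Q) S\<^esub> \<alpha> S g) \<and>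
        \<alpha> S \<one>\<^bsub>pts G S\<^esub> = \<one>\<^bsub>pts (GL K Q) S\<^esub> \<and>
        (\<forall>g\<in>carrier (pts G S). \<forall>n\<in>N S.
           \<alpha> S (g \<otimes>\<^bsub>pts G S\<^esub> n) = \<alpha> S g \<otimes>\<^bsub>pts (GL K Q) S\<^esub> \<rho> S n)) \<and>
     agrees_on K G Q V \<sigma> \<alpha>"

section \<open>The group extension\<close>

definition End_N ::
  "'k ring \<Rightarrow> (('k, 's) module \<Rightarrow> 'g set) \<Rightarrow> ('k, 'q) module
    \<Rightarrow> (('k, 's) module \<Rightarrow> 'g \<Rightarrow> ('q, 's) tens \<Rightarrow> ('q, 's) tens) \<Rightarrow> ('q \<Rightarrow> 'q) set" where
  "End_N K N Q \<rho> = {f \<in> carrier (End_alg K Q).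
     \<forall>S. algebra K S \<longrightarrow> (\<forall>n\<in>N S. \<forall>x\<in>carrier (base_change K Q S).
        end_base_change K Q S f (\<rho> S n x) = \<rho> S n (end_base_change K Q S f x))}"

definition annihilator_J ::
  "'k ring \<Rightarrow> (('k, 's) module \<Rightarrow> 'g set) \<Rightarrow> ('k, 'q) module
    \<Rightarrow> (('k, 's) module \<Rightarrow> 'g \<Rightarrow> ('q, 's) tens \<Rightarrow> ('q, 's) tens) \<Rightarrow> 'q set \<Rightarrow> ('q \<Rightarrow> 'q) set" where
  "annihilator_J K N Q \<rho> V = {f \<in> End_N K N Q \<rho>. \<forall>v\<in>V. f v = \<zero>\<^bsub>Q\<^esub>}"

text \<open>\<open>U(S) = 1 + J\<^sub>V \<otimes>\<^sub>K S\<close>, where \<open>J\<^sub>V \<otimes>\<^sub>K S\<close> is viewed as an \<open>S\<close>-submodule of \<open>End\<^sub>S(Q \<otimes>\<^sub>K S)\<close>.\<close>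

definition U_pts ::
  "'k ring \<Rightarrow> (('k, 's) module \<Rightarrow> 'g set) \<Rightarrow> ('k, 'q) module
    \<Rightarrow> (('k, 's) module \<Rightarrow> 'g \<Rightarrow> ('q, 's) tens \<Rightarrow> ('q, 's) tens) \<Rightarrow> 'q set
    \<Rightarrow> ('k, 's) module \<Rightarrow> (('q, 's) tens \<Rightarrow> ('q, 's) tens) set" where
  "U_pts K N Q \<rho> V S =
    {\<one>\<^bsub>End_alg S (base_change K Q S)\<^esub> \<oplus>\<^bsub>End_alg S (base_change K Q S)\<^esub> j | j.
       j \<in> mod_span S (End_alg S (base_change K Q S))
             (end_base_change K Q S ` annihilator_J K N Q \<rho> V)}"

definition gamma ::
  "'k ring \<Rightarrow> ('k, 's, 'g) kgroup \<Rightarrow> ('k, 'q) module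
    \<Rightarrow> (('k, 's) module \<Rightarrow> 'g \<Rightarrow> ('q, 's) tens \<Rightarrow> ('q, 's) tens)
    \<Rightarrow> ('k, 's) module \<Rightarrow> 'g \<Rightarrow> 'g \<Rightarrow> ('q, 's) tens \<Rightarrow> ('q, 's) tens" where
  "gamma K G Q \<alpha> S g h =
     \<alpha> S g \<otimes>\<^bsub>pts (GL K Q) S\<^esub> \<alpha> S h \<otimes>\<^bsub>pts (GL K Q) S\<^esub>
       inv\<^bsub>pts (GL K Q) S\<^esub> (\<alpha> S (g \<otimes>\<^bsub>pts G S\<^esub> h))"

definition G_diamond ::
  "'k ring \<Rightarrow> ('k, 's, 'g) kgroup \<Rightarrow> (('k, 's) module \<Rightarrow> 'g set) \<Rightarrow> ('k, 'q) module
    \<Rightarrow> (('k, 's) module \<Rightarrow> 'g \<Rightarrow> ('q, 's) tens \<Rightarrow> ('q, 's) tens) \<Rightarrow> 'q set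
    \<Rightarrow> (('k, 's) module \<Rightarrow> 'g \<Rightarrow> ('q, 's) tens \<Rightarrow> ('q, 's) tens)
    \<Rightarrow> ('k, 's, (('q, 's) tens \<Rightarrow> ('q, 's) tens) \<times> 'g) kgroup" where
  "G_diamond K G N Q \<rho> V \<alpha> =
    \<lparr>pts = (\<lambda>S.
       \<lparr>carrier = U_pts K N Q \<rho> V S \<times> carrier (pts G S),
        monoid.mult = (\<lambda>(x, g) (y, h).
          (x \<otimes>\<^bsub>pts (GL K Q) S\<^esub>
             (\<alpha> S g \<otimes>\<^bsub>pts (GL K Q) S\<^esub> y \<otimes>\<^bsub>pts (GL K Q) S\<^esub> inv\<^bsub>pts (GL K Q) S\<^esub> (\<alpha> S g)) \<otimes>\<^bsub>pts (GL K Q) S\<^esub>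
             gamma K G Q \<alpha> S g h,
           g \<otimes>\<^bsub>pts G S\<^esub> h)),
        monoid.one = (\<one>\<^bsub>pts (GL K Q) S\<^esub>, \<one>\<^bsub>pts G S\<^esub>)\<rparr>),
     res = (\<lambda>S T \<phi> (x, g). (res (GL K Q) S T \<phi> x, res G S T \<phi> g))\<rparr>"

definition iota ::
  "'k ring \<Rightarrow> ('k, 'q) module \<Rightarrow> ('k, 's) module \<Rightarrow> 'g \<Rightarrow> (('q, 's) tens \<Rightarrow> ('q, 's) tens) \<times> 'g" where
  "iota K Q S n = (\<one>\<^bsub>pts (GL K Q) S\<^esub>, n)"

text \<open>The homomorphism \<open>s : B \<rightarrow> E\<close> of group schemes splits \<open>p : E \<rightarrow> B\<close>.\<close>

definition splits ::
  "'k ring \<Rightarrow> ('k, 's, 'e) kgroup \<Rightarrow> ('k, 's, 'b) kgroup \<Rightarrow> (('k, 's) module \<Rightarrow> 'e \<Rightarrow> 'b)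
    \<Rightarrow> (('k, 's) module \<Rightarrow> 'b \<Rightarrow> 'e) \<Rightarrow> bool" where
  "splits K E B p s \<longleftrightarrow> group_morphism K B E s \<and>
     (\<forall>S. algebra K S \<longrightarrow> (\<forall>b\<in>carrier (pts B S). p S (s S b) = b))"

section \<open>The three statements\<close>

definition action_extends ::
  "'k ring \<Rightarrow> ('k, 's, 'g) kgroup \<Rightarrow> (('k, 's) module \<Rightarrow> 'g set) \<Rightarrow> ('k, 'q) module
    \<Rightarrow> (('k, 's) module \<Rightarrow> 'g \<Rightarrow> ('q, 's) tens \<Rightarrow> ('q, 's) tens) \<Rightarrow> 'q set
    \<Rightarrow> (('k, 's) module \<Rightarrow> 'g \<Rightarrow> ('q, 's) tens \<Rightarrow> ('q, 's) tens) \<Rightarrow> bool" where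
  "action_extends K G N Q \<rho> V \<sigma> \<longleftrightarrow>
     (\<exists>\<tau>. group_morphism K G (GL K Q) \<tau> \<and>
        (\<forall>S. algebra K S \<longrightarrow> (\<forall>n\<in>N S. \<tau> S n = \<rho> S n)) \<and>
        agrees_on K G Q V \<sigma> \<tau>)"

definition diamond_split ::
  "'k ring \<Rightarrow> ('k, 's, 'g) kgroup \<Rightarrow> (('k, 's) module \<Rightarrow> 'g set) \<Rightarrow> ('k, 'q) module
    \<Rightarrow> (('k, 's) module \<Rightarrow> 'g \<Rightarrow> ('q, 's) tens \<Rightarrow> ('q, 's) tens) \<Rightarrow> 'q set
    \<Rightarrow> (('k, 's) module \<Rightarrow> 'g \<Rightarrow> ('q, 's) tens \<Rightarrow> ('q, 's) tens) \<Rightarrow> bool" where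
  "diamond_split K G N Q \<rho> V \<alpha> \<longleftrightarrow>
     (\<exists>s. splits K (G_diamond K G N Q \<rho> V \<alpha>) G (\<lambda>S. snd) s \<and>
        (\<forall>S. algebra K S \<longrightarrow> (\<forall>n\<in>N S. s S n = iota K Q S n)))"

text \<open>
  Here \<open>\<pi>\<^sub>1 : G\<^sup>\<diamond> \<rightarrow> \<Gamma>\<^sub>1\<close> and \<open>\<pi>\<^sub>2 : G \<rightarrow> \<Gamma>\<^sub>2\<close> are quotients by \<open>\<iota>(N)\<close> and \<open>N\<close>, and \<open>p\<close> is the
  (unique) homomorphism \<open>G\<^sup>\<diamond>/\<iota>(N) \<rightarrow> G/N\<close> induced by the projection \<open>G\<^sup>\<diamond> \<rightarrow> G\<close>.
\<close>

definition quotient_split ::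
  "'k ring \<Rightarrow> ('k, 's, 'd \<times> 'g) kgroup \<Rightarrow> ('k, 's, 'x) kgroup \<Rightarrow> (('k, 's) module \<Rightarrow> 'd \<times> 'g \<Rightarrow> 'x)
    \<Rightarrow> ('k, 's, 'y) kgroup \<Rightarrow> (('k, 's) module \<Rightarrow> 'g \<Rightarrow> 'y) \<Rightarrow> bool" where
  "quotient_split K D \<Gamma>\<^sub>1 \<pi>\<^sub>1 \<Gamma>\<^sub>2 \<pi>\<^sub>2 \<longleftrightarrow>
     (\<exists>p s. group_morphism K \<Gamma>\<^sub>1 \<Gamma>\<^sub>2 p \<and>
        (\<forall>S. algebra K S \<longrightarrow> (\<forall>z\<in>carrier (pts D S). p S (\<pi>\<^sub>1 S z) = \<pi>\<^sub>2 S (snd z))) \<and>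
        splits K \<Gamma>\<^sub>1 \<Gamma>\<^sub>2 p s)"

end

theory Submission
  imports Defs
begin

text \<open>
  For the equivalence of (1) and (2), let \<open>S\<close> be a \<open>K\<close>-algebra. Say that an automorphism \<open>y\<close> of \<open>Q \<otimes> S\<close>
  lies over \<open>g \<in> G(S)\<close> if it intertwines the action of \<open>N\<close> with its conjugate by \<open>g\<close>, over all \<open>S\<close>-algebras, and agrees with \<open>g\<close>
  on \<open>V \<otimes> S\<close>. The pairs \<open>(y, g)\<close> of this kind form a group under componentwise multiplication. The
  automorphisms lying over \<open>1\<close> are the points of \<open>U\<close>, and \<open>\<alpha>(g)\<close> lies over \<open>g\<close>; so \<open>(x, g) \<mapsto> (x \<alpha>(g), g)\<close> is a
  bijection from \<open>G\<^sup>\<diamond>(S)\<close> onto this group, and the cocycle \<open>\<gamma>\<close> is exactly what makes it multiplicative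
  (\<open>D_mult\<close>). An action \<open>\<tau>\<close> of \<open>G\<close> on \<open>Q\<close> as in (1) is the same thing as a homomorphic choice of elements
  \<open>\<tau>(g)\<close> lying over \<open>g\<close> with \<open>\<tau> = \<rho>\<close> on \<open>N\<close>, that is, a splitting of \<open>G\<^sup>\<diamond> \<rightarrow> G\<close>; it extends \<open>\<iota>\<close> because
  \<open>\<alpha> = \<rho>\<close> on \<open>N\<close>.

  Two facts on \<open>U\<close> are needed for this. First, \<open>U(S) = 1 + J \<otimes> S\<close> consists of all endomorphisms of \<open>Q \<otimes> S\<close>
  that commute with \<open>N\<close> over every \<open>S\<close>-algebra and fix \<open>V\<close> (\<open>U_iff\<close>). To see that the coefficients of such
  an endomorphism are in \<open>J\<close>, one extracts them by functionals \<open>S \<rightarrow> K\<close> (slices), and compares with the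
  points of \<open>N\<close> over another algebra \<open>S'\<close> by working over \<open>S \<otimes> S'\<close> (\<open>End_slice_commutes\<close>). Secondly, the
  elements of \<open>U(S)\<close> are invertible (\<open>U_Units\<close>): the subspaces of \<open>Q\<close> killed by the powers of \<open>J\<close> increase
  strictly until they reach \<open>Q\<close>, because \<open>J\<close> kills \<open>V\<close>, hence the socle (\<open>Kfil_strict\<close>).

  The equivalence of (2) and (3) is a matter of faithfully flat descent. Let \<open>D \<rightarrow> \<Gamma>\<close> be faithfully
  flat with comorphism \<open>B \<rightarrow> A\<close>. A point \<open>y \<in> \<Gamma>(S)\<close>, that is, a map \<open>B \<rightarrow> S\<close>, lifts to a point of \<open>D\<close> over \<open>T = S \<otimes>\<^sub>B A\<close>, and \<open>S\<close> is
  the equalizer of the two maps \<open>T \<rightarrow> T \<otimes>\<^sub>S T\<close>, so that points over \<open>T\<close> that are independent of choices come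
  from \<open>S\<close> (\<open>local_lifting\<close>, \<open>affine_descent\<close>). Hence quotients have their universal property
  (\<open>quotient_universal\<close>), by which a splitting that extends \<open>\<iota>\<close> induces one of \<open>G\<^sup>\<diamond>/\<iota>(N) \<rightarrow> G/N\<close>. Conversely
  \<open>G\<^sup>\<diamond>\<close> is the fibre product of \<open>G\<^sup>\<diamond>/\<iota>(N)\<close> and \<open>G\<close> over \<open>G/N\<close> (\<open>fibre_product\<close>), and a splitting of
  \<open>G\<^sup>\<diamond>/\<iota>(N) \<rightarrow> G/N\<close> pulls back.

  All test algebras have their carriers in one type. Tensor products of such algebras can be moved back
  into it, because an algebraically closed field is infinite and the type has at least its cardinality
  (\<open>exists_in_universe\<close>).
\<close>

section \<open>Tensor products\<close>

definition pure_tensor ::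
  "('r, 'x) ring_scheme \<Rightarrow> ('r, 'm) module \<Rightarrow> ('r, 'n) module \<Rightarrow> 'm \<Rightarrow> 'n \<Rightarrow> ('m, 'n) tens" where
  "pure_tensor R M N x y =
     tensor_rel R M N #>\<^bsub>free_Abelian_group (carrier M \<times> carrier N)\<^esub> frag_of (x, y)"

locale tensor_product = M: module R M + N: module R N
  for R :: "('r, 'x) ring_scheme" and M :: "('r, 'm) module" and N :: "('r, 'n) module"
begin

abbreviation "FA \<equiv> free_Abelian_group (carrier M \<times> carrier N)"
abbreviation "TG \<equiv> tensor_group R M N"
abbreviation "pt \<equiv> pure_tensor R M N"

lemma rel_normal: "tensor_rel R M N \<lhd> FA"
proof -
  interpret FA: comm_group FA by (rule abelian_free_Abelian_group)
  have k2: "frag_of p - frag_of q \<in> carrier FA"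
    if "p \<in> carrier M \<times> carrier N" "q \<in> carrier M \<times> carrier N" for p q
    using order.trans[OF keys_diff[of "frag_of p" "frag_of q"], of "carrier M \<times> carrier N"] that by simp
  have k3: "frag_of p - frag_of q - frag_of r \<in> carrier FA"
    if "p \<in> carrier M \<times> carrier N" "q \<in> carrier M \<times> carrier N" "r \<in> carrier M \<times> carrier N" for p q r
    using order.trans[OF keys_diff[of "frag_of p - frag_of q" "frag_of r"], of "carrier M \<times> carrier N"] k2[of p q] that by simp
  have "subgroup (tensor_rel R M N) FA"
    unfolding tensor_rel_def
    by (rule FA.generate_is_subgroup, intro Un_least subsetI; elim CollectE exE conjE; hypsubst; rule k3 k2; simp)
  then show ?thesis by (rule FA.subgroup_imp_normal)
qed

lemma comm_group_TG: "comm_group TG"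
  unfolding tensor_group_def
  by (rule comm_group.abelian_FactGroup[OF abelian_free_Abelian_group normal_imp_subgroup[OF rel_normal]])

sublocale TG: comm_group TG by (rule comm_group_TG)

lemma coset_hom: "(\<lambda>c. tensor_rel R M N #>\<^bsub>FA\<^esub> c) \<in> hom FA TG"
  unfolding tensor_group_def by (rule normal.r_coset_hom_Mod[OF rel_normal])

lemma coset_add: "Poly_Mapping.keys a \<subseteq> carrier M \<times> carrier N \<Longrightarrow> Poly_Mapping.keys b \<subseteq> carrier M \<times> carrier N
  \<Longrightarrow> tensor_rel R M N #>\<^bsub>FA\<^esub> (a + b) = (tensor_rel R M N #>\<^bsub>FA\<^esub> a) \<otimes>\<^bsub>TG\<^esub> (tensor_rel R M N #>\<^bsub>FA\<^esub> b)"
  using hom_mult[OF coset_hom, of a b] by simp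

lemma coset_eqI:
  assumes "a - b \<in> tensor_rel R M N" "Poly_Mapping.keys a \<subseteq> carrier M \<times> carrier N" "Poly_Mapping.keys b \<subseteq> carrier M \<times> carrier N"
  shows "tensor_rel R M N #>\<^bsub>FA\<^esub> a = tensor_rel R M N #>\<^bsub>FA\<^esub> b"
proof -
  interpret FA: comm_group FA by (rule abelian_free_Abelian_group)
  have "a \<in> tensor_rel R M N #>\<^bsub>FA\<^esub> b"
    using assms(1) unfolding r_coset_def by (auto intro!: bexI[of _ "a - b"])
  then show ?thesis
    using FA.repr_independence[OF _ _ normal_imp_subgroup[OF rel_normal]] assms by simp
qed

lemma pt_closed [simp, intro]: "x \<in> carrier M \<Longrightarrow> y \<in> carrier N \<Longrightarrow> pt x y \<in> carrier TG"
  unfolding pure_tensor_def using hom_in_carrier[OF coset_hom, of "frag_of (x,y)"] by simp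

lemma keys2: "x \<in> carrier M \<Longrightarrow> y \<in> carrier N \<Longrightarrow> x' \<in> carrier M \<Longrightarrow> y' \<in> carrier N \<Longrightarrow>
  Poly_Mapping.keys (frag_of (x, y) + frag_of (x', y')) \<subseteq> carrier M \<times> carrier N"
  by (rule order.trans[OF Poly_Mapping.keys_add]) simp

lemma pt_add_left:
  assumes "x \<in> carrier M" "x' \<in> carrier M" "y \<in> carrier N"
  shows "pt (x \<oplus>\<^bsub>M\<^esub> x') y = pt x y \<otimes>\<^bsub>TG\<^esub> pt x' y"
  unfolding pure_tensor_def
  apply (subst coset_add[symmetric])
    apply (simp_all add: assms)
  apply (rule coset_eqI)
  unfolding tensor_rel_def
    apply (rule generate.incl)
  using assms keys2 by (auto simp: diff_diff_eq[symmetric])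

lemma pt_add_right:
  assumes "x \<in> carrier M" "y' \<in> carrier N" "y \<in> carrier N"
  shows "pt x (y \<oplus>\<^bsub>N\<^esub> y') = pt x y \<otimes>\<^bsub>TG\<^esub> pt x y'"
  unfolding pure_tensor_def
  apply (subst coset_add[symmetric])
    apply (simp_all add: assms)
  apply (rule coset_eqI)
  unfolding tensor_rel_def
    apply (rule generate.incl)
  using assms keys2 by (auto simp: diff_diff_eq[symmetric])

lemma pt_balanced:
  assumes "r \<in> carrier R" "x \<in> carrier M" "y \<in> carrier N"
  shows "pt (r \<odot>\<^bsub>M\<^esub> x) y = pt x (r \<odot>\<^bsub>N\<^esub> y)"
  unfolding pure_tensor_def
  apply (rule coset_eqI)
  unfolding tensor_rel_def
    apply (rule generate.incl)
  using assms by auto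

lemma pt_zero_left: "y \<in> carrier N \<Longrightarrow> pt \<zero>\<^bsub>M\<^esub> y = \<one>\<^bsub>TG\<^esub>"
  using pt_add_left[of "\<zero>\<^bsub>M\<^esub>" "\<zero>\<^bsub>M\<^esub>" y] TG.l_cancel_one' by simp

lemma pt_zero_right: "x \<in> carrier M \<Longrightarrow> pt x \<zero>\<^bsub>N\<^esub> = \<one>\<^bsub>TG\<^esub>"
  using pt_add_right[of x "\<zero>\<^bsub>N\<^esub>" "\<zero>\<^bsub>N\<^esub>"] TG.l_cancel_one' by simp

lemma pt_inv: "x \<in> carrier M \<Longrightarrow> y \<in> carrier N \<Longrightarrow> inv\<^bsub>TG\<^esub> (pt x y) = pt (\<ominus>\<^bsub>M\<^esub> x) y"
  by (rule TG.inv_equality) (simp_all add: pt_add_left[symmetric] M.M.l_neg pt_zero_left)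

lemma TG_carrierE:
  assumes "z \<in> carrier TG"
  obtains c where "Poly_Mapping.keys c \<subseteq> carrier M \<times> carrier N" "z = tensor_rel R M N #>\<^bsub>FA\<^esub> c"
  using assms unfolding tensor_group_def FactGroup_def RCOSETS_def by auto

lemma tensor_induct [consumes 1, case_names one add]:
  assumes z: "z \<in> carrier TG"
    and one: "P \<one>\<^bsub>TG\<^esub>"
    and add: "\<And>x y t. x \<in> carrier M \<Longrightarrow> y \<in> carrier N \<Longrightarrow> t \<in> carrier TG \<Longrightarrow> P t \<Longrightarrow> P (pt x y \<otimes>\<^bsub>TG\<^esub> t)"
  shows "P z"
proof -
  \<comment> \<open>Adding an element of \<open>H\<close> preserves \<open>P\<close>; unlike \<open>P\<close>, the set \<open>H\<close> is closed under sums.\<close>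
  define H where "H = {t \<in> carrier TG. \<forall>u\<in>carrier TG. P u \<longrightarrow> P (t \<otimes>\<^bsub>TG\<^esub> u)}"
  have pH: "pt x y \<in> H" if "x \<in> carrier M" "y \<in> carrier N" for x y
    using that add by (auto simp: H_def)
  have mH: "s \<otimes>\<^bsub>TG\<^esub> t \<in> H" if "s \<in> H" "t \<in> H" for s t
    using that by (auto simp: H_def TG.m_assoc)
  have cH: "tensor_rel R M N #>\<^bsub>FA\<^esub> c \<in> H \<and> tensor_rel R M N #>\<^bsub>FA\<^esub> (-c) \<in> H"
    if "Poly_Mapping.keys c \<subseteq> carrier M \<times> carrier N" for c
    using that
  proof (induction c rule: free_Abelian_group_induct[consumes 1, case_names zero diff one])
    case zero
    have "tensor_rel R M N #>\<^bsub>FA\<^esub> 0 = \<one>\<^bsub>TG\<^esub>"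
      using hom_one[OF coset_hom group_free_Abelian_group TG.is_group] by simp
    then show ?case by (simp add: H_def)
  next
    case (diff x y)
    have "tensor_rel R M N #>\<^bsub>FA\<^esub> (x - y) = (tensor_rel R M N #>\<^bsub>FA\<^esub> x) \<otimes>\<^bsub>TG\<^esub> (tensor_rel R M N #>\<^bsub>FA\<^esub> (-y))"
      using coset_add[of x "-y"] diff by simp
    moreover have "tensor_rel R M N #>\<^bsub>FA\<^esub> (-(x - y)) = (tensor_rel R M N #>\<^bsub>FA\<^esub> (-x)) \<otimes>\<^bsub>TG\<^esub> (tensor_rel R M N #>\<^bsub>FA\<^esub> y)"
      using coset_add[of "-x" y] diff by simp
    ultimately show ?case using diff mH by simp
  next
    case (one a)
    obtain x y where a: "a = (x, y)" "x \<in> carrier M" "y \<in> carrier N" using one by auto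
    have e: "tensor_rel R M N #>\<^bsub>FA\<^esub> frag_of a = pt x y" by (simp add: a pure_tensor_def)
    have "tensor_rel R M N #>\<^bsub>FA\<^esub> (- frag_of a) = inv\<^bsub>TG\<^esub> (pt x y)"
      using group_hom.hom_inv[OF group_hom.intro[OF group_free_Abelian_group TG.is_group group_hom_axioms.intro[OF coset_hom]], of "frag_of a"] a
      by (simp add: pure_tensor_def)
    then show ?case using e a pH pt_inv by simp
  qed
  obtain c where "Poly_Mapping.keys c \<subseteq> carrier M \<times> carrier N" "z = tensor_rel R M N #>\<^bsub>FA\<^esub> c"
    using z by (rule TG_carrierE)
  then have "z \<in> H" using cH by blast
  then have "P (z \<otimes>\<^bsub>TG\<^esub> \<one>\<^bsub>TG\<^esub>)" using one by (auto simp: H_def)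
  then show ?thesis using z by simp
qed

definition balanced :: "('h, 'z) monoid_scheme \<Rightarrow> ('m \<Rightarrow> 'n \<Rightarrow> 'h) \<Rightarrow> bool" where
  "balanced H f \<longleftrightarrow> 
    (\<forall>x\<in>carrier M. \<forall>y\<in>carrier N. f x y \<in> carrier H) \<and>
    (\<forall>x\<in>carrier M. \<forall>x'\<in>carrier M. \<forall>y\<in>carrier N. f (x \<oplus>\<^bsub>M\<^esub> x') y = f x y \<otimes>\<^bsub>H\<^esub> f x' y) \<and>
    (\<forall>x\<in>carrier M. \<forall>y\<in>carrier N. \<forall>y'\<in>carrier N. f x (y \<oplus>\<^bsub>N\<^esub> y') = f x y \<otimes>\<^bsub>H\<^esub> f x y') \<and>
    (\<forall>r\<in>carrier R. \<forall>x\<in>carrier M. \<forall>y\<in>carrier N. f (r \<odot>\<^bsub>M\<^esub> x) y = f x (r \<odot>\<^bsub>N\<^esub> y))"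

lemma balancedI:
  assumes "\<And>x y. x \<in> carrier M \<Longrightarrow> y \<in> carrier N \<Longrightarrow> f x y \<in> carrier H"
    and "\<And>x x' y. x \<in> carrier M \<Longrightarrow> x' \<in> carrier M \<Longrightarrow> y \<in> carrier N \<Longrightarrow> f (x \<oplus>\<^bsub>M\<^esub> x') y = f x y \<otimes>\<^bsub>H\<^esub> f x' y"
    and "\<And>x y y'. x \<in> carrier M \<Longrightarrow> y \<in> carrier N \<Longrightarrow> y' \<in> carrier N \<Longrightarrow> f x (y \<oplus>\<^bsub>N\<^esub> y') = f x y \<otimes>\<^bsub>H\<^esub> f x y'"
    and "\<And>r x y. r \<in> carrier R \<Longrightarrow> x \<in> carrier M \<Longrightarrow> y \<in> carrier N \<Longrightarrow> f (r \<odot>\<^bsub>M\<^esub> x) y = f x (r \<odot>\<^bsub>N\<^esub> y)"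
  shows "balanced H f"
  using assms by (simp add: balanced_def)

lemma lift_exists:
  assumes H: "comm_group H" and f: "balanced H f"
  shows "\<exists>h \<in> hom TG H. \<forall>x\<in>carrier M. \<forall>y\<in>carrier N. h (pt x y) = f x y"
proof -
  interpret H: comm_group H by fact
  have fc: "(\<lambda>(x, y). f x y) ` (carrier M \<times> carrier N) \<subseteq> carrier H" using f by (auto simp: balanced_def)
  obtain h where h: "h \<in> hom FA H" "\<And>p. p \<in> carrier M \<times> carrier N \<Longrightarrow> h (frag_of p) = (\<lambda>(x, y). f x y) p"
    using H.free_Abelian_group_universal[OF fc] by blast
  interpret h: group_hom FA H h
    by (intro group_hom.intro group_hom_axioms.intro h) simp_all
  have hd: "h (a - b) = h a \<otimes>\<^bsub>H\<^esub> inv\<^bsub>H\<^esub> h b" if "Poly_Mapping.keys a \<subseteq> carrier M \<times> carrier N" "Poly_Mapping.keys b \<subseteq> carrier M \<times> carrier N" for a b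
    using h.hom_mult[of a "-b"] h.hom_inv[of b] that by simp
  have k2: "Poly_Mapping.keys (frag_of p - frag_of q) \<subseteq> carrier M \<times> carrier N" if "p \<in> carrier M \<times> carrier N" "q \<in> carrier M \<times> carrier N" for p q
    by (rule order.trans[OF keys_diff]) (use that in auto)
  have k3: "Poly_Mapping.keys (frag_of p - frag_of q - frag_of r) \<subseteq> carrier M \<times> carrier N" if "p \<in> carrier M \<times> carrier N" "q \<in> carrier M \<times> carrier N" "r \<in> carrier M \<times> carrier N" for p q r
    by (rule order.trans[OF keys_diff]) (use that k2 in auto)
  have kk: "a \<otimes>\<^bsub>H\<^esub> b \<otimes>\<^bsub>H\<^esub> inv\<^bsub>H\<^esub> a \<otimes>\<^bsub>H\<^esub> inv\<^bsub>H\<^esub> b = \<one>\<^bsub>H\<^esub>" if "a \<in> carrier H" "b \<in> carrier H" for a b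
    using that by (metis H.inv_closed H.inv_mult H.m_assoc H.m_closed H.r_inv)
  have fcl: "f x y \<in> carrier H" if "x \<in> carrier M" "y \<in> carrier N" for x y
    using f that by (auto simp: balanced_def)
  have "tensor_rel R M N \<subseteq> kernel FA H h"
    unfolding tensor_rel_def
  proof (rule h.G.generate_subgroup_incl[OF _ h.subgroup_kernel], intro Un_least subsetI)
    fix c assume "c \<in> {frag_of (x \<oplus>\<^bsub>M\<^esub> x', y) - frag_of (x, y) - frag_of (x', y) |x x' y. x \<in> carrier M \<and> x' \<in> carrier M \<and> y \<in> carrier N}"
    then obtain x x' y where c: "x \<in> carrier M" "x' \<in> carrier M" "y \<in> carrier N" "c = frag_of (x \<oplus>\<^bsub>M\<^esub> x', y) - frag_of (x, y) - frag_of (x', y)" by blast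
    have "f (x \<oplus>\<^bsub>M\<^esub> x') y = f x y \<otimes>\<^bsub>H\<^esub> f x' y" using f c by (simp add: balanced_def)
    then show "c \<in> kernel FA H h" using c k2 k3 fcl by (simp add: kernel_def hd h(2) kk del: frag_of_in_free_Abelian_group)
  next
    fix c assume "c \<in> {frag_of (x, y \<oplus>\<^bsub>N\<^esub> y') - frag_of (x, y) - frag_of (x, y') |x y y'. x \<in> carrier M \<and> y \<in> carrier N \<and> y' \<in> carrier N}"
    then obtain x y y' where c: "x \<in> carrier M" "y' \<in> carrier N" "y \<in> carrier N" "c = frag_of (x, y \<oplus>\<^bsub>N\<^esub> y') - frag_of (x, y) - frag_of (x, y')" by blast
    have "f x (y \<oplus>\<^bsub>N\<^esub> y') = f x y \<otimes>\<^bsub>H\<^esub> f x y'" using f c by (simp add: balanced_def)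
    then show "c \<in> kernel FA H h" using c k2 k3 fcl by (simp add: kernel_def hd h(2) kk del: frag_of_in_free_Abelian_group)
  next
    fix c assume "c \<in> {frag_of (r \<odot>\<^bsub>M\<^esub> x, y) - frag_of (x, r \<odot>\<^bsub>N\<^esub> y) |r x y. r \<in> carrier R \<and> x \<in> carrier M \<and> y \<in> carrier N}"
    then obtain r x y where c: "x \<in> carrier M" "r \<in> carrier R" "y \<in> carrier N" "c = frag_of (r \<odot>\<^bsub>M\<^esub> x, y) - frag_of (x, r \<odot>\<^bsub>N\<^esub> y)" by blast
    have "f (r \<odot>\<^bsub>M\<^esub> x) y = f x (r \<odot>\<^bsub>N\<^esub> y)" using f c by (simp add: balanced_def)
    then show "c \<in> kernel FA H h" using c k2 fcl by (simp add: kernel_def hd h(2) del: frag_of_in_free_Abelian_group)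
  qed
  from h.FactGroup_universal_kernel[OF rel_normal this]
  obtain g where g: "g \<in> hom (FA Mod tensor_rel R M N) H" "\<And>x. x \<in> carrier FA \<Longrightarrow> g (tensor_rel R M N #>\<^bsub>FA\<^esub> x) = h x"
    by blast
  show ?thesis
    by (rule bexI[of _ g]) (use g h(2) in \<open>auto simp: pure_tensor_def tensor_group_def\<close>)
qed

definition lift :: "('h, 'z) monoid_scheme \<Rightarrow> ('m \<Rightarrow> 'n \<Rightarrow> 'h) \<Rightarrow> ('m, 'n) tens \<Rightarrow> 'h" where
  "lift H f = (SOME h. h \<in> hom TG H \<and> (\<forall>x\<in>carrier M. \<forall>y\<in>carrier N. h (pt x y) = f x y))"

lemma lift:
  assumes "comm_group H" and "balanced H f"
  shows "lift H f \<in> hom TG H" "\<And>x y. x \<in> carrier M \<Longrightarrow> y \<in> carrier N \<Longrightarrow> lift H f (pt x y) = f x y"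
  using someI_ex[OF lift_exists[OF assms, unfolded Bex_def]] unfolding lift_def by blast+

end

text \<open>Unlike \<open>linear_maps\<close>, this leaves the values outside the carrier free.\<close>

definition linear :: "('r, 'x) ring_scheme \<Rightarrow> ('r, 'm) module \<Rightarrow> ('r, 'n) module \<Rightarrow> ('m \<Rightarrow> 'n) \<Rightarrow> bool" where
  "linear R M N f \<longleftrightarrow> f \<in> carrier M \<rightarrow> carrier N \<and>
     (\<forall>x\<in>carrier M. \<forall>y\<in>carrier M. f (x \<oplus>\<^bsub>M\<^esub> y) = f x \<oplus>\<^bsub>N\<^esub> f y) \<and>
     (\<forall>r\<in>carrier R. \<forall>x\<in>carrier M. f (r \<odot>\<^bsub>M\<^esub> x) = r \<odot>\<^bsub>N\<^esub> f x)"

lemma linear_maps_iff: "f \<in> linear_maps R M N \<longleftrightarrow> linear R M N f \<and> f \<in> extensional (carrier M)"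
  by (auto simp: linear_maps_def linear_def PiE_iff)

lemma linearI:
  assumes "\<And>x. x \<in> carrier M \<Longrightarrow> f x \<in> carrier N"
    "\<And>x y. x \<in> carrier M \<Longrightarrow> y \<in> carrier M \<Longrightarrow> f (x \<oplus>\<^bsub>M\<^esub> y) = f x \<oplus>\<^bsub>N\<^esub> f y"
    "\<And>r x. r \<in> carrier R \<Longrightarrow> x \<in> carrier M \<Longrightarrow> f (r \<odot>\<^bsub>M\<^esub> x) = r \<odot>\<^bsub>N\<^esub> f x"
  shows "linear R M N f"
  using assms by (auto simp: linear_def)

lemma linearD:
  assumes "linear R M N f"
  shows "\<And>x. x \<in> carrier M \<Longrightarrow> f x \<in> carrier N"
    "\<And>x y. x \<in> carrier M \<Longrightarrow> y \<in> carrier M \<Longrightarrow> f (x \<oplus>\<^bsub>M\<^esub> y) = f x \<oplus>\<^bsub>N\<^esub> f y"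
    "\<And>r x. r \<in> carrier R \<Longrightarrow> x \<in> carrier M \<Longrightarrow> f (r \<odot>\<^bsub>M\<^esub> x) = r \<odot>\<^bsub>N\<^esub> f x"
  using assms by (auto simp: linear_def)

lemma linear_id: "module R M \<Longrightarrow> linear R M M id"
  by (auto simp: linear_def)

lemma linear_zero:
  assumes "linear R M N f" "module R M" "module R N" shows "f \<zero>\<^bsub>M\<^esub> = \<zero>\<^bsub>N\<^esub>"
proof -
  interpret M: module R M by fact
  interpret N: module R N by fact
  have "f \<zero>\<^bsub>M\<^esub> \<oplus>\<^bsub>N\<^esub> f \<zero>\<^bsub>M\<^esub> = f \<zero>\<^bsub>M\<^esub>" using linearD(2)[OF assms(1), of "\<zero>\<^bsub>M\<^esub>" "\<zero>\<^bsub>M\<^esub>"] by simp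
  then show ?thesis using linearD(1)[OF assms(1)] by simp
qed

context tensor_product begin

text \<open>On every representative of a coset, \<open>tensor_map\<close> computes the homomorphism that the universal
  property attaches to \<open>f \<otimes> g\<close>; so the union in its definition is a union of equal cosets.\<close>

lemma tensor_map_props:
  assumes "module R M'" "module R N'" and f: "linear R M M' f" and g: "linear R N N' g"
  shows tensor_map_hom: "tensor_map R M' N' f g \<in> hom TG (tensor_group R M' N')"
    and tensor_map_pt: "\<And>x y. x \<in> carrier M \<Longrightarrow> y \<in> carrier N \<Longrightarrow>
      tensor_map R M' N' f g (pt x y) = pure_tensor R M' N' (f x) (g y)"
proof -
  interpret T': tensor_product R M' N' using assms by (simp add: tensor_product_def)
  have b: "balanced T'.TG (\<lambda>x y. T'.pt (f x) (g y))"
    using linearD[OF f] linearD[OF g] 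
    by (intro balancedI) (simp_all add: T'.pt_add_left T'.pt_add_right T'.pt_balanced)
  define h where "h = lift T'.TG (\<lambda>x y. T'.pt (f x) (g y))"
  note h = lift[OF T'.comm_group_TG b, folded h_def]
  let ?F = "frag_extend (\<lambda>(x, y). frag_of (f x, g y))"
  have F: "Poly_Mapping.keys (?F c) \<subseteq> carrier M' \<times> carrier N' \<and> 
    tensor_rel R M' N' #>\<^bsub>T'.FA\<^esub> ?F c = h (tensor_rel R M N #>\<^bsub>FA\<^esub> c)"
    if "Poly_Mapping.keys c \<subseteq> carrier M \<times> carrier N" for c
    using that
  proof (induction c rule: free_Abelian_group_induct[consumes 1, case_names zero diff one])
    case zero
    have "h \<one>\<^bsub>TG\<^esub> = \<one>\<^bsub>T'.TG\<^esub>" using hom_one[OF h(1)] by simp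
    then show ?case
      using hom_one[OF coset_hom group_free_Abelian_group TG.is_group] hom_one[OF T'.coset_hom group_free_Abelian_group T'.TG.is_group] by simp
  next
    case (diff x y)
    have a: "tensor_rel R M N #>\<^bsub>FA\<^esub> x = (tensor_rel R M N #>\<^bsub>FA\<^esub> (x - y)) \<otimes>\<^bsub>TG\<^esub> (tensor_rel R M N #>\<^bsub>FA\<^esub> y)"
      using coset_add[of "x-y" y] diff keys_diff[of x y] by (simp add: order.trans)
    have k: "Poly_Mapping.keys (?F (x - y)) \<subseteq> carrier M' \<times> carrier N'"
      using diff keys_diff[of "?F x" "?F y"] by (auto simp: frag_extend_diff)
    have b: "tensor_rel R M' N' #>\<^bsub>T'.FA\<^esub> ?F x = (tensor_rel R M' N' #>\<^bsub>T'.FA\<^esub> (?F (x - y))) \<otimes>\<^bsub>T'.TG\<^esub> (tensor_rel R M' N' #>\<^bsub>T'.FA\<^esub> ?F y)"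
      using T'.coset_add[of "?F (x-y)" "?F y"] diff k by (simp add: frag_extend_diff)
    have c1: "tensor_rel R M N #>\<^bsub>FA\<^esub> (x - y) \<in> carrier TG" "tensor_rel R M N #>\<^bsub>FA\<^esub> y \<in> carrier TG"
      using hom_in_carrier[OF coset_hom] diff keys_diff[of x y] by (simp_all add: order.trans)
    have c2: "tensor_rel R M' N' #>\<^bsub>T'.FA\<^esub> (?F (x - y)) \<in> carrier T'.TG" "tensor_rel R M' N' #>\<^bsub>T'.FA\<^esub> ?F y \<in> carrier T'.TG"
      using hom_in_carrier[OF T'.coset_hom, of "?F (x - y)"] hom_in_carrier[OF T'.coset_hom, of "?F y"] diff k by (simp_all del: diff.IH)
    have "h (tensor_rel R M N #>\<^bsub>FA\<^esub> (x - y)) \<otimes>\<^bsub>T'.TG\<^esub> h (tensor_rel R M N #>\<^bsub>FA\<^esub> y) = (tensor_rel R M' N' #>\<^bsub>T'.FA\<^esub> (?F (x - y))) \<otimes>\<^bsub>T'.TG\<^esub> h (tensor_rel R M N #>\<^bsub>FA\<^esub> y)"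
      using a b hom_mult[OF h(1) c1] diff by simp
    moreover have "h (tensor_rel R M N #>\<^bsub>FA\<^esub> (x - y)) \<in> carrier T'.TG" "h (tensor_rel R M N #>\<^bsub>FA\<^esub> y) \<in> carrier T'.TG"
      using hom_in_carrier[OF h(1)] c1 by auto
    ultimately show ?case using k c2 by simp
  next
    case (one a)
    then show ?case using h(2) linearD(1)[OF f] linearD(1)[OF g] by (auto simp: pure_tensor_def split: prod.splits)
  qed
  have tm: "tensor_map R M' N' f g z = h z" if zc: "z \<in> carrier TG" for z
  proof -
    interpret FA: comm_group FA by (rule abelian_free_Abelian_group)
    obtain c where c: "Poly_Mapping.keys c \<subseteq> carrier M \<times> carrier N" "z = tensor_rel R M N #>\<^bsub>FA\<^esub> c"
      using TG_carrierE[OF zc] by blast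
    have cz: "c \<in> z" unfolding c(2) using FA.rcos_self[OF _ normal_imp_subgroup[OF rel_normal]] c(1) by simp
    have "tensor_rel R M' N' #>\<^bsub>T'.FA\<^esub> ?F c' = h z" if "c' \<in> z" for c'
    proof -
      have "tensor_rel R M N #>\<^bsub>FA\<^esub> c \<subseteq> carrier FA"
        by (rule FA.r_coset_subset_G[OF subgroup.subset[OF normal_imp_subgroup[OF rel_normal]]]) (simp add: c)
      then have "c' \<in> carrier FA" using that c(2) by blast
      moreover have "z = tensor_rel R M N #>\<^bsub>FA\<^esub> c'"
        using FA.repr_independence[OF _ _ normal_imp_subgroup[OF rel_normal]] that c by simp
      ultimately show ?thesis using F by simp
    qed
    then show ?thesis using cz unfolding tensor_map_def by blast
  qed
  show "tensor_map R M' N' f g \<in> hom TG (tensor_group R M' N')"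
    using h(1) tm unfolding hom_def by (auto simp: Pi_def)
  show "tensor_map R M' N' f g (pt x y) = T'.pt (f x) (g y)" if "x \<in> carrier M" "y \<in> carrier N" for x y
    using tm h(2) that by simp
qed

end

section \<open>Base change of modules\<close>

lemma (in algebra) smult_one_mult: "c \<in> carrier R \<Longrightarrow> s \<in> carrier M \<Longrightarrow> (c \<odot>\<^bsub>M\<^esub> \<one>\<^bsub>M\<^esub>) \<otimes>\<^bsub>M\<^esub> s = c \<odot>\<^bsub>M\<^esub> s"
  by (simp add: smult_assoc2)

lemma (in algebra) smult_assoc3: "c \<in> carrier R \<Longrightarrow> s \<in> carrier M \<Longrightarrow> t \<in> carrier M \<Longrightarrow> s \<otimes>\<^bsub>M\<^esub> (c \<odot>\<^bsub>M\<^esub> t) = c \<odot>\<^bsub>M\<^esub> (s \<otimes>\<^bsub>M\<^esub> t)"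
  using smult_assoc2[of c t s] by (simp add: m_comm)

lemma linear_mult:
  assumes "algebra K S" "s \<in> carrier S" shows "linear K S S (\<lambda>t. s \<otimes>\<^bsub>S\<^esub> t)"
proof -
  interpret algebra K S by fact
  show ?thesis by (rule linearI) (simp_all add: assms r_distr smult_assoc3)
qed

lemma alg_homD:
  assumes "\<phi> \<in> alg_hom K S T"
  shows "\<phi> \<in> ring_hom S T" "\<And>x. x \<in> carrier S \<Longrightarrow> \<phi> x \<in> carrier T"
    "\<And>x y. x \<in> carrier S \<Longrightarrow> y \<in> carrier S \<Longrightarrow> \<phi> (x \<otimes>\<^bsub>S\<^esub> y) = \<phi> x \<otimes>\<^bsub>T\<^esub> \<phi> y"
    "\<And>x y. x \<in> carrier S \<Longrightarrow> y \<in> carrier S \<Longrightarrow> \<phi> (x \<oplus>\<^bsub>S\<^esub> y) = \<phi> x \<oplus>\<^bsub>T\<^esub> \<phi> y"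
    "\<phi> \<one>\<^bsub>S\<^esub> = \<one>\<^bsub>T\<^esub>"
    "\<And>c x. c \<in> carrier K \<Longrightarrow> x \<in> carrier S \<Longrightarrow> \<phi> (c \<odot>\<^bsub>S\<^esub> x) = c \<odot>\<^bsub>T\<^esub> \<phi> x"
    "\<phi> \<in> extensional (carrier S)"
    "linear K S T \<phi>"
  using assms by (auto simp: alg_hom_def ring_hom_def linear_def)

lemma alg_homI:
  assumes "\<And>x. x \<in> carrier S \<Longrightarrow> \<phi> x \<in> carrier T"
    "\<And>x y. x \<in> carrier S \<Longrightarrow> y \<in> carrier S \<Longrightarrow> \<phi> (x \<otimes>\<^bsub>S\<^esub> y) = \<phi> x \<otimes>\<^bsub>T\<^esub> \<phi> y"
    "\<And>x y. x \<in> carrier S \<Longrightarrow> y \<in> carrier S \<Longrightarrow> \<phi> (x \<oplus>\<^bsub>S\<^esub> y) = \<phi> x \<oplus>\<^bsub>T\<^esub> \<phi> y"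
    "\<phi> \<one>\<^bsub>S\<^esub> = \<one>\<^bsub>T\<^esub>"
    "\<And>c x. c \<in> carrier K \<Longrightarrow> x \<in> carrier S \<Longrightarrow> \<phi> (c \<odot>\<^bsub>S\<^esub> x) = c \<odot>\<^bsub>T\<^esub> \<phi> x"
    "\<phi> \<in> extensional (carrier S)"
  shows "\<phi> \<in> alg_hom K S T"
  using assms by (auto simp: alg_hom_def ring_hom_def)

lemma alg_hom_id: "algebra K S \<Longrightarrow> (\<lambda>x\<in>carrier S. x) \<in> alg_hom K S S"
proof -
  assume "algebra K S" then interpret algebra K S .
  show ?thesis by (rule alg_homI) auto
qed

lemma alg_hom_comp:
  assumes "\<phi> \<in> alg_hom K S T" "\<psi> \<in> alg_hom K T U"
    and "algebra K S"
  shows "compose (carrier S) \<psi> \<phi> \<in> alg_hom K S U"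
proof -
  interpret algebra K S by fact
  show ?thesis
    by (rule alg_homI) (auto simp: compose_def alg_homD[OF assms(1)] alg_homD[OF assms(2)])
qed

lemma alg_hom_ext: "\<phi> \<in> alg_hom K S T \<Longrightarrow> \<psi> \<in> alg_hom K S T \<Longrightarrow> (\<And>x. x \<in> carrier S \<Longrightarrow> \<phi> x = \<psi> x) \<Longrightarrow> \<phi> = \<psi>"
  by (meson alg_homD(7) extensionalityI)

locale scalar_extension = Q: module K Q + S: algebra K S
  for K :: "'k ring" and Q :: "('k, 'q) module" and S :: "('k, 's) module"
begin

sublocale tensor_product K Q S
  by (intro tensor_product.intro Q.module_axioms S.module_axioms)

abbreviation "QS \<equiv> base_change K Q S"

lemma carrier_QS: "carrier QS = carrier TG"
  and add_QS: "add QS = monoid.mult TG"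
  and zero_QS: "\<zero>\<^bsub>QS\<^esub> = \<one>\<^bsub>TG\<^esub>"
  and smult_QS: "s \<odot>\<^bsub>QS\<^esub> x = tensor_map K Q S id (\<lambda>t. s \<otimes>\<^bsub>S\<^esub> t) x"
  by (simp_all add: base_change_def)

lemma abelian_group_QS: "abelian_group QS"
  by (rule abelian_groupI)
    (auto simp: carrier_QS add_QS zero_QS TG.m_ac intro: TG.l_inv_ex)

sublocale QS: abelian_group QS by (rule abelian_group_QS)

lemma pt_QS [simp, intro]: "q \<in> carrier Q \<Longrightarrow> s \<in> carrier S \<Longrightarrow> pt q s \<in> carrier QS"
  by (simp add: carrier_QS)

lemma pt_addl: "x \<in> carrier Q \<Longrightarrow> x' \<in> carrier Q \<Longrightarrow> y \<in> carrier S \<Longrightarrow> pt (x \<oplus>\<^bsub>Q\<^esub> x') y = pt x y \<oplus>\<^bsub>QS\<^esub> pt x' y"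
  by (simp add: add_QS pt_add_left)

lemma pt_addr: "x \<in> carrier Q \<Longrightarrow> y \<in> carrier S \<Longrightarrow> y' \<in> carrier S \<Longrightarrow> pt x (y \<oplus>\<^bsub>S\<^esub> y') = pt x y \<oplus>\<^bsub>QS\<^esub> pt x y'"
  by (simp add: add_QS pt_add_right)

lemma pt_0l [simp]: "y \<in> carrier S \<Longrightarrow> pt \<zero>\<^bsub>Q\<^esub> y = \<zero>\<^bsub>QS\<^esub>" and pt_0r [simp]: "x \<in> carrier Q \<Longrightarrow> pt x \<zero>\<^bsub>S\<^esub> = \<zero>\<^bsub>QS\<^esub>"
  by (simp_all add: zero_QS pt_zero_left pt_zero_right)

lemma QS_induct [consumes 1, case_names zero add]:
  assumes "z \<in> carrier QS" and "P \<zero>\<^bsub>QS\<^esub>"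
    and "\<And>x y t. x \<in> carrier Q \<Longrightarrow> y \<in> carrier S \<Longrightarrow> t \<in> carrier QS \<Longrightarrow> P t \<Longrightarrow> P (pt x y \<oplus>\<^bsub>QS\<^esub> t)"
  shows "P z"
  using tensor_induct[of z P] assms by (simp add: carrier_QS add_QS zero_QS)

lemma smult_hom: "s \<in> carrier S \<Longrightarrow> (\<lambda>x. s \<odot>\<^bsub>QS\<^esub> x) \<in> hom TG TG"
  and smult_pt: "s \<in> carrier S \<Longrightarrow> q \<in> carrier Q \<Longrightarrow> t \<in> carrier S \<Longrightarrow> s \<odot>\<^bsub>QS\<^esub> pt q t = pt q (s \<otimes>\<^bsub>S\<^esub> t)"
  using tensor_map_hom[OF Q.module_axioms S.module_axioms linear_id[OF Q.module_axioms] linear_mult[OF S.algebra_axioms], of s]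
    tensor_map_pt[OF Q.module_axioms S.module_axioms linear_id[OF Q.module_axioms] linear_mult[OF S.algebra_axioms], of s q t]
  unfolding smult_QS by simp_all

lemma smult_QS_closed: "s \<in> carrier S \<Longrightarrow> x \<in> carrier QS \<Longrightarrow> s \<odot>\<^bsub>QS\<^esub> x \<in> carrier QS"
  using hom_in_carrier[OF smult_hom] by (simp add: carrier_QS)

lemma smult_QS_add: "s \<in> carrier S \<Longrightarrow> x \<in> carrier QS \<Longrightarrow> y \<in> carrier QS \<Longrightarrow> s \<odot>\<^bsub>QS\<^esub> (x \<oplus>\<^bsub>QS\<^esub> y) = s \<odot>\<^bsub>QS\<^esub> x \<oplus>\<^bsub>QS\<^esub> s \<odot>\<^bsub>QS\<^esub> y"
  using hom_mult[OF smult_hom] by (simp add: carrier_QS add_QS)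

lemma smult_QS_zero: "s \<in> carrier S \<Longrightarrow> s \<odot>\<^bsub>QS\<^esub> \<zero>\<^bsub>QS\<^esub> = \<zero>\<^bsub>QS\<^esub>"
  using hom_one[OF smult_hom] TG.is_group by (simp add: zero_QS)

lemma module_QS: "module S QS"
proof (rule moduleI)
  show "cring S" by (rule S.M_cring)
  show "abelian_group QS" by (rule abelian_group_QS)
  fix a b x assume ab: "a \<in> carrier S" "b \<in> carrier S"
  { assume "x \<in> carrier QS"
    then show "(a \<oplus>\<^bsub>S\<^esub> b) \<odot>\<^bsub>QS\<^esub> x = a \<odot>\<^bsub>QS\<^esub> x \<oplus>\<^bsub>QS\<^esub> b \<odot>\<^bsub>QS\<^esub> x"
    proof (induction rule: QS_induct)
      case zero show ?case using ab by (simp add: smult_QS_zero)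
    next
      case (add x y t)
      then show ?case using ab
        by (simp add: smult_QS_add smult_pt S.l_distr pt_addr smult_QS_closed QS.a_ac)
    qed }
  { assume "x \<in> carrier QS"
    then show "(a \<otimes>\<^bsub>S\<^esub> b) \<odot>\<^bsub>QS\<^esub> x = a \<odot>\<^bsub>QS\<^esub> (b \<odot>\<^bsub>QS\<^esub> x)"
    proof (induction rule: QS_induct)
      case zero show ?case using ab by (simp add: smult_QS_zero)
    next
      case (add x y t)
      then show ?case using ab
        by (simp add: smult_QS_add smult_pt S.m_assoc smult_QS_closed)
    qed }
next
  fix x assume "x \<in> carrier QS"
  then show "\<one>\<^bsub>S\<^esub> \<odot>\<^bsub>QS\<^esub> x = x"
    by (induction rule: QS_induct) (simp_all add: smult_QS_zero smult_QS_add smult_pt)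
qed (simp_all add: smult_QS_closed smult_QS_add)

sublocale QSm: module S QS by (rule module_QS)

lemma pt_smult: "q \<in> carrier Q \<Longrightarrow> s \<in> carrier S \<Longrightarrow> pt q s = s \<odot>\<^bsub>QS\<^esub> pt q \<one>\<^bsub>S\<^esub>"
  by (simp add: smult_pt)

lemma pt_scalar: "c \<in> carrier K \<Longrightarrow> q \<in> carrier Q \<Longrightarrow> s \<in> carrier S \<Longrightarrow> pt (c \<odot>\<^bsub>Q\<^esub> q) s = (c \<odot>\<^bsub>S\<^esub> \<one>\<^bsub>S\<^esub>) \<odot>\<^bsub>QS\<^esub> pt q s"
  by (simp add: smult_pt pt_balanced S.smult_one_mult)

lemma linear_QS_ext:
  assumes "linear S QS M f" "linear S QS M g" "module S M"
    and "\<And>q. q \<in> carrier Q \<Longrightarrow> f (pt q \<one>\<^bsub>S\<^esub>) = g (pt q \<one>\<^bsub>S\<^esub>)" and "x \<in> carrier QS"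
  shows "f x = g x"
  using assms(5)
proof (induction rule: QS_induct)
  case zero show ?case using linear_zero assms(1-3) module_QS by metis
next
  case (add q s t)
  then show ?case
    by (subst (1 2) pt_smult) (simp_all add: linearD[OF assms(1)] linearD[OF assms(2)] assms(4))
qed

text \<open>The adjunction between base change and restriction of scalars: \<open>F : Q \<rightarrow> M\<close> extends to the \<open>S\<close>-linear
  map \<open>q \<otimes> s \<mapsto> s F(q)\<close>.\<close>

definition extend :: "('s, 'z) module \<Rightarrow> ('q \<Rightarrow> 'z) \<Rightarrow> ('q, 's) tens \<Rightarrow> 'z" where
  "extend M F = restrict (lift (add_monoid M) (\<lambda>q s. s \<odot>\<^bsub>M\<^esub> F q)) (carrier QS)"

lemma extend:
  assumes M: "module S M" and F: "\<And>q. q \<in> carrier Q \<Longrightarrow> F q \<in> carrier M"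
    "\<And>q q'. q \<in> carrier Q \<Longrightarrow> q' \<in> carrier Q \<Longrightarrow> F (q \<oplus>\<^bsub>Q\<^esub> q') = F q \<oplus>\<^bsub>M\<^esub> F q'"
    "\<And>c q. c \<in> carrier K \<Longrightarrow> q \<in> carrier Q \<Longrightarrow> F (c \<odot>\<^bsub>Q\<^esub> q) = (c \<odot>\<^bsub>S\<^esub> \<one>\<^bsub>S\<^esub>) \<odot>\<^bsub>M\<^esub> F q"
  shows "extend M F \<in> linear_maps S QS M"
    and "\<And>q s. q \<in> carrier Q \<Longrightarrow> s \<in> carrier S \<Longrightarrow> extend M F (pt q s) = s \<odot>\<^bsub>M\<^esub> F q"
proof -
  interpret M: module S M by fact
  have b: "balanced (add_monoid M) (\<lambda>q s. s \<odot>\<^bsub>M\<^esub> F q)"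
  proof (rule balancedI)
    fix r x y assume "r \<in> carrier K" "x \<in> carrier Q" "y \<in> carrier S"
    then show "y \<odot>\<^bsub>M\<^esub> F (r \<odot>\<^bsub>Q\<^esub> x) = (r \<odot>\<^bsub>S\<^esub> y) \<odot>\<^bsub>M\<^esub> F x"
      by (simp add: F M.smult_assoc1[symmetric] S.smult_assoc3)
  qed (simp_all add: F M.smult_l_distr M.smult_r_distr)
  let ?f = "lift (add_monoid M) (\<lambda>q s. s \<odot>\<^bsub>M\<^esub> F q)"
  note l = lift[OF M.a_comm_group b]
  show p: "extend M F (pt q s) = s \<odot>\<^bsub>M\<^esub> F q" if "q \<in> carrier Q" "s \<in> carrier S" for q s
    using l(2) that by (simp add: extend_def)
  have c: "?f x \<in> carrier M" if "x \<in> carrier QS" for x using hom_in_carrier[OF l(1)] that by (simp add: carrier_QS)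
  have a: "?f (x \<oplus>\<^bsub>QS\<^esub> y) = ?f x \<oplus>\<^bsub>M\<^esub> ?f y" if "x \<in> carrier QS" "y \<in> carrier QS" for x y
    using hom_mult[OF l(1)] that by (simp add: carrier_QS add_QS)
  have z: "?f \<zero>\<^bsub>QS\<^esub> = \<zero>\<^bsub>M\<^esub>"
    using hom_one[OF l(1) TG.is_group comm_group.axioms(2)[OF M.a_comm_group]] by (simp add: zero_QS)
  have s: "?f (r \<odot>\<^bsub>QS\<^esub> x) = r \<odot>\<^bsub>M\<^esub> ?f x" if "r \<in> carrier S" "x \<in> carrier QS" for r x
    using that(2)
  proof (induction rule: QS_induct)
    case zero then show ?case using that z by simp
  next
    case (add q s t)
    then show ?case using that c
      by (simp add: a QSm.smult_r_distr M.smult_r_distr smult_pt l(2) F M.smult_assoc1)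
  qed
  show "extend M F \<in> linear_maps S QS M"
    unfolding linear_maps_iff using c a s by (auto simp: extend_def intro!: linearI)
qed

lemma linear_zero_QS: "linear S QS M f \<Longrightarrow> module S M \<Longrightarrow> f \<zero>\<^bsub>QS\<^esub> = \<zero>\<^bsub>M\<^esub>"
  using linear_zero module_QS by metis

end

text \<open>Maps between base changes to different algebras are only additive, hence stated for
  an arbitrary pair of linear maps.\<close>

lemma tensor_map_base_change:
  assumes "module K Q" "algebra K S" "module K Q'" "algebra K T" "linear K Q Q' f" "linear K S T g"
  shows "\<And>x. x \<in> carrier (base_change K Q S) \<Longrightarrow> tensor_map K Q' T f g x \<in> carrier (base_change K Q' T)"
    and "\<And>x y. x \<in> carrier (base_change K Q S) \<Longrightarrow> y \<in> carrier (base_change K Q S) \<Longrightarrow>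
      tensor_map K Q' T f g (x \<oplus>\<^bsub>base_change K Q S\<^esub> y) = tensor_map K Q' T f g x \<oplus>\<^bsub>base_change K Q' T\<^esub> tensor_map K Q' T f g y"
    and "tensor_map K Q' T f g \<zero>\<^bsub>base_change K Q S\<^esub> = \<zero>\<^bsub>base_change K Q' T\<^esub>"
    and "\<And>q s. q \<in> carrier Q \<Longrightarrow> s \<in> carrier S \<Longrightarrow> tensor_map K Q' T f g (pure_tensor K Q S q s) = pure_tensor K Q' T (f q) (g s)"
proof -
  interpret A: scalar_extension K Q S using assms by (simp add: scalar_extension_def)
  interpret B: scalar_extension K Q' T using assms by (simp add: scalar_extension_def)
  note h = A.tensor_map_hom[OF assms(3) B.S.module_axioms assms(5,6)]
  note p = A.tensor_map_pt[OF assms(3) B.S.module_axioms assms(5,6)]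
  show "\<And>x. x \<in> carrier A.QS \<Longrightarrow> tensor_map K Q' T f g x \<in> carrier B.QS"
    using hom_in_carrier[OF h] by (simp add: A.carrier_QS B.carrier_QS)
  show "\<And>x y. x \<in> carrier A.QS \<Longrightarrow> y \<in> carrier A.QS \<Longrightarrow> tensor_map K Q' T f g (x \<oplus>\<^bsub>A.QS\<^esub> y) = tensor_map K Q' T f g x \<oplus>\<^bsub>B.QS\<^esub> tensor_map K Q' T f g y"
    using hom_mult[OF h] by (simp add: A.carrier_QS B.carrier_QS A.add_QS B.add_QS)
  show "tensor_map K Q' T f g \<zero>\<^bsub>A.QS\<^esub> = \<zero>\<^bsub>B.QS\<^esub>"
    using hom_one[OF h A.TG.is_group B.TG.is_group] by (simp add: A.zero_QS B.zero_QS)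
  show "\<And>q s. q \<in> carrier Q \<Longrightarrow> s \<in> carrier S \<Longrightarrow> tensor_map K Q' T f g (pure_tensor K Q S q s) = pure_tensor K Q' T (f q) (g s)"
    by (rule p)
qed

section \<open>Linear algebra over a field\<close>

lemma (in module) submoduleI_smult:
  assumes "W \<subseteq> carrier M" "\<zero>\<^bsub>M\<^esub> \<in> W" "\<And>a b. a \<in> W \<Longrightarrow> b \<in> W \<Longrightarrow> a \<oplus>\<^bsub>M\<^esub> b \<in> W"
    and "\<And>c a. c \<in> carrier R \<Longrightarrow> a \<in> W \<Longrightarrow> c \<odot>\<^bsub>M\<^esub> a \<in> W"
  shows "submodule W R M"
proof (rule submoduleI)
  fix a assume a: "a \<in> W"
  have "(\<ominus> \<one>) \<odot>\<^bsub>M\<^esub> a = \<ominus>\<^bsub>M\<^esub> a" using a assms(1) by (subst smult_l_minus) auto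
  then show "\<ominus>\<^bsub>M\<^esub> a \<in> W" using assms(4)[of "\<ominus> \<one>" a] a by simp
qed (use assms in auto)

lemma (in module) submoduleD:
  assumes "submodule W R M"
  shows "\<And>a. a \<in> W \<Longrightarrow> a \<in> carrier M" "\<zero>\<^bsub>M\<^esub> \<in> W" "\<And>a b. a \<in> W \<Longrightarrow> b \<in> W \<Longrightarrow> a \<oplus>\<^bsub>M\<^esub> b \<in> W"
    and "\<And>c a. c \<in> carrier R \<Longrightarrow> a \<in> W \<Longrightarrow> c \<odot>\<^bsub>M\<^esub> a \<in> W"
    and "\<And>a. a \<in> W \<Longrightarrow> \<ominus>\<^bsub>M\<^esub> a \<in> W"
    and "\<And>a b. a \<in> W \<Longrightarrow> b \<in> W \<Longrightarrow> a \<ominus>\<^bsub>M\<^esub> b \<in> W"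
proof -
  note E = submoduleE[OF assms]
  show 1: "\<And>a. a \<in> W \<Longrightarrow> a \<in> carrier M" using E(1) by blast
  obtain w where w: "w \<in> W" using E(2) by blast
  have "\<zero> \<odot>\<^bsub>M\<^esub> w = \<zero>\<^bsub>M\<^esub>" using w 1 by simp
  then show "\<zero>\<^bsub>M\<^esub> \<in> W" using E(4)[of \<zero> w] w by simp
  show "\<And>a b. a \<in> W \<Longrightarrow> b \<in> W \<Longrightarrow> a \<ominus>\<^bsub>M\<^esub> b \<in> W" unfolding a_minus_def using E by blast
qed (use submoduleE[OF assms] in auto)

lemma (in module) submodule_inter:
  assumes "\<And>W. W \<in> F \<Longrightarrow> submodule W R M" "F \<noteq> {}"
  shows "submodule (\<Inter>F) R M"
proof (rule submoduleI_smult)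
  show "\<Inter>F \<subseteq> carrier M" using assms submoduleD(1) by blast
qed (use submoduleD[OF assms(1)] in blast)+

lemma (in module) submodule_adjoin:
  assumes W: "submodule W R M" and x: "x \<in> carrier M"
  shows "submodule {w \<oplus>\<^bsub>M\<^esub> c \<odot>\<^bsub>M\<^esub> x | w c. w \<in> W \<and> c \<in> carrier R} R M" (is "submodule ?H R M")
    and "W \<subseteq> {w \<oplus>\<^bsub>M\<^esub> c \<odot>\<^bsub>M\<^esub> x | w c. w \<in> W \<and> c \<in> carrier R}"
    and "x \<in> {w \<oplus>\<^bsub>M\<^esub> c \<odot>\<^bsub>M\<^esub> x | w c. w \<in> W \<and> c \<in> carrier R}"
proof -
  note D = submoduleD[OF W]
  show "W \<subseteq> ?H"
  proof
    fix w assume "w \<in> W"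
    then have "w = w \<oplus>\<^bsub>M\<^esub> \<zero> \<odot>\<^bsub>M\<^esub> x" using x D(1) by simp
    then show "w \<in> ?H" using \<open>w \<in> W\<close> by blast
  qed
  have "x = \<zero>\<^bsub>M\<^esub> \<oplus>\<^bsub>M\<^esub> \<one> \<odot>\<^bsub>M\<^esub> x" using x by simp
  then show "x \<in> ?H" using D(2) by blast
  show "submodule ?H R M"
  proof (rule submoduleI_smult)
    show "?H \<subseteq> carrier M" using D(1) x by auto
    show "\<zero>\<^bsub>M\<^esub> \<in> ?H" using \<open>W \<subseteq> ?H\<close> D(2) by blast
    fix a b assume "a \<in> ?H" "b \<in> ?H"
    then obtain w c w' c' where ab: "a = w \<oplus>\<^bsub>M\<^esub> c \<odot>\<^bsub>M\<^esub> x" "b = w' \<oplus>\<^bsub>M\<^esub> c' \<odot>\<^bsub>M\<^esub> x" "w \<in> W" "w' \<in> W" "c \<in> carrier R" "c' \<in> carrier R" by blast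
    have "a \<oplus>\<^bsub>M\<^esub> b = (w \<oplus>\<^bsub>M\<^esub> w') \<oplus>\<^bsub>M\<^esub> (c \<oplus> c') \<odot>\<^bsub>M\<^esub> x"
      using ab D(1) x by (simp add: smult_l_distr M.a_ac)
    moreover have "w \<oplus>\<^bsub>M\<^esub> w' \<in> W" "c \<oplus> c' \<in> carrier R" using ab D by auto
    ultimately show "a \<oplus>\<^bsub>M\<^esub> b \<in> ?H" by blast
  next
    fix r a assume r: "r \<in> carrier R" and "a \<in> ?H"
    then obtain w c where a: "a = w \<oplus>\<^bsub>M\<^esub> c \<odot>\<^bsub>M\<^esub> x" "w \<in> W" "c \<in> carrier R" by blast
    have "r \<odot>\<^bsub>M\<^esub> a = r \<odot>\<^bsub>M\<^esub> w \<oplus>\<^bsub>M\<^esub> (r \<otimes> c) \<odot>\<^bsub>M\<^esub> x"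
      using a r D(1) x by (simp add: smult_r_distr smult_assoc1)
    moreover have "r \<odot>\<^bsub>M\<^esub> w \<in> W" "r \<otimes> c \<in> carrier R" using a r D by auto
    ultimately show "r \<odot>\<^bsub>M\<^esub> a \<in> ?H" by blast
  qed
qed

lemma mod_span:
  assumes "module R M" "E \<subseteq> carrier M"
  shows mod_span_submodule: "submodule (mod_span R M E) R M" and mod_span_incl: "E \<subseteq> mod_span R M E"
proof -
  interpret module R M by fact
  have "carrier M \<in> {W. submodule W R M \<and> E \<subseteq> W}" using assms carrier_is_submodule by simp
  then show "submodule (mod_span R M E) R M" unfolding mod_span_def
    by (intro submodule_inter) blast+
  show "E \<subseteq> mod_span R M E" unfolding mod_span_def by blast
qed

lemma mod_span_least: "submodule W R M \<Longrightarrow> E \<subseteq> W \<Longrightarrow> mod_span R M E \<subseteq> W"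
  unfolding mod_span_def by blast

text \<open>Spelled out, since the ring \<open>K\<close> is not a module record over itself.\<close>

definition functional :: "('k, 'x) ring_scheme \<Rightarrow> ('k, 'm) module \<Rightarrow> ('m \<Rightarrow> 'k) \<Rightarrow> bool" where
  "functional K M l \<longleftrightarrow> l \<in> carrier M \<rightarrow> carrier K \<and>
     (\<forall>x\<in>carrier M. \<forall>y\<in>carrier M. l (x \<oplus>\<^bsub>M\<^esub> y) = l x \<oplus>\<^bsub>K\<^esub> l y) \<and>
     (\<forall>c\<in>carrier K. \<forall>x\<in>carrier M. l (c \<odot>\<^bsub>M\<^esub> x) = c \<otimes>\<^bsub>K\<^esub> l x)"

lemma functionalD:
  assumes "functional K M l"
  shows "\<And>x. x \<in> carrier M \<Longrightarrow> l x \<in> carrier K"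
    "\<And>x y. x \<in> carrier M \<Longrightarrow> y \<in> carrier M \<Longrightarrow> l (x \<oplus>\<^bsub>M\<^esub> y) = l x \<oplus>\<^bsub>K\<^esub> l y"
    "\<And>c x. c \<in> carrier K \<Longrightarrow> x \<in> carrier M \<Longrightarrow> l (c \<odot>\<^bsub>M\<^esub> x) = c \<otimes>\<^bsub>K\<^esub> l x"
  using assms by (auto simp: functional_def)

lemma functional_zero:
  assumes "functional K M l" "module K M" shows "l \<zero>\<^bsub>M\<^esub> = \<zero>\<^bsub>K\<^esub>"
proof -
  interpret module K M by fact
  have "l (\<zero>\<^bsub>K\<^esub> \<odot>\<^bsub>M\<^esub> \<zero>\<^bsub>M\<^esub>) = \<zero>\<^bsub>K\<^esub> \<otimes>\<^bsub>K\<^esub> l \<zero>\<^bsub>M\<^esub>" using functionalD(3)[OF assms(1)] by blast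
  then show ?thesis using functionalD(1)[OF assms(1)] by simp
qed

text \<open>A maximal submodule among those that contain \<open>W\<close> but not \<open>v\<close> is a hyperplane complementary to
  the line through \<open>v\<close>, and the coordinate along \<open>v\<close> is the functional.\<close>

lemma separating_functional:
  assumes "field K" "module K M" and W: "submodule W K M" and v: "v \<in> carrier M" "v \<notin> W"
  obtains l where "functional K M l" "\<And>w. w \<in> W \<Longrightarrow> l w = \<zero>\<^bsub>K\<^esub>" "l v = \<one>\<^bsub>K\<^esub>"
proof -
  interpret K: field K by fact
  interpret module K M by fact
  define A where "A = {H. submodule H K M \<and> W \<subseteq> H \<and> v \<notin> H}"
  have "\<exists>H\<in>A. \<forall>Y\<in>A. H \<subseteq> Y \<longrightarrow> Y = H"
  proof (rule subset_Zorn_nonempty)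
    show "A \<noteq> {}" unfolding A_def using W v by blast
    fix C assume C: "C \<noteq> {}" "subset.chain A C"
    then have sub: "\<And>H. H \<in> C \<Longrightarrow> submodule H K M \<and> W \<subseteq> H \<and> v \<notin> H"
      and ch: "\<And>H H'. H \<in> C \<Longrightarrow> H' \<in> C \<Longrightarrow> H \<subseteq> H' \<or> H' \<subseteq> H"
      unfolding subset.chain_def A_def by blast+
    have "submodule (\<Union>C) K M"
    proof (rule submoduleI_smult)
      show "\<Union>C \<subseteq> carrier M" using sub submoduleD(1) by blast
      show "\<zero>\<^bsub>M\<^esub> \<in> \<Union>C" using C(1) sub submoduleD(2) by blast
      show "a \<oplus>\<^bsub>M\<^esub> b \<in> \<Union>C" if ab: "a \<in> \<Union>C" "b \<in> \<Union>C" for a b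
      proof -
        obtain H H' where "H \<in> C" "H' \<in> C" "a \<in> H" "b \<in> H'" using ab by blast
        then obtain H'' where "H'' \<in> C" "a \<in> H''" "b \<in> H''" using ch by blast
        then show ?thesis using sub submoduleD(3) by blast
      qed
      show "c \<odot>\<^bsub>M\<^esub> a \<in> \<Union>C" if "c \<in> carrier K" "a \<in> \<Union>C" for c a
        using that sub submoduleD(4) by blast
    qed
    then show "\<Union>C \<in> A" unfolding A_def using C(1) sub by blast
  qed
  then obtain H where HA: "H \<in> A" and HY: "\<forall>Y\<in>A. H \<subseteq> Y \<longrightarrow> Y = H" by (elim bexE)
  have H: "submodule H K M" "W \<subseteq> H" "v \<notin> H" using HA by (simp_all add: A_def)
  have max: "Y = H" if "submodule Y K M" "v \<notin> Y" "H \<subseteq> Y" for Y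
  proof -
    have "Y \<in> A" using that H(2) by (auto simp: A_def)
    then show ?thesis using HY that(3) by simp
  qed
  note D = submoduleD[OF H(1)]
  have ex: "\<exists>c\<in>carrier K. \<exists>h\<in>H. x = h \<oplus>\<^bsub>M\<^esub> c \<odot>\<^bsub>M\<^esub> v" if x: "x \<in> carrier M" for x
  proof (cases "x \<in> H")
    case True
    then show ?thesis using x v by (intro bexI[of _ "\<zero>\<^bsub>K\<^esub>"] bexI[of _ x]) simp_all
  next
    case False
    let ?Y = "{w \<oplus>\<^bsub>M\<^esub> c \<odot>\<^bsub>M\<^esub> x | w c. w \<in> H \<and> c \<in> carrier K}"
    have "v \<in> ?Y" using max[OF submodule_adjoin(1)[OF H(1) x]] submodule_adjoin(2,3)[OF H(1) x] False by blast
    then obtain w c where wc: "v = w \<oplus>\<^bsub>M\<^esub> c \<odot>\<^bsub>M\<^esub> x" "w \<in> H" "c \<in> carrier K" by blast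
    have c0: "c \<noteq> \<zero>\<^bsub>K\<^esub>" using wc H(3) x D(1) by auto
    then have inv: "inv\<^bsub>K\<^esub> c \<in> carrier K" "inv\<^bsub>K\<^esub> c \<otimes>\<^bsub>K\<^esub> c = \<one>\<^bsub>K\<^esub>"
      using wc(3) K.field_Units by auto
    have "inv\<^bsub>K\<^esub> c \<odot>\<^bsub>M\<^esub> v = inv\<^bsub>K\<^esub> c \<odot>\<^bsub>M\<^esub> w \<oplus>\<^bsub>M\<^esub> x"
      using wc inv x D(1) by (simp add: smult_r_distr smult_assoc1[symmetric])
    then have "x = (\<ominus>\<^bsub>M\<^esub> (inv\<^bsub>K\<^esub> c \<odot>\<^bsub>M\<^esub> w)) \<oplus>\<^bsub>M\<^esub> inv\<^bsub>K\<^esub> c \<odot>\<^bsub>M\<^esub> v"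
      using wc inv x D(1) by (simp add: M.a_assoc[symmetric] M.l_neg)
    moreover have "\<ominus>\<^bsub>M\<^esub> (inv\<^bsub>K\<^esub> c \<odot>\<^bsub>M\<^esub> w) \<in> H" using inv wc D by blast
    ultimately show ?thesis using inv by blast
  qed
  have un: "c = c'" if "h \<oplus>\<^bsub>M\<^esub> c \<odot>\<^bsub>M\<^esub> v = h' \<oplus>\<^bsub>M\<^esub> c' \<odot>\<^bsub>M\<^esub> v" "h \<in> H" "h' \<in> H" "c \<in> carrier K" "c' \<in> carrier K" for h h' c c'
  proof (rule ccontr)
    assume ne: "c \<noteq> c'"
    define d where "d = c \<ominus>\<^bsub>K\<^esub> c'"
    have d: "d \<in> carrier K" "d \<noteq> \<zero>\<^bsub>K\<^esub>" using that ne by (simp_all add: d_def)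
    then have inv: "inv\<^bsub>K\<^esub> d \<in> carrier K" "inv\<^bsub>K\<^esub> d \<otimes>\<^bsub>K\<^esub> d = \<one>\<^bsub>K\<^esub>"
      using K.field_Units by auto
    have cc: "h \<in> carrier M" "h' \<in> carrier M" using that D(1) by auto
    have "d \<odot>\<^bsub>M\<^esub> v = c \<odot>\<^bsub>M\<^esub> v \<ominus>\<^bsub>M\<^esub> c' \<odot>\<^bsub>M\<^esub> v"
      using that v by (simp add: d_def a_minus_def smult_l_distr smult_l_minus)
    also have "\<dots> = (\<ominus>\<^bsub>M\<^esub> h \<oplus>\<^bsub>M\<^esub> (h \<oplus>\<^bsub>M\<^esub> c \<odot>\<^bsub>M\<^esub> v)) \<ominus>\<^bsub>M\<^esub> c' \<odot>\<^bsub>M\<^esub> v"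
      using that(4,5) v cc by (simp add: M.a_assoc[symmetric] M.l_neg)
    also have "\<dots> = \<ominus>\<^bsub>M\<^esub> h \<oplus>\<^bsub>M\<^esub> h'"
      unfolding that(1) using that(3-5) v cc by (simp add: M.a_assoc a_minus_def M.r_neg)
    finally have "d \<odot>\<^bsub>M\<^esub> v \<in> H" using that D by simp
    then have "inv\<^bsub>K\<^esub> d \<odot>\<^bsub>M\<^esub> (d \<odot>\<^bsub>M\<^esub> v) \<in> H" using inv D by blast
    then show False using H(3) inv d v by (simp add: smult_assoc1[symmetric])
  qed
  define l where "l x = (THE c. c \<in> carrier K \<and> (\<exists>h\<in>H. x = h \<oplus>\<^bsub>M\<^esub> c \<odot>\<^bsub>M\<^esub> v))" for x
  have l: "l (h \<oplus>\<^bsub>M\<^esub> c \<odot>\<^bsub>M\<^esub> v) = c" if "h \<in> H" "c \<in> carrier K" for h c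
    unfolding l_def by (rule the_equality) (use that un in blast)+
  have fl: "functional K M l"
    unfolding functional_def
  proof (intro conjI ballI)
    show "l \<in> carrier M \<rightarrow> carrier K" using ex l by force
    fix x assume x: "x \<in> carrier M"
    obtain c h where ch: "c \<in> carrier K" "h \<in> H" "x = h \<oplus>\<^bsub>M\<^esub> c \<odot>\<^bsub>M\<^esub> v" using ex[OF x] by blast
    { fix y assume "y \<in> carrier M"
      then obtain c' h' where ch': "c' \<in> carrier K" "h' \<in> H" "y = h' \<oplus>\<^bsub>M\<^esub> c' \<odot>\<^bsub>M\<^esub> v" using ex by blast
      have "x \<oplus>\<^bsub>M\<^esub> y = (h \<oplus>\<^bsub>M\<^esub> h') \<oplus>\<^bsub>M\<^esub> (c \<oplus>\<^bsub>K\<^esub> c') \<odot>\<^bsub>M\<^esub> v"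
        using ch ch' v D(1) by (simp add: smult_l_distr M.a_ac)
      then show "l (x \<oplus>\<^bsub>M\<^esub> y) = l x \<oplus>\<^bsub>K\<^esub> l y"
        using ch ch' l D(3) by simp }
    fix r assume r: "r \<in> carrier K"
    have "r \<odot>\<^bsub>M\<^esub> x = r \<odot>\<^bsub>M\<^esub> h \<oplus>\<^bsub>M\<^esub> (r \<otimes>\<^bsub>K\<^esub> c) \<odot>\<^bsub>M\<^esub> v"
      using ch r v D(1) by (simp add: smult_r_distr smult_assoc1)
    then show "l (r \<odot>\<^bsub>M\<^esub> x) = r \<otimes>\<^bsub>K\<^esub> l x"
      using ch r l D(4) by simp
  qed
  have "l w = \<zero>\<^bsub>K\<^esub>" if "w \<in> W" for w
    using l[of w "\<zero>\<^bsub>K\<^esub>"] that H(2) D(1) v by auto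
  moreover have "l v = \<one>\<^bsub>K\<^esub>" using l[of "\<zero>\<^bsub>M\<^esub>" "\<one>\<^bsub>K\<^esub>"] D(2) v by simp
  ultimately show thesis using fl that by blast
qed

text \<open>In a generating set \<open>E\<close> of minimal cardinality no element lies in the span of the others, so a
  functional separates it from them. The subspace on which the coordinate formula holds contains \<open>E\<close>.\<close>

lemma dual_basis:
  assumes K: "field K" and fd: "finite_dimensional K Q"
  obtains E l where "finite E" "E \<subseteq> carrier Q" "\<And>e. e \<in> E \<Longrightarrow> functional K Q (l e)"
    "\<And>q. q \<in> carrier Q \<Longrightarrow> q = (\<Oplus>\<^bsub>Q\<^esub>e\<in>E. l e q \<odot>\<^bsub>Q\<^esub> e)"
proof -
  interpret K: field K by fact
  interpret module K Q using fd by (simp add: finite_dimensional_def)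
  define P where "P E \<longleftrightarrow> finite E \<and> E \<subseteq> carrier Q \<and> mod_span K Q E = carrier Q" for E
  obtain E0 where "P E0" using fd by (auto simp: finite_dimensional_def P_def)
  define E where "E = (ARG_MIN card E. P E)"
  have PE: "P E" and min: "\<And>E'. P E' \<Longrightarrow> card E \<le> card E'"
    unfolding E_def using arg_min_natI[of P E0 card] arg_min_nat_le[of P _ card] \<open>P E0\<close> by auto
  then have E: "finite E" "E \<subseteq> carrier Q" "mod_span K Q E = carrier Q" by (auto simp: P_def)
  have "\<exists>l. functional K Q l \<and> (\<forall>e'\<in>E. l e' = (if e' = e then \<one>\<^bsub>K\<^esub> else \<zero>\<^bsub>K\<^esub>))" if e: "e \<in> E" for e
  proof -
    have E': "E - {e} \<subseteq> carrier Q" using E by blast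
    have "e \<notin> mod_span K Q (E - {e})"
    proof
      assume "e \<in> mod_span K Q (E - {e})"
      then have "E \<subseteq> mod_span K Q (E - {e})" using mod_span_incl[OF module_axioms E'] by blast
      then have "mod_span K Q E \<subseteq> mod_span K Q (E - {e})" by (rule mod_span_least[OF mod_span_submodule[OF module_axioms E']])
      then have "P (E - {e})" using E E' submoduleD(1)[OF mod_span_submodule[OF module_axioms E']] by (auto simp: P_def)
      then show False using min[of "E - {e}"] E(1) e by (metis card_Diff1_less not_less)
    qed
    then obtain l where "functional K Q l" "\<And>w. w \<in> mod_span K Q (E - {e}) \<Longrightarrow> l w = \<zero>\<^bsub>K\<^esub>" "l e = \<one>\<^bsub>K\<^esub>"
      using separating_functional[OF K module_axioms mod_span_submodule[OF module_axioms E']] e E(2) by (metis subsetD)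
    then show ?thesis using mod_span_incl[OF module_axioms E'] by (intro exI[of _ l]) auto
  qed
  then obtain l where l: "\<And>e. e \<in> E \<Longrightarrow> functional K Q (l e)"
    "\<And>e e'. e \<in> E \<Longrightarrow> e' \<in> E \<Longrightarrow> l e e' = (if e' = e then \<one>\<^bsub>K\<^esub> else \<zero>\<^bsub>K\<^esub>)"
    by metis
  let ?s = "\<lambda>q. \<Oplus>\<^bsub>Q\<^esub>e\<in>E. l e q \<odot>\<^bsub>Q\<^esub> e"
  let ?W = "{q \<in> carrier Q. q = ?s q}"
  have lc: "l e q \<in> carrier K" if "e \<in> E" "q \<in> carrier Q" for e q using functionalD(1)[OF l(1)] that by blast
  have ec: "e \<in> carrier Q" if "e \<in> E" for e using E that by blast
  have "submodule ?W K Q"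
  proof (rule submoduleI_smult)
    have "?s \<zero>\<^bsub>Q\<^esub> = (\<Oplus>\<^bsub>Q\<^esub>e\<in>E. \<zero>\<^bsub>Q\<^esub>)"
      by (rule M.finsum_cong') (auto simp: functional_zero[OF l(1) module_axioms] ec)
    then show "\<zero>\<^bsub>Q\<^esub> \<in> ?W" by (simp add: M.finsum_zero)
    fix a b assume ab: "a \<in> ?W" "b \<in> ?W"
    have "?s (a \<oplus>\<^bsub>Q\<^esub> b) = (\<Oplus>\<^bsub>Q\<^esub>e\<in>E. l e a \<odot>\<^bsub>Q\<^esub> e \<oplus>\<^bsub>Q\<^esub> l e b \<odot>\<^bsub>Q\<^esub> e)"
      by (rule M.finsum_cong') (use ab in \<open>auto simp: functionalD(2)[OF l(1)] smult_l_distr lc ec\<close>)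
    also have "\<dots> = ?s a \<oplus>\<^bsub>Q\<^esub> ?s b"
      by (rule M.finsum_addf) (use ab in \<open>auto simp: lc ec\<close>)
    finally show "a \<oplus>\<^bsub>Q\<^esub> b \<in> ?W" using ab by simp
  next
    fix c a assume ca: "c \<in> carrier K" "a \<in> ?W"
    have "?s (c \<odot>\<^bsub>Q\<^esub> a) = (\<Oplus>\<^bsub>Q\<^esub>e\<in>E. c \<odot>\<^bsub>Q\<^esub> (l e a \<odot>\<^bsub>Q\<^esub> e))"
      by (rule M.finsum_cong') (use ca in \<open>auto simp: functionalD(3)[OF l(1)] smult_assoc1 lc ec\<close>)
    also have "\<dots> = c \<odot>\<^bsub>Q\<^esub> ?s a"
      by (rule finsum_smult_ldistr[symmetric]) (use ca E in \<open>auto simp: lc ec\<close>)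
    finally show "c \<odot>\<^bsub>Q\<^esub> a \<in> ?W" using ca by simp
  qed auto
  moreover have "E \<subseteq> ?W"
  proof
    fix e assume e: "e \<in> E"
    have "?s e = (\<Oplus>\<^bsub>Q\<^esub>e'\<in>E. if e = e' then e' else \<zero>\<^bsub>Q\<^esub>)"
      by (rule M.finsum_cong') (use e in \<open>auto simp: l(2) ec\<close>)
    also have "\<dots> = e" by (rule M.finsum_singleton) (use e E in auto)
    finally show "e \<in> ?W" using e ec by simp
  qed
  ultimately have "carrier Q \<subseteq> ?W" using mod_span_least[of ?W K Q E] E(3) by blast
  then show thesis using that[of E l] E l by blast
qed

section \<open>Slices of tensors\<close>

locale vector_extension = scalar_extension K Q S + field K
  for K :: "'k ring" and Q :: "('k, 'q) module" and S :: "('k, 's) module"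
begin

text \<open>The map \<open>1 \<otimes> l : Q \<otimes> S \<rightarrow> Q\<close>, which extracts a coefficient from \<open>S\<close>.\<close>

definition slice :: "('s \<Rightarrow> 'k) \<Rightarrow> ('q, 's) tens \<Rightarrow> 'q" where
  "slice l = lift (add_monoid Q) (\<lambda>q s. l s \<odot>\<^bsub>Q\<^esub> q)"

lemma slice:
  assumes l: "functional K S l"
  shows slice_closed: "\<And>x. x \<in> carrier QS \<Longrightarrow> slice l x \<in> carrier Q"
    and slice_add: "\<And>x y. x \<in> carrier QS \<Longrightarrow> y \<in> carrier QS \<Longrightarrow> slice l (x \<oplus>\<^bsub>QS\<^esub> y) = slice l x \<oplus>\<^bsub>Q\<^esub> slice l y"
    and slice_zero: "slice l \<zero>\<^bsub>QS\<^esub> = \<zero>\<^bsub>Q\<^esub>"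
    and slice_pt: "\<And>q s. q \<in> carrier Q \<Longrightarrow> s \<in> carrier S \<Longrightarrow> slice l (pt q s) = l s \<odot>\<^bsub>Q\<^esub> q"
proof -
  note f = functionalD[OF l]
  have b: "balanced (add_monoid Q) (\<lambda>q s. l s \<odot>\<^bsub>Q\<^esub> q)"
    by (rule balancedI) (simp_all add: f Q.smult_l_distr Q.smult_r_distr Q.smult_assoc1[symmetric] Q.R.m_comm)
  note h = lift[OF Q.M.a_comm_group b, folded slice_def]
  show "\<And>x. x \<in> carrier QS \<Longrightarrow> slice l x \<in> carrier Q"
    using hom_in_carrier[OF h(1)] by (simp add: carrier_QS)
  show "\<And>x y. x \<in> carrier QS \<Longrightarrow> y \<in> carrier QS \<Longrightarrow> slice l (x \<oplus>\<^bsub>QS\<^esub> y) = slice l x \<oplus>\<^bsub>Q\<^esub> slice l y"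
    using hom_mult[OF h(1)] by (simp add: carrier_QS add_QS)
  show "slice l \<zero>\<^bsub>QS\<^esub> = \<zero>\<^bsub>Q\<^esub>"
    using hom_one[OF h(1) TG.is_group comm_group.axioms(2)[OF Q.M.a_comm_group]] by (simp add: zero_QS)
  show "\<And>q s. q \<in> carrier Q \<Longrightarrow> s \<in> carrier S \<Longrightarrow> slice l (pt q s) = l s \<odot>\<^bsub>Q\<^esub> q"
    by (rule h(2))
qed

text \<open>
  For subspaces \<open>W\<close> and \<open>Z\<close>, this is the image of \<open>W \<otimes> Z\<close> in \<open>Q \<otimes> S\<close>. Generating it by pure tensors makes
  induction available.
\<close>

inductive_set tensors_in :: "'q set \<Rightarrow> 's set \<Rightarrow> ('q, 's) tens set" for W Z where
  zero: "\<zero>\<^bsub>QS\<^esub> \<in> tensors_in W Z"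
| add: "w \<in> W \<Longrightarrow> z \<in> Z \<Longrightarrow> t \<in> tensors_in W Z \<Longrightarrow> pt w z \<oplus>\<^bsub>QS\<^esub> t \<in> tensors_in W Z"

lemma tensors_in_carrier:
  assumes "W \<subseteq> carrier Q" "Z \<subseteq> carrier S" shows "tensors_in W Z \<subseteq> carrier QS"
proof
  fix t assume "t \<in> tensors_in W Z"
  then show "t \<in> carrier QS" by induction (use assms in auto)
qed

lemma tensors_in_pt: "w \<in> W \<Longrightarrow> z \<in> Z \<Longrightarrow> W \<subseteq> carrier Q \<Longrightarrow> Z \<subseteq> carrier S \<Longrightarrow> pt w z \<in> tensors_in W Z"
  using tensors_in.add[OF _ _ tensors_in.zero, of w W z Z] pt_QS[of w z] by (simp add: subset_iff)

lemma tensors_in_add: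
  assumes "s \<in> tensors_in W Z" "t \<in> tensors_in W Z" "W \<subseteq> carrier Q" "Z \<subseteq> carrier S"
  shows "s \<oplus>\<^bsub>QS\<^esub> t \<in> tensors_in W Z"
  using assms(1)
proof induction
  case zero then show ?case using assms(2) tensors_in_carrier[OF assms(3,4)] by (simp add: subset_iff)
next
  case (add w z u)
  have "pt w z \<in> carrier QS" "u \<in> carrier QS" "t \<in> carrier QS"
    using add assms tensors_in_carrier[OF assms(3,4)] by auto
  then have "pt w z \<oplus>\<^bsub>QS\<^esub> u \<oplus>\<^bsub>QS\<^esub> t = pt w z \<oplus>\<^bsub>QS\<^esub> (u \<oplus>\<^bsub>QS\<^esub> t)" by (rule QS.a_assoc)
  then show ?case using add tensors_in.add by simp
qed

lemma tensors_in_mono: "t \<in> tensors_in W Z \<Longrightarrow> W \<subseteq> W' \<Longrightarrow> Z \<subseteq> Z' \<Longrightarrow> t \<in> tensors_in W' Z'"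
  by (induction rule: tensors_in.induct) (auto intro: tensors_in.intros)

lemma tensors_in_adjoin:
  assumes "t \<in> tensors_in (carrier Q) {z \<oplus>\<^bsub>S\<^esub> c \<odot>\<^bsub>S\<^esub> s | z c. z \<in> Z \<and> c \<in> carrier K}"
    and s: "s \<in> carrier S" and Z: "submodule Z K S"
  shows "\<exists>b\<in>tensors_in (carrier Q) Z. \<exists>q\<in>carrier Q. t = b \<oplus>\<^bsub>QS\<^esub> pt q s"
  using assms(1)
proof induction
  case zero
  show ?case by (rule bexI[OF _ tensors_in.zero], rule bexI[of _ "\<zero>\<^bsub>Q\<^esub>"]) (simp_all add: s)
next
  case (add w z' t)
  obtain z c where z: "z' = z \<oplus>\<^bsub>S\<^esub> c \<odot>\<^bsub>S\<^esub> s" "z \<in> Z" "c \<in> carrier K" using add by blast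
  obtain b q where b: "b \<in> tensors_in (carrier Q) Z" "q \<in> carrier Q" "t = b \<oplus>\<^bsub>QS\<^esub> pt q s" using add by blast
  have Zs: "Z \<subseteq> carrier S" using S.submoduleD(1)[OF Z] by blast
  have bc: "b \<in> carrier QS" using b tensors_in_carrier[OF order.refl Zs] by blast
  have zc: "z \<in> carrier S" using z Zs by blast
  have "pt w z' = pt w z \<oplus>\<^bsub>QS\<^esub> pt (c \<odot>\<^bsub>Q\<^esub> w) s"
    using add z zc s by (simp add: pt_addr pt_balanced)
  then have "pt w z' \<oplus>\<^bsub>QS\<^esub> t = (pt w z \<oplus>\<^bsub>QS\<^esub> b) \<oplus>\<^bsub>QS\<^esub> pt (c \<odot>\<^bsub>Q\<^esub> w \<oplus>\<^bsub>Q\<^esub> q) s"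
    using b bc zc z s add by (simp add: pt_addl QS.a_ac)
  moreover have "pt w z \<oplus>\<^bsub>QS\<^esub> b \<in> tensors_in (carrier Q) Z" using add z b by (simp add: tensors_in.add)
  moreover have "c \<odot>\<^bsub>Q\<^esub> w \<oplus>\<^bsub>Q\<^esub> q \<in> carrier Q" using add z b by simp
  ultimately show ?case by blast
qed

lemma slice_in:
  assumes "functional K S l" "t \<in> tensors_in W (carrier S)" "submodule W K Q"
  shows "slice l t \<in> W"
  using assms(2)
proof induction
  case zero then show ?case using slice_zero[OF assms(1)] Q.submoduleD(2)[OF assms(3)] by simp
next
  case (add w z t)
  have "t \<in> carrier QS" using add(3) tensors_in_carrier[of W "carrier S"] Q.submoduleD(1)[OF assms(3)] by blast
  moreover have "w \<in> carrier Q" using Q.submoduleD(1)[OF assms(3)] add by blast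
  ultimately show ?case using add Q.submoduleD[OF assms(3)] functionalD(1)[OF assms(1)]
    by (simp add: slice_add[OF assms(1)] slice_pt[OF assms(1)])
qed

lemma slice_vanish:
  assumes "functional K S l" "t \<in> tensors_in (carrier Q) Z" "submodule Z K S" "\<And>z. z \<in> Z \<Longrightarrow> l z = \<zero>\<^bsub>K\<^esub>"
  shows "slice l t = \<zero>\<^bsub>Q\<^esub>"
  using assms(2)
proof induction
  case zero then show ?case using slice_zero[OF assms(1)] by simp
next
  case (add w z t)
  have "t \<in> carrier QS" using add(3) tensors_in_carrier[of "carrier Q" Z] S.submoduleD(1)[OF assms(3)] by blast
  moreover have "z \<in> carrier S" using S.submoduleD(1)[OF assms(3)] add by blast
  ultimately show ?case using add assms(4)
    by (simp add: slice_add[OF assms(1)] slice_pt[OF assms(1)])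
qed

text \<open>
  Induction on the number of pure tensors in \<open>x = q \<otimes> s + t\<close>. Enlarging \<open>Z\<close> by \<open>s\<close> leaves only functionals
  that vanish at \<open>s\<close> and do not see \<open>q \<otimes> s\<close>, so that the induction hypothesis applies to \<open>t\<close>. The result
  is \<open>x \<equiv> u \<otimes> s\<close> modulo \<open>W \<otimes> S + Q \<otimes> Z\<close> for some \<open>u \<in> Q\<close>. Either \<open>s \<in> Z\<close>, or a functional with value \<open>1\<close> at
  \<open>s\<close> that vanishes on \<open>Z\<close> shows that \<open>u \<in> W\<close>.
\<close>

lemma slice_criterion_aux:
  assumes W: "submodule W K Q" and "x \<in> carrier QS" "submodule Z K S"
    and "\<And>l. functional K S l \<Longrightarrow> (\<forall>z\<in>Z. l z = \<zero>\<^bsub>K\<^esub>) \<Longrightarrow> slice l x \<in> W"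
  shows "\<exists>a\<in>tensors_in W (carrier S). \<exists>b\<in>tensors_in (carrier Q) Z. x = a \<oplus>\<^bsub>QS\<^esub> b"
  using assms(2-)
proof (induction arbitrary: Z rule: QS_induct)
  case zero
  show ?case by (rule bexI[OF _ tensors_in.zero], rule bexI[OF _ tensors_in.zero]) simp
next
  case (add q s t)
  let ?Z = "{z \<oplus>\<^bsub>S\<^esub> c \<odot>\<^bsub>S\<^esub> s | z c. z \<in> Z \<and> c \<in> carrier K}"
  note adj = S.submodule_adjoin[OF add.prems(1) add.hyps(2)]
  have "slice l t \<in> W" if l: "functional K S l" "\<forall>z\<in>?Z. l z = \<zero>\<^bsub>K\<^esub>" for l
  proof -
    have "l s = \<zero>\<^bsub>K\<^esub>" "\<forall>z\<in>Z. l z = \<zero>\<^bsub>K\<^esub>" using l(2) adj(2,3) by blast+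
    moreover have "slice l (pt q s \<oplus>\<^bsub>QS\<^esub> t) \<in> W" using add.prems(2) l calculation by blast
    ultimately show ?thesis
      using add.hyps slice_closed[OF l(1)] by (simp add: slice_add[OF l(1)] slice_pt[OF l(1)])
  qed
  then obtain a b0 where ab0: "a \<in> tensors_in W (carrier S)" "b0 \<in> tensors_in (carrier Q) ?Z" "t = a \<oplus>\<^bsub>QS\<^esub> b0"
    using add.IH[OF adj(1)] by blast
  obtain b q' where b: "b \<in> tensors_in (carrier Q) Z" "q' \<in> carrier Q" "b0 = b \<oplus>\<^bsub>QS\<^esub> pt q' s"
    using tensors_in_adjoin[OF ab0(2) add.hyps(2) add.prems(1)] by blast
  have Ws: "W \<subseteq> carrier Q" using Q.submoduleD(1)[OF W] by blast
  have Zs: "Z \<subseteq> carrier S" using S.submoduleD(1)[OF add.prems(1)] by blast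
  have ac: "a \<in> carrier QS" and bc: "b \<in> carrier QS"
    using ab0(1) b(1) tensors_in_carrier[OF Ws order.refl] tensors_in_carrier[OF order.refl Zs] by auto
  let ?q = "q \<oplus>\<^bsub>Q\<^esub> q'"
  have x: "pt q s \<oplus>\<^bsub>QS\<^esub> t = a \<oplus>\<^bsub>QS\<^esub> (b \<oplus>\<^bsub>QS\<^esub> pt ?q s)"
    unfolding ab0(3) b(3) using ac bc add.hyps b(2) by (simp add: pt_addl QS.a_ac)
  have qc: "?q \<in> carrier Q" using add b by simp
  show ?case
  proof (cases "s \<in> Z")
    case True
    have "b \<oplus>\<^bsub>QS\<^esub> pt ?q s \<in> tensors_in (carrier Q) Z"
      using tensors_in_add[OF b(1) tensors_in_pt[OF qc True order.refl Zs] order.refl Zs] .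
    then show ?thesis using ab0 x by blast
  next
    case False
    obtain l where l: "functional K S l" "\<And>w. w \<in> Z \<Longrightarrow> l w = \<zero>\<^bsub>K\<^esub>" "l s = \<one>\<^bsub>K\<^esub>"
      using separating_functional[OF field_axioms S.module_axioms add.prems(1) add.hyps(2) False] by blast
    have "slice l (pt q s \<oplus>\<^bsub>QS\<^esub> t) \<in> W" using add.prems(2) l by blast
    then have "slice l a \<oplus>\<^bsub>Q\<^esub> ?q \<in> W" unfolding x
      using ac bc qc add.hyps slice_vanish[OF l(1) b(1) add.prems(1) l(2)] l(3)
      by (simp add: slice_add[OF l(1)] slice_pt[OF l(1)] del: Q.M.add.m_assoc)
    moreover have sa: "slice l a \<in> W" using slice_in[OF l(1) ab0(1) W] .
    ultimately have "(slice l a \<oplus>\<^bsub>Q\<^esub> ?q) \<ominus>\<^bsub>Q\<^esub> slice l a \<in> W" using Q.submoduleD(6)[OF W] by blast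
    moreover have "(slice l a \<oplus>\<^bsub>Q\<^esub> ?q) \<ominus>\<^bsub>Q\<^esub> slice l a = ?q"
    proof -
      have "slice l a \<in> carrier Q" using sa Ws by blast
      then show ?thesis using qc by (simp add: a_minus_def Q.M.a_comm[of "slice l a" ?q] Q.M.a_assoc Q.M.r_neg)
    qed
    ultimately have qW: "?q \<in> W" by simp
    have "pt q s \<oplus>\<^bsub>QS\<^esub> t = (a \<oplus>\<^bsub>QS\<^esub> pt ?q s) \<oplus>\<^bsub>QS\<^esub> b"
      unfolding x using ac bc qc add.hyps by (simp add: QS.a_ac del: Q.M.add.m_assoc)
    moreover have "a \<oplus>\<^bsub>QS\<^esub> pt ?q s \<in> tensors_in W (carrier S)"
      using tensors_in_add[OF ab0(1) tensors_in_pt[OF qW add.hyps(2) Ws order.refl] Ws order.refl] .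
    ultimately show ?thesis using b(1) by blast
  qed
qed

lemma slice_criterion:
  assumes W: "submodule W K Q" and x: "x \<in> carrier QS"
    and "\<And>l. functional K S l \<Longrightarrow> slice l x \<in> W"
  shows "x \<in> tensors_in W (carrier S)"
proof -
  have Z: "submodule {\<zero>\<^bsub>S\<^esub>} K S" by (rule S.submoduleI_smult) auto
  obtain a b where ab: "a \<in> tensors_in W (carrier S)" "b \<in> tensors_in (carrier Q) {\<zero>\<^bsub>S\<^esub>}" "x = a \<oplus>\<^bsub>QS\<^esub> b"
    using slice_criterion_aux[OF W x Z] assms(3) by blast
  have "b = \<zero>\<^bsub>QS\<^esub>" using ab(2) by induction auto
  moreover have "a \<in> carrier QS" using ab(1) tensors_in_carrier[of W "carrier S"] Q.submoduleD(1)[OF W] by blast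
  ultimately show ?thesis using ab by simp
qed

lemma tensors_in_eq_image:
  assumes W: "submodule W K Q"
  shows "tensors_in W (carrier S) = sub_incl K Q S ` carrier (base_change K (sub_mod Q W) S)"
proof -
  have mW: "module K (sub_mod Q W)" using submodule.submodule_is_module[OF W Q.module_axioms] .
  interpret W: scalar_extension K "sub_mod Q W" S by (intro scalar_extension.intro mW S.algebra_axioms)
  have lin: "linear K (sub_mod Q W) Q id" "linear K S S id"
    using Q.submoduleD(1)[OF W] by (auto intro!: linearI)
  note t = tensor_map_base_change[OF mW S.algebra_axioms Q.module_axioms S.algebra_axioms lin]
  show ?thesis
  proof (intro equalityI subsetI)
    fix x assume "x \<in> tensors_in W (carrier S)"
    then show "x \<in> sub_incl K Q S ` carrier W.QS"
    proof induction
      case zero then show ?case using t(3) W.QS.zero_closed by (metis image_eqI)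
    next
      case (add w z x)
      then obtain y where y: "y \<in> carrier W.QS" "x = sub_incl K Q S y" by blast
      have wz: "W.pt w z \<in> carrier W.QS" using add by simp
      have "pt w z \<oplus>\<^bsub>QS\<^esub> x = sub_incl K Q S (W.pt w z \<oplus>\<^bsub>W.QS\<^esub> y)"
        using t(2)[OF wz y(1)] t(4)[of w z] add y by simp
      then show ?case using wz y by blast
    qed
  next
    fix x assume "x \<in> sub_incl K Q S ` carrier W.QS"
    then obtain y where y: "y \<in> carrier W.QS" "x = sub_incl K Q S y" by blast
    from y(1) have "sub_incl K Q S y \<in> tensors_in W (carrier S)"
    proof (induction rule: W.QS_induct)
      case zero then show ?case using t(3) tensors_in.zero by metis
    next
      case (add w z u)
      then show ?case using t(2)[of "W.pt w z" u] t(4)[of w z] tensors_in.add[of w W z "carrier S" "sub_incl K Q S u"]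
        unfolding id_apply by simp
    qed
    then show "x \<in> tensors_in W (carrier S)" using y by simp
  qed
qed

end

section \<open>Endomorphisms of base changes\<close>

lemma End_carrier: "f \<in> carrier (End_alg R M) \<longleftrightarrow> linear R M M f \<and> f \<in> extensional (carrier M)"
  by (simp add: End_alg_def linear_maps_iff)

lemma End_closed: "f \<in> carrier (End_alg R M) \<Longrightarrow> x \<in> carrier M \<Longrightarrow> f x \<in> carrier M"
  using linearD(1)[of R M M f x] by (simp add: End_carrier)

lemma End_linear:
  assumes "f \<in> carrier (End_alg R M)"
  shows "\<And>x y. x \<in> carrier M \<Longrightarrow> y \<in> carrier M \<Longrightarrow> f (x \<oplus>\<^bsub>M\<^esub> y) = f x \<oplus>\<^bsub>M\<^esub> f y"
    "\<And>r x. r \<in> carrier R \<Longrightarrow> x \<in> carrier M \<Longrightarrow> f (r \<odot>\<^bsub>M\<^esub> x) = r \<odot>\<^bsub>M\<^esub> f x"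
  using linearD[of R M M f] assms by (auto simp: End_carrier)

lemma End_ext: "f \<in> carrier (End_alg R M) \<Longrightarrow> g \<in> carrier (End_alg R M) \<Longrightarrow> (\<And>x. x \<in> carrier M \<Longrightarrow> f x = g x) \<Longrightarrow> f = g"
  by (auto simp: End_carrier intro: extensionalityI)

lemma End_apply:
  "x \<in> carrier M \<Longrightarrow> (f \<otimes>\<^bsub>End_alg R M\<^esub> g) x = f (g x)"
  "x \<in> carrier M \<Longrightarrow> (f \<oplus>\<^bsub>End_alg R M\<^esub> g) x = f x \<oplus>\<^bsub>M\<^esub> g x"
  "x \<in> carrier M \<Longrightarrow> \<one>\<^bsub>End_alg R M\<^esub> x = x"
  "x \<in> carrier M \<Longrightarrow> \<zero>\<^bsub>End_alg R M\<^esub> x = \<zero>\<^bsub>M\<^esub>"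
  "x \<in> carrier M \<Longrightarrow> (r \<odot>\<^bsub>End_alg R M\<^esub> f) x = r \<odot>\<^bsub>M\<^esub> f x"
  by (simp_all add: End_alg_def compose_def)

lemma End_extensional:
  "f \<otimes>\<^bsub>End_alg R M\<^esub> g \<in> extensional (carrier M)" "f \<oplus>\<^bsub>End_alg R M\<^esub> g \<in> extensional (carrier M)"
  "\<one>\<^bsub>End_alg R M\<^esub> \<in> extensional (carrier M)" "\<zero>\<^bsub>End_alg R M\<^esub> \<in> extensional (carrier M)"
  "r \<odot>\<^bsub>End_alg R M\<^esub> f \<in> extensional (carrier M)"
  by (simp_all add: End_alg_def compose_def)

lemma End_alg_closed:
  assumes "module R M"
  shows "f \<in> carrier (End_alg R M) \<Longrightarrow> g \<in> carrier (End_alg R M) \<Longrightarrow> f \<otimes>\<^bsub>End_alg R M\<^esub> g \<in> carrier (End_alg R M)"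
    "f \<in> carrier (End_alg R M) \<Longrightarrow> g \<in> carrier (End_alg R M) \<Longrightarrow> f \<oplus>\<^bsub>End_alg R M\<^esub> g \<in> carrier (End_alg R M)"
    "\<one>\<^bsub>End_alg R M\<^esub> \<in> carrier (End_alg R M)" "\<zero>\<^bsub>End_alg R M\<^esub> \<in> carrier (End_alg R M)"
    "r \<in> carrier R \<Longrightarrow> f \<in> carrier (End_alg R M) \<Longrightarrow> r \<odot>\<^bsub>End_alg R M\<^esub> f \<in> carrier (End_alg R M)"
proof -
  interpret module R M by fact
  note ls = End_closed[of _ R M] End_linear[of _ R M] End_apply
  have I: "f \<in> carrier (End_alg R M)" if "linear R M M f" "f \<in> extensional (carrier M)" for f
    using that by (simp add: End_carrier)
  show "f \<in> carrier (End_alg R M) \<Longrightarrow> g \<in> carrier (End_alg R M) \<Longrightarrow> f \<otimes>\<^bsub>End_alg R M\<^esub> g \<in> carrier (End_alg R M)"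
    by (rule I[OF linearI End_extensional(1)]) (simp_all add: ls)
  show "f \<in> carrier (End_alg R M) \<Longrightarrow> g \<in> carrier (End_alg R M) \<Longrightarrow> f \<oplus>\<^bsub>End_alg R M\<^esub> g \<in> carrier (End_alg R M)"
    by (rule I[OF linearI End_extensional(2)]) (simp_all add: ls M.a_ac smult_r_distr)
  show "\<one>\<^bsub>End_alg R M\<^esub> \<in> carrier (End_alg R M)"
    by (rule I[OF linearI End_extensional(3)]) (simp_all add: ls)
  show "\<zero>\<^bsub>End_alg R M\<^esub> \<in> carrier (End_alg R M)"
    by (rule I[OF linearI End_extensional(4)]) (simp_all add: ls)
  show "r \<in> carrier R \<Longrightarrow> f \<in> carrier (End_alg R M) \<Longrightarrow> r \<odot>\<^bsub>End_alg R M\<^esub> f \<in> carrier (End_alg R M)"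
    by (rule I[OF linearI End_extensional(5)]) (simp_all add: ls smult_r_distr smult_assoc1[symmetric] R.m_comm)
qed

lemma End_neg:
  assumes "module R M" "f \<in> carrier (End_alg R M)"
  shows "(\<ominus>\<^bsub>R\<^esub> \<one>\<^bsub>R\<^esub>) \<odot>\<^bsub>End_alg R M\<^esub> f \<in> carrier (End_alg R M)"
    "(\<ominus>\<^bsub>R\<^esub> \<one>\<^bsub>R\<^esub>) \<odot>\<^bsub>End_alg R M\<^esub> f \<oplus>\<^bsub>End_alg R M\<^esub> f = \<zero>\<^bsub>End_alg R M\<^esub>"
proof -
  interpret module R M by fact
  show c: "(\<ominus>\<^bsub>R\<^esub> \<one>\<^bsub>R\<^esub>) \<odot>\<^bsub>End_alg R M\<^esub> f \<in> carrier (End_alg R M)"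
    using End_alg_closed[OF assms(1)] assms(2) by simp
  show "(\<ominus>\<^bsub>R\<^esub> \<one>\<^bsub>R\<^esub>) \<odot>\<^bsub>End_alg R M\<^esub> f \<oplus>\<^bsub>End_alg R M\<^esub> f = \<zero>\<^bsub>End_alg R M\<^esub>"
    by (rule End_ext[OF End_alg_closed(2)[OF assms(1) c assms(2)] End_alg_closed(4)[OF assms(1)]])
      (use End_closed[OF assms(2)] in \<open>simp add: End_apply smult_l_minus M.l_neg\<close>)
qed

lemma ring_End_alg: "module R M \<Longrightarrow> ring (End_alg R M)"
proof -
  assume m: "module R M"
  interpret module R M by fact
  note c = End_alg_closed[OF m] and a = End_apply and e = End_ext[of _ R M] and l = End_closed[of _ R M] End_linear[of _ R M]
  show ?thesis
  proof (rule ringI)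
    show "abelian_group (End_alg R M)"
    proof (rule abelian_groupI)
      show "\<And>x. x \<in> carrier (End_alg R M) \<Longrightarrow> \<exists>y\<in>carrier (End_alg R M). y \<oplus>\<^bsub>End_alg R M\<^esub> x = \<zero>\<^bsub>End_alg R M\<^esub>"
        using End_neg[OF m] by blast
    qed (simp_all add: c, (rule e; simp add: c a l M.a_ac)+)
    show "monoid (End_alg R M)"
      by (rule monoidI) (simp_all add: c, (rule e; simp add: c a l)+)
    fix x y z assume xyz: "x \<in> carrier (End_alg R M)" "y \<in> carrier (End_alg R M)" "z \<in> carrier (End_alg R M)"
    show "(x \<oplus>\<^bsub>End_alg R M\<^esub> y) \<otimes>\<^bsub>End_alg R M\<^esub> z = x \<otimes>\<^bsub>End_alg R M\<^esub> z \<oplus>\<^bsub>End_alg R M\<^esub> y \<otimes>\<^bsub>End_alg R M\<^esub> z"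
      by (rule e) (use xyz in \<open>simp_all add: c a l\<close>)
    show "z \<otimes>\<^bsub>End_alg R M\<^esub> (x \<oplus>\<^bsub>End_alg R M\<^esub> y) = z \<otimes>\<^bsub>End_alg R M\<^esub> x \<oplus>\<^bsub>End_alg R M\<^esub> z \<otimes>\<^bsub>End_alg R M\<^esub> y"
      by (rule e) (use xyz in \<open>simp_all add: c a l\<close>)
  qed
qed

lemma module_End_alg: "module R M \<Longrightarrow> module R (End_alg R M)"
proof -
  assume m: "module R M"
  interpret module R M by fact
  note c = End_alg_closed[OF m] and a = End_apply and e = End_ext[of _ R M] and l = End_closed[of _ R M] End_linear[of _ R M]
  interpret E: ring "End_alg R M" by (rule ring_End_alg[OF m])
  show ?thesis
    by (rule moduleI[OF R.is_cring E.is_abelian_group])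
      (simp_all add: c, (rule e; simp add: c a l smult_l_distr smult_r_distr smult_assoc1)+)
qed

lemma GL_simps:
  "carrier (pts (GL K Q) S) = Units (End_alg S (base_change K Q S))"
  "monoid.mult (pts (GL K Q) S) = monoid.mult (End_alg S (base_change K Q S))"
  "\<one>\<^bsub>pts (GL K Q) S\<^esub> = \<one>\<^bsub>End_alg S (base_change K Q S)\<^esub>"
  by (simp_all add: GL_def units_of_def)

text \<open>The map \<open>1 \<otimes> \<phi> : Q \<otimes> S \<rightarrow> Q \<otimes> T\<close> in the definition of the restriction maps of \<open>GL\<close>.\<close>

definition base_map :: "'k ring \<Rightarrow> ('k, 'q) module \<Rightarrow> ('k, 's) module \<Rightarrow> ('s \<Rightarrow> 's) \<Rightarrow> ('q, 's) tens \<Rightarrow> ('q, 's) tens" where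
  "base_map K Q T \<phi> = tensor_map K Q T id \<phi>"

locale extension_hom = module K Q + S: scalar_extension K Q S + T: scalar_extension K Q T
  for K :: "'k ring" and Q :: "('k, 'q) module" and S T :: "('k, 's) module" +
  fixes \<phi> :: "'s \<Rightarrow> 's"
  assumes hom: "\<phi> \<in> alg_hom K S T"
begin

abbreviation "bm \<equiv> base_map K Q T \<phi>"

lemmas bm = tensor_map_base_change[OF module_axioms S.S.algebra_axioms module_axioms T.S.algebra_axioms linear_id[OF module_axioms] alg_homD(8)[OF hom], folded base_map_def, unfolded id_apply]

lemma bm_smult:
  assumes "s \<in> carrier S" "x \<in> carrier S.QS"
  shows "bm (s \<odot>\<^bsub>S.QS\<^esub> x) = \<phi> s \<odot>\<^bsub>T.QS\<^esub> bm x"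
  using assms(2)
proof (induction rule: S.QS_induct)
  case zero show ?case using assms alg_homD(2)[OF hom] by (simp add: bm(3))
next
  case (add q t x)
  then show ?case using assms alg_homD[OF hom]
    by (simp add: S.QSm.smult_r_distr T.QSm.smult_r_distr bm S.smult_pt T.smult_pt)
qed

abbreviation "ES \<equiv> End_alg S S.QS"
abbreviation "ET \<equiv> End_alg T T.QS"
abbreviation "rs \<equiv> res (GL K Q) S T \<phi>"

lemma ET_ext:
  assumes "b \<in> carrier ET" "b' \<in> carrier ET" "\<And>q. q \<in> carrier Q \<Longrightarrow> b (T.pt q \<one>\<^bsub>T\<^esub>) = b' (T.pt q \<one>\<^bsub>T\<^esub>)"
  shows "b = b'"
  using assms T.linear_QS_ext[OF _ _ T.module_QS] by (intro End_ext[of b T T.QS b']) (auto simp: End_carrier)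

lemma bm_pt1: "q \<in> carrier Q \<Longrightarrow> bm (S.pt q \<one>\<^bsub>S\<^esub>) = T.pt q \<one>\<^bsub>T\<^esub>"
  using bm(4) alg_homD(5)[OF hom] by simp

text \<open>Existence and uniqueness justify the definite description by which \<open>GL\<close> restricts endomorphisms. Both
  hold because \<open>b\<close> is determined by the \<open>K\<close>-linear map \<open>q \<mapsto> b (q \<otimes> 1) = (1 \<otimes> \<phi>) (a (q \<otimes> 1))\<close>.\<close>

lemma base_change_End_exists:
  assumes a: "a \<in> carrier ES"
  shows "\<exists>b. b \<in> carrier ET \<and> (\<forall>x\<in>carrier S.QS. b (bm x) = bm (a x))"
proof -
  note la = linearD[OF conjunct1[OF a[unfolded End_carrier]]]
  define F where "F q = bm (a (S.pt q \<one>\<^bsub>S\<^esub>))" for q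
  have Fc: "F q \<in> carrier T.QS" if "q \<in> carrier Q" for q using that by (simp add: F_def bm la)
  have Fa: "F (q \<oplus>\<^bsub>Q\<^esub> q') = F q \<oplus>\<^bsub>T.QS\<^esub> F q'" if "q \<in> carrier Q" "q' \<in> carrier Q" for q q'
    using that by (simp add: F_def S.pt_addl la bm)
  have Fs: "F (c \<odot>\<^bsub>Q\<^esub> q) = (c \<odot>\<^bsub>T\<^esub> \<one>\<^bsub>T\<^esub>) \<odot>\<^bsub>T.QS\<^esub> F q" if "c \<in> carrier K" "q \<in> carrier Q" for c q
    using that alg_homD[OF hom] by (simp add: F_def S.pt_scalar la bm_smult)
  note e = T.extend[OF T.module_QS Fc Fa Fs]
  let ?b = "T.extend T.QS F"
  have eE: "?b \<in> carrier ET" using e(1) by (simp add: End_alg_def)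
  note le = linearD[OF conjunct1[OF eE[unfolded End_carrier]]]
  have "?b (bm x) = bm (a x)" if "x \<in> carrier S.QS" for x
    using that
  proof (induction rule: S.QS_induct)
    case zero
    have "a \<zero>\<^bsub>S.QS\<^esub> = \<zero>\<^bsub>S.QS\<^esub>" "?b \<zero>\<^bsub>T.QS\<^esub> = \<zero>\<^bsub>T.QS\<^esub>"
      using S.linear_zero_QS[OF _ S.module_QS] T.linear_zero_QS[OF _ T.module_QS] a eE unfolding End_carrier by blast+
    then show ?case by (simp add: bm(3))
  next
    case (add q s x)
    have "?b (bm (S.pt q s)) = bm (a (S.pt q s))"
      using add alg_homD(2)[OF hom] by (subst (2) S.pt_smult) (simp_all add: bm e(2) la bm_smult, simp add: F_def)
    then show ?case using add by (simp add: bm le la alg_homD(2)[OF hom])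
  qed
  then show ?thesis using eE by blast
qed

lemma base_change_End_unique:
  assumes "b \<in> carrier ET" "\<forall>x\<in>carrier S.QS. b (bm x) = bm (a x)"
    and "b' \<in> carrier ET" "\<forall>x\<in>carrier S.QS. b' (bm x) = bm (a x)"
  shows "b = b'"
proof (rule ET_ext[OF assms(1,3)])
  fix q assume q: "q \<in> carrier Q"
  then have "S.pt q \<one>\<^bsub>S\<^esub> \<in> carrier S.QS" by simp
  then show "b (T.pt q \<one>\<^bsub>T\<^esub>) = b' (T.pt q \<one>\<^bsub>T\<^esub>)"
    using assms(2,4) bm_pt1[OF q] by metis
qed

lemma res_End:
  assumes "a \<in> carrier ES"
  shows res_closed: "rs a \<in> carrier ET" and res_bm: "\<And>x. x \<in> carrier S.QS \<Longrightarrow> rs a (bm x) = bm (a x)"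
proof -
  have "\<exists>!b. b \<in> carrier ET \<and> (\<forall>x\<in>carrier S.QS. b (bm x) = bm (a x))"
    using base_change_End_exists[OF assms] base_change_End_unique by (intro ex_ex1I) blast+
  from theI'[OF this] show "rs a \<in> carrier ET" "\<And>x. x \<in> carrier S.QS \<Longrightarrow> rs a (bm x) = bm (a x)"
    by (simp_all add: GL_def base_map_def)
qed

lemma res_pt: "a \<in> carrier ES \<Longrightarrow> q \<in> carrier Q \<Longrightarrow> rs a (T.pt q \<one>\<^bsub>T\<^esub>) = bm (a (S.pt q \<one>\<^bsub>S\<^esub>))"
  using res_bm[of a "S.pt q \<one>\<^bsub>S\<^esub>"] bm_pt1 by simp

lemma res_eqI:
  assumes "a \<in> carrier ES" "b \<in> carrier ET" "\<And>q. q \<in> carrier Q \<Longrightarrow> b (T.pt q \<one>\<^bsub>T\<^esub>) = bm (a (S.pt q \<one>\<^bsub>S\<^esub>))"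
  shows "rs a = b"
  by (rule ET_ext[OF res_closed[OF assms(1)] assms(2)]) (simp add: res_pt assms)

sublocale ES: ring ES by (rule ring_End_alg[OF S.module_QS])
sublocale ET: ring ET by (rule ring_End_alg[OF T.module_QS])

lemma res_mult: "a \<in> carrier ES \<Longrightarrow> b \<in> carrier ES \<Longrightarrow> rs (a \<otimes>\<^bsub>ES\<^esub> b) = rs a \<otimes>\<^bsub>ET\<^esub> rs b"
  by (rule res_eqI) (simp_all add: res_closed End_apply res_pt res_bm End_closed[of _ S S.QS])

lemma res_add: "a \<in> carrier ES \<Longrightarrow> b \<in> carrier ES \<Longrightarrow> rs (a \<oplus>\<^bsub>ES\<^esub> b) = rs a \<oplus>\<^bsub>ET\<^esub> rs b"
  by (rule res_eqI) (simp_all add: res_closed End_apply res_pt bm End_closed[of _ S S.QS])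

lemma res_one: "rs \<one>\<^bsub>ES\<^esub> = \<one>\<^bsub>ET\<^esub>"
  by (rule res_eqI) (simp_all add: End_apply bm_pt1)

lemma res_Units: "a \<in> Units ES \<Longrightarrow> rs a \<in> Units ET"
proof -
  assume a: "a \<in> Units ES"
  note c = ES.Units_closed[OF a] ES.Units_inv_closed[OF a]
  have "rs a \<otimes>\<^bsub>ET\<^esub> rs (inv\<^bsub>ES\<^esub> a) = \<one>\<^bsub>ET\<^esub>" "rs (inv\<^bsub>ES\<^esub> a) \<otimes>\<^bsub>ET\<^esub> rs a = \<one>\<^bsub>ET\<^esub>"
    using a c by (simp_all add: res_mult[symmetric] res_one)
  then show ?thesis using c res_closed unfolding Units_def by blast
qed

end

lemma extension_homI:
  "module K Q \<Longrightarrow> algebra K S \<Longrightarrow> algebra K T \<Longrightarrow> \<phi> \<in> alg_hom K S T \<Longrightarrow> extension_hom K Q S T \<phi>"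
  by (simp add: extension_hom_def extension_hom_axioms_def scalar_extension_def)

lemma base_map_comp:
  assumes "module K Q" "algebra K S" "algebra K T" "algebra K U" "\<phi> \<in> alg_hom K S T" "\<psi> \<in> alg_hom K T U"
    and "x \<in> carrier (base_change K Q S)"
  shows "base_map K Q U (compose (carrier S) \<psi> \<phi>) x = base_map K Q U \<psi> (base_map K Q T \<phi> x)"
proof -
  interpret A: extension_hom K Q S T \<phi> using assms extension_homI by blast
  interpret B: extension_hom K Q T U \<psi> using assms extension_homI by blast
  interpret C: extension_hom K Q S U "compose (carrier S) \<psi> \<phi>" using assms extension_homI alg_hom_comp by blast
  show ?thesis using assms(7)
  proof (induction rule: A.S.QS_induct)
    case zero show ?case unfolding A.bm(3) B.bm(3) C.bm(3) by (rule refl)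
  next
    case (add q s t)
    then show ?case using alg_homD[OF assms(5)] alg_homD[OF assms(6)]
      by (simp add: A.bm(1,2,4) B.bm(1,2,4) C.bm(1,2,4) compose_eq)
  qed
qed

lemma res_comp:
  assumes "module K Q" "algebra K S" "algebra K T" "algebra K U" "\<phi> \<in> alg_hom K S T" "\<psi> \<in> alg_hom K T U"
    and "a \<in> carrier (End_alg S (base_change K Q S))"
  shows "res (GL K Q) S U (compose (carrier S) \<psi> \<phi>) a = res (GL K Q) T U \<psi> (res (GL K Q) S T \<phi> a)"
proof -
  interpret A: extension_hom K Q S T \<phi> using assms extension_homI by blast
  interpret B: extension_hom K Q T U \<psi> using assms extension_homI by blast
  interpret C: extension_hom K Q S U "compose (carrier S) \<psi> \<phi>" using assms extension_homI alg_hom_comp by blast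
  show ?thesis
    by (rule C.res_eqI[OF assms(7)])
      (simp_all add: B.res_closed A.res_closed assms(7) B.res_pt A.res_pt base_map_comp[OF assms(1-6)] End_closed[OF assms(7)])
qed

lemma base_map_id:
  assumes "module K Q" "algebra K S" "x \<in> carrier (base_change K Q S)"
  shows "base_map K Q S (\<lambda>x\<in>carrier S. x) x = x"
proof -
  define i where "i = (\<lambda>x\<in>carrier S. x)"
  have i: "i \<in> alg_hom K S S" using assms alg_hom_id by (simp add: i_def)
  have iS: "i s = s" if "s \<in> carrier S" for s using that by (simp add: i_def)
  interpret A: extension_hom K Q S S i using assms extension_homI i by blast
  have "A.bm x = x" using assms(3)
  proof (induction rule: A.S.QS_induct)
    case zero show ?case by (rule A.bm(3))
  next
    case (add q s t)
    then show ?case using A.bm(2)[OF A.S.pt_QS[OF add(1,2)] add(3)] A.bm(4)[OF add(1,2)] by (simp add: iS)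
  qed
  then show ?thesis by (simp add: i_def)
qed

lemma res_id:
  assumes "module K Q" "algebra K S" "a \<in> carrier (End_alg S (base_change K Q S))"
  shows "res (GL K Q) S S (\<lambda>x\<in>carrier S. x) a = a"
proof -
  interpret A: extension_hom K Q S S "\<lambda>x\<in>carrier S. x" using assms extension_homI alg_hom_id by blast
  show ?thesis
    by (rule A.res_eqI[OF assms(3,3)]) (simp add: base_map_id[OF assms(1,2)] End_closed[OF assms(3)])
qed

context scalar_extension begin

abbreviation "EQ \<equiv> End_alg K Q"
abbreviation "EQS \<equiv> End_alg S QS"
abbreviation "ebc \<equiv> end_base_change K Q S"

lemma ebc:
  assumes f: "f \<in> carrier EQ"
  shows ebc_closed: "ebc f \<in> carrier EQS"
    and ebc_pt: "\<And>q s. q \<in> carrier Q \<Longrightarrow> s \<in> carrier S \<Longrightarrow> ebc f (pt q s) = pt (f q) s"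
proof -
  have l: "linear K Q Q f" using f by (simp add: End_carrier)
  define h where "h = tensor_map K Q S f id"
  note t = tensor_map_base_change[OF Q.module_axioms S.algebra_axioms Q.module_axioms S.algebra_axioms l linear_id[OF S.module_axioms], folded h_def, unfolded id_apply]
  have s: "h (s \<odot>\<^bsub>QS\<^esub> x) = s \<odot>\<^bsub>QS\<^esub> h x" if "s \<in> carrier S" "x \<in> carrier QS" for s x
    using that(2)
  proof (induction rule: QS_induct)
    case zero show ?case using that by (simp add: t(3))
  next
    case (add q u y)
    then show ?case using that linearD(1)[OF l]
      by (simp add: QSm.smult_r_distr t(1,2,4) smult_pt)
  qed
  show "ebc f \<in> carrier EQS"
    using t s unfolding End_carrier by (auto simp: end_base_change_def h_def[symmetric] intro!: linearI)
  show "\<And>q s. q \<in> carrier Q \<Longrightarrow> s \<in> carrier S \<Longrightarrow> ebc f (pt q s) = pt (f q) s"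
    using t(4) by (simp add: end_base_change_def h_def[symmetric])
qed

lemma EQS_ext:
  assumes "b \<in> carrier EQS" "b' \<in> carrier EQS" "\<And>q. q \<in> carrier Q \<Longrightarrow> b (pt q \<one>\<^bsub>S\<^esub>) = b' (pt q \<one>\<^bsub>S\<^esub>)"
  shows "b = b'"
  using assms linear_QS_ext[OF _ _ module_QS] by (intro End_ext[of b S QS b']) (auto simp: End_carrier)

sublocale EQ: ring EQ by (rule ring_End_alg[OF Q.module_axioms])
sublocale EQS: ring EQS by (rule ring_End_alg[OF module_QS])
sublocale EQm: module K EQ by (rule module_End_alg[OF Q.module_axioms])
sublocale EQSm: module S EQS by (rule module_End_alg[OF module_QS])

lemma ebc_add: "f \<in> carrier EQ \<Longrightarrow> g \<in> carrier EQ \<Longrightarrow> ebc (f \<oplus>\<^bsub>EQ\<^esub> g) = ebc f \<oplus>\<^bsub>EQS\<^esub> ebc g"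
  by (rule EQS_ext) (simp_all add: ebc_closed ebc_pt End_apply pt_addl End_closed[of _ K Q])

lemma ebc_smult: "c \<in> carrier K \<Longrightarrow> f \<in> carrier EQ \<Longrightarrow> ebc (c \<odot>\<^bsub>EQ\<^esub> f) = (c \<odot>\<^bsub>S\<^esub> \<one>\<^bsub>S\<^esub>) \<odot>\<^bsub>EQS\<^esub> ebc f"
  by (rule EQS_ext) (simp_all add: ebc_closed ebc_pt End_apply pt_scalar End_closed[of _ K Q])

end

section \<open>Pushouts of algebras inside the universe\<close>

lemma module_restrict_scalars:
  assumes "cring R" "cring S" "\<psi> \<in> ring_hom R S"
  shows "module R (restrict_scalars S \<psi>)"
proof -
  interpret R: cring R by fact
  interpret S: cring S by fact
  interpret h: ring_hom_cring R S \<psi> by (unfold_locales) (rule assms(3))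
  show ?thesis
    by (rule moduleI[OF assms(1)], rule abelian_groupI)
      (auto simp: restrict_scalars_def S.a_ac S.m_ac S.l_distr S.r_distr intro: S.l_neg bexI[of _ "\<ominus>\<^bsub>S\<^esub> x" for x])
qed

lemma restrict_scalars_simps [simp]:
  "carrier (restrict_scalars S \<psi>) = carrier S" "add (restrict_scalars S \<psi>) = add S" "\<zero>\<^bsub>restrict_scalars S \<psi>\<^esub> = \<zero>\<^bsub>S\<^esub>"
  "b \<odot>\<^bsub>restrict_scalars S \<psi>\<^esub> x = \<psi> b \<otimes>\<^bsub>S\<^esub> x"
  by (simp_all add: restrict_scalars_def)

text \<open>
  \<open>R\<close> is a ring only, which may live on any type: it is required merely that the scalars of \<open>S\<close> and \<open>A\<close>
  come from common elements of \<open>R\<close>. This covers both \<open>S \<otimes>\<^sub>K A\<close> and \<open>S \<otimes>\<^sub>B A\<close> for a \<open>K\<close>-algebra \<open>B\<close>.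
\<close>

locale pushout = S: algebra K S + A: algebra K A + R: cring R
  for K :: "'k ring" and S A :: "('k, 's) module" and R :: "('r, 'x) ring_scheme" +
  fixes \<psi> \<phi> :: "'r \<Rightarrow> 's"
  assumes psi: "\<psi> \<in> ring_hom R S" and phi: "\<phi> \<in> ring_hom R A"
    and compat: "\<And>c. c \<in> carrier K \<Longrightarrow> \<exists>b\<in>carrier R. \<psi> b = c \<odot>\<^bsub>S\<^esub> \<one>\<^bsub>S\<^esub> \<and> \<phi> b = c \<odot>\<^bsub>A\<^esub> \<one>\<^bsub>A\<^esub>"
begin

sublocale psi: ring_hom_cring R S \<psi> by (unfold_locales) (rule psi)
sublocale phi: ring_hom_cring R A \<phi> by (unfold_locales) (rule phi)

abbreviation "MS \<equiv> restrict_scalars S \<psi>"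
abbreviation "MA \<equiv> restrict_scalars A \<phi>"

lemma mS: "module R MS" and mA: "module R MA"
  using module_restrict_scalars R.is_cring S.M_cring A.M_cring psi phi by blast+

sublocale tensor_product R MS MA
  by (intro tensor_product.intro mS mA)

lemma lS: "s \<in> carrier S \<Longrightarrow> linear R MS MS (\<lambda>t. s \<otimes>\<^bsub>S\<^esub> t)"
  by (rule linearI) (simp_all add: S.r_distr S.m_lcomm)

lemma lA: "s \<in> carrier A \<Longrightarrow> linear R MA MA (\<lambda>t. s \<otimes>\<^bsub>A\<^esub> t)"
  by (rule linearI) (simp_all add: A.r_distr A.m_lcomm)

text \<open>Multiplication by \<open>s \<otimes> a\<close>.\<close>

definition L :: "'s \<Rightarrow> 's \<Rightarrow> ('s, 's) tens \<Rightarrow> ('s, 's) tens" where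
  "L s a = tensor_map R MS MA (\<lambda>t. s \<otimes>\<^bsub>S\<^esub> t) (\<lambda>t. a \<otimes>\<^bsub>A\<^esub> t)"

lemma L:
  assumes "s \<in> carrier S" "a \<in> carrier A"
  shows L_closed: "\<And>x. x \<in> carrier TG \<Longrightarrow> L s a x \<in> carrier TG"
    and L_mult: "\<And>x y. x \<in> carrier TG \<Longrightarrow> y \<in> carrier TG \<Longrightarrow> L s a (x \<otimes>\<^bsub>TG\<^esub> y) = L s a x \<otimes>\<^bsub>TG\<^esub> L s a y"
    and L_one: "L s a \<one>\<^bsub>TG\<^esub> = \<one>\<^bsub>TG\<^esub>"
    and L_pt: "\<And>t b. t \<in> carrier S \<Longrightarrow> b \<in> carrier A \<Longrightarrow> L s a (pt t b) = pt (s \<otimes>\<^bsub>S\<^esub> t) (a \<otimes>\<^bsub>A\<^esub> b)"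
proof -
  note h = tensor_map_hom[OF mS mA lS[OF assms(1)] lA[OF assms(2)], folded L_def]
  show "\<And>x. x \<in> carrier TG \<Longrightarrow> L s a x \<in> carrier TG" using hom_in_carrier[OF h] .
  show "\<And>x y. x \<in> carrier TG \<Longrightarrow> y \<in> carrier TG \<Longrightarrow> L s a (x \<otimes>\<^bsub>TG\<^esub> y) = L s a x \<otimes>\<^bsub>TG\<^esub> L s a y" using hom_mult[OF h] .
  show "L s a \<one>\<^bsub>TG\<^esub> = \<one>\<^bsub>TG\<^esub>" using hom_one[OF h TG.is_group TG.is_group] .
  show "\<And>t b. t \<in> carrier S \<Longrightarrow> b \<in> carrier A \<Longrightarrow> L s a (pt t b) = pt (s \<otimes>\<^bsub>S\<^esub> t) (a \<otimes>\<^bsub>A\<^esub> b)"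
    using tensor_map_pt[OF mS mA lS[OF assms(1)] lA[OF assms(2)], folded L_def] by simp
qed

lemma pt_c [simp]: "x \<in> carrier S \<Longrightarrow> y \<in> carrier A \<Longrightarrow> pt x y \<in> carrier TG"
  using pt_closed by simp

lemmas pt_addS = pt_add_left[simplified] and pt_addA = pt_add_right[simplified] and pt_bal = pt_balanced[simplified]

lemma pt_induct [consumes 1, case_names one add]:
  assumes "z \<in> carrier TG" "P \<one>\<^bsub>TG\<^esub>"
    and "\<And>x y t. x \<in> carrier S \<Longrightarrow> y \<in> carrier A \<Longrightarrow> t \<in> carrier TG \<Longrightarrow> P t \<Longrightarrow> P (pt x y \<otimes>\<^bsub>TG\<^esub> t)"
  shows "P z"
  using tensor_induct[of z P] assms by simp

lemma bal_L:
  assumes y: "y \<in> carrier TG" shows "balanced TG (\<lambda>s a. L s a y)"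
proof (rule balancedI, unfold restrict_scalars_simps)
  fix s a assume "s \<in> carrier S" "a \<in> carrier A" then show "L s a y \<in> carrier TG" using y by (rule L_closed)
next
  fix s s' a assume a: "s \<in> carrier S" "s' \<in> carrier S" "a \<in> carrier A"
  show "L (s \<oplus>\<^bsub>S\<^esub> s') a y = L s a y \<otimes>\<^bsub>TG\<^esub> L s' a y"
    using y
  proof (induction rule: pt_induct)
    case one then show ?case using a by (simp add: L_one)
  next
    case (add x b t)
    then show ?case using a by (simp add: L_mult L_closed L_pt S.l_distr pt_addS TG.m_ac)
  qed
next
  fix s a a' assume a: "s \<in> carrier S" "a \<in> carrier A" "a' \<in> carrier A"
  show "L s (a \<oplus>\<^bsub>A\<^esub> a') y = L s a y \<otimes>\<^bsub>TG\<^esub> L s a' y"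
    using y
  proof (induction rule: pt_induct)
    case one then show ?case using a by (simp add: L_one)
  next
    case (add x b t)
    then show ?case using a by (simp add: L_mult L_closed L_pt A.l_distr pt_addA TG.m_ac)
  qed
next
  fix r s a assume a: "r \<in> carrier R" "s \<in> carrier S" "a \<in> carrier A"
  show "L (\<psi> r \<otimes>\<^bsub>S\<^esub> s) a y = L s (\<phi> r \<otimes>\<^bsub>A\<^esub> a) y"
    using y
  proof (induction rule: pt_induct)
    case one then show ?case using a by (simp add: L_one)
  next
    case (add x b t)
    then show ?case using a by (simp add: L_mult L_closed L_pt A.m_assoc S.m_assoc pt_bal)
  qed
qed

definition tmul :: "('s, 's) tens \<Rightarrow> ('s, 's) tens \<Rightarrow> ('s, 's) tens" where
  "tmul x y = lift TG (\<lambda>s a. L s a y) x"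

lemma tmul_pt: "s \<in> carrier S \<Longrightarrow> a \<in> carrier A \<Longrightarrow> y \<in> carrier TG \<Longrightarrow> tmul (pt s a) y = L s a y"
  using lift(2)[OF comm_group_TG bal_L] by (simp add: tmul_def)

lemma tmul_closed [simp]: "x \<in> carrier TG \<Longrightarrow> y \<in> carrier TG \<Longrightarrow> tmul x y \<in> carrier TG"
  using hom_in_carrier[OF lift(1)[OF comm_group_TG bal_L]] by (simp add: tmul_def)

lemma tmul_add_left: "x \<in> carrier TG \<Longrightarrow> x' \<in> carrier TG \<Longrightarrow> y \<in> carrier TG \<Longrightarrow> tmul (x \<otimes>\<^bsub>TG\<^esub> x') y = tmul x y \<otimes>\<^bsub>TG\<^esub> tmul x' y"
  using hom_mult[OF lift(1)[OF comm_group_TG bal_L]] by (simp add: tmul_def)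

lemma tmul_one_left: "y \<in> carrier TG \<Longrightarrow> tmul \<one>\<^bsub>TG\<^esub> y = \<one>\<^bsub>TG\<^esub>"
  using hom_one[OF lift(1)[OF comm_group_TG bal_L]] by (simp add: tmul_def)

lemma tmul_pt_pt: "s \<in> carrier S \<Longrightarrow> a \<in> carrier A \<Longrightarrow> t \<in> carrier S \<Longrightarrow> b \<in> carrier A \<Longrightarrow>
   tmul (pt s a) (pt t b) = pt (s \<otimes>\<^bsub>S\<^esub> t) (a \<otimes>\<^bsub>A\<^esub> b)"
  by (simp add: tmul_pt L_pt)

lemma tmul_one_right: "y \<in> carrier TG \<Longrightarrow> tmul y \<one>\<^bsub>TG\<^esub> = \<one>\<^bsub>TG\<^esub>"
proof (induction rule: pt_induct)
  case one show ?case by (simp add: tmul_one_left)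
next
  case (add s a t) then show ?case by (simp add: tmul_add_left tmul_pt L_one)
qed

lemma tmul_comm:
  assumes "x \<in> carrier TG" "y \<in> carrier TG" shows "tmul x y = tmul y x"
proof -
  have p: "L s a y = tmul y (pt s a)" if "y \<in> carrier TG" "s \<in> carrier S" "a \<in> carrier A" for s a y
    using that(1)
  proof (induction rule: pt_induct)
    case one then show ?case using that by (simp add: tmul_one_left L_one)
  next
    case (add t b u)
    then show ?case using that by (simp add: tmul_add_left tmul_pt_pt L_mult L_pt S.m_comm A.m_comm)
  qed
  show ?thesis using assms(1)
  proof (induction rule: pt_induct)
    case one then show ?case using assms(2) tmul_one_right by (simp add: tmul_one_left)
  next
    case (add s a t)
    have "tmul y (pt s a \<otimes>\<^bsub>TG\<^esub> t) = tmul y (pt s a) \<otimes>\<^bsub>TG\<^esub> tmul y t"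
      using assms(2)
    proof (induction rule: pt_induct)
      case one then show ?case using add by (simp add: tmul_one_left)
    next
      case (add t' b u)
      then show ?case using \<open>s \<in> carrier S\<close> \<open>a \<in> carrier A\<close> \<open>t \<in> carrier TG\<close>
        by (simp add: tmul_add_left tmul_pt L_mult L_closed TG.m_ac)
    qed
    then show ?case using add assms(2) by (simp add: tmul_add_left tmul_pt p)
  qed
qed

lemma tmul_add_right: "x \<in> carrier TG \<Longrightarrow> y \<in> carrier TG \<Longrightarrow> z \<in> carrier TG \<Longrightarrow> tmul z (x \<otimes>\<^bsub>TG\<^esub> y) = tmul z x \<otimes>\<^bsub>TG\<^esub> tmul z y"
  using tmul_add_left[of x y z] tmul_comm by simp

lemma tmul_assoc:
  assumes "x \<in> carrier TG" "y \<in> carrier TG" "z \<in> carrier TG" shows "tmul (tmul x y) z = tmul x (tmul y z)"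
  using assms(1)
proof (induction rule: pt_induct)
  case one then show ?case using assms by (simp add: tmul_one_left)
next
  case (add s a t)
  have "tmul (tmul (pt s a) y) z = tmul (pt s a) (tmul y z)"
    using assms(2)
  proof (induction rule: pt_induct)
    case one then show ?case using add assms by (simp add: tmul_one_left tmul_one_right)
  next
    case (add s' a' t')
    have "tmul (tmul (pt s a) (pt s' a')) z = tmul (pt s a) (tmul (pt s' a') z)"
      using assms(3)
    proof (induction rule: pt_induct)
      case one
      then show ?case using \<open>s \<in> carrier S\<close> \<open>a \<in> carrier A\<close> \<open>s' \<in> carrier S\<close> \<open>a' \<in> carrier A\<close>
        by (simp add: tmul_one_right)
    next
      case (add s'' a'' t'')
      then show ?case using \<open>s \<in> carrier S\<close> \<open>a \<in> carrier A\<close> \<open>s' \<in> carrier S\<close> \<open>a' \<in> carrier A\<close>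
        by (simp add: tmul_add_right tmul_pt_pt S.m_assoc A.m_assoc)
    qed
    then show ?case using \<open>s \<in> carrier S\<close> \<open>a \<in> carrier A\<close> add assms
      by (simp add: tmul_add_left tmul_add_right)
  qed
  then show ?case using add assms by (simp add: tmul_add_left)
qed

lemma tmul_unit: "y \<in> carrier TG \<Longrightarrow> tmul (pt \<one>\<^bsub>S\<^esub> \<one>\<^bsub>A\<^esub>) y = y"
proof (induction rule: pt_induct)
  case one then show ?case by (simp add: tmul_one_right)
next
  case (add s a t) then show ?case by (simp add: tmul_add_right tmul_pt_pt)
qed

definition TA :: "('k, ('s, 's) tens) module" where
  "TA = \<lparr>carrier = carrier TG, monoid.mult = tmul, monoid.one = pt \<one>\<^bsub>S\<^esub> \<one>\<^bsub>A\<^esub>,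
     ring.zero = \<one>\<^bsub>TG\<^esub>, ring.add = monoid.mult TG, module.smult = (\<lambda>c. tmul (pt (c \<odot>\<^bsub>S\<^esub> \<one>\<^bsub>S\<^esub>) \<one>\<^bsub>A\<^esub>))\<rparr>"

lemma TA_simps [simp]:
  "carrier TA = carrier TG" "monoid.mult TA = tmul" "\<one>\<^bsub>TA\<^esub> = pt \<one>\<^bsub>S\<^esub> \<one>\<^bsub>A\<^esub>" "\<zero>\<^bsub>TA\<^esub> = \<one>\<^bsub>TG\<^esub>"
  "add TA = monoid.mult TG" "c \<odot>\<^bsub>TA\<^esub> x = tmul (pt (c \<odot>\<^bsub>S\<^esub> \<one>\<^bsub>S\<^esub>) \<one>\<^bsub>A\<^esub>) x"
  by (simp_all add: TA_def)

lemma cring_TA: "cring TA"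
proof (rule cringI)
  show "abelian_group TA"
    by (rule abelian_groupI) (auto simp: TG.m_ac intro: TG.l_inv_ex)
  show "comm_monoid TA"
  proof (rule comm_monoidI)
    show "x \<otimes>\<^bsub>TA\<^esub> y = y \<otimes>\<^bsub>TA\<^esub> x" if "x \<in> carrier TA" "y \<in> carrier TA" for x y
      using that tmul_comm by simp
  qed (simp_all add: tmul_assoc tmul_unit)
qed (simp add: tmul_add_left)

lemma algebra_TA: "algebra K TA"
proof (rule algebraI)
  show "cring K" by (rule S.R_cring)
  show "cring TA" by (rule cring_TA)
qed (simp_all add: tmul_add_left[symmetric] tmul_add_right tmul_assoc[symmetric] tmul_pt_pt S.smult_l_distr pt_addS S.smult_assoc1 S.smult_assoc2 tmul_unit)

definition "i1 = (\<lambda>s\<in>carrier S. pt s \<one>\<^bsub>A\<^esub>)"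
definition "i2 = (\<lambda>a\<in>carrier A. pt \<one>\<^bsub>S\<^esub> a)"

lemma i1: "i1 \<in> alg_hom K S TA"
  by (rule alg_homI) (auto simp: i1_def tmul_pt_pt pt_addS S.smult_assoc2)

lemma i2: "i2 \<in> alg_hom K A TA"
proof (rule alg_homI)
  fix c a assume ca: "c \<in> carrier K" "a \<in> carrier A"
  obtain b where b: "b \<in> carrier R" "\<psi> b = c \<odot>\<^bsub>S\<^esub> \<one>\<^bsub>S\<^esub>" "\<phi> b = c \<odot>\<^bsub>A\<^esub> \<one>\<^bsub>A\<^esub>" using compat ca by blast
  show "i2 (c \<odot>\<^bsub>A\<^esub> a) = c \<odot>\<^bsub>TA\<^esub> i2 a"
    using pt_bal[OF b(1) S.one_closed ca(2)] ca b by (simp add: i2_def tmul_pt_pt A.smult_assoc2)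
qed (auto simp: i2_def tmul_pt_pt pt_addA)

lemma i12: "b \<in> carrier R \<Longrightarrow> i1 (\<psi> b) = i2 (\<phi> b)"
  using pt_bal[of b "\<one>\<^bsub>S\<^esub>" "\<one>\<^bsub>A\<^esub>"] by (simp add: i1_def i2_def)

lemma pt_i12: "s \<in> carrier S \<Longrightarrow> a \<in> carrier A \<Longrightarrow> pt s a = i1 s \<otimes>\<^bsub>TA\<^esub> i2 a"
  by (simp add: i1_def i2_def tmul_pt_pt)

lemma TA_universal:
  assumes U: "algebra K U" and f: "f \<in> alg_hom K S U" and g: "g \<in> alg_hom K A U"
    and fg: "\<And>b. b \<in> carrier R \<Longrightarrow> f (\<psi> b) = g (\<phi> b)"
  obtains k where "k \<in> alg_hom K TA U" "\<And>s. s \<in> carrier S \<Longrightarrow> k (i1 s) = f s" "\<And>a. a \<in> carrier A \<Longrightarrow> k (i2 a) = g a"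
proof -
  interpret U: algebra K U by fact
  note f' = alg_homD[OF f] and g' = alg_homD[OF g]
  have b: "balanced (add_monoid U) (\<lambda>s a. f s \<otimes>\<^bsub>U\<^esub> g a)"
    by (rule balancedI) (simp_all add: f' g' U.l_distr U.r_distr fg U.m_ac)
  let ?k = "lift (add_monoid U) (\<lambda>s a. f s \<otimes>\<^bsub>U\<^esub> g a)"
  note l = lift[OF U.a_comm_group b]
  have kc: "?k x \<in> carrier U" if "x \<in> carrier TG" for x using hom_in_carrier[OF l(1)] that by simp
  have ka: "?k (x \<otimes>\<^bsub>TG\<^esub> y) = ?k x \<oplus>\<^bsub>U\<^esub> ?k y" if "x \<in> carrier TG" "y \<in> carrier TG" for x y
    using hom_mult[OF l(1)] that by simp
  have kz: "?k \<one>\<^bsub>TG\<^esub> = \<zero>\<^bsub>U\<^esub>" using hom_one[OF l(1) TG.is_group comm_group.axioms(2)[OF U.a_comm_group]] by simp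
  have kp: "?k (pt s a) = f s \<otimes>\<^bsub>U\<^esub> g a" if "s \<in> carrier S" "a \<in> carrier A" for s a using l(2) that by simp
  have kmp: "?k (tmul (pt s a) y) = ?k (pt s a) \<otimes>\<^bsub>U\<^esub> ?k y" if "s \<in> carrier S" "a \<in> carrier A" "y \<in> carrier TG" for s a y
    using that(3)
  proof (induction rule: pt_induct)
    case one then show ?case using that kz kc[of "pt s a"] by (simp add: tmul_one_right)
  next
    case (add s' a' t)
    then show ?case using that kc
      by (simp add: tmul_add_right ka tmul_pt_pt kp f' g' U.r_distr U.m_ac)
  qed
  have km: "?k (tmul x y) = ?k x \<otimes>\<^bsub>U\<^esub> ?k y" if "x \<in> carrier TG" "y \<in> carrier TG" for x y
    using that(1)
  proof (induction rule: pt_induct)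
    case one then show ?case using that kz kc by (simp add: tmul_one_left)
  next
    case (add s a t)
    then show ?case using that kc[of "pt s a"] kc[of t] kc[of y]
      by (simp add: tmul_add_left ka kmp U.l_distr)
  qed
  let ?k' = "restrict ?k (carrier TG)"
  show thesis
  proof
    show "?k' \<in> alg_hom K TA U"
      by (rule alg_homI) (simp_all add: kc km ka kp f' g' U.smult_assoc2)
    show "?k' (i1 s) = f s" if "s \<in> carrier S" for s using that by (simp add: i1_def kp f' g')
    show "?k' (i2 a) = g a" if "a \<in> carrier A" for a using that by (simp add: i2_def kp f' g')
  qed
qed

end

text \<open>On a finite field the map \<open>x \<mapsto> x\<^sup>2 + x\<close> is not injective, since it vanishes at \<open>0\<close> and \<open>-1\<close>. So it
  misses some \<open>a\<close>, and \<open>X\<^sup>2 + X - a\<close> has no root.\<close>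

lemma algebraically_closed_infinite:
  assumes "algebraically_closed K" shows "infinite (carrier K)"
proof
  interpret algebraically_closed K by fact
  assume fin: "finite (carrier K)"
  let ?f = "\<lambda>x. x \<otimes>\<^bsub>K\<^esub> (x \<oplus>\<^bsub>K\<^esub> \<one>\<^bsub>K\<^esub>)"
  have "\<not> inj_on ?f (carrier K)"
  proof
    assume "inj_on ?f (carrier K)"
    moreover have "?f \<zero>\<^bsub>K\<^esub> = ?f (\<ominus>\<^bsub>K\<^esub> \<one>\<^bsub>K\<^esub>)" by (simp add: l_neg)
    ultimately have "\<zero>\<^bsub>K\<^esub> = \<ominus>\<^bsub>K\<^esub> \<one>\<^bsub>K\<^esub>" by (rule inj_onD) simp_all
    then show False using one_not_zero by (metis minus_minus minus_zero one_closed)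
  qed
  moreover have "?f ` carrier K \<subseteq> carrier K" by auto
  ultimately obtain a where a: "a \<in> carrier K" "a \<notin> ?f ` carrier K"
    using fin endo_inj_surj finite_surj_inj by (metis subset_antisym subsetI)
  let ?p = "[\<one>\<^bsub>K\<^esub>, \<one>\<^bsub>K\<^esub>, \<ominus>\<^bsub>K\<^esub> a]"
  have p: "?p \<in> carrier (poly_ring K)"
    using a by (simp add: univ_poly_carrier[symmetric] polynomial_def)
  have "size (roots ?p) = 2" using roots_over_carrier[OF p] by (simp add: splitted_def)
  then obtain x where "x \<in># roots ?p" by (metis size_eq_Suc_imp_elem numeral_2_eq_2)
  then have "is_root ?p x" using roots_mem_iff_is_root[OF p] by simp
  then have x: "x \<in> carrier K" "eval ?p x = \<zero>\<^bsub>K\<^esub>" unfolding is_root_def by blast+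
  have "x \<otimes>\<^bsub>K\<^esub> x \<oplus>\<^bsub>K\<^esub> x \<ominus>\<^bsub>K\<^esub> a = \<zero>\<^bsub>K\<^esub>"
  proof -
    have "eval ?p x = x \<otimes>\<^bsub>K\<^esub> x \<oplus>\<^bsub>K\<^esub> x \<ominus>\<^bsub>K\<^esub> a"
      using x(1) a(1) by (simp add: a_minus_def numeral_2_eq_2 a_assoc)
    then show ?thesis using x(2) by simp
  qed
  then have "?f x = a" using x(1) a(1) by (simp add: r_distr)
  then show False using a x by blast
qed

text \<open>Transport of structure along an injection into the universe.\<close>

lemma algebra_in_universe:
  fixes A :: "('k, 'c) module"
  assumes A: "algebra K A" and le: "carrier A \<lesssim> (UNIV :: 's set)"
  obtains T :: "('k, 's) module" and h where "algebra K T" "bij_betw h (carrier A) (carrier T)"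
    "h \<in> alg_hom K A T" "(\<lambda>y\<in>carrier T. inv_into (carrier A) h y) \<in> alg_hom K T A"
proof -
  interpret A: algebra K A by fact
  obtain h0 :: "'c \<Rightarrow> 's" where h0: "inj_on h0 (carrier A)" using le by (auto simp: lepoll_def)
  define h where "h = restrict h0 (carrier A)"
  have hi: "inj_on h (carrier A)" using h0 by (simp add: h_def inj_on_def)
  let ?g = "inv_into (carrier A) h"
  have g: "?g (h x) = x" if "x \<in> carrier A" for x using inv_into_f_f[OF hi that] .
  define T :: "('k, 's) module" where
    "T = \<lparr>carrier = h ` carrier A, monoid.mult = (\<lambda>x y. h (?g x \<otimes>\<^bsub>A\<^esub> ?g y)), monoid.one = h \<one>\<^bsub>A\<^esub>,
     ring.zero = h \<zero>\<^bsub>A\<^esub>, ring.add = (\<lambda>x y. h (?g x \<oplus>\<^bsub>A\<^esub> ?g y)), module.smult = (\<lambda>c x. h (c \<odot>\<^bsub>A\<^esub> ?g x))\<rparr>"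
  have s: "carrier T = h ` carrier A" "x \<otimes>\<^bsub>T\<^esub> y = h (?g x \<otimes>\<^bsub>A\<^esub> ?g y)" "\<one>\<^bsub>T\<^esub> = h \<one>\<^bsub>A\<^esub>" "\<zero>\<^bsub>T\<^esub> = h \<zero>\<^bsub>A\<^esub>"
    "x \<oplus>\<^bsub>T\<^esub> y = h (?g x \<oplus>\<^bsub>A\<^esub> ?g y)" "c \<odot>\<^bsub>T\<^esub> x = h (c \<odot>\<^bsub>A\<^esub> ?g x)" for x y c
    by (simp_all add: T_def)
  have hc: "h x \<in> carrier T" if "x \<in> carrier A" for x using that by (simp add: s)
  have "cring T"
  proof (rule cringI)
    show "abelian_group T"
    proof (rule abelian_groupI)
      fix x assume "x \<in> carrier T"
      then obtain u where u: "u \<in> carrier A" "x = h u" by (auto simp: s)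
      show "\<exists>y\<in>carrier T. y \<oplus>\<^bsub>T\<^esub> x = \<zero>\<^bsub>T\<^esub>"
        by (rule bexI[of _ "h (\<ominus>\<^bsub>A\<^esub> u)"]) (use u in \<open>simp_all add: s g A.l_neg\<close>)
    qed (auto simp: s g A.a_ac)
    show "comm_monoid T" by (rule comm_monoidI) (auto simp: s g A.m_ac)
  qed (auto simp: s g A.l_distr)
  then have T: "algebra K T"
    by (intro algebraI A.R_cring)
      (auto simp: s g A.smult_l_distr A.smult_r_distr A.smult_assoc1 A.smult_assoc2)
  show thesis
  proof (rule that[OF T])
    show "bij_betw h (carrier A) (carrier T)" using hi by (simp add: bij_betw_def s)
    show "h \<in> alg_hom K A T"
      by (rule alg_homI) (auto simp: s g, simp add: h_def)
    show "(\<lambda>y\<in>carrier T. ?g y) \<in> alg_hom K T A"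
      by (rule alg_homI) (auto simp: s g inj_on_eq_iff[OF hi])
  qed
qed

text \<open>The tensor product is a quotient of the free abelian group on a subset of \<open>'s \<times> 's\<close>, and for infinite
  \<open>'s\<close> this group has no more elements than \<open>'s\<close>.\<close>

lemma (in pushout) TG_in_universe:
  assumes "infinite (UNIV :: 's set)"
  shows "carrier TG \<lesssim> (UNIV :: 's set)"
proof -
  have "carrier TG \<subseteq> (\<lambda>c. tensor_rel R MS MA #>\<^bsub>FA\<^esub> c) ` carrier FA"
  proof
    fix z assume "z \<in> carrier TG"
    then obtain c where "Poly_Mapping.keys c \<subseteq> carrier MS \<times> carrier MA" "z = tensor_rel R MS MA #>\<^bsub>FA\<^esub> c"
      by (rule TG_carrierE)
    then show "z \<in> (\<lambda>c. tensor_rel R MS MA #>\<^bsub>FA\<^esub> c) ` carrier FA" by simp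
  qed
  then have "carrier TG \<lesssim> carrier FA"
    using lepoll_trans[OF subset_imp_lepoll image_lepoll] by blast
  also have "carrier FA \<lesssim> carrier (free_Abelian_group (UNIV :: ('s \<times> 's) set))"
    by (rule subset_imp_lepoll) auto
  also have "\<dots> \<lesssim> (UNIV :: ('s \<times> 's) set)"
  proof (rule eqpoll_imp_lepoll[OF eqpoll_free_Abelian_group_infinite])
    show "infinite (UNIV :: ('s \<times> 's) set)" using assms by (simp add: finite_prod)
  qed
  also have "\<dots> \<lesssim> (UNIV :: 's set)"
    using card_of_Times_same_infinite[OF assms]
    by (simp add: eqpoll_iff_card_of_ordIso eqpoll_imp_lepoll)
  finally show ?thesis .
qed

text \<open>The bijection \<open>\<theta>\<close> is part of the result, because flatness speaks about the tensor product itself and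
  not about its copy \<open>T\<close>.\<close>

lemma (in pushout) exists_in_universe:
  assumes inf: "infinite (UNIV :: 's set)"
  obtains T :: "('k, 's) module" and j1 j2 \<theta> where "algebra K T" "j1 \<in> alg_hom K S T" "j2 \<in> alg_hom K A T"
    "\<forall>b\<in>carrier R. j1 (\<psi> b) = j2 (\<phi> b)"
    "\<theta> \<in> hom TG (add_monoid T)" "bij_betw \<theta> (carrier TG) (carrier T)"
    "\<forall>s\<in>carrier S. \<forall>a\<in>carrier A. \<theta> (pt s a) = j1 s \<otimes>\<^bsub>T\<^esub> j2 a"
    "\<forall>(U :: ('k, 's) module) f g. algebra K U \<longrightarrow> f \<in> alg_hom K S U \<longrightarrow> g \<in> alg_hom K A U \<longrightarrow>
      (\<forall>b\<in>carrier R. f (\<psi> b) = g (\<phi> b)) \<longrightarrow>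
      (\<exists>k\<in>alg_hom K T U. compose (carrier S) k j1 = f \<and> compose (carrier A) k j2 = g)"
proof -
  obtain T :: "('k, 's) module" and h where T: "algebra K T" "bij_betw h (carrier TA) (carrier T)"
    "h \<in> alg_hom K TA T" "(\<lambda>y\<in>carrier T. inv_into (carrier TA) h y) \<in> alg_hom K T TA"
    using algebra_in_universe[OF algebra_TA] TG_in_universe[OF inf] by auto
  let ?j1 = "compose (carrier S) h i1" and ?j2 = "compose (carrier A) h i2"
  note h = alg_homD[OF T(3)] and e1 = alg_homD[OF i1] and e2 = alg_homD[OF i2]
  show thesis
  proof (rule that[OF T(1), of ?j1 ?j2 h])
    show "?j1 \<in> alg_hom K S T" "?j2 \<in> alg_hom K A T"
      using alg_hom_comp[OF i1 T(3) S.algebra_axioms] alg_hom_comp[OF i2 T(3) A.algebra_axioms] .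
    show "\<forall>b\<in>carrier R. ?j1 (\<psi> b) = ?j2 (\<phi> b)"
      using i12 by (simp add: compose_eq)
    show "h \<in> hom TG (add_monoid T)" using h(2,4) by (auto simp: hom_def)
    show "bij_betw h (carrier TG) (carrier T)" using T(2) by simp
    show "\<forall>s\<in>carrier S. \<forall>a\<in>carrier A. h (pt s a) = ?j1 s \<otimes>\<^bsub>T\<^esub> ?j2 a"
      using e1(2) e2(2) h(3) by (simp add: compose_eq pt_i12)
    show "\<forall>(U :: ('k, 's) module) f g. algebra K U \<longrightarrow> f \<in> alg_hom K S U \<longrightarrow> g \<in> alg_hom K A U \<longrightarrow>
      (\<forall>b\<in>carrier R. f (\<psi> b) = g (\<phi> b)) \<longrightarrow>
      (\<exists>k\<in>alg_hom K T U. compose (carrier S) k ?j1 = f \<and> compose (carrier A) k ?j2 = g)"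
    proof (intro allI impI)
    fix U :: "('k, 's) module" and f g
    assume "algebra K U" "f \<in> alg_hom K S U" "g \<in> alg_hom K A U" "\<forall>b\<in>carrier R. f (\<psi> b) = g (\<phi> b)"
    then obtain k where k: "k \<in> alg_hom K TA U" "\<And>s. s \<in> carrier S \<Longrightarrow> k (i1 s) = f s" "\<And>a. a \<in> carrier A \<Longrightarrow> k (i2 a) = g a"
      using TA_universal by blast
    let ?hi = "\<lambda>y\<in>carrier T. inv_into (carrier TA) h y"
    have hi: "?hi (h x) = x" if "x \<in> carrier TG" for x
      using that T(2) h(2) by (simp add: bij_betw_def inv_into_f_f)
    have "compose (carrier T) k ?hi \<in> alg_hom K T U" by (rule alg_hom_comp[OF T(4) k(1) T(1)])
    moreover have "compose (carrier S) (compose (carrier T) k ?hi) ?j1 = f"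
      by (rule extensionalityI[OF compose_extensional alg_homD(7)[OF \<open>f \<in> alg_hom K S U\<close>]])
        (use e1(2) h(2) hi k(2) in \<open>simp add: compose_eq del: restrict_apply\<close>)
    moreover have "compose (carrier A) (compose (carrier T) k ?hi) ?j2 = g"
      by (rule extensionalityI[OF compose_extensional alg_homD(7)[OF \<open>g \<in> alg_hom K A U\<close>]])
        (use e2(2) h(2) hi k(3) in \<open>simp add: compose_eq del: restrict_apply\<close>)
    ultimately show "\<exists>k\<in>alg_hom K T U. compose (carrier S) k ?j1 = f \<and> compose (carrier A) k ?j2 = g" by blast
    qed
  qed
qed

section \<open>Faithfully flat descent\<close>

text \<open>Quotient modules, realised on representatives so that they stay inside the universe.\<close>

lemma quotient_module:
  fixes M :: "('r, 'm) module"
  assumes M: "module R M" and P: "submodule P R M"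
  obtains Z :: "('r, 'm) module" and q where "module R Z" "linear R M Z q"
    "\<And>x. x \<in> carrier M \<Longrightarrow> q x = \<zero>\<^bsub>Z\<^esub> \<longleftrightarrow> x \<in> P" "carrier Z = q ` carrier M"
proof -
  interpret module R M by fact
  note D = submoduleD[OF P]
  define q where "q x = (SOME y. y \<in> carrier M \<and> y \<ominus>\<^bsub>M\<^esub> x \<in> P)" for x
  have q: "q x \<in> carrier M \<and> q x \<ominus>\<^bsub>M\<^esub> x \<in> P" if "x \<in> carrier M" for x
    unfolding q_def by (rule someI[of _ x]) (use that D in \<open>simp add: a_minus_def M.r_neg\<close>)
  have cancel: "(u \<oplus>\<^bsub>M\<^esub> d) \<ominus>\<^bsub>M\<^esub> d = u" if "u \<in> carrier M" "d \<in> carrier M" for u d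
    using that by (simp add: a_minus_def M.a_assoc M.r_neg)
  have telescope: "(u \<ominus>\<^bsub>M\<^esub> x) \<oplus>\<^bsub>M\<^esub> (x \<ominus>\<^bsub>M\<^esub> y) = u \<ominus>\<^bsub>M\<^esub> y" if "u \<in> carrier M" "x \<in> carrier M" "y \<in> carrier M" for u x y
    using that by (simp add: a_minus_def M.a_assoc) (simp add: M.a_assoc[symmetric] M.l_neg)
  have qeq: "q x = q y" if "x \<in> carrier M" "y \<in> carrier M" "x \<ominus>\<^bsub>M\<^esub> y \<in> P" for x y
  proof -
    have "z \<ominus>\<^bsub>M\<^esub> x \<in> P \<longleftrightarrow> z \<ominus>\<^bsub>M\<^esub> y \<in> P" if z: "z \<in> carrier M" for z
    proof -
      have 1: "z \<ominus>\<^bsub>M\<^esub> y = (z \<ominus>\<^bsub>M\<^esub> x) \<oplus>\<^bsub>M\<^esub> (x \<ominus>\<^bsub>M\<^esub> y)"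
        using telescope z \<open>x \<in> carrier M\<close> \<open>y \<in> carrier M\<close> by simp
      have 2: "z \<ominus>\<^bsub>M\<^esub> x = (z \<ominus>\<^bsub>M\<^esub> y) \<ominus>\<^bsub>M\<^esub> (x \<ominus>\<^bsub>M\<^esub> y)"
        unfolding 1 using cancel[of "z \<ominus>\<^bsub>M\<^esub> x" "x \<ominus>\<^bsub>M\<^esub> y"] that \<open>x \<in> carrier M\<close> \<open>y \<in> carrier M\<close> by simp
      show ?thesis using 1 2 D \<open>x \<ominus>\<^bsub>M\<^esub> y \<in> P\<close> by metis
    qed
    then show ?thesis unfolding q_def by (intro arg_cong[where f=Eps] ext) auto
  qed
  have qD: "x \<ominus>\<^bsub>M\<^esub> y \<in> P" if "x \<in> carrier M" "y \<in> carrier M" "q x = q y" for x y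
  proof -
    let ?u = "q y"
    have u: "?u \<in> carrier M" "?u \<ominus>\<^bsub>M\<^esub> x \<in> P" "?u \<ominus>\<^bsub>M\<^esub> y \<in> P"
      using q[OF that(1)] q[OF that(2)] that(3) by simp_all
    have "x \<ominus>\<^bsub>M\<^esub> y = ((x \<ominus>\<^bsub>M\<^esub> y) \<oplus>\<^bsub>M\<^esub> (?u \<ominus>\<^bsub>M\<^esub> x)) \<ominus>\<^bsub>M\<^esub> (?u \<ominus>\<^bsub>M\<^esub> x)"
      using cancel[of "x \<ominus>\<^bsub>M\<^esub> y" "?u \<ominus>\<^bsub>M\<^esub> x"] that u by simp
    also have "(x \<ominus>\<^bsub>M\<^esub> y) \<oplus>\<^bsub>M\<^esub> (?u \<ominus>\<^bsub>M\<^esub> x) = ?u \<ominus>\<^bsub>M\<^esub> y"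
      using telescope[of ?u x y] M.a_comm[of "x \<ominus>\<^bsub>M\<^esub> y" "?u \<ominus>\<^bsub>M\<^esub> x"] that u by simp
    finally show ?thesis using u D(6) by metis
  qed
  have qq: "q (q x) = q x" if "x \<in> carrier M" for x
    using q[OF that] that by (intro qeq) auto
  have q_add: "q (q x \<oplus>\<^bsub>M\<^esub> q y) = q (x \<oplus>\<^bsub>M\<^esub> y)" if "x \<in> carrier M" "y \<in> carrier M" for x y
  proof (rule qeq)
    have "(q x \<oplus>\<^bsub>M\<^esub> q y) \<ominus>\<^bsub>M\<^esub> (x \<oplus>\<^bsub>M\<^esub> y) = (q x \<ominus>\<^bsub>M\<^esub> x) \<oplus>\<^bsub>M\<^esub> (q y \<ominus>\<^bsub>M\<^esub> y)"
      using q[OF that(1)] q[OF that(2)] that by (simp add: a_minus_def M.minus_add M.a_ac)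
    then show "(q x \<oplus>\<^bsub>M\<^esub> q y) \<ominus>\<^bsub>M\<^esub> (x \<oplus>\<^bsub>M\<^esub> y) \<in> P" using q that D(3) by simp
  qed (use q that in auto)
  have q_smult: "q (c \<odot>\<^bsub>M\<^esub> q x) = q (c \<odot>\<^bsub>M\<^esub> x)" if "c \<in> carrier R" "x \<in> carrier M" for c x
  proof (rule qeq)
    have "c \<odot>\<^bsub>M\<^esub> q x \<ominus>\<^bsub>M\<^esub> c \<odot>\<^bsub>M\<^esub> x = c \<odot>\<^bsub>M\<^esub> (q x \<ominus>\<^bsub>M\<^esub> x)"
      using q[OF that(2)] that by (simp add: a_minus_def smult_r_distr smult_r_minus)
    then show "c \<odot>\<^bsub>M\<^esub> q x \<ominus>\<^bsub>M\<^esub> c \<odot>\<^bsub>M\<^esub> x \<in> P" using q that D(4) by simp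
  qed (use q that in auto)
  define Z :: "('r, 'm) module" where
    "Z = \<lparr>carrier = q ` carrier M, monoid.mult = undefined, monoid.one = undefined, ring.zero = q \<zero>\<^bsub>M\<^esub>,
       ring.add = (\<lambda>x y. q (x \<oplus>\<^bsub>M\<^esub> y)), module.smult = (\<lambda>c x. q (c \<odot>\<^bsub>M\<^esub> x))\<rparr>"
  have s: "carrier Z = q ` carrier M" "\<zero>\<^bsub>Z\<^esub> = q \<zero>\<^bsub>M\<^esub>" "x \<oplus>\<^bsub>Z\<^esub> y = q (x \<oplus>\<^bsub>M\<^esub> y)" "c \<odot>\<^bsub>Z\<^esub> x = q (c \<odot>\<^bsub>M\<^esub> x)" for x y c
    by (simp_all add: Z_def)
  have q_addl: "q (q x \<oplus>\<^bsub>M\<^esub> y) = q (x \<oplus>\<^bsub>M\<^esub> y)" if "x \<in> carrier M" "y \<in> carrier M" for x y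
    using q_add[of "q x" y] q_add[of x y] that q by (simp add: qq)
  have q_addr: "q (x \<oplus>\<^bsub>M\<^esub> q y) = q (x \<oplus>\<^bsub>M\<^esub> y)" if "x \<in> carrier M" "y \<in> carrier M" for x y
    using q_addl[of y x] that q by (simp add: M.a_comm)
  have qc: "q x \<in> carrier M" if "x \<in> carrier M" for x using q that by blast
  have "module R Z"
  proof (rule moduleI[OF R.is_cring])
    show "abelian_group Z"
    proof (rule abelian_groupI)
      fix x assume "x \<in> carrier Z"
      then obtain u where u: "u \<in> carrier M" "x = q u" by (auto simp: s)
      show "\<exists>y\<in>carrier Z. y \<oplus>\<^bsub>Z\<^esub> x = \<zero>\<^bsub>Z\<^esub>"
        by (rule bexI[of _ "q (\<ominus>\<^bsub>M\<^esub> u)"]) (use u in \<open>simp_all add: s q_add M.l_neg\<close>)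
    next
      fix x y assume "x \<in> carrier Z" "y \<in> carrier Z"
      then show "x \<oplus>\<^bsub>Z\<^esub> y = y \<oplus>\<^bsub>Z\<^esub> x" by (auto simp: s qc M.a_comm)
    qed (auto simp: s qc qq q_addl q_addr M.a_assoc)
  qed (auto simp: s qc qq q_addl q_addr q_smult smult_l_distr[symmetric] smult_r_distr[symmetric] smult_assoc1[symmetric])
  moreover have "linear R M Z q"
    by (rule linearI) (simp_all add: s q_add q_smult)
  moreover have "q x = \<zero>\<^bsub>Z\<^esub> \<longleftrightarrow> x \<in> P" if "x \<in> carrier M" for x
    unfolding s using qD[of x "\<zero>\<^bsub>M\<^esub>"] qeq[of x "\<zero>\<^bsub>M\<^esub>"] cancel[of x "\<zero>\<^bsub>M\<^esub>"] that by auto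
  ultimately show thesis using that s(1) by blast
qed

text \<open>By flatness \<open>W \<otimes>\<^sub>B A\<close> embeds in \<open>M \<otimes>\<^sub>B A\<close>, where its generators vanish. So \<open>W \<otimes>\<^sub>B A = 0\<close>, and \<open>W = 0\<close> by
  faithfulness.\<close>

lemma faithfully_flat_zero:
  fixes B A :: "('k, 's) module"
  assumes ff: "faithfully_flat B A \<phi>" and B: "cring B" and A: "cring A" and phi: "\<phi> \<in> ring_hom B A"
    and W: "module B (W :: ('s, 's) module)" and M: "module B (M :: ('s, 's) module)"
    and f: "linear B W M f" and inj: "inj_on f (carrier W)"
    and zero: "\<And>w a. w \<in> carrier W \<Longrightarrow> a \<in> carrier A \<Longrightarrow>
       pure_tensor B M (restrict_scalars A \<phi>) (f w) a = \<one>\<^bsub>tensor_group B M (restrict_scalars A \<phi>)\<^esub>"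
  shows "carrier W = {\<zero>\<^bsub>W\<^esub>}"
proof (rule ccontr)
  assume ne: "carrier W \<noteq> {\<zero>\<^bsub>W\<^esub>}"
  let ?N = "restrict_scalars A \<phi>"
  have mN: "module B ?N" by (rule module_restrict_scalars[OF B A phi])
  interpret W: tensor_product B W ?N by (intro tensor_product.intro W mN)
  interpret M: tensor_product B M ?N by (intro tensor_product.intro M mN)
  let ?g = "restrict f (carrier W)"
  have gl: "linear B W M ?g"
    using linearD[OF f] by (intro linearI) auto
  then have gm: "?g \<in> linear_maps B W M" by (simp add: linear_maps_iff)
  have gi: "inj_on ?g (carrier W)" using inj by (simp add: inj_on_def)
  let ?t = "tensor_map B M ?N ?g id"
  have ti: "inj_on ?t (carrier W.TG)"
    using ff[unfolded faithfully_flat_def, THEN conjunct1, rule_format, of W M ?g] W M gm gi by simp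
  have ne': "carrier W.TG \<noteq> {\<one>\<^bsub>W.TG\<^esub>}"
    using ff[unfolded faithfully_flat_def, THEN conjunct2, rule_format, of W] W ne by simp
  define t where "t = ?t"
  note th = W.tensor_map_hom[OF M mN gl linear_id[OF mN], folded t_def]
  note tp = W.tensor_map_pt[OF M mN gl linear_id[OF mN], folded t_def]
  have t1: "t \<one>\<^bsub>W.TG\<^esub> = \<one>\<^bsub>M.TG\<^esub>" using hom_one[OF th W.TG.is_group M.TG.is_group] .
  have "t z = \<one>\<^bsub>M.TG\<^esub>" if "z \<in> carrier W.TG" for z
    using that
  proof (induction rule: W.tensor_induct)
    case one then show ?case by (rule t1)
  next
    case (add x y z)
    then show ?case using hom_mult[OF th, of "W.pt x y" z] tp[of x y] zero[of x y] by simp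
  qed
  then have "z = \<one>\<^bsub>W.TG\<^esub>" if "z \<in> carrier W.TG" for z
    using ti that t1 unfolding t_def by (metis W.TG.one_closed inj_onD)
  then show False using ne' W.TG.one_closed by blast
qed

text \<open>
  Let \<open>i : S \<rightarrow> T\<close>. A quantity \<open>v\<close> that depends on a map from \<open>T\<close> to some algebra \<open>U\<close> is equalized if it only
  depends on the restriction to \<open>S\<close>. For \<open>v f = f t\<close> this says that \<open>t\<close> has the same image under both maps
  \<open>T \<rightarrow> T \<otimes>\<^sub>S T\<close>, without a construction of \<open>T \<otimes>\<^sub>S T\<close>.
\<close>

definition equalized :: "'k ring \<Rightarrow> ('k, 's) module \<Rightarrow> ('k, 's) module \<Rightarrow> ('s \<Rightarrow> 's) \<Rightarrow> (('k, 's) module \<Rightarrow> ('s \<Rightarrow> 's) \<Rightarrow> 't) \<Rightarrow> bool" where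
  "equalized K S T i v \<longleftrightarrow> (\<forall>U f g. algebra K U \<and> f \<in> alg_hom K T U \<and> g \<in> alg_hom K T U \<and>
     compose (carrier S) f i = compose (carrier S) g i \<longrightarrow> v U f = v U g)"

text \<open>
  \<open>T = S \<otimes>\<^sub>B A\<close> is the pushout of \<open>\<psi> : B \<rightarrow> S\<close> along the faithfully flat map \<open>\<phi> : B \<rightarrow> A\<close>. For injectivity of
  \<open>S \<rightarrow> T\<close>, let \<open>I\<close> be the kernel. For \<open>x \<in> I\<close> the tensor \<open>x \<otimes> a = (x \<otimes> 1)(1 \<otimes> a)\<close> vanishes in
  \<open>S \<otimes>\<^sub>B A\<close>, and \<open>I = 0\<close> by the preceding lemma.

  For the last assertion, consider \<open>Z = T/S\<close> and its submodule \<open>W = B \<cdot> t\<close>. Write \<open>t = \<Sum> s\<^sub>i \<otimes> a\<^sub>i\<close>. The map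
  \<open>k : T \<rightarrow> T \<otimes>\<^sub>B A\<close> with \<open>s \<otimes> a \<mapsto> (s \<otimes> 1) \<otimes> a\<close> and the map \<open>j1 : u \<mapsto> u \<otimes> 1\<close> agree on \<open>S\<close>, hence at \<open>t\<close>, which is equalized. So
  \<open>t \<otimes> a = \<Sum> s\<^sub>i \<otimes> a\<^sub>i a\<close> in \<open>T \<otimes>\<^sub>B A\<close>, which becomes \<open>0\<close> in \<open>Z \<otimes>\<^sub>B A\<close>. Again the preceding lemma gives
  \<open>W = 0\<close>, which means \<open>t \<in> S\<close>.
\<close>

lemma faithfully_flat_pushout:
  fixes B S A :: "('k, 's) module"
  assumes inf: "infinite (UNIV :: 's set)" and B: "algebra K B" and S: "algebra K S" and A: "algebra K A"
    and psi: "\<psi> \<in> alg_hom K B S" and phi: "\<phi> \<in> alg_hom K B A" and ff: "faithfully_flat B A \<phi>"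
  obtains T i1 i2 where "algebra K T" "i1 \<in> alg_hom K S T" "i2 \<in> alg_hom K A T"
    "compose (carrier B) i1 \<psi> = compose (carrier B) i2 \<phi>"
    "\<And>(U :: ('k, 's) module) f g. algebra K U \<Longrightarrow> f \<in> alg_hom K S U \<Longrightarrow> g \<in> alg_hom K A U \<Longrightarrow>
      compose (carrier B) f \<psi> = compose (carrier B) g \<phi> \<Longrightarrow>
      \<exists>k\<in>alg_hom K T U. compose (carrier S) k i1 = f \<and> compose (carrier A) k i2 = g"
    "inj_on i1 (carrier S)"
    "\<And>t. t \<in> carrier T \<Longrightarrow> equalized K S T i1 (\<lambda>U f. f t) \<Longrightarrow> t \<in> i1 ` carrier S"
proof -
  interpret B: algebra K B by fact
  interpret S: algebra K S by fact
  interpret A: algebra K A by fact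
  note psi' = alg_homD[OF psi] and phi' = alg_homD[OF phi]
  interpret P: pushout K S A B \<psi> \<phi>
  proof
    fix c assume c: "c \<in> carrier K"
    then show "\<exists>b\<in>carrier B. \<psi> b = c \<odot>\<^bsub>S\<^esub> \<one>\<^bsub>S\<^esub> \<and> \<phi> b = c \<odot>\<^bsub>A\<^esub> \<one>\<^bsub>A\<^esub>"
      by (intro bexI[of _ "c \<odot>\<^bsub>B\<^esub> \<one>\<^bsub>B\<^esub>"]) (simp_all add: psi' phi')
  qed (fact psi'(1) phi'(1))+
  obtain T :: "('k, 's) module" and i1 i2 \<theta> where T: "algebra K T" and i1: "i1 \<in> alg_hom K S T" and i2: "i2 \<in> alg_hom K A T"
    and i12: "\<forall>b\<in>carrier B. i1 (\<psi> b) = i2 (\<phi> b)"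
    and th: "\<theta> \<in> hom P.TG (add_monoid T)" "bij_betw \<theta> (carrier P.TG) (carrier T)"
    and thp: "\<forall>s\<in>carrier S. \<forall>a\<in>carrier A. \<theta> (P.pt s a) = i1 s \<otimes>\<^bsub>T\<^esub> i2 a"
    and univ: "\<forall>(U :: ('k, 's) module) f g. algebra K U \<longrightarrow> f \<in> alg_hom K S U \<longrightarrow> g \<in> alg_hom K A U \<longrightarrow>
      (\<forall>b\<in>carrier B. f (\<psi> b) = g (\<phi> b)) \<longrightarrow>
      (\<exists>k\<in>alg_hom K T U. compose (carrier S) k i1 = f \<and> compose (carrier A) k i2 = g)"
    by (rule P.exists_in_universe[OF inf]) (rule that; assumption)
  interpret T: algebra K T by fact
  note i1' = alg_homD[OF i1] and i2' = alg_homD[OF i2]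
  have th0: "\<theta> \<one>\<^bsub>P.TG\<^esub> = \<zero>\<^bsub>T\<^esub>"
    using hom_one[OF th(1) P.TG.is_group comm_group.axioms(2)[OF T.a_comm_group]] by simp
  have thinj: "x = y" if "x \<in> carrier P.TG" "y \<in> carrier P.TG" "\<theta> x = \<theta> y" for x y
    using that th(2) by (simp add: bij_betw_def inj_on_def)
  have inj: "inj_on i1 (carrier S)"
  proof -
    let ?I = "{s \<in> carrier S. i1 s = \<zero>\<^bsub>T\<^esub>}"
    have "submodule ?I B P.MS"
      by (rule P.M.submoduleI_smult)
        (use i1' psi' linear_zero[OF i1'(8) S.module_axioms T.module_axioms] in auto)
    then have W: "module B (P.MS\<lparr>carrier := ?I\<rparr>)" by (rule submodule.submodule_is_module[OF _ P.mS])
    have "carrier (P.MS\<lparr>carrier := ?I\<rparr>) = {\<zero>\<^bsub>P.MS\<lparr>carrier := ?I\<rparr>\<^esub>}"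
    proof (rule faithfully_flat_zero[OF ff B.M_cring A.M_cring phi'(1) W P.mS, of id])
      show "linear B (P.MS\<lparr>carrier := ?I\<rparr>) P.MS id" by (rule linearI) auto
      show "inj_on id (carrier (P.MS\<lparr>carrier := ?I\<rparr>))" by simp
      fix w a assume "w \<in> carrier (P.MS\<lparr>carrier := ?I\<rparr>)" and a: "a \<in> carrier A"
      then have w: "w \<in> carrier S" "i1 w = \<zero>\<^bsub>T\<^esub>" by auto
      have "P.pt w a = \<one>\<^bsub>P.TG\<^esub>"
        by (rule thinj) (use w a i2' th0 thp in simp_all)
      then show "P.pt (id w) a = \<one>\<^bsub>P.TG\<^esub>" by simp
    qed
    then have I0: "?I = {\<zero>\<^bsub>S\<^esub>}" by simp
    show ?thesis
    proof (rule inj_onI)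
      fix x y assume xy: "x \<in> carrier S" "y \<in> carrier S" "i1 x = i1 y"
      have "i1 (x \<ominus>\<^bsub>S\<^esub> y) \<oplus>\<^bsub>T\<^esub> i1 y = i1 (x \<ominus>\<^bsub>S\<^esub> y \<oplus>\<^bsub>S\<^esub> y)" using xy i1' by simp
      also have "x \<ominus>\<^bsub>S\<^esub> y \<oplus>\<^bsub>S\<^esub> y = x" using xy by (simp add: a_minus_def S.a_assoc S.l_neg)
      finally have "i1 (x \<ominus>\<^bsub>S\<^esub> y) = \<zero>\<^bsub>T\<^esub>" using xy i1'
        by (metis S.minus_closed T.add.r_cancel_one)
      then have "x \<ominus>\<^bsub>S\<^esub> y \<in> ?I" using xy by simp
      then have "x \<ominus>\<^bsub>S\<^esub> y = \<zero>\<^bsub>S\<^esub>" using I0 by blast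
      then show "x = y" using xy by (metis S.add.m_comm S.add.r_cancel_one' S.minus_closed \<open>x \<ominus>\<^bsub>S\<^esub> y \<oplus>\<^bsub>S\<^esub> y = x\<close>)
    qed
  qed
  have descent: "t \<in> i1 ` carrier S" if t: "t \<in> carrier T" and eq: "equalized K S T i1 (\<lambda>U f. f t)" for t
  proof -
    let ?c = "compose (carrier B) i1 \<psi>"
    have c: "?c \<in> alg_hom K B T" by (rule alg_hom_comp[OF psi i1 B])
    note c' = alg_homD[OF c]
    interpret P2: pushout K T A B ?c \<phi>
    proof
      fix k assume k: "k \<in> carrier K"
      then show "\<exists>b\<in>carrier B. ?c b = k \<odot>\<^bsub>T\<^esub> \<one>\<^bsub>T\<^esub> \<and> \<phi> b = k \<odot>\<^bsub>A\<^esub> \<one>\<^bsub>A\<^esub>"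
        by (intro bexI[of _ "k \<odot>\<^bsub>B\<^esub> \<one>\<^bsub>B\<^esub>"]) (simp_all add: c' phi')
    qed (fact c'(1) phi'(1))+
    obtain T' :: "('k, 's) module" and j1 j2 \<eta> where T': "algebra K T'" and j1: "j1 \<in> alg_hom K T T'" and j2: "j2 \<in> alg_hom K A T'"
      and j12: "\<forall>b\<in>carrier B. j1 (?c b) = j2 (\<phi> b)"
      and et: "\<eta> \<in> hom P2.TG (add_monoid T')" "bij_betw \<eta> (carrier P2.TG) (carrier T')"
      and etp: "\<forall>s\<in>carrier T. \<forall>a\<in>carrier A. \<eta> (P2.pt s a) = j1 s \<otimes>\<^bsub>T'\<^esub> j2 a"
      by (rule P2.exists_in_universe[OF inf]) (rule that; assumption)
    interpret T': algebra K T' by fact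
    note j1' = alg_homD[OF j1] and j2' = alg_homD[OF j2]
    have et0: "\<eta> \<one>\<^bsub>P2.TG\<^esub> = \<zero>\<^bsub>T'\<^esub>"
      using hom_one[OF et(1) P2.TG.is_group comm_group.axioms(2)[OF T'.a_comm_group]] by simp
    have et_add: "\<eta> (x \<otimes>\<^bsub>P2.TG\<^esub> y) = \<eta> x \<oplus>\<^bsub>T'\<^esub> \<eta> y" if "x \<in> carrier P2.TG" "y \<in> carrier P2.TG" for x y
      using hom_mult[OF et(1) that] by simp
    have etinj: "x = y" if "x \<in> carrier P2.TG" "y \<in> carrier P2.TG" "\<eta> x = \<eta> y" for x y
      using that et(2) by (simp add: bij_betw_def inj_on_def)
    have ji: "compose (carrier S) j1 i1 \<in> alg_hom K S T'" by (rule alg_hom_comp[OF i1 j1 S])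
    have "compose (carrier S) j1 i1 (\<psi> b) = j2 (\<phi> b)" if "b \<in> carrier B" for b
      using bspec[OF j12 that] that psi'(2) by (simp add: compose_eq)
    then obtain k where k: "k \<in> alg_hom K T T'" "compose (carrier S) k i1 = compose (carrier S) j1 i1" "compose (carrier A) k i2 = j2"
      using univ T' ji j2 by meson
    note k' = alg_homD[OF k(1)]
    have kt: "k t = j1 t" using eq T' k j1 unfolding equalized_def by blast
    have ki1: "k (i1 s) = j1 (i1 s)" if "s \<in> carrier S" for s using k(2) that by (metis compose_eq)
    have ki2: "k (i2 a) = j2 a" if "a \<in> carrier A" for a using k(3) that by (metis compose_eq)
    have P: "submodule (i1 ` carrier S) B P2.MS"
    proof (rule P2.M.submoduleI_smult)
      show "\<zero>\<^bsub>P2.MS\<^esub> \<in> i1 ` carrier S"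
        using linear_zero[OF i1'(8) S.module_axioms T.module_axioms] by (metis S.zero_closed image_eqI restrict_scalars_simps(3))
      show "a \<oplus>\<^bsub>P2.MS\<^esub> b \<in> i1 ` carrier S" if ab: "a \<in> i1 ` carrier S" "b \<in> i1 ` carrier S" for a b
      proof -
        obtain x y where "a = i1 x" "b = i1 y" "x \<in> carrier S" "y \<in> carrier S" using ab by blast
        then have "a \<oplus>\<^bsub>P2.MS\<^esub> b = i1 (x \<oplus>\<^bsub>S\<^esub> y)" "x \<oplus>\<^bsub>S\<^esub> y \<in> carrier S" using i1' by simp_all
        then show ?thesis by blast
      qed
      show "b \<odot>\<^bsub>P2.MS\<^esub> a \<in> i1 ` carrier S" if ab: "b \<in> carrier B" "a \<in> i1 ` carrier S" for a b
      proof -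
        obtain x where "a = i1 x" "x \<in> carrier S" using ab by blast
        then have "b \<odot>\<^bsub>P2.MS\<^esub> a = i1 (\<psi> b \<otimes>\<^bsub>S\<^esub> x)" "\<psi> b \<otimes>\<^bsub>S\<^esub> x \<in> carrier S" using i1' psi' ab by (simp_all add: compose_eq)
        then show ?thesis by blast
      qed
    qed (use i1' in auto)
    obtain Z :: "('s, 's) module" and q where Z: "module B Z" and q: "linear B P2.MS Z q"
      and q0: "\<And>x. x \<in> carrier P2.MS \<Longrightarrow> q x = \<zero>\<^bsub>Z\<^esub> \<longleftrightarrow> x \<in> i1 ` carrier S"
      using quotient_module[OF P2.mS P] by metis
    interpret Z: module B Z by fact
    interpret ZT: tensor_product B Z P2.MA by (intro tensor_product.intro Z P2.mA)
    note q' = linearD[OF q, unfolded restrict_scalars_simps]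
    define \<Phi> where "\<Phi> = tensor_map B Z P2.MA q id"
    note Ph = P2.tensor_map_hom[OF Z P2.mA q linear_id[OF P2.mA], folded \<Phi>_def]
    note Php = P2.tensor_map_pt[OF Z P2.mA q linear_id[OF P2.mA], folded \<Phi>_def, unfolded restrict_scalars_simps id_apply]
    have Ph1: "\<Phi> \<one>\<^bsub>P2.TG\<^esub> = \<one>\<^bsub>ZT.TG\<^esub>" using hom_one[OF Ph P2.TG.is_group ZT.TG.is_group] .
    \<comment> \<open>Writing \<open>\<theta> y = \<Sum> s\<^sub>i \<otimes> a\<^sub>i\<close>, the element \<open>z\<close> is \<open>\<Sum> s\<^sub>i \<otimes> a\<^sub>i a\<close>.\<close>
    have claim: "\<exists>z\<in>carrier P2.TG. \<eta> z = k (\<theta> y) \<otimes>\<^bsub>T'\<^esub> j2 a \<and> \<Phi> z = \<one>\<^bsub>ZT.TG\<^esub>"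
      if a: "a \<in> carrier A" and y: "y \<in> carrier P.TG" for a y
      using y
    proof (induction rule: P.pt_induct)
      case one
      have "k \<zero>\<^bsub>T\<^esub> = \<zero>\<^bsub>T'\<^esub>" using linear_zero[OF k'(8) T.module_axioms T'.module_axioms] .
      then show ?case using a j2'
        by (intro bexI[of _ "\<one>\<^bsub>P2.TG\<^esub>"]) (simp_all add: th0 et0 Ph1)
    next
      case (add s x y)
      then obtain z where z: "z \<in> carrier P2.TG" "\<eta> z = k (\<theta> y) \<otimes>\<^bsub>T'\<^esub> j2 a" "\<Phi> z = \<one>\<^bsub>ZT.TG\<^esub>" by blast
      have ty: "\<theta> y \<in> carrier T" using hom_in_carrier[OF th(1) add(3)] by simp
      let ?p = "P2.pt (i1 s) (x \<otimes>\<^bsub>A\<^esub> a)"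
      have pc: "?p \<in> carrier P2.TG" using add a i1' by simp
      have "\<theta> (P.pt s x \<otimes>\<^bsub>P.TG\<^esub> y) = i1 s \<otimes>\<^bsub>T\<^esub> i2 x \<oplus>\<^bsub>T\<^esub> \<theta> y"
        using hom_mult[OF th(1), of "P.pt s x" y] add thp by simp
      then have "k (\<theta> (P.pt s x \<otimes>\<^bsub>P.TG\<^esub> y)) = j1 (i1 s) \<otimes>\<^bsub>T'\<^esub> j2 x \<oplus>\<^bsub>T'\<^esub> k (\<theta> y)"
        using add ty i1' i2' k' ki1 ki2 by simp
      then have "\<eta> (?p \<otimes>\<^bsub>P2.TG\<^esub> z) = k (\<theta> (P.pt s x \<otimes>\<^bsub>P.TG\<^esub> y)) \<otimes>\<^bsub>T'\<^esub> j2 a"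
        using add a ty i1' j1' j2' k' by (simp add: et_add[OF pc z(1)] z(2) etp T'.l_distr T'.m_assoc)
      moreover have "\<Phi> (?p \<otimes>\<^bsub>P2.TG\<^esub> z) = \<one>\<^bsub>ZT.TG\<^esub>"
      proof -
        have "q (i1 s) = \<zero>\<^bsub>Z\<^esub>" using q0[of "i1 s"] add i1' by simp
        then have "\<Phi> ?p = \<one>\<^bsub>ZT.TG\<^esub>" using Php[of "i1 s" "x \<otimes>\<^bsub>A\<^esub> a"] add a i1' ZT.pt_zero_left by simp
        then show ?thesis using hom_mult[OF Ph pc z(1)] z(3) by simp
      qed
      moreover have "?p \<otimes>\<^bsub>P2.TG\<^esub> z \<in> carrier P2.TG" using pc z(1) by simp
      ultimately show ?case by blast
    qed
    have zero: "ZT.pt (q t) a = \<one>\<^bsub>ZT.TG\<^esub>" if a: "a \<in> carrier A" for a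
    proof -
      obtain y where y: "y \<in> carrier P.TG" "\<theta> y = t" using th(2) t by (metis bij_betw_imp_surj_on imageE)
      obtain z where z: "z \<in> carrier P2.TG" "\<eta> z = k t \<otimes>\<^bsub>T'\<^esub> j2 a" "\<Phi> z = \<one>\<^bsub>ZT.TG\<^esub>" using claim[OF a y(1)] y(2) by blast
      have "P2.pt t a = z" by (rule etinj) (use a t z etp kt in simp_all)
      then show ?thesis using z(3) Php[OF t a] by simp
    qed
    let ?W = "{b \<odot>\<^bsub>Z\<^esub> q t | b. b \<in> carrier B}"
    have qt: "q t \<in> carrier Z" using q'(1) t .
    have "submodule ?W B Z"
    proof (rule Z.submoduleI_smult)
      show "?W \<subseteq> carrier Z" using qt by auto
      have "\<zero>\<^bsub>Z\<^esub> = \<zero>\<^bsub>B\<^esub> \<odot>\<^bsub>Z\<^esub> q t" using qt by simp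
      then show "\<zero>\<^bsub>Z\<^esub> \<in> ?W" by blast
      show "x \<oplus>\<^bsub>Z\<^esub> y \<in> ?W" if "x \<in> ?W" "y \<in> ?W" for x y
      proof -
        obtain b b' where "x = b \<odot>\<^bsub>Z\<^esub> q t" "y = b' \<odot>\<^bsub>Z\<^esub> q t" "b \<in> carrier B" "b' \<in> carrier B" using \<open>x \<in> ?W\<close> \<open>y \<in> ?W\<close> by blast
        then have "x \<oplus>\<^bsub>Z\<^esub> y = (b \<oplus>\<^bsub>B\<^esub> b') \<odot>\<^bsub>Z\<^esub> q t" "b \<oplus>\<^bsub>B\<^esub> b' \<in> carrier B" using qt by (simp_all add: Z.smult_l_distr)
        then show ?thesis by blast
      qed
      show "c \<odot>\<^bsub>Z\<^esub> x \<in> ?W" if "c \<in> carrier B" "x \<in> ?W" for c x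
      proof -
        obtain b where "x = b \<odot>\<^bsub>Z\<^esub> q t" "b \<in> carrier B" using \<open>x \<in> ?W\<close> by blast
        then have "c \<odot>\<^bsub>Z\<^esub> x = (c \<otimes>\<^bsub>B\<^esub> b) \<odot>\<^bsub>Z\<^esub> q t" "c \<otimes>\<^bsub>B\<^esub> b \<in> carrier B" using qt \<open>c \<in> carrier B\<close> by (simp_all add: Z.smult_assoc1)
        then show ?thesis by blast
      qed
    qed
    then have W: "module B (Z\<lparr>carrier := ?W\<rparr>)" by (rule submodule.submodule_is_module[OF _ Z])
    have "carrier (Z\<lparr>carrier := ?W\<rparr>) = {\<zero>\<^bsub>Z\<lparr>carrier := ?W\<rparr>\<^esub>}"
    proof (rule faithfully_flat_zero[OF ff B.M_cring A.M_cring phi'(1) W Z, of id])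
      show "linear B (Z\<lparr>carrier := ?W\<rparr>) Z id" by (rule linearI) (use qt in auto)
      show "inj_on id (carrier (Z\<lparr>carrier := ?W\<rparr>))" by simp
      fix w a assume "w \<in> carrier (Z\<lparr>carrier := ?W\<rparr>)" and a: "a \<in> carrier A"
      then obtain b where b: "w = b \<odot>\<^bsub>Z\<^esub> q t" "b \<in> carrier B" by auto
      have "ZT.pt w a = ZT.pt (q t) (\<phi> b \<otimes>\<^bsub>A\<^esub> a)"
        using ZT.pt_balanced[OF b(2) qt, of a] a b by simp
      also have "\<dots> = \<one>\<^bsub>ZT.TG\<^esub>" using zero a b phi' by simp
      finally show "ZT.pt (id w) a = \<one>\<^bsub>ZT.TG\<^esub>" by simp
    qed
    moreover have "q t = \<one>\<^bsub>B\<^esub> \<odot>\<^bsub>Z\<^esub> q t" using qt by simp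
    ultimately have "q t = \<zero>\<^bsub>Z\<^esub>" using B.one_closed by auto
    then show ?thesis using q0[of t] t by simp
  qed
  show thesis
  proof (rule that[OF T i1 i2 _ _ inj descent])
    show "compose (carrier B) i1 \<psi> = compose (carrier B) i2 \<phi>"
      by (rule extensionalityI[OF compose_extensional compose_extensional]) (simp add: compose_eq i12)
    fix U :: "('k, 's) module" and f g
    assume U: "algebra K U" "f \<in> alg_hom K S U" "g \<in> alg_hom K A U" "compose (carrier B) f \<psi> = compose (carrier B) g \<phi>"
    have "f (\<psi> b) = g (\<phi> b)" if "b \<in> carrier B" for b using U(4) that by (metis compose_eq)
    then show "\<exists>k\<in>alg_hom K T U. compose (carrier S) k i1 = f \<and> compose (carrier A) k i2 = g" using univ U by meson
  qed
qed

section \<open>Points of affine group schemes\<close>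

lemma group_functorD:
  assumes "group_functor K F"
  shows "\<And>S. algebra K S \<Longrightarrow> group (pts F S)"
    "\<And>S T \<phi>. algebra K S \<Longrightarrow> algebra K T \<Longrightarrow> \<phi> \<in> alg_hom K S T \<Longrightarrow> res F S T \<phi> \<in> hom (pts F S) (pts F T)"
    "\<And>S g. algebra K S \<Longrightarrow> g \<in> carrier (pts F S) \<Longrightarrow> res F S S (\<lambda>x\<in>carrier S. x) g = g"
    "\<And>S T R \<phi> \<psi> g. algebra K S \<Longrightarrow> algebra K T \<Longrightarrow> algebra K R \<Longrightarrow> \<phi> \<in> alg_hom K S T \<Longrightarrow> \<psi> \<in> alg_hom K T R \<Longrightarrow>
      g \<in> carrier (pts F S) \<Longrightarrow> res F S R (compose (carrier S) \<psi> \<phi>) g = res F T R \<psi> (res F S T \<phi> g)"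
    "\<And>S T \<phi> g. algebra K S \<Longrightarrow> algebra K T \<Longrightarrow> \<phi> \<in> alg_hom K S T \<Longrightarrow> g \<in> carrier (pts F S) \<Longrightarrow> res F S T \<phi> g \<in> carrier (pts F T)"
proof -
  note a = assms[unfolded group_functor_def]
  show "\<And>S. algebra K S \<Longrightarrow> group (pts F S)" using a by simp
  show h: "\<And>S T \<phi>. algebra K S \<Longrightarrow> algebra K T \<Longrightarrow> \<phi> \<in> alg_hom K S T \<Longrightarrow> res F S T \<phi> \<in> hom (pts F S) (pts F T)" using a by simp
  show "\<And>S g. algebra K S \<Longrightarrow> g \<in> carrier (pts F S) \<Longrightarrow> res F S S (\<lambda>x\<in>carrier S. x) g = g"
    using a by (simp del: restrict_apply)
  show "\<And>S T R \<phi> \<psi> g. algebra K S \<Longrightarrow> algebra K T \<Longrightarrow> algebra K R \<Longrightarrow> \<phi> \<in> alg_hom K S T \<Longrightarrow> \<psi> \<in> alg_hom K T R \<Longrightarrow>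
      g \<in> carrier (pts F S) \<Longrightarrow> res F S R (compose (carrier S) \<psi> \<phi>) g = res F T R \<psi> (res F S T \<phi> g)" using a by simp
  show "\<And>S T \<phi> g. algebra K S \<Longrightarrow> algebra K T \<Longrightarrow> \<phi> \<in> alg_hom K S T \<Longrightarrow> g \<in> carrier (pts F S) \<Longrightarrow> res F S T \<phi> g \<in> carrier (pts F T)"
    using hom_in_carrier[OF h] .
qed

lemma scheme_morphismD:
  assumes "scheme_morphism K G H f"
  shows "\<And>S g. algebra K S \<Longrightarrow> g \<in> carrier (pts G S) \<Longrightarrow> f S g \<in> carrier (pts H S)"
    "\<And>S T \<phi> g. algebra K S \<Longrightarrow> algebra K T \<Longrightarrow> \<phi> \<in> alg_hom K S T \<Longrightarrow> g \<in> carrier (pts G S) \<Longrightarrow>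
       f T (res G S T \<phi> g) = res H S T \<phi> (f S g)"
proof -
  note a = assms[unfolded scheme_morphism_def]
  show "\<And>S g. algebra K S \<Longrightarrow> g \<in> carrier (pts G S) \<Longrightarrow> f S g \<in> carrier (pts H S)"
    using conjunct1[OF a] by (simp add: Pi_iff)
  show "\<And>S T \<phi> g. algebra K S \<Longrightarrow> algebra K T \<Longrightarrow> \<phi> \<in> alg_hom K S T \<Longrightarrow> g \<in> carrier (pts G S) \<Longrightarrow>
       f T (res G S T \<phi> g) = res H S T \<phi> (f S g)"
    by (rule conjunct2[OF a, rule_format, OF conjI[OF _ conjI]])
qed

lemma represents_point:
  assumes "represents K F C c" "algebra K S" "x \<in> carrier (pts F S)"
  obtains \<chi> where "\<chi> \<in> alg_hom K C S" "res F C S \<chi> c = x"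
proof -
  have "bij_betw (\<lambda>\<phi>. res F C S \<phi> c) (alg_hom K C S) (carrier (pts F S))"
    using assms(1,2) by (simp add: represents_def)
  then have "x \<in> (\<lambda>\<phi>. res F C S \<phi> c) ` alg_hom K C S" using assms(3) by (simp add: bij_betw_def)
  then show thesis using that by (elim imageE) simp
qed

lemma represents_unique:
  assumes "represents K F C c" "algebra K S" "\<chi> \<in> alg_hom K C S" "\<chi>' \<in> alg_hom K C S" "res F C S \<chi> c = res F C S \<chi>' c"
  shows "\<chi> = \<chi>'"
proof -
  have "inj_on (\<lambda>\<phi>. res F C S \<phi> c) (alg_hom K C S)"
    using assms(1,2) by (simp add: represents_def bij_betw_def)
  from inj_onD[OF this _ assms(3,4)] show ?thesis using assms(5) by simp
qed

text \<open>Points of \<open>F\<close> are maps out of its coordinate algebra, and the injection \<open>f\<close> can be cancelled on the left.\<close>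

lemma affine_res_inj:
  assumes F: "group_functor K F" "represents K F C c" and S: "algebra K S" "algebra K T"
    and f: "f \<in> alg_hom K S T" "inj_on f (carrier S)"
    and xy: "x \<in> carrier (pts F S)" "y \<in> carrier (pts F S)" "res F S T f x = res F S T f y"
  shows "x = y"
proof -
  have C: "algebra K C" "c \<in> carrier (pts F C)" using F(2) by (auto simp: represents_def)
  interpret C: algebra K C by fact
  obtain a where a: "a \<in> alg_hom K C S" "res F C S a c = x" using represents_point[OF F(2) S(1) xy(1)] .
  obtain b where b: "b \<in> alg_hom K C S" "res F C S b c = y" using represents_point[OF F(2) S(1) xy(2)] .
  have "res F C T (compose (carrier C) f a) c = res F C T (compose (carrier C) f b) c"
    using group_functorD(4)[OF F(1) C(1) S _ f(1) C(2)] a b xy(3) by simp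
  then have e: "compose (carrier C) f a = compose (carrier C) f b"
    by (rule represents_unique[OF F(2) S(2) alg_hom_comp[OF a(1) f(1) C(1)] alg_hom_comp[OF b(1) f(1) C(1)]])
  have "a = b"
  proof (rule alg_hom_ext[OF a(1) b(1)])
    fix z assume z: "z \<in> carrier C"
    have "f (a z) = f (b z)" using fun_cong[OF e, of z] z by (simp add: compose_eq)
    then show "a z = b z" using f(2) z alg_homD(2)[OF a(1)] alg_homD(2)[OF b(1)] by (simp add: inj_on_def)
  qed
  then show ?thesis using a b by simp
qed

text \<open>The point \<open>z\<close> is a map from the coordinate algebra of \<open>F\<close> to \<open>T\<close>. Its values are equalized, hence in
  the image of \<open>S\<close>.\<close>

lemma affine_descent:
  fixes S T :: "('k, 's) module"
  assumes F: "group_functor K F" "represents K F C c" and S: "algebra K S" "algebra K T"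
    and i: "i \<in> alg_hom K S T" "inj_on i (carrier S)"
    and desc: "\<And>t. t \<in> carrier T \<Longrightarrow> equalized K S T i (\<lambda>U f. f t) \<Longrightarrow> t \<in> i ` carrier S"
    and z: "z \<in> carrier (pts F T)" "equalized K S T i (\<lambda>U f. res F T U f z)"
  obtains e where "e \<in> carrier (pts F S)" "res F S T i e = z"
proof -
  have C: "algebra K C" "c \<in> carrier (pts F C)" using F(2) by (auto simp: represents_def)
  interpret C: algebra K C by fact
  interpret S: algebra K S by fact
  interpret T: algebra K T by fact
  obtain x where x: "x \<in> alg_hom K C T" "res F C T x c = z" using represents_point[OF F(2) S(2) z(1)] .
  note x' = alg_homD[OF x(1)] and i' = alg_homD[OF i(1)]
  have im: "x d \<in> i ` carrier S" if d: "d \<in> carrier C" for d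
  proof (rule desc)
    show "x d \<in> carrier T" using x' d by simp
    show "equalized K S T i (\<lambda>U f. f (x d))"
      unfolding equalized_def
    proof (intro allI impI, elim conjE)
      fix U :: "('k, 's) module" and f g assume U: "algebra K U" "f \<in> alg_hom K T U" "g \<in> alg_hom K T U"
        and e: "compose (carrier S) f i = compose (carrier S) g i"
      have "res F T U f z = res F T U g z" using z(2) U e unfolding equalized_def by blast
      then have "res F C U (compose (carrier C) f x) c = res F C U (compose (carrier C) g x) c"
        using group_functorD(4)[OF F(1) C(1) S(2) U(1) x(1) _ C(2)] U x(2) by simp
      then have "compose (carrier C) f x = compose (carrier C) g x"
        by (rule represents_unique[OF F(2) U(1) alg_hom_comp[OF x(1) U(2) C(1)] alg_hom_comp[OF x(1) U(3) C(1)]])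
      then show "f (x d) = g (x d)" using d by (metis compose_eq)
    qed
  qed
  define x0 where "x0 = (\<lambda>d\<in>carrier C. inv_into (carrier S) i (x d))"
  have x0: "x0 d \<in> carrier S" "i (x0 d) = x d" if "d \<in> carrier C" for d
    using im[OF that] that by (simp_all add: x0_def inv_into_into f_inv_into_f)
  have u: "s = t" if "i s = i t" "s \<in> carrier S" "t \<in> carrier S" for s t using i(2) that by (simp add: inj_on_def)
  have x0h: "x0 \<in> alg_hom K C S"
    by (rule alg_homI, simp add: x0, (rule u; simp add: x0 x' i')+, simp add: x0_def)
  have "compose (carrier C) i x0 = x"
    by (rule extensionalityI[OF compose_extensional x'(7)]) (simp add: compose_eq x0)
  then have "res F S T i (res F C S x0 c) = z"
    using group_functorD(4)[OF F(1) C(1) S x0h i(1) C(2)] x(2) by simp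
  moreover have "res F C S x0 c \<in> carrier (pts F S)" using group_functorD(5)[OF F(1) C(1) S(1) x0h C(2)] .
  ultimately show thesis using that by blast
qed

text \<open>
  The fibre of \<open>\<pi>\<close> over \<open>y\<close> is represented by \<open>T = S \<otimes>\<^sub>B A\<close>. So \<open>y\<close> has a universal lift \<open>g\<close> over \<open>T\<close>, of which
  all lifts over \<open>S\<close>-algebras are specializations.
\<close>

lemma local_lifting:
  fixes D :: "('k, 's, 'd) kgroup" and \<Gamma> :: "('k, 's, 'g) kgroup"
  assumes inf: "infinite (UNIV :: 's set)" and D: "group_functor K D" and \<Gamma>: "group_functor K \<Gamma>"
    and \<pi>: "scheme_morphism K D \<Gamma> \<pi>" and ff: "faithfully_flat_morphism K D \<Gamma> \<pi>"
    and S: "algebra K S" and y: "y \<in> carrier (pts \<Gamma> S)"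
  obtains T i g where "algebra K T" "i \<in> alg_hom K S T" "inj_on i (carrier S)"
    "g \<in> carrier (pts D T)" "\<pi> T g = res \<Gamma> S T i y"
    "\<And>U j h. algebra K U \<Longrightarrow> j \<in> alg_hom K S U \<Longrightarrow> h \<in> carrier (pts D U) \<Longrightarrow> \<pi> U h = res \<Gamma> S U j y \<Longrightarrow>
       \<exists>k\<in>alg_hom K T U. compose (carrier S) k i = j \<and> res D T U k g = h"
    "\<And>t. t \<in> carrier T \<Longrightarrow> equalized K S T i (\<lambda>U f. f t) \<Longrightarrow> t \<in> i ` carrier S"
proof -
  obtain A u B w \<phi> where A: "represents K D A u" and B: "represents K \<Gamma> B w" and phi: "\<phi> \<in> alg_hom K B A"
    and pu: "\<pi> A u = res \<Gamma> B A \<phi> w" and ffl: "faithfully_flat B A \<phi>"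
    using ff unfolding faithfully_flat_morphism_def by blast
  have alg: "algebra K A" "algebra K B" and u: "u \<in> carrier (pts D A)" and w: "w \<in> carrier (pts \<Gamma> B)"
    using A B by (auto simp: represents_def)
  obtain \<psi> where psi: "\<psi> \<in> alg_hom K B S" "res \<Gamma> B S \<psi> w = y" using represents_point[OF B S y] .
  obtain T i1 i2 where T: "algebra K T" "i1 \<in> alg_hom K S T" "i2 \<in> alg_hom K A T"
    "compose (carrier B) i1 \<psi> = compose (carrier B) i2 \<phi>"
    and univ: "\<And>(U :: ('k, 's) module) f g. algebra K U \<Longrightarrow> f \<in> alg_hom K S U \<Longrightarrow> g \<in> alg_hom K A U \<Longrightarrow>
      compose (carrier B) f \<psi> = compose (carrier B) g \<phi> \<Longrightarrow>
      \<exists>k\<in>alg_hom K T U. compose (carrier S) k i1 = f \<and> compose (carrier A) k i2 = g"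
    and inj: "inj_on i1 (carrier S)"
    and desc: "\<And>t. t \<in> carrier T \<Longrightarrow> equalized K S T i1 (\<lambda>U f. f t) \<Longrightarrow> t \<in> i1 ` carrier S"
    using faithfully_flat_pushout[OF inf alg(2) S alg(1) psi(1) phi ffl] by metis
  have pr: "\<pi> U (res D A U \<chi> u) = res \<Gamma> B U (compose (carrier B) \<chi> \<phi>) w" if "algebra K U" "\<chi> \<in> alg_hom K A U" for U :: "('k, 's) module" and \<chi>
    using scheme_morphismD(2)[OF \<pi> alg(1) that u] group_functorD(4)[OF \<Gamma> alg(2,1) that(1) phi that(2) w] pu by simp
  have yr: "res \<Gamma> S U j y = res \<Gamma> B U (compose (carrier B) j \<psi>) w" if "algebra K U" "j \<in> alg_hom K S U" for U :: "('k, 's) module" and j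
    using group_functorD(4)[OF \<Gamma> alg(2) S that(1) psi(1) that(2) w] psi(2) by simp
  show thesis
  proof (rule that[OF T(1,2) inj _ _ _ desc])
    show "res D A T i2 u \<in> carrier (pts D T)" using group_functorD(5)[OF D alg(1) T(1,3) u] .
    show "\<pi> T (res D A T i2 u) = res \<Gamma> S T i1 y" using pr[OF T(1,3)] yr[OF T(1,2)] T(4) by simp
    fix U :: "('k, 's) module" and j h assume U: "algebra K U" "j \<in> alg_hom K S U" "h \<in> carrier (pts D U)" "\<pi> U h = res \<Gamma> S U j y"
    obtain \<chi> where x: "\<chi> \<in> alg_hom K A U" "res D A U \<chi> u = h" using represents_point[OF A U(1,3)] .
    have "res \<Gamma> B U (compose (carrier B) \<chi> \<phi>) w = res \<Gamma> B U (compose (carrier B) j \<psi>) w"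
      using pr[OF U(1) x(1)] yr[OF U(1,2)] U(4) x(2) by simp
    then have "compose (carrier B) \<chi> \<phi> = compose (carrier B) j \<psi>"
      using represents_unique[OF B U(1)] alg_hom_comp[OF phi x(1) alg(2)] alg_hom_comp[OF psi(1) U(2) alg(2)] by blast
    then obtain k where k: "k \<in> alg_hom K T U" "compose (carrier S) k i1 = j" "compose (carrier A) k i2 = \<chi>"
      using univ[OF U(1,2) x(1)] by metis
    have "res D T U k (res D A T i2 u) = h"
      using group_functorD(4)[OF D alg(1) T(1) U(1) T(3) k(1) u] k(3) x(2) by simp
    then show "\<exists>k\<in>alg_hom K T U. compose (carrier S) k i1 = j \<and> res D T U k (res D A T i2 u) = h" using k by blast
  qed
qed

section \<open>Slices of endomorphisms\<close>

lemma (in extension_hom) res_smult: "s \<in> carrier S \<Longrightarrow> a \<in> carrier ES \<Longrightarrow> rs (s \<odot>\<^bsub>ES\<^esub> a) = \<phi> s \<odot>\<^bsub>ET\<^esub> rs a"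
  by (rule res_eqI) (simp_all add: alg_homD(2)[OF hom] res_closed End_apply res_pt bm_smult End_closed[of _ S S.QS])

lemma (in extension_hom) res_ebc: "f \<in> carrier S.EQ \<Longrightarrow> rs (S.ebc f) = T.ebc f"
  by (rule res_eqI) (simp_all add: S.ebc_closed T.ebc_closed S.ebc_pt T.ebc_pt bm_pt1 End_closed[of _ K Q])

context vector_extension begin

lemma slice_scalar:
  assumes l: "functional K S l" and c: "c \<in> carrier K" and z: "z \<in> carrier QS"
  shows "slice l ((c \<odot>\<^bsub>S\<^esub> \<one>\<^bsub>S\<^esub>) \<odot>\<^bsub>QS\<^esub> z) = c \<odot>\<^bsub>Q\<^esub> slice l z"
  using z
proof (induction rule: QS_induct)
  case zero then show ?case using c by (simp add: slice_zero[OF l])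
next
  case (add q s t)
  then show ?case using c functionalD[OF l]
    by (simp add: QSm.smult_r_distr slice_add[OF l] slice_closed[OF l] smult_pt S.smult_one_mult slice_pt[OF l]
        Q.smult_r_distr Q.smult_assoc1)
qed

text \<open>The coefficient of \<open>j \<in> End(Q) \<otimes> S\<close> extracted by \<open>l\<close>.\<close>

definition End_slice :: "('s \<Rightarrow> 'k) \<Rightarrow> (('q, 's) tens \<Rightarrow> ('q, 's) tens) \<Rightarrow> 'q \<Rightarrow> 'q" where
  "End_slice l j = (\<lambda>q\<in>carrier Q. slice l (j (pt q \<one>\<^bsub>S\<^esub>)))"

lemma End_slice_closed:
  assumes l: "functional K S l" and j: "j \<in> carrier EQS"
  shows "End_slice l j \<in> carrier EQ"
  unfolding End_carrier
proof
  note j' = End_closed[OF j] End_linear[OF j]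
  show "linear K Q Q (End_slice l j)"
    by (rule linearI) (simp_all add: End_slice_def slice_closed[OF l] j' pt_addl slice_add[OF l] pt_scalar slice_scalar[OF l])
  show "End_slice l j \<in> extensional (carrier Q)" by (simp add: End_slice_def)
qed

text \<open>\<open>Q\<close> being finite dimensional, \<open>End(Q \<otimes> S) = End(Q) \<otimes> S\<close>, so that the slice criterion applies to
  endomorphisms as well.\<close>

lemma End_slice_criterion:
  assumes fd: "finite_dimensional K Q" and W: "submodule W K EQ" and j: "j \<in> carrier EQS"
    and sl: "\<And>l. functional K S l \<Longrightarrow> End_slice l j \<in> W"
  shows "j \<in> mod_span S EQS (ebc ` W)"
proof -
  interpret D: vector_extension K EQ S
    by (intro vector_extension.intro scalar_extension.intro EQm.module_axioms S.algebra_axioms field_axioms)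
  note j' = End_closed[OF j] End_linear[OF j]
  note ex = D.extend[OF module_End_alg[OF module_QS], of ebc, OF ebc_closed ebc_add ebc_smult]
  \<comment> \<open>The canonical map \<open>End(Q) \<otimes> S \<rightarrow> End(Q \<otimes> S)\<close>; a dual basis of \<open>Q\<close> shows that it is onto.\<close>
  define \<Psi> where "\<Psi> = D.extend EQS ebc"
  have Pl: "linear S D.QS EQS \<Psi>" using ex(1) by (simp add: \<Psi>_def linear_maps_iff)
  note P = linearD[OF Pl]
  have Pp: "\<Psi> (D.pt f s) = s \<odot>\<^bsub>EQS\<^esub> ebc f" if "f \<in> carrier EQ" "s \<in> carrier S" for f s
    using ex(2) that by (simp add: \<Psi>_def)
  have P0: "\<Psi> \<zero>\<^bsub>D.QS\<^esub> = \<zero>\<^bsub>EQS\<^esub>" using linear_zero[OF Pl D.module_QS module_End_alg[OF module_QS]] .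
  obtain E l where E: "finite E" "E \<subseteq> carrier Q" and l: "\<And>e. e \<in> E \<Longrightarrow> functional K Q (l e)"
    and dual: "\<And>q. q \<in> carrier Q \<Longrightarrow> q = (\<Oplus>\<^bsub>Q\<^esub>e\<in>E. l e q \<odot>\<^bsub>Q\<^esub> e)"
    using dual_basis[OF field_axioms fd] by blast
  have rank_one: "\<exists>Y\<in>carrier D.QS. \<forall>q\<in>carrier Q. \<Psi> Y (pt q \<one>\<^bsub>S\<^esub>) = (l e q \<odot>\<^bsub>S\<^esub> \<one>\<^bsub>S\<^esub>) \<odot>\<^bsub>QS\<^esub> z"
    if e: "e \<in> E" and z: "z \<in> carrier QS" for e z
    using z
  proof (induction rule: QS_induct)
    case zero
    show ?case using functionalD(1)[OF l[OF e]] by (intro bexI[of _ "\<zero>\<^bsub>D.QS\<^esub>"]) (simp_all add: P0 End_apply)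
  next
    case (add q0 s z)
    then obtain Y where Y: "Y \<in> carrier D.QS" "\<forall>q\<in>carrier Q. \<Psi> Y (pt q \<one>\<^bsub>S\<^esub>) = (l e q \<odot>\<^bsub>S\<^esub> \<one>\<^bsub>S\<^esub>) \<odot>\<^bsub>QS\<^esub> z" by blast
    note le = functionalD[OF l[OF e]]
    define f where "f = (\<lambda>q\<in>carrier Q. l e q \<odot>\<^bsub>Q\<^esub> q0)"
    have f: "f \<in> carrier EQ"
      unfolding End_carrier by (intro conjI linearI) (use add(1) in \<open>simp_all add: f_def le Q.smult_l_distr Q.smult_assoc1\<close>)
    have "\<Psi> (D.pt f s \<oplus>\<^bsub>D.QS\<^esub> Y) (pt q \<one>\<^bsub>S\<^esub>) = (l e q \<odot>\<^bsub>S\<^esub> \<one>\<^bsub>S\<^esub>) \<odot>\<^bsub>QS\<^esub> (pt q0 s \<oplus>\<^bsub>QS\<^esub> z)" if q: "q \<in> carrier Q" for q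
    proof -
      have "\<Psi> (D.pt f s \<oplus>\<^bsub>D.QS\<^esub> Y) (pt q \<one>\<^bsub>S\<^esub>) = s \<odot>\<^bsub>QS\<^esub> ebc f (pt q \<one>\<^bsub>S\<^esub>) \<oplus>\<^bsub>QS\<^esub> \<Psi> Y (pt q \<one>\<^bsub>S\<^esub>)"
        using P(2)[OF D.pt_QS[OF f add(2)] Y(1)] Pp[OF f add(2)] q by (simp add: End_apply)
      also have "ebc f (pt q \<one>\<^bsub>S\<^esub>) = pt (l e q \<odot>\<^bsub>Q\<^esub> q0) \<one>\<^bsub>S\<^esub>" using ebc_pt[OF f q] q by (simp add: f_def)
      also have "s \<odot>\<^bsub>QS\<^esub> pt (l e q \<odot>\<^bsub>Q\<^esub> q0) \<one>\<^bsub>S\<^esub> = (l e q \<odot>\<^bsub>S\<^esub> \<one>\<^bsub>S\<^esub>) \<odot>\<^bsub>QS\<^esub> pt q0 s"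
        using add q le by (simp add: smult_pt pt_scalar S.m_comm)
      finally show ?thesis using Y(2) q add le by (simp add: QSm.smult_r_distr)
    qed
    then show ?case using D.pt_QS[OF f add(2)] Y(1) by (intro bexI[of _ "D.pt f s \<oplus>\<^bsub>D.QS\<^esub> Y"]) auto
  qed
  have ec: "e \<in> carrier Q" if "e \<in> E" for e using that E by blast
  have "\<exists>Y\<in>carrier D.QS. \<forall>q\<in>carrier Q. \<Psi> Y (pt q \<one>\<^bsub>S\<^esub>) = j (pt (\<Oplus>\<^bsub>Q\<^esub>e\<in>F. l e q \<odot>\<^bsub>Q\<^esub> e) \<one>\<^bsub>S\<^esub>)"
    if "finite F" "F \<subseteq> E" for F
    using that
  proof (induction F rule: finite_induct)
    case empty
    have "j \<zero>\<^bsub>QS\<^esub> = \<zero>\<^bsub>QS\<^esub>" using linear_zero_QS[OF _ module_QS] j by (simp add: End_carrier)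
    then show ?case by (intro bexI[of _ "\<zero>\<^bsub>D.QS\<^esub>"]) (simp_all add: P0 End_apply)
  next
    case (insert e F)
    then obtain Y where Y: "Y \<in> carrier D.QS" "\<forall>q\<in>carrier Q. \<Psi> Y (pt q \<one>\<^bsub>S\<^esub>) = j (pt (\<Oplus>\<^bsub>Q\<^esub>e\<in>F. l e q \<odot>\<^bsub>Q\<^esub> e) \<one>\<^bsub>S\<^esub>)" by auto
    have e: "e \<in> E" "F \<subseteq> E" using insert by auto
    obtain Y' where Y': "Y' \<in> carrier D.QS" "\<forall>q\<in>carrier Q. \<Psi> Y' (pt q \<one>\<^bsub>S\<^esub>) = (l e q \<odot>\<^bsub>S\<^esub> \<one>\<^bsub>S\<^esub>) \<odot>\<^bsub>QS\<^esub> j (pt e \<one>\<^bsub>S\<^esub>)"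
      using rank_one[OF e(1), of "j (pt e \<one>\<^bsub>S\<^esub>)"] j'(1) ec[OF e(1)] by auto
    have "\<Psi> (Y' \<oplus>\<^bsub>D.QS\<^esub> Y) (pt q \<one>\<^bsub>S\<^esub>) = j (pt (\<Oplus>\<^bsub>Q\<^esub>e\<in>insert e F. l e q \<odot>\<^bsub>Q\<^esub> e) \<one>\<^bsub>S\<^esub>)" if q: "q \<in> carrier Q" for q
    proof -
      have c: "l e' q \<odot>\<^bsub>Q\<^esub> e' \<in> carrier Q" if "e' \<in> E" for e' using functionalD(1)[OF l[OF that] q] ec[OF that] by simp
      have fc: "(\<Oplus>\<^bsub>Q\<^esub>e\<in>F. l e q \<odot>\<^bsub>Q\<^esub> e) \<in> carrier Q" by (rule Q.M.finsum_closed) (use c e in auto)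
      have "(\<Oplus>\<^bsub>Q\<^esub>e\<in>insert e F. l e q \<odot>\<^bsub>Q\<^esub> e) = l e q \<odot>\<^bsub>Q\<^esub> e \<oplus>\<^bsub>Q\<^esub> (\<Oplus>\<^bsub>Q\<^esub>e\<in>F. l e q \<odot>\<^bsub>Q\<^esub> e)"
        by (rule Q.M.finsum_insert) (use insert c e in auto)
      then show ?thesis
        using Y Y' q fc c[OF e(1)] ec[OF e(1)] functionalD(1)[OF l[OF e(1)] q]
        by (simp add: P(2) End_apply pt_addl j' pt_scalar)
    qed
    then show ?case using Y Y' by (intro bexI[of _ "Y' \<oplus>\<^bsub>D.QS\<^esub> Y"]) auto
  qed
  from this[OF E(1) order.refl] obtain Y where Y: "Y \<in> carrier D.QS"
    and Yj: "\<And>q. q \<in> carrier Q \<Longrightarrow> \<Psi> Y (pt q \<one>\<^bsub>S\<^esub>) = j (pt q \<one>\<^bsub>S\<^esub>)"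
    using dual by auto
  have j_eq: "j = \<Psi> Y" by (rule EQS_ext[OF j P(1)[OF Y]]) (simp add: Yj)
  have sY: "D.slice l Y q = slice l (\<Psi> Y (pt q \<one>\<^bsub>S\<^esub>))" if l: "functional K S l" and Y: "Y \<in> carrier D.QS" and q: "q \<in> carrier Q" for l Y q
    using Y
  proof (induction rule: D.QS_induct)
    case zero then show ?case using q by (simp add: D.slice_zero[OF l] P0 End_apply slice_zero[OF l])
  next
    case (add f s t)
    then show ?case using q functionalD(1)[OF l] End_closed[of f K Q]
      by (simp add: D.slice_add[OF l] D.slice_pt[OF l] P(2) Pp End_apply ebc_pt smult_pt slice_add[OF l] slice_pt[OF l]
          QSm.smult_closed End_closed[of _ S QS] P(1))
  qed
  have "D.slice l Y \<in> W" if l: "functional K S l" for l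
  proof -
    have "D.slice l Y = End_slice l j"
      by (rule End_ext[OF D.slice_closed[OF l Y] End_slice_closed[OF l j]])
        (simp add: sY[OF l Y] End_slice_def Yj)
    then show ?thesis using sl[OF l] by simp
  qed
  then have "Y \<in> D.tensors_in W (carrier S)" by (rule D.slice_criterion[OF W Y])
  then have "\<Psi> Y \<in> mod_span S EQS (ebc ` W)"
  proof induction
    case zero
    have "ebc ` W \<subseteq> carrier EQS" using ebc_closed EQm.submoduleD(1)[OF W] by auto
    note sp = EQSm.submoduleD[OF mod_span_submodule[OF module_End_alg[OF module_QS] this]]
    show ?case using P0 sp(2) by simp
  next
    case (add w s t)
    have sub: "ebc ` W \<subseteq> carrier EQS" using ebc_closed EQm.submoduleD(1)[OF W] by auto
    note sp = EQSm.submoduleD[OF mod_span_submodule[OF module_End_alg[OF module_QS] sub]]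
    have wc: "w \<in> carrier EQ" using add(1) EQm.submoduleD(1)[OF W] by blast
    have tc: "t \<in> carrier D.QS" using add(3) D.tensors_in_carrier[of W "carrier S"] EQm.submoduleD(1)[OF W] by blast
    have "ebc w \<in> mod_span S EQS (ebc ` W)" using mod_span_incl[OF module_End_alg[OF module_QS] sub] add(1) by blast
    then show ?case using add wc tc sp by (simp add: P(2) Pp)
  qed
  then show ?thesis using j_eq by simp
qed

end

text \<open>A functional on \<open>S\<close> base changes to an \<open>S'\<close>-linear map \<open>S \<otimes> S' \<rightarrow> S'\<close>.\<close>

lemma retraction:
  fixes S S' :: "('k, 's) module"
  assumes inf: "infinite (UNIV :: 's set)" and S: "algebra K S" and S': "algebra K S'" and l: "functional K S l"
  obtains T :: "('k, 's) module" and i1 i2 r where "algebra K T" "i1 \<in> alg_hom K S T" "i2 \<in> alg_hom K S' T" "linear K T S' r"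
    "\<forall>s\<in>carrier S. \<forall>s'\<in>carrier S'. r (i1 s \<otimes>\<^bsub>T\<^esub> i2 s') = l s \<odot>\<^bsub>S'\<^esub> s'"
    "\<forall>t\<in>carrier T. \<forall>s'\<in>carrier S'. r (i2 s' \<otimes>\<^bsub>T\<^esub> t) = s' \<otimes>\<^bsub>S'\<^esub> r t"
proof -
  interpret S: algebra K S by fact
  interpret S': algebra K S' by fact
  let ?u = "\<lambda>c. c \<odot>\<^bsub>S\<^esub> \<one>\<^bsub>S\<^esub>" and ?u' = "\<lambda>c. c \<odot>\<^bsub>S'\<^esub> \<one>\<^bsub>S'\<^esub>"
  interpret P: pushout K S S' K ?u ?u'
  proof
    show "?u \<in> ring_hom K S"
      by (rule ring_hom_memI) (simp_all add: S.smult_l_distr S.smult_assoc1 S.smult_assoc2)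
    show "?u' \<in> ring_hom K S'"
      by (rule ring_hom_memI) (simp_all add: S'.smult_l_distr S'.smult_assoc1 S'.smult_assoc2)
  qed auto
  obtain T :: "('k, 's) module" and i1 i2 \<theta> where T: "algebra K T" and i1: "i1 \<in> alg_hom K S T" and i2: "i2 \<in> alg_hom K S' T"
    and th: "\<theta> \<in> hom P.TG (add_monoid T)" "bij_betw \<theta> (carrier P.TG) (carrier T)"
    and thp: "\<forall>s\<in>carrier S. \<forall>a\<in>carrier S'. \<theta> (P.pt s a) = i1 s \<otimes>\<^bsub>T\<^esub> i2 a"
    by (rule P.exists_in_universe[OF inf]) (rule that; assumption)
  interpret T: algebra K T by fact
  note i1' = alg_homD[OF i1] and i2' = alg_homD[OF i2] and l' = functionalD[OF l]
  have b: "P.balanced (add_monoid S') (\<lambda>s s'. l s \<odot>\<^bsub>S'\<^esub> s')"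
    by (rule P.balancedI)
      (simp_all add: l' S.smult_one_mult S'.smult_one_mult S'.smult_l_distr S'.smult_r_distr S'.smult_assoc1[symmetric] S.R.m_comm)
  let ?k = "P.lift (add_monoid S') (\<lambda>s s'. l s \<odot>\<^bsub>S'\<^esub> s')"
  note k = P.lift[OF S'.a_comm_group b, unfolded restrict_scalars_simps]
  have ka: "?k (x \<otimes>\<^bsub>P.TG\<^esub> y) = ?k x \<oplus>\<^bsub>S'\<^esub> ?k y" if "x \<in> carrier P.TG" "y \<in> carrier P.TG" for x y
    using hom_mult[OF k(1)] that by simp
  have kc: "?k x \<in> carrier S'" if "x \<in> carrier P.TG" for x using hom_in_carrier[OF k(1)] that by simp
  have k0: "?k \<one>\<^bsub>P.TG\<^esub> = \<zero>\<^bsub>S'\<^esub>" using hom_one[OF k(1) P.TG.is_group comm_group.axioms(2)[OF S'.a_comm_group]] by simp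
  have tha: "\<theta> (x \<otimes>\<^bsub>P.TG\<^esub> y) = \<theta> x \<oplus>\<^bsub>T\<^esub> \<theta> y" if "x \<in> carrier P.TG" "y \<in> carrier P.TG" for x y
    using hom_mult[OF th(1)] that by simp
  have thc: "\<theta> x \<in> carrier T" if "x \<in> carrier P.TG" for x using hom_in_carrier[OF th(1)] that by simp
  have th0: "\<theta> \<one>\<^bsub>P.TG\<^esub> = \<zero>\<^bsub>T\<^esub>"
    using hom_one[OF th(1) P.TG.is_group comm_group.axioms(2)[OF T.a_comm_group]] by simp
  define r where "r t = ?k (inv_into (carrier P.TG) \<theta> t)" for t
  have r: "r (\<theta> x) = ?k x" if "x \<in> carrier P.TG" for x
    using th(2) that by (simp add: r_def bij_betw_def inv_into_f_f)
  have surj: "\<exists>x\<in>carrier P.TG. t = \<theta> x" if "t \<in> carrier T" for t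
    using th(2) that by (auto simp: bij_betw_def)
  have mult: "r (i2 s' \<otimes>\<^bsub>T\<^esub> \<theta> x) = s' \<otimes>\<^bsub>S'\<^esub> ?k x \<and> (\<exists>y\<in>carrier P.TG. \<theta> y = i2 s' \<otimes>\<^bsub>T\<^esub> \<theta> x \<and> ?k y = s' \<otimes>\<^bsub>S'\<^esub> ?k x)"
    if s': "s' \<in> carrier S'" and x: "x \<in> carrier P.TG" for s' x
  proof -
    have "\<exists>y\<in>carrier P.TG. \<theta> y = i2 s' \<otimes>\<^bsub>T\<^esub> \<theta> x \<and> ?k y = s' \<otimes>\<^bsub>S'\<^esub> ?k x"
      using x
    proof (induction rule: P.pt_induct)
      case one show ?case using s' i2' by (intro bexI[of _ "\<one>\<^bsub>P.TG\<^esub>"]) (simp_all add: th0 k0)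
    next
      case (add s a t)
      then obtain y where y: "y \<in> carrier P.TG" "\<theta> y = i2 s' \<otimes>\<^bsub>T\<^esub> \<theta> t" "?k y = s' \<otimes>\<^bsub>S'\<^esub> ?k t" by blast
      let ?p = "P.pt s (s' \<otimes>\<^bsub>S'\<^esub> a)"
      have p: "?p \<in> carrier P.TG" using add s' by simp
      have "\<theta> (?p \<otimes>\<^bsub>P.TG\<^esub> y) = i2 s' \<otimes>\<^bsub>T\<^esub> \<theta> (P.pt s a \<otimes>\<^bsub>P.TG\<^esub> t)"
        using add s' i1' i2' thc[OF add(3)] by (simp add: tha[OF p y(1)] tha y(2) thp T.r_distr T.m_lcomm)
      moreover have "?k (?p \<otimes>\<^bsub>P.TG\<^esub> y) = s' \<otimes>\<^bsub>S'\<^esub> ?k (P.pt s a \<otimes>\<^bsub>P.TG\<^esub> t)"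
        using add s' l' kc[OF add(3)] by (simp add: ka[OF p y(1)] ka y(3) k(2) S'.r_distr S'.smult_assoc3)
      ultimately show ?case using p y(1) by (intro bexI[of _ "?p \<otimes>\<^bsub>P.TG\<^esub> y"]) auto
    qed
    then show ?thesis using r by metis
  qed
  have r_mult: "r (i2 s' \<otimes>\<^bsub>T\<^esub> t) = s' \<otimes>\<^bsub>S'\<^esub> r t" if "t \<in> carrier T" "s' \<in> carrier S'" for t s'
    using surj[OF that(1)] mult[OF that(2)] r by auto
  show thesis
  proof (rule that[OF T i1 i2])
    show "linear K T S' r"
    proof (rule linearI)
      show "r t \<in> carrier S'" if "t \<in> carrier T" for t using surj[OF that] r kc by auto
      show "r (t \<oplus>\<^bsub>T\<^esub> t') = r t \<oplus>\<^bsub>S'\<^esub> r t'" if "t \<in> carrier T" "t' \<in> carrier T" for t t'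
      proof -
        obtain x x' where "x \<in> carrier P.TG" "x' \<in> carrier P.TG" "t = \<theta> x" "t' = \<theta> x'" using surj \<open>t \<in> carrier T\<close> \<open>t' \<in> carrier T\<close> by blast
        then show ?thesis using r[of "x \<otimes>\<^bsub>P.TG\<^esub> x'"] r[of x] r[of x'] by (simp add: tha ka)
      qed
      show "r (c \<odot>\<^bsub>T\<^esub> t) = c \<odot>\<^bsub>S'\<^esub> r t" if "c \<in> carrier K" "t \<in> carrier T" for c t
      proof -
        have rt: "r t \<in> carrier S'" using surj[OF that(2)] r kc by auto
        have "c \<odot>\<^bsub>T\<^esub> t = i2 (c \<odot>\<^bsub>S'\<^esub> \<one>\<^bsub>S'\<^esub>) \<otimes>\<^bsub>T\<^esub> t" using that i2' by (simp add: T.smult_one_mult)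
        then show ?thesis using r_mult[OF that(2), of "c \<odot>\<^bsub>S'\<^esub> \<one>\<^bsub>S'\<^esub>"] that rt by (simp add: S'.smult_one_mult)
      qed
    qed
    show "\<forall>s\<in>carrier S. \<forall>s'\<in>carrier S'. r (i1 s \<otimes>\<^bsub>T\<^esub> i2 s') = l s \<odot>\<^bsub>S'\<^esub> s'"
      using r k(2) thp by (metis P.pt_c)
    show "\<forall>t\<in>carrier T. \<forall>s'\<in>carrier S'. r (i2 s' \<otimes>\<^bsub>T\<^esub> t) = s' \<otimes>\<^bsub>S'\<^esub> r t" using r_mult by blast
  qed
qed

section \<open>Strongly stable pairs\<close>

locale stable_pair =
  fixes K :: "'k ring"
    and G :: "('k, 's, 'g) kgroup"
    and N :: "('k, 's) module \<Rightarrow> 'g set"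
    and Q :: "('k, 'q) module"
    and \<rho> \<sigma> \<alpha> :: "('k, 's) module \<Rightarrow> 'g \<Rightarrow> ('q, 's) tens \<Rightarrow> ('q, 's) tens"
    and V :: "'q set"
  assumes field: "field K" and inf: "infinite (UNIV :: 's set)"
    and G: "group_functor K G"
    and N: "closed_normal_subgroup K G N"
    and fd: "finite_dimensional K Q"
    and rho: "group_morphism K (subgroup_functor G N) (GL K Q) \<rho>"
    and V: "G_submodule K G N Q \<rho> V \<sigma>"
    and soc: "socle K N Q \<rho> \<subseteq> V"
    and stable: "strongly_stable K G N Q \<rho> V \<sigma> \<alpha>"
begin

abbreviation "QB S \<equiv> base_change K Q S"
abbreviation "E S \<equiv> End_alg S (base_change K Q S)"
abbreviation "rs \<equiv> res (GL K Q)"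
abbreviation "J \<equiv> annihilator_J K N Q \<rho> V"
abbreviation "tin S \<equiv> vector_extension.tensors_in K Q S"

lemma mQ: "module K Q" using fd by (simp add: finite_dimensional_def)

lemma VE: "algebra K S \<Longrightarrow> vector_extension K Q S"
  by (intro vector_extension.intro scalar_extension.intro mQ field)

lemma EH: "algebra K S \<Longrightarrow> algebra K T \<Longrightarrow> \<phi> \<in> alg_hom K S T \<Longrightarrow> extension_hom K Q S T \<phi>"
  by (rule extension_homI[OF mQ])

lemma ring_E: "algebra K S \<Longrightarrow> ring (E S)"
proof -
  assume "algebra K S" then interpret S: vector_extension K Q S by (rule VE)
  show ?thesis by (rule S.EQS.ring_axioms)
qed

lemma N_normal: "algebra K S \<Longrightarrow> N S \<lhd> pts G S"
  using N unfolding closed_normal_subgroup_def by blast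

lemma N_sub: "algebra K S \<Longrightarrow> n \<in> N S \<Longrightarrow> n \<in> carrier (pts G S)"
  using normal_imp_subgroup[OF N_normal] subgroup.subset by blast

lemma N_res:
  assumes "algebra K S" "algebra K T" "\<phi> \<in> alg_hom K S T" "n \<in> N S"
  shows "res G S T \<phi> n \<in> N T"
proof -
  obtain F where F: "F \<subseteq> regular_functions K G"
    and NF: "\<forall>S. algebra K S \<longrightarrow> N S = {g \<in> carrier (pts G S). \<forall>f\<in>F. f S g = \<zero>\<^bsub>S\<^esub>}"
    using N unfolding closed_normal_subgroup_def by blast
  interpret S: algebra K S by fact
  interpret T: algebra K T by fact
  have "f T (res G S T \<phi> n) = \<zero>\<^bsub>T\<^esub>" if f: "f \<in> F" for f
  proof -
    have "f T (res G S T \<phi> n) = \<phi> (f S n)"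
    proof -
      have "f \<in> regular_functions K G" using f F by blast
      then have "\<forall>S T \<phi>. algebra K S \<and> algebra K T \<and> \<phi> \<in> alg_hom K S T \<longrightarrow>
        (\<forall>g\<in>carrier (pts G S). f T (res G S T \<phi> g) = \<phi> (f S g))"
        unfolding regular_functions_def by blast
      then show ?thesis using assms N_sub by blast
    qed
    also have "f S n = \<zero>\<^bsub>S\<^esub>" using NF assms f by blast
    also have "\<phi> \<zero>\<^bsub>S\<^esub> = \<zero>\<^bsub>T\<^esub>" using linear_zero[OF alg_homD(8)[OF assms(3)] S.module_axioms T.module_axioms] .
    finally show ?thesis .
  qed
  moreover have "res G S T \<phi> n \<in> carrier (pts G T)" using group_functorD(5)[OF G assms(1-3)] N_sub assms by blast
  ultimately show ?thesis using NF assms(2) by blast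
qed

lemma rho_hom: "algebra K S \<Longrightarrow> \<rho> S \<in> hom ((pts G S)\<lparr>carrier := N S\<rparr>) (pts (GL K Q) S)"
  using rho unfolding group_morphism_def subgroup_functor_def by simp

lemma rho_Units: "algebra K S \<Longrightarrow> n \<in> N S \<Longrightarrow> \<rho> S n \<in> Units (E S)"
  using hom_in_carrier[OF rho_hom] by (simp add: GL_simps)

lemma rho_End: "algebra K S \<Longrightarrow> n \<in> N S \<Longrightarrow> \<rho> S n \<in> carrier (E S)"
  using rho_Units unfolding Units_def by blast

lemma rho_res: "algebra K S \<Longrightarrow> algebra K T \<Longrightarrow> \<phi> \<in> alg_hom K S T \<Longrightarrow> n \<in> N S \<Longrightarrow>
    \<rho> T (res G S T \<phi> n) = rs S T \<phi> (\<rho> S n)"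
  using scheme_morphismD(2)[of K "subgroup_functor G N" "GL K Q" \<rho> S T \<phi> n] rho
  unfolding group_morphism_def subgroup_functor_def by simp

lemma V_sub: "submodule V K Q" using V unfolding G_submodule_def by blast

lemma V_carrier: "v \<in> V \<Longrightarrow> v \<in> carrier Q"
  using module.submoduleD(1)[OF mQ V_sub] .

text \<open>Commuting with the points of \<open>N\<close> over \<open>S\<close> alone would be too weak: \<open>N\<close> need not be reduced, and may
  have few points over \<open>S\<close>.\<close>

definition commutes :: "('k, 's) module \<Rightarrow> (('q, 's) tens \<Rightarrow> ('q, 's) tens) \<Rightarrow> bool" where
  "commutes S x \<longleftrightarrow> (\<forall>T \<phi> n. algebra K T \<longrightarrow> \<phi> \<in> alg_hom K S T \<longrightarrow> n \<in> N T \<longrightarrow>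
     rs S T \<phi> x \<otimes>\<^bsub>E T\<^esub> \<rho> T n = \<rho> T n \<otimes>\<^bsub>E T\<^esub> rs S T \<phi> x)"

lemma commutesD: "commutes S x \<Longrightarrow> algebra K T \<Longrightarrow> \<phi> \<in> alg_hom K S T \<Longrightarrow> n \<in> N T \<Longrightarrow>
    rs S T \<phi> x \<otimes>\<^bsub>E T\<^esub> \<rho> T n = \<rho> T n \<otimes>\<^bsub>E T\<^esub> rs S T \<phi> x"
  unfolding commutes_def by blast

lemma commutes_add:
  assumes S: "algebra K S" and a: "a \<in> carrier (E S)" "commutes S a" and b: "b \<in> carrier (E S)" "commutes S b"
  shows "commutes S (a \<oplus>\<^bsub>E S\<^esub> b)"
  unfolding commutes_def
proof (intro allI impI)
  fix T \<phi> n assume T: "algebra K T" "\<phi> \<in> alg_hom K S T" "n \<in> N T"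
  interpret h: extension_hom K Q S T \<phi> using EH[OF S T(1,2)] .
  show "rs S T \<phi> (a \<oplus>\<^bsub>E S\<^esub> b) \<otimes>\<^bsub>E T\<^esub> \<rho> T n = \<rho> T n \<otimes>\<^bsub>E T\<^esub> rs S T \<phi> (a \<oplus>\<^bsub>E S\<^esub> b)"
    using commutesD[OF a(2) T] commutesD[OF b(2) T] rho_End[OF T(1,3)] a b
    by (simp add: h.res_add h.T.EQS.l_distr h.T.EQS.r_distr h.res_closed)
qed

lemma commutes_smult:
  assumes S: "algebra K S" and a: "a \<in> carrier (E S)" "commutes S a" and s: "s \<in> carrier S"
  shows "commutes S (s \<odot>\<^bsub>E S\<^esub> a)"
  unfolding commutes_def
proof (intro allI impI)
  fix T \<phi> n assume T: "algebra K T" "\<phi> \<in> alg_hom K S T" "n \<in> N T"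
  interpret h: extension_hom K Q S T \<phi> using EH[OF S T(1,2)] .
  note r = rho_End[OF T(1,3)]
  have c: "\<phi> s \<in> carrier T" "rs S T \<phi> a \<in> carrier (E T)" using alg_homD(2)[OF T(2)] s h.res_closed a by auto
  have "(\<phi> s \<odot>\<^bsub>E T\<^esub> rs S T \<phi> a) \<otimes>\<^bsub>E T\<^esub> \<rho> T n = \<phi> s \<odot>\<^bsub>E T\<^esub> (rs S T \<phi> a \<otimes>\<^bsub>E T\<^esub> \<rho> T n)"
    by (rule End_ext[of _ T "QB T"]) (use r c End_closed[OF r] in \<open>simp_all add: h.T.EQSm.smult_closed End_apply\<close>)
  moreover have "\<rho> T n \<otimes>\<^bsub>E T\<^esub> (\<phi> s \<odot>\<^bsub>E T\<^esub> rs S T \<phi> a) = \<phi> s \<odot>\<^bsub>E T\<^esub> (\<rho> T n \<otimes>\<^bsub>E T\<^esub> rs S T \<phi> a)"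
    by (rule End_ext[of _ T "QB T"]) (use r c End_closed[OF c(2)] End_linear(2)[OF r] in \<open>simp_all add: h.T.EQSm.smult_closed End_apply\<close>)
  ultimately show "rs S T \<phi> (s \<odot>\<^bsub>E S\<^esub> a) \<otimes>\<^bsub>E T\<^esub> \<rho> T n = \<rho> T n \<otimes>\<^bsub>E T\<^esub> rs S T \<phi> (s \<odot>\<^bsub>E S\<^esub> a)"
    using commutesD[OF a(2) T] a s by (simp add: h.res_smult)
qed

lemma commutes_one: "algebra K S \<Longrightarrow> commutes S \<one>\<^bsub>E S\<^esub>"
  unfolding commutes_def
proof (intro allI impI)
  fix T \<phi> n assume S: "algebra K S" and T: "algebra K T" "\<phi> \<in> alg_hom K S T" "n \<in> N T"
  interpret h: extension_hom K Q S T \<phi> using EH[OF S T(1,2)] .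
  show "rs S T \<phi> \<one>\<^bsub>E S\<^esub> \<otimes>\<^bsub>E T\<^esub> \<rho> T n = \<rho> T n \<otimes>\<^bsub>E T\<^esub> rs S T \<phi> \<one>\<^bsub>E S\<^esub>"
    using rho_End[OF T(1,3)] by (simp add: h.res_one)
qed

lemma End_ND:
  assumes f: "f \<in> End_N K N Q \<rho>"
  shows "f \<in> carrier (End_alg K Q)"
    "\<And>S n x. algebra K S \<Longrightarrow> n \<in> N S \<Longrightarrow> x \<in> carrier (QB S) \<Longrightarrow>
      end_base_change K Q S f (\<rho> S n x) = \<rho> S n (end_base_change K Q S f x)"
  using f unfolding End_N_def by blast+

lemma ebc_commutes:
  assumes S: "algebra K S" and f: "f \<in> End_N K N Q \<rho>"
  shows "commutes S (end_base_change K Q S f)"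
  unfolding commutes_def
proof (intro allI impI)
  fix T \<phi> n assume T: "algebra K T" "\<phi> \<in> alg_hom K S T" "n \<in> N T"
  interpret h: extension_hom K Q S T \<phi> using EH[OF S T(1,2)] .
  note f' = End_ND[OF f]
  note r = rho_End[OF T(1,3)]
  have "end_base_change K Q T f \<otimes>\<^bsub>E T\<^esub> \<rho> T n = \<rho> T n \<otimes>\<^bsub>E T\<^esub> end_base_change K Q T f"
    by (rule End_ext[of _ T "QB T"]) (use r h.T.ebc_closed[OF f'(1)] f'(2)[OF T(1,3)] in \<open>simp_all add: End_apply\<close>)
  then show "rs S T \<phi> (end_base_change K Q S f) \<otimes>\<^bsub>E T\<^esub> \<rho> T n = \<rho> T n \<otimes>\<^bsub>E T\<^esub> rs S T \<phi> (end_base_change K Q S f)"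
    using h.res_ebc[OF f'(1)] by simp
qed

text \<open>For \<open>n \<in> N(S')\<close> one works over \<open>S \<otimes> S'\<close>, where \<open>j\<close> commutes with \<open>n\<close>, and applies the \<open>S'\<close>-linear
  retraction \<open>S \<otimes> S' \<rightarrow> S'\<close> defined by the functional.\<close>

lemma End_slice_commutes:
  assumes S: "algebra K S" and j: "j \<in> carrier (E S)" and cj: "commutes S j" and l: "functional K S l"
  shows "vector_extension.End_slice K Q S l j \<in> End_N K N Q \<rho>"
proof -
  interpret S: vector_extension K Q S by (rule VE[OF S])
  let ?f = "S.End_slice l j"
  have f: "?f \<in> carrier (End_alg K Q)" by (rule S.End_slice_closed[OF l j])
  note j' = End_closed[OF j] End_linear[OF j]
  have "end_base_change K Q S' ?f (\<rho> S' n y) = \<rho> S' n (end_base_change K Q S' ?f y)"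
    if S': "algebra K S'" and n: "n \<in> N S'" and y: "y \<in> carrier (QB S')" for S' n y
  proof -
    interpret S': vector_extension K Q S' by (rule VE[OF S'])
    obtain T :: "('k, 's) module" and i1 i2 r where T: "algebra K T" and i1: "i1 \<in> alg_hom K S T" and i2: "i2 \<in> alg_hom K S' T"
      and r: "linear K T S' r"
      and r1: "\<forall>s\<in>carrier S. \<forall>s'\<in>carrier S'. r (i1 s \<otimes>\<^bsub>T\<^esub> i2 s') = l s \<odot>\<^bsub>S'\<^esub> s'"
      and r2: "\<forall>t\<in>carrier T. \<forall>s'\<in>carrier S'. r (i2 s' \<otimes>\<^bsub>T\<^esub> t) = s' \<otimes>\<^bsub>S'\<^esub> r t"
      by (rule retraction[OF inf S S' l])
    interpret T: vector_extension K Q T by (rule VE[OF T])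
    interpret a: extension_hom K Q S T i1 by (rule EH[OF S T i1])
    interpret b: extension_hom K Q S' T i2 by (rule EH[OF S' T i2])
    note i1' = alg_homD[OF i1] and i2' = alg_homD[OF i2] and l' = functionalD[OF l] and r' = linearD[OF r]
    \<comment> \<open>\<open>L\<close> carries the base change of \<open>j\<close> to that of its slice, and commutes with the endomorphisms that come from \<open>S'\<close>.\<close>
    define L where "L = base_map K Q S' r"
    note L = tensor_map_base_change[OF mQ T mQ S' linear_id[OF mQ] r, folded base_map_def, folded L_def, unfolded id_apply]
    have La: "L (i2 s' \<odot>\<^bsub>T.QS\<^esub> a.bm z) = S'.pt (S.slice l z) s'" if s': "s' \<in> carrier S'" and z: "z \<in> carrier (QB S)" for s' z
      using z
    proof (induction rule: S.QS_induct)
      case zero then show ?case using s' i2' by (simp add: a.bm(3) L(3) S.slice_zero[OF l])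
    next
      case (add q s t)
      have "r (i2 s' \<otimes>\<^bsub>T\<^esub> i1 s) = l s \<odot>\<^bsub>S'\<^esub> s'"
        using r1 add(2) s' i1' i2' by (simp add: T.S.m_comm[of "i2 s'" "i1 s"])
      then have "L (i2 s' \<odot>\<^bsub>T.QS\<^esub> a.bm (S.pt q s)) = S'.pt (l s \<odot>\<^bsub>Q\<^esub> q) s'"
        using add(1,2) s' i1' i2' l' by (simp add: a.bm(4) T.smult_pt L(4) S'.pt_balanced)
      then show ?case using add s' i1' i2' l' a.bm
        by (simp add: T.QSm.smult_r_distr L(2) S.slice_add[OF l] S.slice_pt[OF l] S.slice_closed[OF l] S'.pt_addl)
    qed
    have Lc: "L (t \<odot>\<^bsub>T.QS\<^esub> b.bm z) = r t \<odot>\<^bsub>S'.QS\<^esub> z" if t: "t \<in> carrier T" and z: "z \<in> carrier (QB S')" for t z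
      using z
    proof (induction rule: S'.QS_induct)
      case zero then show ?case using t r' by (simp add: b.bm(3) L(3))
    next
      case (add q u z)
      have "r (t \<otimes>\<^bsub>T\<^esub> i2 u) = r t \<otimes>\<^bsub>S'\<^esub> u"
        using r2 add(2) t i2' r' by (simp add: T.S.m_comm[of t "i2 u"] S'.S.m_comm[of u "r t"])
      then have "L (t \<odot>\<^bsub>T.QS\<^esub> b.bm (S'.pt q u)) = r t \<odot>\<^bsub>S'.QS\<^esub> S'.pt q u"
        using add(1,2) t i2' r' by (simp add: b.bm(4) T.smult_pt L(4) S'.smult_pt)
      then show ?case using add t i2' r' b.bm
        by (simp add: T.QSm.smult_r_distr S'.QSm.smult_r_distr L(2))
    qed
    have La': "L (rs S T i1 j (b.bm z)) = end_base_change K Q S' ?f z" if z: "z \<in> carrier (QB S')" for z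
      using z
    proof (induction rule: S'.QS_induct)
      case zero
      have "rs S T i1 j \<zero>\<^bsub>T.QS\<^esub> = \<zero>\<^bsub>T.QS\<^esub>" using T.linear_zero_QS[OF _ T.module_QS] a.res_closed[OF j] by (simp add: End_carrier)
      moreover have "end_base_change K Q S' ?f \<zero>\<^bsub>S'.QS\<^esub> = \<zero>\<^bsub>S'.QS\<^esub>" using S'.linear_zero_QS[OF _ S'.module_QS] S'.ebc_closed[OF f] by (simp add: End_carrier)
      ultimately show ?case by (simp add: b.bm(3) L(3))
    next
      case (add q u z)
      note rj = End_closed[OF a.res_closed[OF j]] End_linear[OF a.res_closed[OF j]]
      note ef = End_linear[OF S'.ebc_closed[OF f]]
      have "rs S T i1 j (b.bm (S'.pt q u)) = i2 u \<odot>\<^bsub>T.QS\<^esub> a.bm (j (S.pt q \<one>\<^bsub>S\<^esub>))"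
        using add(1,2) i2' rj(3)[of "i2 u" "T.pt q \<one>\<^bsub>T\<^esub>"] a.res_pt[OF j, of q] by (simp add: b.bm(4) T.smult_pt)
      then have "L (rs S T i1 j (b.bm (S'.pt q u))) = end_base_change K Q S' ?f (S'.pt q u)"
        using La[OF add(2), of "j (S.pt q \<one>\<^bsub>S\<^esub>)"] add(1,2) j' S'.ebc_pt[OF f] by (simp add: S.End_slice_def)
      then show ?case using add rj ef b.bm(1,2) by (simp add: L(2))
    qed
    have Lb: "L (rs S' T i2 c w) = c (L w)" if c: "c \<in> carrier (E S')" and w: "w \<in> carrier (QB T)" for c w
      using w
    proof (induction rule: T.QS_induct)
      case zero
      have "rs S' T i2 c \<zero>\<^bsub>T.QS\<^esub> = \<zero>\<^bsub>T.QS\<^esub>" using T.linear_zero_QS[OF _ T.module_QS] b.res_closed[OF c] by (simp add: End_carrier)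
      moreover have "c \<zero>\<^bsub>S'.QS\<^esub> = \<zero>\<^bsub>S'.QS\<^esub>" using S'.linear_zero_QS[OF _ S'.module_QS] c by (simp add: End_carrier)
      ultimately show ?case by (simp add: L(3))
    next
      case (add q t w)
      note rc = End_closed[OF b.res_closed[OF c]] End_linear[OF b.res_closed[OF c]]
      note c' = End_closed[OF c] End_linear[OF c]
      have "rs S' T i2 c (T.pt q t) = t \<odot>\<^bsub>T.QS\<^esub> b.bm (c (S'.pt q \<one>\<^bsub>S'\<^esub>))"
        using add(1,2) rc(3)[of t "T.pt q \<one>\<^bsub>T\<^esub>"] b.res_pt[OF c, of q] by (simp add: T.smult_pt)
      then have "L (rs S' T i2 c (T.pt q t)) = r t \<odot>\<^bsub>S'.QS\<^esub> c (S'.pt q \<one>\<^bsub>S'\<^esub>)"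
        using Lc[OF add(2), of "c (S'.pt q \<one>\<^bsub>S'\<^esub>)"] add(1) c' by simp
      also have "\<dots> = c (L (T.pt q t))"
        using add(1,2) c'(3)[of "r t" "S'.pt q \<one>\<^bsub>S'\<^esub>"] r' by (simp add: L(4) S'.smult_pt)
      finally show ?case using add rc c' by (simp add: L(1,2))
    qed
    note rn = rho_End[OF S' n]
    have nT: "res G S' T i2 n \<in> N T" by (rule N_res[OF S' T i2 n])
    have ry: "\<rho> S' n y \<in> carrier (QB S')" using End_closed[OF rn y] .
    have bmy: "b.bm y \<in> carrier (QB T)" using b.bm(1)[OF y] .
    have "end_base_change K Q S' ?f (\<rho> S' n y) = L (rs S T i1 j (b.bm (\<rho> S' n y)))" using La'[OF ry] by simp
    also have "b.bm (\<rho> S' n y) = \<rho> T (res G S' T i2 n) (b.bm y)"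
      using b.res_bm[OF rn y] rho_res[OF S' T i2 n] by simp
    also have "rs S T i1 j (\<rho> T (res G S' T i2 n) (b.bm y)) = \<rho> T (res G S' T i2 n) (rs S T i1 j (b.bm y))"
      using fun_cong[OF commutesD[OF cj T i1 nT], of "b.bm y"] bmy by (simp add: End_apply)
    also have "\<dots> = rs S' T i2 (\<rho> S' n) (rs S T i1 j (b.bm y))" using rho_res[OF S' T i2 n] by simp
    also have "L \<dots> = \<rho> S' n (L (rs S T i1 j (b.bm y)))"
      by (rule Lb[OF rn]) (rule End_closed[OF a.res_closed[OF j] bmy])
    also have "L (rs S T i1 j (b.bm y)) = end_base_change K Q S' ?f y" by (rule La'[OF y])
    finally show ?thesis .
  qed
  then show ?thesis using f unfolding End_N_def by blast
qed

lemma J_D: "f \<in> J \<Longrightarrow> f \<in> End_N K N Q \<rho>" "f \<in> J \<Longrightarrow> v \<in> V \<Longrightarrow> f v = \<zero>\<^bsub>Q\<^esub>"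
  unfolding annihilator_J_def by auto

lemma J_carrier: "f \<in> J \<Longrightarrow> f \<in> carrier (End_alg K Q)"
  using J_D End_ND by blast

lemma J_submodule: "submodule J K (End_alg K Q)"
proof -
  interpret module K Q by (rule mQ)
  interpret EQ: module K "End_alg K Q" by (rule module_End_alg[OF mQ])
  show ?thesis
  proof (rule EQ.submoduleI_smult)
    show "J \<subseteq> carrier (End_alg K Q)" using J_carrier by blast
    have z: "end_base_change K Q S \<zero>\<^bsub>End_alg K Q\<^esub> x = \<zero>\<^bsub>QB S\<^esub>" if S: "algebra K S" and x: "x \<in> carrier (QB S)" for S x
    proof -
      interpret S: vector_extension K Q S by (rule VE[OF S])
      have "S.ebc \<zero>\<^bsub>S.EQ\<^esub> = \<zero>\<^bsub>S.EQS\<^esub>"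
        by (rule S.EQS_ext) (simp_all add: S.ebc_closed S.ebc_pt End_apply)
      then show ?thesis using x by (simp add: End_apply)
    qed
    show "\<zero>\<^bsub>End_alg K Q\<^esub> \<in> J"
      unfolding annihilator_J_def End_N_def
    proof (intro CollectI conjI allI impI ballI)
      fix S n x assume S: "algebra K S" and n: "n \<in> N S" and x: "x \<in> carrier (QB S)"
      interpret S: vector_extension K Q S by (rule VE[OF S])
      have "\<rho> S n \<zero>\<^bsub>QB S\<^esub> = \<zero>\<^bsub>QB S\<^esub>" using S.linear_zero_QS[OF _ S.module_QS] rho_End[OF S n] by (simp add: End_carrier)
      then show "end_base_change K Q S \<zero>\<^bsub>End_alg K Q\<^esub> (\<rho> S n x) = \<rho> S n (end_base_change K Q S \<zero>\<^bsub>End_alg K Q\<^esub> x)"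
        using z[OF S] x End_closed[OF rho_End[OF S n] x] by simp
    qed (simp_all add: V_carrier End_apply)
    show "f \<oplus>\<^bsub>End_alg K Q\<^esub> g \<in> J" if fg: "f \<in> J" "g \<in> J" for f g
      unfolding annihilator_J_def End_N_def
    proof (intro CollectI conjI allI impI ballI)
      show "f \<oplus>\<^bsub>End_alg K Q\<^esub> g \<in> carrier (End_alg K Q)" using fg J_carrier by simp
      fix S n x assume S: "algebra K S" and n: "n \<in> N S" and x: "x \<in> carrier (QB S)"
      interpret S: vector_extension K Q S by (rule VE[OF S])
      note r = rho_End[OF S n]
      show "end_base_change K Q S (f \<oplus>\<^bsub>End_alg K Q\<^esub> g) (\<rho> S n x) = \<rho> S n (end_base_change K Q S (f \<oplus>\<^bsub>End_alg K Q\<^esub> g) x)"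
        using End_ND(2)[OF J_D(1)[OF fg(1)] S n x] End_ND(2)[OF J_D(1)[OF fg(2)] S n x] x End_closed[OF r x] End_linear(1)[OF r]
          End_closed[OF S.ebc_closed[OF J_carrier[OF fg(1)]] x] End_closed[OF S.ebc_closed[OF J_carrier[OF fg(2)]] x]
        by (simp add: S.ebc_add J_carrier fg End_apply)
    next
      fix v assume "v \<in> V" then show "(f \<oplus>\<^bsub>End_alg K Q\<^esub> g) v = \<zero>\<^bsub>Q\<^esub>"
        using J_D(2)[OF fg(1)] J_D(2)[OF fg(2)] V_carrier by (simp add: End_apply)
    qed
    show "c \<odot>\<^bsub>End_alg K Q\<^esub> f \<in> J" if c: "c \<in> carrier K" and f: "f \<in> J" for c f
      unfolding annihilator_J_def End_N_def
    proof (intro CollectI conjI allI impI ballI)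
      show "c \<odot>\<^bsub>End_alg K Q\<^esub> f \<in> carrier (End_alg K Q)" using c f J_carrier by simp
      fix S n x assume S: "algebra K S" and n: "n \<in> N S" and x: "x \<in> carrier (QB S)"
      interpret S: vector_extension K Q S by (rule VE[OF S])
      note r = rho_End[OF S n]
      show "end_base_change K Q S (c \<odot>\<^bsub>End_alg K Q\<^esub> f) (\<rho> S n x) = \<rho> S n (end_base_change K Q S (c \<odot>\<^bsub>End_alg K Q\<^esub> f) x)"
        using End_ND(2)[OF J_D(1)[OF f] S n x] x c End_closed[OF r x] End_linear(2)[OF r]
          End_closed[OF S.ebc_closed[OF J_carrier[OF f]] x]
        by (simp add: S.ebc_smult J_carrier f End_apply)
    next
      fix v assume "v \<in> V" then show "(c \<odot>\<^bsub>End_alg K Q\<^esub> f) v = \<zero>\<^bsub>Q\<^esub>"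
        using J_D(2)[OF f] c V_carrier by (simp add: End_apply)
    qed
  qed
qed

definition fixes_V :: "('k, 's) module \<Rightarrow> (('q, 's) tens \<Rightarrow> ('q, 's) tens) \<Rightarrow> bool" where
  "fixes_V S x \<longleftrightarrow> (\<forall>v\<in>V. x (pure_tensor K Q S v \<one>\<^bsub>S\<^esub>) = pure_tensor K Q S v \<one>\<^bsub>S\<^esub>)"

abbreviation "U \<equiv> U_pts K N Q \<rho> V"

text \<open>An element of \<open>J \<otimes> S\<close> commutes with \<open>N\<close> and kills \<open>V\<close>, because the base changes of elements of \<open>J\<close> do.
  Conversely, if \<open>1 + j\<close> commutes with \<open>N\<close> and fixes \<open>V\<close>, then all slices of \<open>j\<close> are in \<open>J\<close>, and \<open>j \<in> J \<otimes> S\<close>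
  by the slice criterion.\<close>

lemma U_iff:
  assumes S: "algebra K S"
  shows "x \<in> U S \<longleftrightarrow> x \<in> carrier (E S) \<and> commutes S x \<and> fixes_V S x"
proof -
  interpret S: vector_extension K Q S by (rule VE[OF S])
  have sub: "S.ebc ` J \<subseteq> carrier (E S)" using S.ebc_closed J_carrier by auto
  note span = mod_span_submodule[OF module_End_alg[OF S.module_QS] sub]
  show ?thesis
  proof
    assume "x \<in> U S"
    then obtain j where j: "j \<in> mod_span S (E S) (S.ebc ` J)" and x: "x = \<one>\<^bsub>E S\<^esub> \<oplus>\<^bsub>E S\<^esub> j"
      unfolding U_pts_def by blast
    let ?H = "{j \<in> carrier (E S). commutes S j \<and> (\<forall>v\<in>V. j (S.pt v \<one>\<^bsub>S\<^esub>) = \<zero>\<^bsub>S.QS\<^esub>)}"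
    have "submodule ?H S (E S)"
    proof (rule S.EQSm.submoduleI_smult)
      have "commutes S (\<zero>\<^bsub>S\<^esub> \<odot>\<^bsub>E S\<^esub> \<one>\<^bsub>E S\<^esub>)" by (rule commutes_smult[OF S _ commutes_one[OF S]]) simp_all
      then show "\<zero>\<^bsub>E S\<^esub> \<in> ?H" by (simp add: End_apply V_carrier)
    qed (auto simp: commutes_add[OF S] commutes_smult[OF S] End_apply V_carrier)
    moreover have "S.ebc ` J \<subseteq> ?H"
    proof
      fix y assume "y \<in> S.ebc ` J"
      then obtain f where f: "f \<in> J" "y = S.ebc f" by blast
      show "y \<in> ?H"
        using sub f ebc_commutes[OF S J_D(1)[OF f(1)]] J_D(2)[OF f(1)]
        by (auto simp: S.ebc_pt[OF J_carrier[OF f(1)]] V_carrier)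
    qed
    ultimately have "j \<in> ?H" using mod_span_least[of ?H S "E S" "S.ebc ` J"] j by blast
    then show "x \<in> carrier (E S) \<and> commutes S x \<and> fixes_V S x"
      unfolding x fixes_V_def using commutes_add[OF S] commutes_one[OF S] by (auto simp: End_apply V_carrier)
  next
    assume x: "x \<in> carrier (E S) \<and> commutes S x \<and> fixes_V S x"
    define j where "j = (\<ominus>\<^bsub>S\<^esub> \<one>\<^bsub>S\<^esub>) \<odot>\<^bsub>E S\<^esub> \<one>\<^bsub>E S\<^esub> \<oplus>\<^bsub>E S\<^esub> x"
    have j: "j \<in> carrier (E S)" using x by (simp add: j_def)
    have cj: "commutes S j" unfolding j_def
      using x commutes_add[OF S] commutes_smult[OF S _ commutes_one[OF S]] by simp
    have xj: "x = \<one>\<^bsub>E S\<^esub> \<oplus>\<^bsub>E S\<^esub> j"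
      using x by (simp add: j_def S.EQSm.smult_l_minus S.EQS.a_assoc[symmetric] S.EQS.r_neg)
    have jv: "j (S.pt v \<one>\<^bsub>S\<^esub>) = \<zero>\<^bsub>S.QS\<^esub>" if "v \<in> V" for v
      using x that V_carrier[OF that] unfolding fixes_V_def j_def
      by (simp add: End_apply S.QSm.smult_l_minus S.QS.l_neg)
    have "S.End_slice l j \<in> J" if l: "functional K S l" for l
      unfolding annihilator_J_def
      using End_slice_commutes[OF S j cj l] by (auto simp: S.End_slice_def V_carrier jv S.slice_zero[OF l])
    then have "j \<in> mod_span S (E S) (S.ebc ` J)"
      by (rule S.End_slice_criterion[OF fd J_submodule j])
    then show "x \<in> U S" unfolding U_pts_def xj by blast
  qed
qed

lemma fixes_V_tensors:
  assumes S: "algebra K S" and x: "x \<in> carrier (E S)" "fixes_V S x" and t: "t \<in> tin S V (carrier S)"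
  shows "x t = t"
proof -
  interpret S: vector_extension K Q S by (rule VE[OF S])
  show ?thesis using t
  proof induction
    case zero show ?case using S.linear_zero_QS[OF _ S.module_QS] x by (simp add: End_carrier)
  next
    case (add v s t)
    have t: "t \<in> carrier S.QS" using add(3) S.tensors_in_carrier[of V "carrier S"] V_carrier by blast
    have p: "x (S.pt v s) = S.pt v s"
      using End_linear(2)[OF x(1), of s "S.pt v \<one>\<^bsub>S\<^esub>"] x(2) add(1,2) V_carrier[OF add(1)]
      by (simp add: S.smult_pt fixes_V_def)
    show ?case using End_linear(1)[OF x(1) S.pt_QS[OF V_carrier[OF add(1)] add(2)] t] p add.IH by simp
  qed
qed

end

section \<open>The socle filtration and unipotence\<close>

text \<open>
  A bounded strictly monotone rank on subspaces: the number of pivot positions with respect to the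
  coordinates given by a finite dual basis. If \<open>W \<subseteq> W'\<close> have the same pivot positions, then elements of
  \<open>W'\<close> can be reduced to \<open>0\<close> by subtracting elements of \<open>W\<close>.
\<close>

lemma subspace_rank:
  assumes K: "field K" and fd: "finite_dimensional K Q"
  obtains d :: "'q set \<Rightarrow> nat" and n where
    "\<And>W W'. submodule W K Q \<Longrightarrow> submodule W' K Q \<Longrightarrow> W \<subset> W' \<Longrightarrow> d W < d W'"
    "\<And>W. d W \<le> n"
proof -
  interpret K: field K by fact
  interpret module K Q using fd by (simp add: finite_dimensional_def)
  obtain E l where E: "finite E" "E \<subseteq> carrier Q" and l: "\<And>e. e \<in> E \<Longrightarrow> functional K Q (l e)"
    and dual: "\<And>q. q \<in> carrier Q \<Longrightarrow> q = (\<Oplus>\<^bsub>Q\<^esub>e\<in>E. l e q \<odot>\<^bsub>Q\<^esub> e)"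
    using dual_basis[OF K fd] by blast
  obtain es where es: "set es = E" using E(1) finite_list by blast
  let ?n = "length es"
  define x where "x i = l (es ! i)" for i
  have x: "functional K Q (x i)" if "i < ?n" for i using l[of "es ! i"] nth_mem[OF that] es by (simp add: x_def)
  note x' = functionalD[OF x]
  have zero: "q = \<zero>\<^bsub>Q\<^esub>" if q: "q \<in> carrier Q" and "\<And>i. i < ?n \<Longrightarrow> x i q = \<zero>\<^bsub>K\<^esub>" for q
  proof -
    have "l e q = \<zero>\<^bsub>K\<^esub>" if "e \<in> E" for e
      using that \<open>\<And>i. i < ?n \<Longrightarrow> x i q = \<zero>\<^bsub>K\<^esub>\<close> unfolding x_def es[symmetric] in_set_conv_nth by blast
    then have "(\<Oplus>\<^bsub>Q\<^esub>e\<in>E. l e q \<odot>\<^bsub>Q\<^esub> e) = (\<Oplus>\<^bsub>Q\<^esub>e\<in>E. \<zero>\<^bsub>Q\<^esub>)"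
      by (intro M.finsum_cong') (use E in auto)
    then show ?thesis using dual[OF q] by (simp add: M.finsum_zero)
  qed
  define piv where "piv W = {i. i < ?n \<and> (\<exists>w\<in>W. x i w \<noteq> \<zero>\<^bsub>K\<^esub> \<and> (\<forall>j<i. x j w = \<zero>\<^bsub>K\<^esub>))}" for W
  have fin: "finite (piv W)" for W by (simp add: piv_def)
  have strict: "card (piv W) < card (piv W')" if W: "submodule W K Q" and W': "submodule W' K Q" and lt: "W \<subset> W'" for W W'
  proof (rule psubset_card_mono[OF fin], rule psubsetI)
    show "piv W \<subseteq> piv W'" using lt by (auto simp: piv_def)
    show "piv W \<noteq> piv W'"
    proof
      assume eq: "piv W = piv W'"
      note D = submoduleD[OF W] and D' = submoduleD[OF W']
      have "w \<in> W" if "k \<le> ?n" "w \<in> W'" "\<forall>j<k. x j w = \<zero>\<^bsub>K\<^esub>" for k w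
        using that
      proof (induction k arbitrary: w rule: inc_induct)
        case base
        then show ?case using zero[of w] D'(1) D(2) by auto
      next
        case (step k)
        note kn = \<open>k < ?n\<close>
        show ?case
        proof (cases "x k w = \<zero>\<^bsub>K\<^esub>")
          case True then show ?thesis using step by (simp add: less_Suc_eq)
        next
          case False
          then have "k \<in> piv W" using eq step kn by (auto simp: piv_def)
          then obtain u where u: "u \<in> W" "x k u \<noteq> \<zero>\<^bsub>K\<^esub>" "\<forall>j<k. x j u = \<zero>\<^bsub>K\<^esub>" by (auto simp: piv_def)
          have uc: "u \<in> carrier Q" "u \<in> W'" and wc: "w \<in> carrier Q" using u D(1) D'(1) step lt by auto
          have xk: "x k u \<in> carrier K" "x k w \<in> carrier K" using x'(1)[OF kn] uc wc by auto
          define c where "c = \<ominus>\<^bsub>K\<^esub> (x k w \<otimes>\<^bsub>K\<^esub> inv\<^bsub>K\<^esub> x k u)"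
          have inv: "inv\<^bsub>K\<^esub> x k u \<in> carrier K" "inv\<^bsub>K\<^esub> x k u \<otimes>\<^bsub>K\<^esub> x k u = \<one>\<^bsub>K\<^esub>" using xk u(2) K.field_Units by auto
          have c: "c \<in> carrier K" "c \<otimes>\<^bsub>K\<^esub> x k u = \<ominus>\<^bsub>K\<^esub> x k w" using inv xk by (simp_all add: c_def K.l_minus K.m_assoc)
          let ?v = "w \<oplus>\<^bsub>Q\<^esub> c \<odot>\<^bsub>Q\<^esub> u"
          have "x j ?v = \<zero>\<^bsub>K\<^esub>" if "j < Suc k" for j
          proof (cases "j = k")
            case True then show ?thesis using x'[OF kn] wc uc c xk by (simp add: K.r_neg)
          next
            case False
            then have j: "j < k" "j < ?n" using that kn by auto
            then show ?thesis using x'[OF j(2)] wc uc c u(3) step by simp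
          qed
          moreover have "?v \<in> W'" using D'(3)[OF _ D'(4)[OF c(1) uc(2)]] step.prems by simp
          ultimately have vW: "?v \<in> W" using step.IH[of ?v] by simp
          have "?v \<ominus>\<^bsub>Q\<^esub> c \<odot>\<^bsub>Q\<^esub> u \<in> W" by (rule D(6)[OF vW D(4)[OF c(1) u(1)]])
          moreover have "?v \<ominus>\<^bsub>Q\<^esub> c \<odot>\<^bsub>Q\<^esub> u = w" using wc uc c by (simp add: a_minus_def M.a_assoc M.r_neg)
          ultimately show ?thesis by simp
        qed
      qed
      from this[of 0] lt show False by auto
    qed
  qed
  have "card (piv W) \<le> ?n" for W
    using card_mono[of "{..<?n}" "piv W"] by (auto simp: piv_def)
  then show thesis using that[of "\<lambda>W. card (piv W)" ?n] strict by blast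
qed

context vector_extension begin

lemma slice_ebc:
  assumes l: "functional K S l" and f: "f \<in> carrier EQ" and z: "z \<in> carrier QS"
  shows "slice l (ebc f z) = f (slice l z)"
  using z
proof (induction rule: QS_induct)
  case zero
  have "ebc f \<zero>\<^bsub>QS\<^esub> = \<zero>\<^bsub>QS\<^esub>" using linear_zero_QS[OF _ module_QS] ebc_closed[OF f] by (simp add: End_carrier)
  moreover have "f \<zero>\<^bsub>Q\<^esub> = \<zero>\<^bsub>Q\<^esub>" using linear_zero[OF _ Q.module_axioms Q.module_axioms] f by (simp add: End_carrier)
  ultimately show ?case by (simp add: slice_zero[OF l])
next
  case (add q s t)
  note f' = End_closed[OF f] End_linear[OF f] and e' = End_closed[OF ebc_closed[OF f]] End_linear[OF ebc_closed[OF f]]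
  show ?case using add f' e' functionalD(1)[OF l]
    by (simp add: ebc_pt[OF f] slice_add[OF l] slice_pt[OF l] slice_closed[OF l])
qed

lemma ebc_tensors:
  assumes f: "f \<in> carrier EQ" and W: "W \<subseteq> carrier Q" and t: "t \<in> tensors_in W (carrier S)" and fW: "\<And>w. w \<in> W \<Longrightarrow> f w \<in> W'"
  shows "ebc f t \<in> tensors_in W' (carrier S)"
  using t
proof induction
  case zero
  have "ebc f \<zero>\<^bsub>QS\<^esub> = \<zero>\<^bsub>QS\<^esub>" using linear_zero_QS[OF _ module_QS] ebc_closed[OF f] by (simp add: End_carrier)
  then show ?case using tensors_in.zero by simp
next
  case (add w s t)
  have "t \<in> carrier QS" using add(3) tensors_in_carrier[OF W order.refl] by blast
  moreover have "w \<in> carrier Q" using add W by blast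
  ultimately have "ebc f (pt w s \<oplus>\<^bsub>QS\<^esub> t) = pt (f w) s \<oplus>\<^bsub>QS\<^esub> ebc f t"
    using End_linear(1)[OF ebc_closed[OF f]] add(2) by (simp add: ebc_pt[OF f])
  then show ?case using tensors_in.add[OF fW[OF add(1)] add(2) add.IH] by simp
qed

lemma tensors_in_image:
  assumes f: "f \<in> carrier EQ" and W: "W \<subseteq> carrier Q" and t: "t \<in> tensors_in (f ` W) (carrier S)"
  shows "\<exists>u\<in>tensors_in W (carrier S). t = ebc f u"
  using t
proof induction
  case zero
  have "ebc f \<zero>\<^bsub>QS\<^esub> = \<zero>\<^bsub>QS\<^esub>" using linear_zero_QS[OF _ module_QS] ebc_closed[OF f] by (simp add: End_carrier)
  then show ?case using tensors_in.zero by metis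
next
  case (add w s t)
  obtain v where v: "v \<in> W" "w = f v" using add by blast
  obtain u where u: "u \<in> tensors_in W (carrier S)" "t = ebc f u" using add by blast
  have uc: "u \<in> carrier QS" using u tensors_in_carrier[OF W order.refl] by blast
  have vc: "v \<in> carrier Q" using v W by blast
  have "ebc f (pt v s \<oplus>\<^bsub>QS\<^esub> u) = pt w s \<oplus>\<^bsub>QS\<^esub> t"
    using End_linear(1)[OF ebc_closed[OF f] pt_QS[OF vc add(2)] uc] ebc_pt[OF f vc add(2)] u v by simp
  then show ?case using tensors_in.add[OF v(1) add(2) u(1)] by metis
qed

lemma tensors_in_smult:
  assumes W: "W \<subseteq> carrier Q" and t: "t \<in> tensors_in W (carrier S)" and r: "r \<in> carrier S"
  shows "r \<odot>\<^bsub>QS\<^esub> t \<in> tensors_in W (carrier S)"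
  using t
proof induction
  case zero then show ?case using r tensors_in.zero by simp
next
  case (add w s t)
  have t: "t \<in> carrier QS" using add(3) tensors_in_carrier[OF W order.refl] by blast
  have w: "w \<in> carrier Q" using add W by blast
  have "r \<odot>\<^bsub>QS\<^esub> (pt w s \<oplus>\<^bsub>QS\<^esub> t) = pt w (r \<otimes>\<^bsub>S\<^esub> s) \<oplus>\<^bsub>QS\<^esub> r \<odot>\<^bsub>QS\<^esub> t"
    using t w r add(2) by (simp add: QSm.smult_r_distr smult_pt)
  then show ?case using tensors_in.add[OF add(1) _ add.IH, of "r \<otimes>\<^bsub>S\<^esub> s"] r add(2) by simp
qed

lemma tensors_in_submodule: "W \<subseteq> carrier Q \<Longrightarrow> submodule (tensors_in W (carrier S)) S QS"
  by (rule QSm.submoduleI_smult)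
    (simp_all add: tensors_in_carrier tensors_in.zero tensors_in_add tensors_in_smult)

end

context stable_pair begin

lemma N_submodule_iff:
  "N_submodule K N Q \<rho> W \<longleftrightarrow> submodule W K Q \<and>
     (\<forall>S n t. algebra K S \<longrightarrow> n \<in> N S \<longrightarrow> t \<in> tin S W (carrier S) \<longrightarrow> \<rho> S n t \<in> tin S W (carrier S))"
proof (cases "submodule W K Q")
  case True
  have eq: "tin S W (carrier S) = sub_incl K Q S ` carrier (base_change K (sub_mod Q W) S)" if "algebra K S" for S
    using vector_extension.tensors_in_eq_image[OF VE[OF that] True] .
  have "(\<forall>n\<in>N S. \<forall>x\<in>carrier (base_change K (sub_mod Q W) S).
      \<rho> S n (sub_incl K Q S x) \<in> sub_incl K Q S ` carrier (base_change K (sub_mod Q W) S)) \<longleftrightarrow>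
    (\<forall>n t. n \<in> N S \<longrightarrow> t \<in> tin S W (carrier S) \<longrightarrow> \<rho> S n t \<in> tin S W (carrier S))" if "algebra K S" for S
    unfolding eq[OF that] by fast
  then show ?thesis using True unfolding N_submodule_def by simp
qed (simp add: N_submodule_def)

lemma N_submoduleD:
  assumes "N_submodule K N Q \<rho> W"
  shows "submodule W K Q" "W \<subseteq> carrier Q"
    "\<And>S n t. algebra K S \<Longrightarrow> n \<in> N S \<Longrightarrow> t \<in> tin S W (carrier S) \<Longrightarrow> \<rho> S n t \<in> tin S W (carrier S)"
proof -
  note a = assms[unfolded N_submodule_iff]
  show "submodule W K Q" using a by simp
  then show "W \<subseteq> carrier Q" using module.submoduleD(1)[OF mQ] by blast
  show "\<And>S n t. algebra K S \<Longrightarrow> n \<in> N S \<Longrightarrow> t \<in> tin S W (carrier S) \<Longrightarrow> \<rho> S n t \<in> tin S W (carrier S)"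
    using a by simp
qed

lemma N_submodule_carrier: "N_submodule K N Q \<rho> (carrier Q)"
  unfolding N_submodule_iff
proof (intro conjI allI impI)
  show "submodule (carrier Q) K Q" by (rule module.carrier_is_submodule[OF mQ])
  fix S n t assume S: "algebra K S" and n: "n \<in> N S" and t: "t \<in> tin S (carrier Q) (carrier S)"
  interpret S: vector_extension K Q S by (rule VE[OF S])
  have tc: "t \<in> carrier S.QS" using t S.tensors_in_carrier[of "carrier Q" "carrier S"] by blast
  show "\<rho> S n t \<in> S.tensors_in (carrier Q) (carrier S)"
    by (rule S.slice_criterion[OF module.carrier_is_submodule[OF mQ] End_closed[OF rho_End[OF S n] tc]])
      (rule S.slice_closed[OF _ End_closed[OF rho_End[OF S n] tc]])
qed

lemma N_submodule_image:
  assumes g: "g \<in> End_N K N Q \<rho>" and W: "N_submodule K N Q \<rho> W"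
  shows "N_submodule K N Q \<rho> (g ` W)"
  unfolding N_submodule_iff
proof (intro conjI allI impI)
  interpret module K Q by (rule mQ)
  note gc = End_ND(1)[OF g] and W' = N_submoduleD[OF W]
  note g' = End_closed[OF gc] End_linear[OF gc]
  note D = submoduleD[OF W'(1)]
  have g0: "g \<zero>\<^bsub>Q\<^esub> = \<zero>\<^bsub>Q\<^esub>" using linear_zero[OF _ mQ mQ] gc by (simp add: End_carrier)
  show "submodule (g ` W) K Q"
  proof (rule submoduleI_smult)
    show "g ` W \<subseteq> carrier Q" using g' W' by auto
    show "\<zero>\<^bsub>Q\<^esub> \<in> g ` W" using g0 D(2) by (metis image_eqI)
    show "a \<oplus>\<^bsub>Q\<^esub> b \<in> g ` W" if ab: "a \<in> g ` W" "b \<in> g ` W" for a b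
    proof -
      obtain u v where "u \<in> W" "v \<in> W" "a = g u" "b = g v" using ab by blast
      then have "a \<oplus>\<^bsub>Q\<^esub> b = g (u \<oplus>\<^bsub>Q\<^esub> v)" "u \<oplus>\<^bsub>Q\<^esub> v \<in> W" using g' D by simp_all
      then show ?thesis by blast
    qed
    show "c \<odot>\<^bsub>Q\<^esub> a \<in> g ` W" if ca: "c \<in> carrier K" "a \<in> g ` W" for c a
    proof -
      obtain u where "u \<in> W" "a = g u" using ca by blast
      then have "c \<odot>\<^bsub>Q\<^esub> a = g (c \<odot>\<^bsub>Q\<^esub> u)" "c \<odot>\<^bsub>Q\<^esub> u \<in> W" using g' D ca by simp_all
      then show ?thesis by blast
    qed
  qed
  fix S n t assume S: "algebra K S" and n: "n \<in> N S" and t: "t \<in> tin S (g ` W) (carrier S)"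
  interpret S: vector_extension K Q S by (rule VE[OF S])
  obtain u where u: "u \<in> S.tensors_in W (carrier S)" "t = S.ebc g u" using S.tensors_in_image[OF gc W'(2) t] by blast
  have uc: "u \<in> carrier S.QS" using u S.tensors_in_carrier[OF W'(2) order.refl] by blast
  have "\<rho> S n t = S.ebc g (\<rho> S n u)" using u(2) End_ND(2)[OF g S n uc] by simp
  then show "\<rho> S n t \<in> S.tensors_in (g ` W) (carrier S)"
    using S.ebc_tensors[OF gc W'(2) W'(3)[OF S n u(1)], of "g ` W"] by simp
qed

text \<open>Membership in a preimage is tested on slices, which are compatible with endomorphisms defined over \<open>K\<close>.\<close>

lemma N_submodule_preimage:
  assumes H: "H \<subseteq> End_N K N Q \<rho>" and W: "N_submodule K N Q \<rho> W" and W': "N_submodule K N Q \<rho> W'"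
  shows "N_submodule K N Q \<rho> {q \<in> W. \<forall>g\<in>H. g q \<in> W'}" (is "N_submodule K N Q \<rho> ?P")
  unfolding N_submodule_iff
proof (intro conjI allI impI)
  interpret module K Q by (rule mQ)
  have gc: "g \<in> carrier (End_alg K Q)" if "g \<in> H" for g using H that End_ND(1) by blast
  note w = N_submoduleD[OF W] and w' = N_submoduleD[OF W']
  note D = submoduleD[OF w(1)] and D' = submoduleD[OF w'(1)]
  show sP: "submodule ?P K Q"
  proof (rule submoduleI_smult)
    have "g \<zero>\<^bsub>Q\<^esub> \<in> W'" if "g \<in> H" for g using linear_zero[OF _ mQ mQ, of g] gc[OF that] D'(2) by (simp add: End_carrier)
    then show "\<zero>\<^bsub>Q\<^esub> \<in> ?P" using D(2) by blast
    show "a \<oplus>\<^bsub>Q\<^esub> b \<in> ?P" if a: "a \<in> ?P" and b: "b \<in> ?P" for a b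
    proof (intro CollectI conjI ballI)
      show "a \<oplus>\<^bsub>Q\<^esub> b \<in> W" using a b D(3) by simp
      fix g assume g: "g \<in> H"
      have "g (a \<oplus>\<^bsub>Q\<^esub> b) = g a \<oplus>\<^bsub>Q\<^esub> g b" using End_linear(1)[OF gc[OF g]] a b D(1) by simp
      then show "g (a \<oplus>\<^bsub>Q\<^esub> b) \<in> W'" using D'(3) a b g by simp
    qed
    show "c \<odot>\<^bsub>Q\<^esub> a \<in> ?P" if c: "c \<in> carrier K" and a: "a \<in> ?P" for c a
    proof (intro CollectI conjI ballI)
      show "c \<odot>\<^bsub>Q\<^esub> a \<in> W" using a c D(4) by simp
      fix g assume g: "g \<in> H"
      have "g (c \<odot>\<^bsub>Q\<^esub> a) = c \<odot>\<^bsub>Q\<^esub> g a" using End_linear(2)[OF gc[OF g] c] a D(1) by simp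
      then show "g (c \<odot>\<^bsub>Q\<^esub> a) \<in> W'" using D'(4) a c g by simp
    qed
  qed (use D(1) in auto)
  fix S n t assume S: "algebra K S" and n: "n \<in> N S" and t: "t \<in> tin S ?P (carrier S)"
  interpret S: vector_extension K Q S by (rule VE[OF S])
  have Pc: "?P \<subseteq> carrier Q" using D(1) by auto
  have tc: "t \<in> carrier S.QS" using t S.tensors_in_carrier[OF Pc order.refl] by blast
  have rc: "\<rho> S n t \<in> carrier S.QS" using End_closed[OF rho_End[OF S n] tc] .
  have tW: "t \<in> S.tensors_in W (carrier S)" using S.tensors_in_mono[OF t, of W "carrier S"] by auto
  show "\<rho> S n t \<in> S.tensors_in ?P (carrier S)"
  proof (rule S.slice_criterion[OF sP rc])
    fix l assume l: "functional K S l"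
    have "g (S.slice l (\<rho> S n t)) \<in> W'" if g: "g \<in> H" for g
    proof -
      have "S.ebc g t \<in> S.tensors_in W' (carrier S)" by (rule S.ebc_tensors[OF gc[OF g] Pc t]) (use g in auto)
      then have "\<rho> S n (S.ebc g t) \<in> S.tensors_in W' (carrier S)" using w'(3)[OF S n] by blast
      then have "S.slice l (\<rho> S n (S.ebc g t)) \<in> W'" by (rule S.slice_in[OF l _ w'(1)])
      then show ?thesis using S.slice_ebc[OF l gc[OF g] rc] End_ND(2)[of g, OF _ S n tc] g H by auto
    qed
    moreover have "S.slice l (\<rho> S n t) \<in> W" using S.slice_in[OF l w(3)[OF S n tW] w(1)] .
    ultimately show "S.slice l (\<rho> S n t) \<in> ?P" by simp
  qed
qed

lemma N_submodule_zero: "N_submodule K N Q \<rho> {\<zero>\<^bsub>Q\<^esub>}"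
  unfolding N_submodule_iff
proof (intro conjI allI impI)
  interpret module K Q by (rule mQ)
  show "submodule {\<zero>\<^bsub>Q\<^esub>} K Q" by (rule submoduleI_smult) auto
  fix S n t assume S: "algebra K S" and n: "n \<in> N S" and t: "t \<in> tin S {\<zero>\<^bsub>Q\<^esub>} (carrier S)"
  interpret S: vector_extension K Q S by (rule VE[OF S])
  have "t = \<zero>\<^bsub>S.QS\<^esub>" using t by induction auto
  moreover have "\<rho> S n \<zero>\<^bsub>S.QS\<^esub> = \<zero>\<^bsub>S.QS\<^esub>" using S.linear_zero_QS[OF _ S.module_QS] rho_End[OF S n] by (simp add: End_carrier)
  ultimately show "\<rho> S n t \<in> S.tensors_in {\<zero>\<^bsub>Q\<^esub>} (carrier S)" using S.tensors_in.zero by simp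
qed

fun J_power :: "nat \<Rightarrow> ('q \<Rightarrow> 'q) set" where
  "J_power 0 = {\<one>\<^bsub>End_alg K Q\<^esub>}"
| "J_power (Suc i) = {f \<otimes>\<^bsub>End_alg K Q\<^esub> p | f p. f \<in> J \<and> p \<in> J_power i}"

lemma End_NI:
  assumes "f \<in> carrier (End_alg K Q)"
    and "\<And>S n x. algebra K S \<Longrightarrow> n \<in> N S \<Longrightarrow> x \<in> carrier (QB S) \<Longrightarrow>
      end_base_change K Q S f (\<rho> S n x) = \<rho> S n (end_base_change K Q S f x)"
  shows "f \<in> End_N K N Q \<rho>"
  using assms unfolding End_N_def by blast

lemma rho_closed: "algebra K S \<Longrightarrow> n \<in> N S \<Longrightarrow> x \<in> carrier (QB S) \<Longrightarrow> \<rho> S n x \<in> carrier (QB S)"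
  by (rule End_closed[OF rho_End])

lemma End_N_one: "\<one>\<^bsub>End_alg K Q\<^esub> \<in> End_N K N Q \<rho>"
proof -
  interpret module K Q by (rule mQ)
  have "end_base_change K Q S \<one>\<^bsub>End_alg K Q\<^esub> x = x" if S: "algebra K S" and x: "x \<in> carrier (QB S)" for S :: "('k, 's) module" and x
  proof -
    interpret S: vector_extension K Q S by (rule VE[OF S])
    have "S.ebc \<one>\<^bsub>S.EQ\<^esub> = \<one>\<^bsub>S.EQS\<^esub>"
      by (rule S.EQS_ext) (simp_all add: S.ebc_closed S.ebc_pt End_apply)
    then show ?thesis using x by (simp add: End_apply)
  qed
  then show ?thesis
    by (intro End_NI End_alg_closed(3)[OF mQ]) (simp only: rho_closed)
qed

lemma End_N_mult:
  assumes f: "f \<in> End_N K N Q \<rho>" and g: "g \<in> End_N K N Q \<rho>"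
  shows "f \<otimes>\<^bsub>End_alg K Q\<^esub> g \<in> End_N K N Q \<rho>"
proof -
  note f' = End_ND[OF f] and g' = End_ND[OF g]
  have c: "f \<otimes>\<^bsub>End_alg K Q\<^esub> g \<in> carrier (End_alg K Q)" using End_alg_closed(1)[OF mQ f'(1) g'(1)] .
  have "end_base_change K Q S (f \<otimes>\<^bsub>End_alg K Q\<^esub> g) x = end_base_change K Q S f (end_base_change K Q S g x)"
    if S: "algebra K S" and x: "x \<in> carrier (QB S)" for S :: "('k, 's) module" and x
  proof -
    interpret S: vector_extension K Q S by (rule VE[OF S])
    have "S.ebc (f \<otimes>\<^bsub>S.EQ\<^esub> g) = S.ebc f \<otimes>\<^bsub>S.EQS\<^esub> S.ebc g"
      by (rule S.EQS_ext) (use f' g' c End_closed[OF g'(1)] in \<open>simp_all add: S.ebc_closed S.ebc_pt End_apply\<close>)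
    then show ?thesis using x by (simp add: End_apply)
  qed
  moreover have "end_base_change K Q S g x \<in> carrier (QB S)" if S: "algebra K S" and x: "x \<in> carrier (QB S)" for S :: "('k, 's) module" and x
  proof -
    interpret S: vector_extension K Q S by (rule VE[OF S])
    show ?thesis using End_closed[OF S.ebc_closed[OF g'(1)] x] .
  qed
  ultimately show ?thesis
    by (intro End_NI[OF c]) (simp only: rho_closed f'(2) g'(2))
qed

lemma J_power_End_N: "p \<in> J_power i \<Longrightarrow> p \<in> End_N K N Q \<rho>"
proof (induction i arbitrary: p)
  case 0 then show ?case using End_N_one by simp
next
  case (Suc i) then show ?case using End_N_mult J_D(1) by auto
qed

lemma J_power_snoc: "p \<in> J_power i \<Longrightarrow> f \<in> J \<Longrightarrow> p \<otimes>\<^bsub>End_alg K Q\<^esub> f \<in> J_power (Suc i)"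
proof (induction i arbitrary: p)
  interpret EQ: ring "End_alg K Q" by (rule ring_End_alg[OF mQ])
  case 0
  then have "p \<otimes>\<^bsub>End_alg K Q\<^esub> f = f \<otimes>\<^bsub>End_alg K Q\<^esub> \<one>\<^bsub>End_alg K Q\<^esub>" using J_carrier by simp
  then show ?case using 0 by auto
next
  interpret EQ: ring "End_alg K Q" by (rule ring_End_alg[OF mQ])
  case (Suc i)
  then obtain g r where p: "p = g \<otimes>\<^bsub>End_alg K Q\<^esub> r" "g \<in> J" "r \<in> J_power i" by auto
  have "p \<otimes>\<^bsub>End_alg K Q\<^esub> f = g \<otimes>\<^bsub>End_alg K Q\<^esub> (r \<otimes>\<^bsub>End_alg K Q\<^esub> f)"
    using p Suc J_carrier End_ND(1)[OF J_power_End_N] by (simp add: EQ.m_assoc)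
  then show ?case using p(2) Suc.IH[OF p(3) Suc.prems(2)] by auto
qed

text \<open>The subspace killed by \<open>J\<^sup>i\<close>, in the form of a preimage of \<open>{\<zero>}\<close> to which \<open>N_submodule_preimage\<close>
  applies.\<close>

definition Kfil :: "nat \<Rightarrow> 'q set" where
  "Kfil i = {q \<in> carrier Q. \<forall>p\<in>J_power i. p q \<in> {\<zero>\<^bsub>Q\<^esub>}}"

lemma Kfil_N: "N_submodule K N Q \<rho> (Kfil i)"
  unfolding Kfil_def by (rule N_submodule_preimage[OF _ N_submodule_carrier N_submodule_zero]) (use J_power_End_N in blast)

lemma Kfil_0: "Kfil 0 = {\<zero>\<^bsub>Q\<^esub>}"
proof -
  interpret module K Q by (rule mQ)
  show ?thesis by (auto simp: Kfil_def End_apply)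
qed

lemma Kfil_J: "f \<in> J \<Longrightarrow> q \<in> Kfil (Suc i) \<Longrightarrow> f q \<in> Kfil i"
  unfolding Kfil_def
proof (intro CollectI conjI ballI)
  assume f: "f \<in> J" and q: "q \<in> {q \<in> carrier Q. \<forall>p\<in>J_power (Suc i). p q \<in> {\<zero>\<^bsub>Q\<^esub>}}"
  show "f q \<in> carrier Q" using q End_closed[OF J_carrier[OF f]] by auto
  fix p assume "p \<in> J_power i"
  then have "(p \<otimes>\<^bsub>End_alg K Q\<^esub> f) q = \<zero>\<^bsub>Q\<^esub>" using q J_power_snoc[OF _ f] by blast
  then show "p (f q) \<in> {\<zero>\<^bsub>Q\<^esub>}" using q by (simp add: End_apply)
qed

text \<open>
  A minimal \<open>N\<close>-submodule \<open>W\<close> above \<open>Kfil i\<close> is contained in \<open>Kfil (Suc i)\<close>: the image of \<open>W\<close> under a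
  product of \<open>i\<close> elements of \<open>J\<close> is \<open>0\<close> or simple, hence contained in the socle, which is killed by \<open>J\<close>.
\<close>

lemma Kfil_strict:
  assumes ne: "Kfil i \<noteq> carrier Q"
  shows "Kfil i \<subset> Kfil (Suc i)"
proof -
  interpret module K Q by (rule mQ)
  obtain d :: "'q set \<Rightarrow> nat" and m where d: "\<And>W W'. submodule W K Q \<Longrightarrow> submodule W' K Q \<Longrightarrow> W \<subset> W' \<Longrightarrow> d W < d W'"
    using subspace_rank[OF field fd] by metis
  let ?P = "\<lambda>W. N_submodule K N Q \<rho> W \<and> Kfil i \<subset> W"
  have "?P (carrier Q)" using N_submodule_carrier ne by (auto simp: Kfil_def)
  then obtain W where W: "?P W" and min: "\<And>W'. ?P W' \<Longrightarrow> d W \<le> d W'"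
    using arg_min_natI[of ?P "carrier Q" d] arg_min_nat_le[of ?P _ d] by blast
  have minimal: "W' = W \<or> W' = Kfil i" if "N_submodule K N Q \<rho> W'" "Kfil i \<subseteq> W'" "W' \<subseteq> W" for W'
    using d[of W' W] min[of W'] that N_submoduleD(1) W by (metis leD psubsetI)
  have Wc: "W \<subseteq> carrier Q" using W N_submoduleD(2) by blast
  have "W \<subseteq> Kfil (Suc i)"
  proof
    fix w assume w: "w \<in> W"
    have "(f \<otimes>\<^bsub>End_alg K Q\<^esub> g) w = \<zero>\<^bsub>Q\<^esub>" if f: "f \<in> J" and g: "g \<in> J_power i" for f g
    proof -
      note gN = J_power_End_N[OF g]
      have gW: "N_submodule K N Q \<rho> (g ` W)" using N_submodule_image[OF gN] W by blast
      have "g w \<in> V"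
      proof (cases "g ` W = {\<zero>\<^bsub>Q\<^esub>}")
        case True
        then have "g w = \<zero>\<^bsub>Q\<^esub>" using w by blast
        then show ?thesis using submoduleD(2)[OF V_sub] by simp
      next
        case False
        have "simple_N_submodule K N Q \<rho> (g ` W)"
          unfolding simple_N_submodule_def
        proof (intro conjI allI impI)
          fix W' assume W': "N_submodule K N Q \<rho> W' \<and> W' \<subseteq> g ` W"
          let ?R = "{q \<in> W. \<forall>g\<in>{g}. g q \<in> W'}"
          have R: "N_submodule K N Q \<rho> ?R" by (rule N_submodule_preimage) (use gN W W' in auto)
          have "Kfil i \<subseteq> ?R"
            using W g submoduleD(2)[OF N_submoduleD(1)] W' by (auto simp: Kfil_def)
          then consider "?R = W" | "?R = Kfil i" using minimal[OF R] by blast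
          then show "W' = {\<zero>\<^bsub>Q\<^esub>} \<or> W' = g ` W"
          proof cases
            case 1 then show ?thesis using W' by blast
          next
            case 2
            have "W' \<subseteq> {\<zero>\<^bsub>Q\<^esub>}"
            proof
              fix u assume u: "u \<in> W'"
              then obtain q where q: "q \<in> W" "u = g q" using W' by blast
              then have "q \<in> Kfil i" using 2 u by blast
              then show "u \<in> {\<zero>\<^bsub>Q\<^esub>}" using q g by (simp add: Kfil_def)
            qed
            then show ?thesis using submoduleD(2)[OF N_submoduleD(1)] W' by blast
          qed
        qed (use gW False in auto)
        then have "g ` W \<subseteq> \<Union>{W. simple_N_submodule K N Q \<rho> W}" by blast
        moreover have "\<Union>{W. simple_N_submodule K N Q \<rho> W} \<subseteq> carrier Q"
          using N_submoduleD(2) unfolding simple_N_submodule_def by blast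
        ultimately have "g ` W \<subseteq> socle K N Q \<rho>"
          unfolding socle_def using mod_span_incl[OF mQ] by blast
        then show ?thesis using soc w by blast
      qed
      then have "f (g w) = \<zero>\<^bsub>Q\<^esub>" using J_D(2)[OF f] by blast
      then show ?thesis using w Wc by (simp add: End_apply subset_iff)
    qed
    then show "w \<in> Kfil (Suc i)" using w Wc by (auto simp: Kfil_def)
  qed
  then show ?thesis using W by blast
qed

lemma Kfil_exhausts: "\<exists>m. Kfil m = carrier Q"
proof (rule ccontr)
  assume "\<nexists>m. Kfil m = carrier Q"
  then have s: "Kfil i \<subset> Kfil (Suc i)" for i using Kfil_strict by blast
  obtain d :: "'q set \<Rightarrow> nat" and m where d: "\<And>W W'. submodule W K Q \<Longrightarrow> submodule W' K Q \<Longrightarrow> W \<subset> W' \<Longrightarrow> d W < d W'"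
    and m: "\<And>W. d W \<le> m"
    using subspace_rank[OF field fd] by metis
  have "i \<le> d (Kfil i)" for i
  proof (induction i)
    case (Suc i) then show ?case using d[OF N_submoduleD(1)[OF Kfil_N] N_submoduleD(1)[OF Kfil_N] s[of i]] by simp
  qed simp
  from this[of "Suc m"] m[of "Kfil (Suc m)"] show False by simp
qed

lemma U_lowers:
  assumes S: "algebra K S" and x: "x \<in> U S"
  obtains j where "j \<in> carrier (E S)" "\<And>z. z \<in> carrier (QB S) \<Longrightarrow> x z = z \<oplus>\<^bsub>QB S\<^esub> j z"
    "\<And>i t. t \<in> tin S (Kfil (Suc i)) (carrier S) \<Longrightarrow> j t \<in> tin S (Kfil i) (carrier S)"
proof -
  interpret S: vector_extension K Q S by (rule VE[OF S])
  obtain j where j: "j \<in> mod_span S (E S) (S.ebc ` J)" and xj: "x = \<one>\<^bsub>E S\<^esub> \<oplus>\<^bsub>E S\<^esub> j"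
    using x unfolding U_pts_def by blast
  have Kc: "Kfil i \<subseteq> carrier Q" for i using N_submoduleD(2)[OF Kfil_N] .
  note T = S.QSm.submoduleD[OF S.tensors_in_submodule[OF Kc]]
  let ?H = "{j \<in> carrier (E S). \<forall>i. \<forall>t\<in>S.tensors_in (Kfil (Suc i)) (carrier S). j t \<in> S.tensors_in (Kfil i) (carrier S)}"
  have "submodule ?H S (E S)"
    by (rule S.EQSm.submoduleI_smult) (auto simp: End_apply T)
  moreover have "S.ebc ` J \<subseteq> ?H"
    using S.ebc_tensors[OF J_carrier Kc _ Kfil_J] S.ebc_closed[OF J_carrier] by auto
  ultimately have "j \<in> ?H" using mod_span_least[of ?H S "E S" "S.ebc ` J"] j by blast
  then show thesis using that[of j] xj by (auto simp: End_apply)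
qed

text \<open>
  Write \<open>x = 1 + j\<close>, where \<open>j\<close> lowers the filtration by one step, and argue by induction along the
  filtration: if \<open>x u = 0\<close>, then \<open>u = -j u\<close> is one step lower; and if \<open>x u = j w\<close>, then \<open>x (w - u) = w\<close>.
\<close>

lemma U_Units:
  assumes S: "algebra K S" and x: "x \<in> U S"
  shows "x \<in> Units (E S)"
proof -
  interpret S: vector_extension K Q S by (rule VE[OF S])
  obtain j where j: "j \<in> carrier (E S)" and xj: "\<And>z. z \<in> carrier S.QS \<Longrightarrow> x z = z \<oplus>\<^bsub>S.QS\<^esub> j z"
    and low: "\<And>i t. t \<in> S.tensors_in (Kfil (Suc i)) (carrier S) \<Longrightarrow> j t \<in> S.tensors_in (Kfil i) (carrier S)"
    using U_lowers[OF S x] by blast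
  have xE: "x \<in> carrier (E S)" using x U_iff[OF S] by blast
  note x' = End_closed[OF xE] End_linear[OF xE] and j' = End_closed[OF j] End_linear[OF j]
  have Kc: "Kfil i \<subseteq> carrier Q" for i using N_submoduleD(2)[OF Kfil_N] .
  note T = S.QSm.submoduleD[OF S.tensors_in_submodule[OF Kc]]
  obtain m where m: "Kfil m = carrier Q" using Kfil_exhausts by blast
  have all: "z \<in> S.tensors_in (Kfil m) (carrier S)" if "z \<in> carrier S.QS" for z
    unfolding m by (rule S.slice_criterion[OF module.carrier_is_submodule[OF mQ] that]) (rule S.slice_closed[OF _ that])
  have ker: "u = \<zero>\<^bsub>S.QS\<^esub>" if "u \<in> S.tensors_in (Kfil i) (carrier S)" "x u = \<zero>\<^bsub>S.QS\<^esub>" for u i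
    using that
  proof (induction i)
    case 0
    have "u \<in> S.tensors_in {\<zero>\<^bsub>Q\<^esub>} (carrier S)" using 0 by (simp add: Kfil_0)
    then show ?case by induction auto
  next
    case (Suc i)
    have u: "u \<in> carrier S.QS" using T(1) Suc.prems(1) .
    have "u \<oplus>\<^bsub>S.QS\<^esub> j u = \<zero>\<^bsub>S.QS\<^esub>" using xj[OF u] Suc.prems(2) by simp
    then have "u = \<ominus>\<^bsub>S.QS\<^esub> j u" using u j'(1) by (simp add: S.QS.minus_equality[symmetric] S.QS.a_comm)
    then have "u \<in> S.tensors_in (Kfil i) (carrier S)" using T(5)[OF low[OF Suc.prems(1)]] by simp
    then show ?case using Suc by blast
  qed
  have im: "\<exists>u\<in>carrier S.QS. x u = w" if "w \<in> S.tensors_in (Kfil i) (carrier S)" for w i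
    using that
  proof (induction i arbitrary: w)
    case 0
    have "w \<in> S.tensors_in {\<zero>\<^bsub>Q\<^esub>} (carrier S)" using 0 by (simp add: Kfil_0)
    then have "w = \<zero>\<^bsub>S.QS\<^esub>" by induction auto
    moreover have "x \<zero>\<^bsub>S.QS\<^esub> = \<zero>\<^bsub>S.QS\<^esub>" using S.linear_zero_QS[OF _ S.module_QS] xE by (simp add: End_carrier)
    ultimately show ?case by (intro bexI[of _ "\<zero>\<^bsub>S.QS\<^esub>"]) auto
  next
    case (Suc i)
    have w: "w \<in> carrier S.QS" using T(1) Suc.prems .
    obtain u where u: "u \<in> carrier S.QS" "x u = j w" using Suc.IH[OF low[OF Suc.prems]] by blast
    have xw: "x w = w \<oplus>\<^bsub>S.QS\<^esub> x u" using xj[OF w] u(2) by simp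
    let ?v = "w \<ominus>\<^bsub>S.QS\<^esub> u"
    have v: "?v \<in> carrier S.QS" using w u by simp
    have "x ?v \<oplus>\<^bsub>S.QS\<^esub> x u = x (?v \<oplus>\<^bsub>S.QS\<^esub> u)" using x'(2)[OF v u(1)] by simp
    also have "?v \<oplus>\<^bsub>S.QS\<^esub> u = w" using w u by (simp add: a_minus_def S.QS.a_assoc S.QS.l_neg)
    finally have "x ?v \<oplus>\<^bsub>S.QS\<^esub> x u = w \<oplus>\<^bsub>S.QS\<^esub> x u" using xw by simp
    then have "x ?v = w" using S.QS.add.right_cancel[OF x'(1)[OF u(1)] x'(1)[OF v] w] by blast
    then show ?case using v by blast
  qed
  have inj: "u = v" if uv: "u \<in> carrier S.QS" "v \<in> carrier S.QS" "x u = x v" for u v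
  proof -
    let ?d = "u \<ominus>\<^bsub>S.QS\<^esub> v"
    have d: "?d \<in> carrier S.QS" using uv by simp
    have dv: "?d \<oplus>\<^bsub>S.QS\<^esub> v = u" using uv by (simp add: a_minus_def S.QS.a_assoc S.QS.l_neg)
    have "x ?d \<oplus>\<^bsub>S.QS\<^esub> x v = \<zero>\<^bsub>S.QS\<^esub> \<oplus>\<^bsub>S.QS\<^esub> x v" using x'(2)[OF d uv(2)] dv uv x'(1) by simp
    then have "x ?d = \<zero>\<^bsub>S.QS\<^esub>" using x'(1)[OF d] x'(1)[OF uv(2)] S.QS.add.right_cancel S.QS.zero_closed by blast
    then have "?d = \<zero>\<^bsub>S.QS\<^esub>" using ker[OF all[OF d]] by blast
    then show ?thesis using dv uv by simp
  qed
  have surj: "\<exists>u\<in>carrier S.QS. x u = w" if "w \<in> carrier S.QS" for w using im[OF all[OF that]] .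
  define y where "y = (\<lambda>w\<in>carrier S.QS. SOME u. u \<in> carrier S.QS \<and> x u = w)"
  have y: "y w \<in> carrier S.QS" "x (y w) = w" if "w \<in> carrier S.QS" for w
    using someI_ex[OF surj[OF that, unfolded Bex_def]] that by (simp_all add: y_def)
  have yE: "y \<in> carrier (E S)"
    unfolding End_carrier
  proof (intro conjI linearI)
    show "y (a \<oplus>\<^bsub>S.QS\<^esub> b) = y a \<oplus>\<^bsub>S.QS\<^esub> y b" if "a \<in> carrier S.QS" "b \<in> carrier S.QS" for a b
      by (rule inj) (use that y x' in simp_all)
    show "y (r \<odot>\<^bsub>S.QS\<^esub> a) = r \<odot>\<^bsub>S.QS\<^esub> y a" if "r \<in> carrier S" "a \<in> carrier S.QS" for r a
      by (rule inj) (use that y x' in simp_all)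
  qed (use y in \<open>simp_all add: y_def\<close>)
  have "x \<otimes>\<^bsub>E S\<^esub> y = \<one>\<^bsub>E S\<^esub>"
    by (rule End_ext[of _ S S.QS]) (use xE yE y in \<open>simp_all add: End_apply\<close>)
  moreover have "y \<otimes>\<^bsub>E S\<^esub> x = \<one>\<^bsub>E S\<^esub>"
    by (rule End_ext[of _ S S.QS]) (use xE yE y x' inj in \<open>simp_all add: End_apply\<close>)
  ultimately show ?thesis unfolding Units_def using xE yE by blast
qed

end

section \<open>Quotient maps\<close>

lemma group_morphismD:
  assumes "group_morphism K G H f"
  shows "scheme_morphism K G H f"
    "\<And>S. algebra K S \<Longrightarrow> f S \<in> hom (pts G S) (pts H S)"
    "\<And>S x y. algebra K S \<Longrightarrow> x \<in> carrier (pts G S) \<Longrightarrow> y \<in> carrier (pts G S) \<Longrightarrow>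
       f S (x \<otimes>\<^bsub>pts G S\<^esub> y) = f S x \<otimes>\<^bsub>pts H S\<^esub> f S y"
  using assms unfolding group_morphism_def by (simp_all add: hom_mult)

lemma group_morphism_one:
  assumes "group_morphism K G H f" "group_functor K G" "group_functor K H" "algebra K S"
  shows "f S \<one>\<^bsub>pts G S\<^esub> = \<one>\<^bsub>pts H S\<^esub>"
  using hom_one[OF group_morphismD(2)[OF assms(1,4)] group_functorD(1)[OF assms(2,4)] group_functorD(1)[OF assms(3,4)]] .

lemma group_morphism_comp:
  assumes f: "group_morphism K G H f" and g: "group_morphism K H L g"
  shows "group_morphism K G L (\<lambda>S x. g S (f S x))"
proof -
  note f' = scheme_morphismD[OF group_morphismD(1)[OF f]] and g' = scheme_morphismD[OF group_morphismD(1)[OF g]]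
  show ?thesis
    unfolding group_morphism_def scheme_morphism_def hom_def
    by (auto simp: f'(1) g'(1) f'(2) g'(2) group_morphismD(3)[OF f] group_morphismD(3)[OF g])
qed

lemma quotient_lift_diff:
  assumes D: "group_functor K D" and \<Gamma>: "group_functor K \<Gamma>" and q: "is_quotient K D M \<Gamma> \<pi>" and S: "algebra K S"
    and d: "d \<in> carrier (pts D S)" and e: "e \<in> carrier (pts D S)" and eq: "\<pi> S d = \<pi> S e"
  shows "inv\<^bsub>pts D S\<^esub> d \<otimes>\<^bsub>pts D S\<^esub> e \<in> M S"
proof -
  have pi: "group_morphism K D \<Gamma> \<pi>" and ker: "kernel (pts D S) (pts \<Gamma> S) (\<pi> S) = M S"
    using q S unfolding is_quotient_def by auto
  interpret h: group_hom "pts D S" "pts \<Gamma> S" "\<pi> S"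
    by (intro group_hom.intro group_hom_axioms.intro group_functorD(1)[OF D S] group_functorD(1)[OF \<Gamma> S] group_morphismD(2)[OF pi S])
  have "inv\<^bsub>pts D S\<^esub> d \<otimes>\<^bsub>pts D S\<^esub> e \<in> kernel (pts D S) (pts \<Gamma> S) (\<pi> S)"
    using d e eq by (simp add: kernel_def)
  then show ?thesis using ker by simp
qed

lemma quotient_kernel:
  assumes q: "is_quotient K D M \<Gamma> \<pi>" and S: "algebra K S" and n: "n \<in> M S"
  shows "n \<in> carrier (pts D S)" "\<pi> S n = \<one>\<^bsub>pts \<Gamma> S\<^esub>"
proof -
  have "kernel (pts D S) (pts \<Gamma> S) (\<pi> S) = M S" using q S unfolding is_quotient_def by auto
  then show "n \<in> carrier (pts D S)" "\<pi> S n = \<one>\<^bsub>pts \<Gamma> S\<^esub>" using n unfolding kernel_def by auto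
qed

text \<open>
  The value of \<open>hb\<close> at \<open>y\<close> is the only point \<open>e\<close> with \<open>h d = e\<close> for all lifts \<open>d\<close> of \<open>y\<close> over \<open>S\<close>-algebras. It
  exists by descent from a universal lift, since \<open>h\<close> agrees on lifts of the same point. By uniqueness
  \<open>hb\<close> is natural, and it is multiplicative because products of lifts are lifts of products.
\<close>

lemma quotient_universal:
  fixes D :: "('k, 's, 'd) kgroup" and \<Gamma> :: "('k, 's, 'g) kgroup" and H :: "('k, 's, 'h) kgroup"
  assumes inf: "infinite (UNIV :: 's set)" and D: "group_functor K D" and \<Gamma>: "group_functor K \<Gamma>"
    and q: "is_quotient K D M \<Gamma> \<pi>"
    and H: "group_functor K H" "represents K H C c" and h: "group_morphism K D H h"
    and hM: "\<And>S n. algebra K S \<Longrightarrow> n \<in> M S \<Longrightarrow> h S n = \<one>\<^bsub>pts H S\<^esub>"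
  obtains hb where "group_morphism K \<Gamma> H hb" "\<And>S d. algebra K S \<Longrightarrow> d \<in> carrier (pts D S) \<Longrightarrow> hb S (\<pi> S d) = h S d"
proof -
  have pi: "group_morphism K D \<Gamma> \<pi>" and ff: "faithfully_flat_morphism K D \<Gamma> \<pi>"
    using q unfolding is_quotient_def by auto
  note pi' = scheme_morphismD[OF group_morphismD(1)[OF pi]] and h' = scheme_morphismD[OF group_morphismD(1)[OF h]]
  note D' = group_functorD[OF D] and \<Gamma>' = group_functorD[OF \<Gamma>] and H' = group_functorD[OF H(1)]
  have same: "h S d = h S e" if S: "algebra K S" and d: "d \<in> carrier (pts D S)" and e: "e \<in> carrier (pts D S)" and eq: "\<pi> S d = \<pi> S e" for S d e
  proof -
    interpret D: group "pts D S" by (rule D'(1)[OF S])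
    interpret H: group "pts H S" by (rule H'(1)[OF S])
    have n: "inv\<^bsub>pts D S\<^esub> d \<otimes>\<^bsub>pts D S\<^esub> e \<in> M S" by (rule quotient_lift_diff[OF D \<Gamma> q S d e eq])
    have "h S e = h S (d \<otimes>\<^bsub>pts D S\<^esub> (inv\<^bsub>pts D S\<^esub> d \<otimes>\<^bsub>pts D S\<^esub> e))" using d e by (simp add: D.m_assoc[symmetric])
    also have "\<dots> = h S d \<otimes>\<^bsub>pts H S\<^esub> h S (inv\<^bsub>pts D S\<^esub> d \<otimes>\<^bsub>pts D S\<^esub> e)" using d e group_morphismD(3)[OF h S] by simp
    also have "\<dots> = h S d" using hM[OF S n] h'(1)[OF S d] by simp
    finally show ?thesis by simp
  qed
  define spec where "spec S y e \<longleftrightarrow> e \<in> carrier (pts H S) \<and> (\<forall>U j d. algebra K U \<longrightarrow> j \<in> alg_hom K S U \<longrightarrow> d \<in> carrier (pts D U) \<longrightarrow>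
     \<pi> U d = res \<Gamma> S U j y \<longrightarrow> h U d = res H S U j e)" for S :: "('k, 's) module" and y e
  have specD: "h U d = res H S U j e" if "spec S y e" "algebra K U" "j \<in> alg_hom K S U" "d \<in> carrier (pts D U)" "\<pi> U d = res \<Gamma> S U j y"
    for S U j d y e using that unfolding spec_def by blast
  have specc: "e \<in> carrier (pts H S)" if "spec S y e" for S y e using that unfolding spec_def by blast
  have ex: "\<exists>e. spec S y e" and un: "\<And>e e'. spec S y e \<Longrightarrow> spec S y e' \<Longrightarrow> e = e'"
    if S: "algebra K S" and y: "y \<in> carrier (pts \<Gamma> S)" for S y
  proof -
    obtain T i g where T: "algebra K T" and i: "i \<in> alg_hom K S T" "inj_on i (carrier S)"
      and g: "g \<in> carrier (pts D T)" "\<pi> T g = res \<Gamma> S T i y"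
      and univ: "\<And>U j d. algebra K U \<Longrightarrow> j \<in> alg_hom K S U \<Longrightarrow> d \<in> carrier (pts D U) \<Longrightarrow> \<pi> U d = res \<Gamma> S U j y \<Longrightarrow>
       \<exists>k\<in>alg_hom K T U. compose (carrier S) k i = j \<and> res D T U k g = d"
      and desc: "\<And>t. t \<in> carrier T \<Longrightarrow> equalized K S T i (\<lambda>U f. f t) \<Longrightarrow> t \<in> i ` carrier S"
      using local_lifting[OF inf D \<Gamma> group_morphismD(1)[OF pi] ff S y] by metis
    have gT: "h T g \<in> carrier (pts H T)" by (rule h'(1)[OF T g(1)])
    have "equalized K S T i (\<lambda>U f. res H T U f (h T g))"
      unfolding equalized_def
    proof (intro allI impI, elim conjE)
      fix U :: "('k, 's) module" and f f'
      assume U: "algebra K U" "f \<in> alg_hom K T U" "f' \<in> alg_hom K T U" and e: "compose (carrier S) f i = compose (carrier S) f' i"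
      have p: "\<pi> U (res D T U f g) = res \<Gamma> S U (compose (carrier S) f i) y" if "f \<in> alg_hom K T U" for f
        using pi'(2)[OF T U(1) that g(1)] g(2) \<Gamma>'(4)[OF S T U(1) i(1) that y] by simp
      have "h U (res D T U f g) = h U (res D T U f' g)"
        by (rule same[OF U(1) D'(5)[OF T U(1,2) g(1)] D'(5)[OF T U(1,3) g(1)]]) (simp add: p[OF U(2)] p[OF U(3)] e)
      then show "res H T U f (h T g) = res H T U f' (h T g)" using h'(2)[OF T U(1,2) g(1)] h'(2)[OF T U(1,3) g(1)] by simp
    qed
    then obtain e where e: "e \<in> carrier (pts H S)" "res H S T i e = h T g"
      using affine_descent[OF H S T i desc gT] by blast
    have "spec S y e"
      unfolding spec_def
    proof (intro conjI allI impI)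
      fix U :: "('k, 's) module" and j d
      assume U: "algebra K U" "j \<in> alg_hom K S U" "d \<in> carrier (pts D U)" "\<pi> U d = res \<Gamma> S U j y"
      obtain k where k: "k \<in> alg_hom K T U" "compose (carrier S) k i = j" "res D T U k g = d" using univ[OF U] by blast
      have "h U d = res H T U k (h T g)" using h'(2)[OF T U(1) k(1) g(1)] k(3) by simp
      also have "\<dots> = res H S U j e" using H'(4)[OF S T U(1) i(1) k(1) e(1)] e(2) k(2) by simp
      finally show "h U d = res H S U j e" .
    qed (rule e(1))
    then show "\<exists>e. spec S y e" by blast
    show "e = e'" if "spec S y e" "spec S y e'" for e e'
      by (rule affine_res_inj[OF H S T i specc[OF that(1)] specc[OF that(2)]])
        (use specD[OF that(1) T i(1) g] specD[OF that(2) T i(1) g] in simp)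
  qed
  define hb where "hb S y = (SOME e. spec S y e)" for S y
  have hb: "spec S y (hb S y)" if "algebra K S" "y \<in> carrier (pts \<Gamma> S)" for S y
    unfolding hb_def by (rule someI_ex[OF ex[OF that]])
  have hb_eq: "hb S (\<pi> S d) = h S d" if S: "algebra K S" and d: "d \<in> carrier (pts D S)" for S d
  proof -
    have "h S d = res H S S (\<lambda>x\<in>carrier S. x) (hb S (\<pi> S d))"
      by (rule specD[OF hb[OF S pi'(1)[OF S d]] S alg_hom_id[OF S] d]) (rule \<Gamma>'(3)[OF S pi'(1)[OF S d], symmetric])
    also have "\<dots> = hb S (\<pi> S d)" by (rule H'(3)[OF S specc[OF hb[OF S pi'(1)[OF S d]]]])
    finally show ?thesis by simp
  qed
  have nat: "hb T (res \<Gamma> S T \<phi> y) = res H S T \<phi> (hb S y)" if S: "algebra K S" and T: "algebra K T" and phi: "\<phi> \<in> alg_hom K S T" and y: "y \<in> carrier (pts \<Gamma> S)" for S T \<phi> y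
  proof (rule un[OF T \<Gamma>'(5)[OF S T phi y] hb[OF T \<Gamma>'(5)[OF S T phi y]]])
    have c: "hb S y \<in> carrier (pts H S)" by (rule specc[OF hb[OF S y]])
    show "spec T (res \<Gamma> S T \<phi> y) (res H S T \<phi> (hb S y))"
      unfolding spec_def
    proof (intro conjI allI impI)
      show "res H S T \<phi> (hb S y) \<in> carrier (pts H T)" by (rule H'(5)[OF S T phi c])
      fix U :: "('k, 's) module" and j d
      assume U: "algebra K U" "j \<in> alg_hom K T U" "d \<in> carrier (pts D U)" "\<pi> U d = res \<Gamma> T U j (res \<Gamma> S T \<phi> y)"
      have "h U d = res H S U (compose (carrier S) j \<phi>) (hb S y)"
        by (rule specD[OF hb[OF S y] U(1) alg_hom_comp[OF phi U(2) S] U(3)])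
          (simp add: U(4) \<Gamma>'(4)[OF S T U(1) phi U(2) y])
      then show "h U d = res H T U j (res H S T \<phi> (hb S y))" using H'(4)[OF S T U(1) phi U(2) c] by simp
    qed
  qed
  have mult: "hb S (y \<otimes>\<^bsub>pts \<Gamma> S\<^esub> z) = hb S y \<otimes>\<^bsub>pts H S\<^esub> hb S z"
    if S: "algebra K S" and y: "y \<in> carrier (pts \<Gamma> S)" and z: "z \<in> carrier (pts \<Gamma> S)" for S y z
  proof -
    interpret GS: group "pts \<Gamma> S" by (rule \<Gamma>'(1)[OF S])
    interpret HS: group "pts H S" by (rule H'(1)[OF S])
    obtain T i d where T: "algebra K T" and i: "i \<in> alg_hom K S T" "inj_on i (carrier S)"
      and d: "d \<in> carrier (pts D T)" "\<pi> T d = res \<Gamma> S T i y"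
      using local_lifting[OF inf D \<Gamma> group_morphismD(1)[OF pi] ff S y] by metis
    obtain U j e where U: "algebra K U" and j: "j \<in> alg_hom K T U" "inj_on j (carrier T)"
      and e: "e \<in> carrier (pts D U)" "\<pi> U e = res \<Gamma> T U j (res \<Gamma> S T i z)"
      using local_lifting[OF inf D \<Gamma> group_morphismD(1)[OF pi] ff T \<Gamma>'(5)[OF S T i(1) z]] by metis
    let ?k = "compose (carrier S) j i"
    have k: "?k \<in> alg_hom K S U" by (rule alg_hom_comp[OF i(1) j(1) S])
    have kinj: "inj_on ?k (carrier S)"
      using i(2) j(2) alg_homD(2)[OF i(1)] by (auto simp: inj_on_def compose_eq)
    interpret DU: group "pts D U" by (rule D'(1)[OF U])
    let ?d = "res D T U j d"
    have dU: "?d \<in> carrier (pts D U)" by (rule D'(5)[OF T U j(1) d(1)])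
    have pd: "\<pi> U ?d = res \<Gamma> S U ?k y"
      using pi'(2)[OF T U j(1) d(1)] d(2) \<Gamma>'(4)[OF S T U i(1) j(1) y] by simp
    have pe: "\<pi> U e = res \<Gamma> S U ?k z" using e(2) \<Gamma>'(4)[OF S T U i(1) j(1) z] by simp
    have pde: "\<pi> U (?d \<otimes>\<^bsub>pts D U\<^esub> e) = res \<Gamma> S U ?k (y \<otimes>\<^bsub>pts \<Gamma> S\<^esub> z)"
      using group_morphismD(3)[OF pi U dU e(1)] pd pe hom_mult[OF \<Gamma>'(2)[OF S U k] y z] by simp
    have yz: "y \<otimes>\<^bsub>pts \<Gamma> S\<^esub> z \<in> carrier (pts \<Gamma> S)" using y z by simp
    note c = specc[OF hb[OF S y]] specc[OF hb[OF S z]]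
    have "res H S U ?k (hb S (y \<otimes>\<^bsub>pts \<Gamma> S\<^esub> z)) = h U (?d \<otimes>\<^bsub>pts D U\<^esub> e)"
      using specD[OF hb[OF S yz] U k _ pde] dU e(1) by simp
    also have "\<dots> = res H S U ?k (hb S y) \<otimes>\<^bsub>pts H U\<^esub> res H S U ?k (hb S z)"
      using group_morphismD(3)[OF h U dU e(1)] specD[OF hb[OF S y] U k dU pd] specD[OF hb[OF S z] U k e(1) pe] by simp
    also have "\<dots> = res H S U ?k (hb S y \<otimes>\<^bsub>pts H S\<^esub> hb S z)"
      using hom_mult[OF H'(2)[OF S U k] c] by simp
    finally show ?thesis
      by (rule affine_res_inj[OF H S U k kinj specc[OF hb[OF S yz]], rotated]) (use c in simp)
  qed
  have "group_morphism K \<Gamma> H hb"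
    unfolding group_morphism_def scheme_morphism_def hom_def
  proof (intro conjI allI impI ballI CollectI Pi_I)
    fix S :: "('k, 's) module" and y z assume S: "algebra K S" and y: "y \<in> carrier (pts \<Gamma> S)"
    show "hb S y \<in> carrier (pts H S)" "hb S y \<in> carrier (pts H S)" by (rule specc[OF hb[OF S y]])+
    assume "z \<in> carrier (pts \<Gamma> S)"
    then show "hb S (y \<otimes>\<^bsub>pts \<Gamma> S\<^esub> z) = hb S y \<otimes>\<^bsub>pts H S\<^esub> hb S z" by (rule mult[OF S y])
  qed (elim conjE, rule nat)
  then show thesis using that hb_eq by blast
qed

text \<open>Both sides may be compared after restriction to an algebra over which \<open>y\<close> has a lift.\<close>

lemma quotient_epi:
  fixes D :: "('k, 's, 'd) kgroup" and \<Gamma> :: "('k, 's, 'g) kgroup" and H :: "('k, 's, 'h) kgroup"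
  assumes inf: "infinite (UNIV :: 's set)" and D: "group_functor K D" and \<Gamma>: "group_functor K \<Gamma>"
    and q: "is_quotient K D M \<Gamma> \<pi>"
    and H: "group_functor K H" "represents K H C c" and a: "scheme_morphism K \<Gamma> H a" and b: "scheme_morphism K \<Gamma> H b"
    and eq: "\<And>S d. algebra K S \<Longrightarrow> d \<in> carrier (pts D S) \<Longrightarrow> a S (\<pi> S d) = b S (\<pi> S d)"
    and S: "algebra K S" and y: "y \<in> carrier (pts \<Gamma> S)"
  shows "a S y = b S y"
proof -
  have pi: "group_morphism K D \<Gamma> \<pi>" and ff: "faithfully_flat_morphism K D \<Gamma> \<pi>"
    using q unfolding is_quotient_def by auto
  obtain T i d where T: "algebra K T" and i: "i \<in> alg_hom K S T" "inj_on i (carrier S)"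
    and d: "d \<in> carrier (pts D T)" "\<pi> T d = res \<Gamma> S T i y"
    using local_lifting[OF inf D \<Gamma> group_morphismD(1)[OF pi] ff S y] by metis
  show ?thesis
    by (rule affine_res_inj[OF H S T i scheme_morphismD(1)[OF a S y] scheme_morphismD(1)[OF b S y]])
      (use scheme_morphismD(2)[OF a S T i(1) y] scheme_morphismD(2)[OF b S T i(1) y] eq[OF T d(1)] d(2) in simp)
qed

section \<open>The extension \<open>G\<^sup>\<diamond>\<close>\<close>

lemma (in group) conj_swap:
  assumes "y \<otimes> a = b \<otimes> y" "y \<in> carrier G" "a \<in> carrier G" "b \<in> carrier G"
  shows "a \<otimes> inv y = inv y \<otimes> b"
proof -
  have "b = (b \<otimes> y) \<otimes> inv y" using assms(2-4) by (simp add: m_assoc)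
  also have "\<dots> = y \<otimes> (a \<otimes> inv y)" using assms by (simp add: assms(1)[symmetric] m_assoc)
  finally have "inv y \<otimes> b = inv y \<otimes> (y \<otimes> (a \<otimes> inv y))" by simp
  then show ?thesis using assms(2-4) by (simp add: m_assoc[symmetric])
qed

context stable_pair begin

abbreviation "W S \<equiv> pts (GL K Q) S"

lemma W_eq: "W S = units_of (E S)" by (simp add: GL_def)

lemma group_W: "algebra K S \<Longrightarrow> group (W S)"
  using monoid.units_group[OF ring.is_monoid[OF ring_E]] by (simp add: W_eq)

lemma W_End: "y \<in> carrier (W S) \<Longrightarrow> y \<in> carrier (E S)"
  by (simp add: GL_simps Units_def)

lemma W_res:
  assumes "algebra K S" "algebra K T" "\<phi> \<in> alg_hom K S T"
  shows "rs S T \<phi> \<in> hom (W S) (W T)"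
proof -
  interpret h: extension_hom K Q S T \<phi> using EH[OF assms] .
  show ?thesis unfolding hom_def
    using h.res_Units h.res_mult by (auto simp: GL_simps Units_def)
qed

lemma W_apply: "x \<in> carrier (QB S) \<Longrightarrow> (y \<otimes>\<^bsub>W S\<^esub> z) x = y (z x)"
  by (simp add: GL_simps End_apply)

lemma W_one_apply: "x \<in> carrier (QB S) \<Longrightarrow> \<one>\<^bsub>W S\<^esub> x = x"
  by (simp add: GL_simps End_apply)

lemma W_inv_apply: "algebra K S \<Longrightarrow> y \<in> carrier (W S) \<Longrightarrow> x \<in> carrier (QB S) \<Longrightarrow> (inv\<^bsub>W S\<^esub> y) (y x) = x"
  using W_apply[of x S "inv\<^bsub>W S\<^esub> y" y] group.l_inv[OF group_W] W_one_apply by metis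

abbreviation "incl S \<equiv> sub_incl K Q S"
abbreviation "VB S \<equiv> base_change K (sub_mod Q V) S"

lemma incl_closed: "algebra K S \<Longrightarrow> v \<in> carrier (VB S) \<Longrightarrow> incl S v \<in> carrier (QB S)"
proof -
  assume S: "algebra K S" and v: "v \<in> carrier (VB S)"
  interpret S: vector_extension K Q S by (rule VE[OF S])
  have "incl S v \<in> S.tensors_in V (carrier S)" using v S.tensors_in_eq_image[OF V_sub] by blast
  then show ?thesis using S.tensors_in_carrier[of V "carrier S"] V_carrier by blast
qed

lemma sigma_hom: "algebra K S \<Longrightarrow> \<sigma> S \<in> hom (pts G S) (pts (GL K (sub_mod Q V)) S)"
  using V unfolding G_submodule_def by (intro group_morphismD(2)) auto

lemma sigma_closed: "algebra K S \<Longrightarrow> g \<in> carrier (pts G S) \<Longrightarrow> v \<in> carrier (VB S) \<Longrightarrow> \<sigma> S g v \<in> carrier (VB S)"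
  using hom_in_carrier[OF sigma_hom, of S g] by (auto simp: GL_simps Units_def intro: End_closed)

lemma sigma_mult: "algebra K S \<Longrightarrow> g \<in> carrier (pts G S) \<Longrightarrow> h \<in> carrier (pts G S) \<Longrightarrow> v \<in> carrier (VB S) \<Longrightarrow>
   \<sigma> S (g \<otimes>\<^bsub>pts G S\<^esub> h) v = \<sigma> S g (\<sigma> S h v)"
  using hom_mult[OF sigma_hom, of S g h] by (simp add: GL_simps End_apply)

lemma sigma_one:
  assumes "algebra K S" "v \<in> carrier (VB S)" shows "\<sigma> S \<one>\<^bsub>pts G S\<^esub> v = v"
proof -
  have mV: "module K (sub_mod Q V)" using submodule.submodule_is_module[OF V_sub mQ] .
  interpret S: vector_extension K "sub_mod Q V" S
    by (intro vector_extension.intro scalar_extension.intro mV assms(1) field)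
  have "group (pts (GL K (sub_mod Q V)) S)"
    using monoid.units_group[OF ring.is_monoid[OF ring_End_alg[OF S.module_QS]]] by (simp add: GL_def)
  then have "\<sigma> S \<one>\<^bsub>pts G S\<^esub> = \<one>\<^bsub>pts (GL K (sub_mod Q V)) S\<^esub>"
    using hom_one[OF sigma_hom[OF assms(1)] group_functorD(1)[OF G assms(1)]] by blast
  then show ?thesis using assms(2) by (simp add: GL_simps End_apply)
qed

text \<open>
  An automorphism \<open>y\<close> of \<open>Q \<otimes> S\<close> lies over \<open>g \<in> G(S)\<close> if it intertwines the
  \<open>N\<close>-action with its conjugate by \<open>g\<close> and agrees with \<open>g\<close> on \<open>V\<close>. The pairs \<open>(y, g)\<close> form a group, in
  which \<open>U\<close> is the fibre over \<open>1\<close> and \<open>\<alpha>\<close> is a section; \<open>G\<^sup>\<diamond>\<close> is this group in other coordinates.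
\<close>

definition lies_over :: "('k, 's) module \<Rightarrow> 'g \<Rightarrow> (('q, 's) tens \<Rightarrow> ('q, 's) tens) \<Rightarrow> bool" where
  "lies_over S g y \<longleftrightarrow> y \<in> carrier (W S) \<and>
    (\<forall>T \<phi> n. algebra K T \<longrightarrow> \<phi> \<in> alg_hom K S T \<longrightarrow> n \<in> N T \<longrightarrow>
       rs S T \<phi> y \<otimes>\<^bsub>W T\<^esub> \<rho> T n =
       \<rho> T (res G S T \<phi> g \<otimes>\<^bsub>pts G T\<^esub> n \<otimes>\<^bsub>pts G T\<^esub> inv\<^bsub>pts G T\<^esub> (res G S T \<phi> g)) \<otimes>\<^bsub>W T\<^esub> rs S T \<phi> y) \<and>
    (\<forall>v\<in>carrier (VB S). y (incl S v) = incl S (\<sigma> S g v))"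

lemma lies_overD:
  assumes "lies_over S g y"
  shows "y \<in> carrier (W S)"
    "\<And>T \<phi> n. algebra K T \<Longrightarrow> \<phi> \<in> alg_hom K S T \<Longrightarrow> n \<in> N T \<Longrightarrow>
       rs S T \<phi> y \<otimes>\<^bsub>W T\<^esub> \<rho> T n =
       \<rho> T (res G S T \<phi> g \<otimes>\<^bsub>pts G T\<^esub> n \<otimes>\<^bsub>pts G T\<^esub> inv\<^bsub>pts G T\<^esub> (res G S T \<phi> g)) \<otimes>\<^bsub>W T\<^esub> rs S T \<phi> y"
    "\<And>v. v \<in> carrier (VB S) \<Longrightarrow> y (incl S v) = incl S (\<sigma> S g v)"
  using assms unfolding lies_over_def by blast+

lemma conj_N: "algebra K T \<Longrightarrow> g \<in> carrier (pts G T) \<Longrightarrow> n \<in> N T \<Longrightarrow> g \<otimes>\<^bsub>pts G T\<^esub> n \<otimes>\<^bsub>pts G T\<^esub> inv\<^bsub>pts G T\<^esub> g \<in> N T"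
  using normal.inv_op_closed2[OF N_normal] by blast

lemma rho_W: "algebra K S \<Longrightarrow> n \<in> N S \<Longrightarrow> \<rho> S n \<in> carrier (W S)"
  using rho_Units by (simp add: GL_simps)

lemma lies_over_mult:
  assumes S: "algebra K S" and g: "g \<in> carrier (pts G S)" and h: "h \<in> carrier (pts G S)"
    and y: "lies_over S g y" and z: "lies_over S h z"
  shows "lies_over S (g \<otimes>\<^bsub>pts G S\<^esub> h) (y \<otimes>\<^bsub>W S\<^esub> z)"
  unfolding lies_over_def
proof (intro conjI allI impI ballI)
  note y' = lies_overD[OF y] and z' = lies_overD[OF z]
  show "y \<otimes>\<^bsub>W S\<^esub> z \<in> carrier (W S)" using group.subgroup_self[OF group_W[OF S]] y' z' subgroup.m_closed by fastforce
  show "(y \<otimes>\<^bsub>W S\<^esub> z) (incl S v) = incl S (\<sigma> S (g \<otimes>\<^bsub>pts G S\<^esub> h) v)" if v: "v \<in> carrier (VB S)" for v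
    using v y'(3) z'(3) sigma_closed[OF S h v] incl_closed[OF S v] by (simp add: W_apply sigma_mult[OF S g h])
  fix T \<phi> n assume T: "algebra K T" and phi: "\<phi> \<in> alg_hom K S T" and n: "n \<in> N T"
  interpret WT: group "W T" by (rule group_W[OF T])
  interpret GT: group "pts G T" by (rule group_functorD(1)[OF G T])
  let ?g = "res G S T \<phi> g" and ?h = "res G S T \<phi> h" and ?y = "rs S T \<phi> y" and ?z = "rs S T \<phi> z"
  have c: "?g \<in> carrier (pts G T)" "?h \<in> carrier (pts G T)" "?y \<in> carrier (W T)" "?z \<in> carrier (W T)"
    using group_functorD(5)[OF G S T phi] g h hom_in_carrier[OF W_res[OF S T phi]] y' z' by auto
  have nc: "n \<in> carrier (pts G T)" using N_sub[OF T n] .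
  let ?n = "?h \<otimes>\<^bsub>pts G T\<^esub> n \<otimes>\<^bsub>pts G T\<^esub> inv\<^bsub>pts G T\<^esub> ?h"
  have n': "?n \<in> N T" by (rule conj_N[OF T c(2) n])
  have gn: "?g \<otimes>\<^bsub>pts G T\<^esub> ?n \<otimes>\<^bsub>pts G T\<^esub> inv\<^bsub>pts G T\<^esub> ?g = (?g \<otimes>\<^bsub>pts G T\<^esub> ?h) \<otimes>\<^bsub>pts G T\<^esub> n \<otimes>\<^bsub>pts G T\<^esub> inv\<^bsub>pts G T\<^esub> (?g \<otimes>\<^bsub>pts G T\<^esub> ?h)"
    using c nc by (simp add: GT.m_assoc GT.inv_mult_group)
  have r: "\<rho> T n \<in> carrier (W T)" "\<rho> T ?n \<in> carrier (W T)" "\<rho> T (?g \<otimes>\<^bsub>pts G T\<^esub> ?n \<otimes>\<^bsub>pts G T\<^esub> inv\<^bsub>pts G T\<^esub> ?g) \<in> carrier (W T)"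
    using rho_W[OF T] n n' conj_N[OF T c(1) n'] by auto
  have "(?y \<otimes>\<^bsub>W T\<^esub> ?z) \<otimes>\<^bsub>W T\<^esub> \<rho> T n = ?y \<otimes>\<^bsub>W T\<^esub> (\<rho> T ?n \<otimes>\<^bsub>W T\<^esub> ?z)"
    using z'(2)[OF T phi n] c r by (simp add: WT.m_assoc)
  also have "\<dots> = \<rho> T (?g \<otimes>\<^bsub>pts G T\<^esub> ?n \<otimes>\<^bsub>pts G T\<^esub> inv\<^bsub>pts G T\<^esub> ?g) \<otimes>\<^bsub>W T\<^esub> (?y \<otimes>\<^bsub>W T\<^esub> ?z)"
    using y'(2)[OF T phi n'] c r by (simp add: WT.m_assoc[symmetric])
  finally show "rs S T \<phi> (y \<otimes>\<^bsub>W S\<^esub> z) \<otimes>\<^bsub>W T\<^esub> \<rho> T n =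
     \<rho> T (res G S T \<phi> (g \<otimes>\<^bsub>pts G S\<^esub> h) \<otimes>\<^bsub>pts G T\<^esub> n \<otimes>\<^bsub>pts G T\<^esub> inv\<^bsub>pts G T\<^esub> (res G S T \<phi> (g \<otimes>\<^bsub>pts G S\<^esub> h))) \<otimes>\<^bsub>W T\<^esub> rs S T \<phi> (y \<otimes>\<^bsub>W S\<^esub> z)"
    unfolding gn hom_mult[OF W_res[OF S T phi] y'(1) z'(1)] hom_mult[OF group_functorD(2)[OF G S T phi] g h] .
qed

lemma lies_over_inv:
  assumes S: "algebra K S" and g: "g \<in> carrier (pts G S)" and y: "lies_over S g y"
  shows "lies_over S (inv\<^bsub>pts G S\<^esub> g) (inv\<^bsub>W S\<^esub> y)"
  unfolding lies_over_def
proof (intro conjI allI impI ballI)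
  note y' = lies_overD[OF y]
  interpret WS: group "W S" by (rule group_W[OF S])
  interpret GS: group "pts G S" by (rule group_functorD(1)[OF G S])
  show "inv\<^bsub>W S\<^esub> y \<in> carrier (W S)" using y' by simp
  show "(inv\<^bsub>W S\<^esub> y) (incl S v) = incl S (\<sigma> S (inv\<^bsub>pts G S\<^esub> g) v)" if v: "v \<in> carrier (VB S)" for v
  proof -
    have gi: "inv\<^bsub>pts G S\<^esub> g \<in> carrier (pts G S)" using g by simp
    have s: "\<sigma> S (inv\<^bsub>pts G S\<^esub> g) v \<in> carrier (VB S)" by (rule sigma_closed[OF S gi v])
    have "\<sigma> S g (\<sigma> S (inv\<^bsub>pts G S\<^esub> g) v) = v" using sigma_mult[OF S g gi v] sigma_one[OF S v] g by simp
    then have "y (incl S (\<sigma> S (inv\<^bsub>pts G S\<^esub> g) v)) = incl S v" using y'(3)[OF s] by simp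
    then show ?thesis using W_inv_apply[OF S y'(1) incl_closed[OF S s]] by simp
  qed
  fix T \<phi> n assume T: "algebra K T" and phi: "\<phi> \<in> alg_hom K S T" and n: "n \<in> N T"
  interpret WT: group "W T" by (rule group_W[OF T])
  interpret GT: group "pts G T" by (rule group_functorD(1)[OF G T])
  interpret r: group_hom "W S" "W T" "rs S T \<phi>"
    by (intro group_hom.intro group_hom_axioms.intro W_res[OF S T phi]) unfold_locales
  interpret rg: group_hom "pts G S" "pts G T" "res G S T \<phi>"
    by (intro group_hom.intro group_hom_axioms.intro group_functorD(2)[OF G S T phi]) unfold_locales
  let ?g = "res G S T \<phi> g" and ?y = "rs S T \<phi> y"
  have c: "?g \<in> carrier (pts G T)" "?y \<in> carrier (W T)" using g y' by auto
  have nc: "n \<in> carrier (pts G T)" using N_sub[OF T n] .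
  let ?n = "inv\<^bsub>pts G T\<^esub> ?g \<otimes>\<^bsub>pts G T\<^esub> n \<otimes>\<^bsub>pts G T\<^esub> inv\<^bsub>pts G T\<^esub> (inv\<^bsub>pts G T\<^esub> ?g)"
  have n': "?n \<in> N T" using conj_N[OF T _ n, of "inv\<^bsub>pts G T\<^esub> ?g"] c by simp
  have gn: "?g \<otimes>\<^bsub>pts G T\<^esub> ?n \<otimes>\<^bsub>pts G T\<^esub> inv\<^bsub>pts G T\<^esub> ?g = n"
  proof -
    have "?g \<otimes>\<^bsub>pts G T\<^esub> (inv\<^bsub>pts G T\<^esub> ?g \<otimes>\<^bsub>pts G T\<^esub> n \<otimes>\<^bsub>pts G T\<^esub> ?g) \<otimes>\<^bsub>pts G T\<^esub> inv\<^bsub>pts G T\<^esub> ?g = 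
      (?g \<otimes>\<^bsub>pts G T\<^esub> inv\<^bsub>pts G T\<^esub> ?g) \<otimes>\<^bsub>pts G T\<^esub> n \<otimes>\<^bsub>pts G T\<^esub> (?g \<otimes>\<^bsub>pts G T\<^esub> inv\<^bsub>pts G T\<^esub> ?g)"
      using c nc by (simp only: GT.m_assoc GT.inv_closed GT.m_closed)
    then show ?thesis using c nc by simp
  qed
  have r: "\<rho> T n \<in> carrier (W T)" "\<rho> T ?n \<in> carrier (W T)" using rho_W[OF T] n n' by auto
  have "?y \<otimes>\<^bsub>W T\<^esub> \<rho> T ?n = \<rho> T n \<otimes>\<^bsub>W T\<^esub> ?y" using y'(2)[OF T phi n'] gn by simp
  then have "\<rho> T ?n \<otimes>\<^bsub>W T\<^esub> inv\<^bsub>W T\<^esub> ?y = inv\<^bsub>W T\<^esub> ?y \<otimes>\<^bsub>W T\<^esub> \<rho> T n"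
    by (rule WT.conj_swap) (use c r in auto)
  then show "rs S T \<phi> (inv\<^bsub>W S\<^esub> y) \<otimes>\<^bsub>W T\<^esub> \<rho> T n =
     \<rho> T (res G S T \<phi> (inv\<^bsub>pts G S\<^esub> g) \<otimes>\<^bsub>pts G T\<^esub> n \<otimes>\<^bsub>pts G T\<^esub> inv\<^bsub>pts G T\<^esub> (res G S T \<phi> (inv\<^bsub>pts G S\<^esub> g))) \<otimes>\<^bsub>W T\<^esub> rs S T \<phi> (inv\<^bsub>W S\<^esub> y)"
    using g y' by simp
qed

lemma pure_tensor_incl:
  assumes T: "algebra K T" and v: "v \<in> V"
  shows "pure_tensor K Q T v \<one>\<^bsub>T\<^esub> = incl T (pure_tensor K (sub_mod Q V) T v \<one>\<^bsub>T\<^esub>)"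
    "pure_tensor K (sub_mod Q V) T v \<one>\<^bsub>T\<^esub> \<in> carrier (VB T)"
proof -
  interpret T: algebra K T by fact
  have mV: "module K (sub_mod Q V)" using submodule.submodule_is_module[OF V_sub mQ] .
  interpret T: vector_extension K "sub_mod Q V" T
    by (intro vector_extension.intro scalar_extension.intro mV T field)
  have lin: "linear K (sub_mod Q V) Q id" "linear K T T id"
    by (auto intro!: linearI simp: V_carrier)
  show "pure_tensor K Q T v \<one>\<^bsub>T\<^esub> = incl T (pure_tensor K (sub_mod Q V) T v \<one>\<^bsub>T\<^esub>)"
    using tensor_map_base_change(4)[OF mV T mQ T lin, of v "\<one>\<^bsub>T\<^esub>"] v by simp
  show "pure_tensor K (sub_mod Q V) T v \<one>\<^bsub>T\<^esub> \<in> carrier (VB T)" using v by simp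
qed

text \<open>Over \<open>1\<close> the conditions become those of \<open>U_iff\<close>, together with invertibility, which is automatic by
  \<open>U_Units\<close>.\<close>

lemma lies_over_one_iff:
  assumes S: "algebra K S"
  shows "lies_over S \<one>\<^bsub>pts G S\<^esub> x \<longleftrightarrow> x \<in> U S"
proof -
  interpret S: vector_extension K Q S by (rule VE[OF S])
  have conj1: "res G S T \<phi> \<one>\<^bsub>pts G S\<^esub> \<otimes>\<^bsub>pts G T\<^esub> n \<otimes>\<^bsub>pts G T\<^esub> inv\<^bsub>pts G T\<^esub> (res G S T \<phi> \<one>\<^bsub>pts G S\<^esub>) = n"
    if T: "algebra K T" "\<phi> \<in> alg_hom K S T" "n \<in> N T" for T \<phi> n
  proof -
    interpret GT: group "pts G T" by (rule group_functorD(1)[OF G T(1)])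
    have "res G S T \<phi> \<one>\<^bsub>pts G S\<^esub> = \<one>\<^bsub>pts G T\<^esub>"
      using hom_one[OF group_functorD(2)[OF G S T(1,2)] group_functorD(1)[OF G S] GT.is_group] .
    then show ?thesis using N_sub[OF T(1,3)] by simp
  qed
  have com: "commutes S x \<longleftrightarrow> (\<forall>T \<phi> n. algebra K T \<longrightarrow> \<phi> \<in> alg_hom K S T \<longrightarrow> n \<in> N T \<longrightarrow>
       rs S T \<phi> x \<otimes>\<^bsub>W T\<^esub> \<rho> T n =
       \<rho> T (res G S T \<phi> \<one>\<^bsub>pts G S\<^esub> \<otimes>\<^bsub>pts G T\<^esub> n \<otimes>\<^bsub>pts G T\<^esub> inv\<^bsub>pts G T\<^esub> (res G S T \<phi> \<one>\<^bsub>pts G S\<^esub>)) \<otimes>\<^bsub>W T\<^esub> rs S T \<phi> x)"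
    unfolding commutes_def by (simp add: conj1 GL_simps)
  have fixV: "(\<forall>v\<in>carrier (VB S). x (incl S v) = incl S (\<sigma> S \<one>\<^bsub>pts G S\<^esub> v)) \<longleftrightarrow> fixes_V S x" if xE: "x \<in> carrier (E S)"
  proof
    assume a: "\<forall>v\<in>carrier (VB S). x (incl S v) = incl S (\<sigma> S \<one>\<^bsub>pts G S\<^esub> v)"
    show "fixes_V S x" unfolding fixes_V_def
      using a pure_tensor_incl[OF S] sigma_one[OF S] by metis
  next
    assume f: "fixes_V S x"
    have "x (incl S v) = incl S v" if v: "v \<in> carrier (VB S)" for v
      by (rule fixes_V_tensors[OF S xE f]) (use v S.tensors_in_eq_image[OF V_sub] in blast)
    then show "\<forall>v\<in>carrier (VB S). x (incl S v) = incl S (\<sigma> S \<one>\<^bsub>pts G S\<^esub> v)" using sigma_one[OF S] by simp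
  qed
  show ?thesis
  proof
    assume l: "lies_over S \<one>\<^bsub>pts G S\<^esub> x"
    then have "x \<in> carrier (E S)" using lies_overD(1) W_End by blast
    then show "x \<in> U S" using l com fixV unfolding lies_over_def U_iff[OF S] by simp
  next
    assume u: "x \<in> U S"
    then have "x \<in> carrier (W S)" using U_Units[OF S] by (simp add: GL_simps)
    then show "lies_over S \<one>\<^bsub>pts G S\<^esub> x" using u com fixV[OF W_End] unfolding lies_over_def U_iff[OF S] by simp
  qed
qed

lemma U_res:
  assumes S: "algebra K S" and T: "algebra K T" and phi: "\<phi> \<in> alg_hom K S T" and x: "x \<in> U S"
  shows "rs S T \<phi> x \<in> U T"
proof -
  interpret h: extension_hom K Q S T \<phi> using EH[OF S T phi] .
  have xE: "x \<in> carrier (E S)" "commutes S x" "fixes_V S x" using x U_iff[OF S] by auto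
  have "commutes T (rs S T \<phi> x)"
    unfolding commutes_def
  proof (intro allI impI)
    fix R \<psi> n assume R: "algebra K R" "\<psi> \<in> alg_hom K T R" "n \<in> N R"
    show "rs T R \<psi> (rs S T \<phi> x) \<otimes>\<^bsub>E R\<^esub> \<rho> R n = \<rho> R n \<otimes>\<^bsub>E R\<^esub> rs T R \<psi> (rs S T \<phi> x)"
      using commutesD[OF xE(2) R(1) alg_hom_comp[OF phi R(2) S] R(3)] res_comp[OF mQ S T R(1) phi R(2) xE(1)] by simp
  qed
  moreover have "fixes_V T (rs S T \<phi> x)"
    using xE(3) h.res_pt[OF xE(1)] h.bm_pt1 V_carrier unfolding fixes_V_def by simp
  ultimately show ?thesis using h.res_closed[OF xE(1)] U_iff[OF T] by simp
qed

lemma alpha_facts: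
  shows alpha_W: "\<And>S g. algebra K S \<Longrightarrow> g \<in> carrier (pts G S) \<Longrightarrow> \<alpha> S g \<in> carrier (W S)"
    and alpha_res: "\<And>S T \<phi> g. algebra K S \<Longrightarrow> algebra K T \<Longrightarrow> \<phi> \<in> alg_hom K S T \<Longrightarrow> g \<in> carrier (pts G S) \<Longrightarrow>
      \<alpha> T (res G S T \<phi> g) = rs S T \<phi> (\<alpha> S g)"
    and alpha_rho: "\<And>S g n. algebra K S \<Longrightarrow> g \<in> carrier (pts G S) \<Longrightarrow> n \<in> N S \<Longrightarrow>
      \<alpha> S g \<otimes>\<^bsub>W S\<^esub> \<rho> S n = \<rho> S (g \<otimes>\<^bsub>pts G S\<^esub> n \<otimes>\<^bsub>pts G S\<^esub> inv\<^bsub>pts G S\<^esub> g) \<otimes>\<^bsub>W S\<^esub> \<alpha> S g"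
    and alpha_one: "\<And>S. algebra K S \<Longrightarrow> \<alpha> S \<one>\<^bsub>pts G S\<^esub> = \<one>\<^bsub>W S\<^esub>"
    and alpha_mult_N: "\<And>S g n. algebra K S \<Longrightarrow> g \<in> carrier (pts G S) \<Longrightarrow> n \<in> N S \<Longrightarrow>
      \<alpha> S (g \<otimes>\<^bsub>pts G S\<^esub> n) = \<alpha> S g \<otimes>\<^bsub>W S\<^esub> \<rho> S n"
    and alpha_V: "\<And>S g v. algebra K S \<Longrightarrow> g \<in> carrier (pts G S) \<Longrightarrow> v \<in> carrier (VB S) \<Longrightarrow>
      \<alpha> S g (incl S v) = incl S (\<sigma> S g v)"
proof -
  note s = stable[unfolded strongly_stable_def]
  note m = scheme_morphismD[OF conjunct1[OF s]]
  show "\<And>S g. algebra K S \<Longrightarrow> g \<in> carrier (pts G S) \<Longrightarrow> \<alpha> S g \<in> carrier (W S)" by (rule m(1))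
  show "\<And>S T \<phi> g. algebra K S \<Longrightarrow> algebra K T \<Longrightarrow> \<phi> \<in> alg_hom K S T \<Longrightarrow> g \<in> carrier (pts G S) \<Longrightarrow>
      \<alpha> T (res G S T \<phi> g) = rs S T \<phi> (\<alpha> S g)" by (rule m(2))
  show "\<And>S g n. algebra K S \<Longrightarrow> g \<in> carrier (pts G S) \<Longrightarrow> n \<in> N S \<Longrightarrow>
      \<alpha> S g \<otimes>\<^bsub>W S\<^esub> \<rho> S n = \<rho> S (g \<otimes>\<^bsub>pts G S\<^esub> n \<otimes>\<^bsub>pts G S\<^esub> inv\<^bsub>pts G S\<^esub> g) \<otimes>\<^bsub>W S\<^esub> \<alpha> S g"
    using conjunct1[OF conjunct2[OF s]] by blast
  show "\<And>S. algebra K S \<Longrightarrow> \<alpha> S \<one>\<^bsub>pts G S\<^esub> = \<one>\<^bsub>W S\<^esub>"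
    using conjunct1[OF conjunct2[OF s]] by blast
  show "\<And>S g n. algebra K S \<Longrightarrow> g \<in> carrier (pts G S) \<Longrightarrow> n \<in> N S \<Longrightarrow>
      \<alpha> S (g \<otimes>\<^bsub>pts G S\<^esub> n) = \<alpha> S g \<otimes>\<^bsub>W S\<^esub> \<rho> S n"
    using conjunct1[OF conjunct2[OF s]] by blast
  show "\<And>S g v. algebra K S \<Longrightarrow> g \<in> carrier (pts G S) \<Longrightarrow> v \<in> carrier (VB S) \<Longrightarrow>
      \<alpha> S g (incl S v) = incl S (\<sigma> S g v)"
    using conjunct2[OF conjunct2[OF s]] unfolding agrees_on_def by blast
qed

lemma alpha_N: "algebra K S \<Longrightarrow> n \<in> N S \<Longrightarrow> \<alpha> S n = \<rho> S n"
proof -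
  assume S: "algebra K S" and n: "n \<in> N S"
  interpret GS: group "pts G S" by (rule group_functorD(1)[OF G S])
  interpret WS: group "W S" by (rule group_W[OF S])
  show ?thesis using alpha_mult_N[OF S GS.one_closed n] alpha_one[OF S] N_sub[OF S n] rho_W[OF S n] by simp
qed

lemma lies_over_alpha:
  assumes S: "algebra K S" and g: "g \<in> carrier (pts G S)"
  shows "lies_over S g (\<alpha> S g)"
  unfolding lies_over_def
proof (intro conjI allI impI ballI)
  fix T \<phi> n assume T: "algebra K T" and phi: "\<phi> \<in> alg_hom K S T" and n: "n \<in> N T"
  show "rs S T \<phi> (\<alpha> S g) \<otimes>\<^bsub>W T\<^esub> \<rho> T n =
       \<rho> T (res G S T \<phi> g \<otimes>\<^bsub>pts G T\<^esub> n \<otimes>\<^bsub>pts G T\<^esub> inv\<^bsub>pts G T\<^esub> (res G S T \<phi> g)) \<otimes>\<^bsub>W T\<^esub> rs S T \<phi> (\<alpha> S g)"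
    using alpha_rho[OF T group_functorD(5)[OF G S T phi g] n] alpha_res[OF S T phi g] by simp
qed (use alpha_W[OF S g] alpha_V[OF S g] in auto)

abbreviation "D \<equiv> G_diamond K G N Q \<rho> V \<alpha>"

lemma D_carrier: "carrier (pts D S) = U S \<times> carrier (pts G S)"
  and D_one: "\<one>\<^bsub>pts D S\<^esub> = (\<one>\<^bsub>W S\<^esub>, \<one>\<^bsub>pts G S\<^esub>)"
  and D_res: "res D S T \<phi> (x, g) = (rs S T \<phi> x, res G S T \<phi> g)"
  by (simp_all add: G_diamond_def)

lemma U_W: "algebra K S \<Longrightarrow> x \<in> U S \<Longrightarrow> x \<in> carrier (W S)"
  using lies_over_one_iff lies_overD(1) by blast

text \<open>After multiplication by \<open>\<alpha>(gh)\<close> the first component is the product of \<open>x \<alpha>(g)\<close> and \<open>y \<alpha>(h)\<close>: in the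
  coordinates \<open>(x \<alpha>(g), g)\<close> multiplication is componentwise.\<close>

lemma D_mult:
  assumes S: "algebra K S" and x: "x \<in> U S" and g: "g \<in> carrier (pts G S)" and y: "y \<in> U S" and h: "h \<in> carrier (pts G S)"
  shows "(x, g) \<otimes>\<^bsub>pts D S\<^esub> (y, h) =
    ((x \<otimes>\<^bsub>W S\<^esub> \<alpha> S g) \<otimes>\<^bsub>W S\<^esub> (y \<otimes>\<^bsub>W S\<^esub> \<alpha> S h) \<otimes>\<^bsub>W S\<^esub> inv\<^bsub>W S\<^esub> (\<alpha> S (g \<otimes>\<^bsub>pts G S\<^esub> h)), g \<otimes>\<^bsub>pts G S\<^esub> h)"
proof -
  interpret GS: group "pts G S" by (rule group_functorD(1)[OF G S])
  interpret WS: group "W S" by (rule group_W[OF S])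
  have c: "x \<in> carrier (W S)" "y \<in> carrier (W S)" "\<alpha> S g \<in> carrier (W S)" "\<alpha> S h \<in> carrier (W S)" "\<alpha> S (g \<otimes>\<^bsub>pts G S\<^esub> h) \<in> carrier (W S)"
    using U_W[OF S] x y alpha_W[OF S] g h by auto
  have l: "inv\<^bsub>W S\<^esub> a \<otimes>\<^bsub>W S\<^esub> (a \<otimes>\<^bsub>W S\<^esub> b) = b" if "a \<in> carrier (W S)" "b \<in> carrier (W S)" for a b
    using that by (simp add: WS.m_assoc[symmetric])
  show ?thesis using c by (simp add: G_diamond_def gamma_def WS.m_assoc l)
qed

lemma lies_over_UE:
  assumes S: "algebra K S" and g: "g \<in> carrier (pts G S)" and y: "lies_over S g y"
  shows "y \<otimes>\<^bsub>W S\<^esub> inv\<^bsub>W S\<^esub> (\<alpha> S g) \<in> U S"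
proof -
  interpret GS: group "pts G S" by (rule group_functorD(1)[OF G S])
  show ?thesis
    using lies_over_mult[OF S g _ y lies_over_inv[OF S g lies_over_alpha[OF S g]]] g lies_over_one_iff[OF S] by simp
qed

lemma lies_over_UI:
  assumes S: "algebra K S" and g: "g \<in> carrier (pts G S)" and x: "x \<in> U S"
  shows "lies_over S g (x \<otimes>\<^bsub>W S\<^esub> \<alpha> S g)"
proof -
  interpret GS: group "pts G S" by (rule group_functorD(1)[OF G S])
  show ?thesis
    using lies_over_mult[OF S GS.one_closed g _ lies_over_alpha[OF S g]] x g lies_over_one_iff[OF S] by simp
qed

lemma D_mult_closed:
  assumes S: "algebra K S" and x: "x \<in> U S" and g: "g \<in> carrier (pts G S)" and y: "y \<in> U S" and h: "h \<in> carrier (pts G S)"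
  shows "(x \<otimes>\<^bsub>W S\<^esub> \<alpha> S g) \<otimes>\<^bsub>W S\<^esub> (y \<otimes>\<^bsub>W S\<^esub> \<alpha> S h) \<otimes>\<^bsub>W S\<^esub> inv\<^bsub>W S\<^esub> (\<alpha> S (g \<otimes>\<^bsub>pts G S\<^esub> h)) \<in> U S"
proof -
  interpret GS: group "pts G S" by (rule group_functorD(1)[OF G S])
  show ?thesis
    by (rule lies_over_UE[OF S _ lies_over_mult[OF S g h lies_over_UI[OF S g x] lies_over_UI[OF S h y]]]) (use g h in simp)
qed

lemma group_D: assumes S: "algebra K S" shows "group (pts D S)"
proof (rule groupI)
  interpret GS: group "pts G S" by (rule group_functorD(1)[OF G S])
  interpret WS: group "W S" by (rule group_W[OF S])
  have U1: "\<one>\<^bsub>W S\<^esub> \<in> U S"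
    using lies_over_alpha[OF S GS.one_closed] alpha_one[OF S] lies_over_one_iff[OF S] by simp
  show "\<one>\<^bsub>pts D S\<^esub> \<in> carrier (pts D S)" using U1 by (simp add: D_carrier D_one)
  fix a assume "a \<in> carrier (pts D S)"
  then obtain x g where a: "a = (x, g)" "x \<in> U S" "g \<in> carrier (pts G S)" by (auto simp: D_carrier)
  note ca = U_W[OF S a(2)] alpha_W[OF S a(3)]
  show "\<one>\<^bsub>pts D S\<^esub> \<otimes>\<^bsub>pts D S\<^esub> a = a"
    using a ca by (simp add: D_one D_mult[OF S U1 GS.one_closed a(2,3)] alpha_one[OF S] WS.m_assoc)
  { fix b assume "b \<in> carrier (pts D S)"
    then obtain y h where b: "b = (y, h)" "y \<in> U S" "h \<in> carrier (pts G S)" by (auto simp: D_carrier)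
    note cb = U_W[OF S b(2)] alpha_W[OF S b(3)]
    show "a \<otimes>\<^bsub>pts D S\<^esub> b \<in> carrier (pts D S)"
      using a b D_mult_closed[OF S a(2,3) b(2,3)] by (simp add: D_mult[OF S a(2,3) b(2,3)] D_carrier)
    fix c assume "c \<in> carrier (pts D S)"
    then obtain z k where c: "c = (z, k)" "z \<in> U S" "k \<in> carrier (pts G S)" by (auto simp: D_carrier)
    note cc = U_W[OF S c(2)] alpha_W[OF S c(3)]
    have gh: "g \<otimes>\<^bsub>pts G S\<^esub> h \<in> carrier (pts G S)" and hk: "h \<otimes>\<^bsub>pts G S\<^esub> k \<in> carrier (pts G S)" using a b c by auto
    define p where "p = (x \<otimes>\<^bsub>W S\<^esub> \<alpha> S g) \<otimes>\<^bsub>W S\<^esub> (y \<otimes>\<^bsub>W S\<^esub> \<alpha> S h) \<otimes>\<^bsub>W S\<^esub> inv\<^bsub>W S\<^esub> (\<alpha> S (g \<otimes>\<^bsub>pts G S\<^esub> h))"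
    define q where "q = (y \<otimes>\<^bsub>W S\<^esub> \<alpha> S h) \<otimes>\<^bsub>W S\<^esub> (z \<otimes>\<^bsub>W S\<^esub> \<alpha> S k) \<otimes>\<^bsub>W S\<^esub> inv\<^bsub>W S\<^esub> (\<alpha> S (h \<otimes>\<^bsub>pts G S\<^esub> k))"
    have pU: "p \<in> U S" and qU: "q \<in> U S"
      unfolding p_def q_def by (rule D_mult_closed[OF S a(2,3) b(2,3)] D_mult_closed[OF S b(2,3) c(2,3)])+
    have "p \<otimes>\<^bsub>W S\<^esub> \<alpha> S (g \<otimes>\<^bsub>pts G S\<^esub> h) = (x \<otimes>\<^bsub>W S\<^esub> \<alpha> S g) \<otimes>\<^bsub>W S\<^esub> (y \<otimes>\<^bsub>W S\<^esub> \<alpha> S h)"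
      "q \<otimes>\<^bsub>W S\<^esub> \<alpha> S (h \<otimes>\<^bsub>pts G S\<^esub> k) = (y \<otimes>\<^bsub>W S\<^esub> \<alpha> S h) \<otimes>\<^bsub>W S\<^esub> (z \<otimes>\<^bsub>W S\<^esub> \<alpha> S k)"
      using ca cb cc alpha_W[OF S gh] alpha_W[OF S hk] by (simp_all add: p_def q_def WS.m_assoc)
    then show "a \<otimes>\<^bsub>pts D S\<^esub> b \<otimes>\<^bsub>pts D S\<^esub> c = a \<otimes>\<^bsub>pts D S\<^esub> (b \<otimes>\<^bsub>pts D S\<^esub> c)"
      unfolding a(1) b(1) c(1) D_mult[OF S a(2,3) b(2,3)] D_mult[OF S b(2,3) c(2,3)] p_def[symmetric] q_def[symmetric]
        D_mult[OF S pU gh c(2,3)] D_mult[OF S a(2,3) qU hk]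
      using ca cb cc a b c alpha_W[OF S, of "g \<otimes>\<^bsub>pts G S\<^esub> (h \<otimes>\<^bsub>pts G S\<^esub> k)"] hk
      by (simp add: WS.m_assoc GS.m_assoc) }
  let ?h = "inv\<^bsub>pts G S\<^esub> g"
  let ?y = "inv\<^bsub>W S\<^esub> (x \<otimes>\<^bsub>W S\<^esub> \<alpha> S g) \<otimes>\<^bsub>W S\<^esub> inv\<^bsub>W S\<^esub> (\<alpha> S ?h)"
  have h: "?h \<in> carrier (pts G S)" using a by simp
  have y: "?y \<in> U S" by (rule lies_over_UE[OF S h lies_over_inv[OF S a(3) lies_over_UI[OF S a(3,2)]]])
  have "(?y, ?h) \<otimes>\<^bsub>pts D S\<^esub> a = \<one>\<^bsub>pts D S\<^esub>"
    using a ca alpha_W[OF S h] by (simp add: D_mult[OF S y h a(2,3)] D_one alpha_one[OF S] WS.m_assoc)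
  then show "\<exists>b\<in>carrier (pts D S). b \<otimes>\<^bsub>pts D S\<^esub> a = \<one>\<^bsub>pts D S\<^esub>" using y h by (intro bexI[of _ "(?y, ?h)"]) (auto simp: D_carrier)
qed

lemma group_functor_D: "group_functor K D"
  unfolding group_functor_def
proof (intro conjI allI impI ballI; (elim conjE)?)
  show "group (pts D S)" if "algebra K S" for S using group_D[OF that] .
  show "res D S S (\<lambda>x\<in>carrier S. x) g = g" if S: "algebra K S" and g: "g \<in> carrier (pts D S)" for S :: "('k, 's) module" and g
  proof -
    obtain x h where g': "g = (x, h)" "x \<in> U S" "h \<in> carrier (pts G S)" using g by (auto simp: D_carrier)
    have "rs S S (\<lambda>x\<in>carrier S. x) x = x" by (rule res_id[OF mQ S W_End[OF U_W[OF S g'(2)]]])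
    moreover have "res G S S (\<lambda>x\<in>carrier S. x) h = h" by (rule group_functorD(3)[OF G S g'(3)])
    ultimately show ?thesis unfolding g'(1) D_res by (simp only:)
  qed
  fix S T :: "('k, 's) module" and \<phi> assume S: "algebra K S" and T: "algebra K T" and phi: "\<phi> \<in> alg_hom K S T"
  show "res D S T \<phi> \<in> hom (pts D S) (pts D T)"
  proof (rule homI)
    fix a assume "a \<in> carrier (pts D S)"
    then obtain x g where a: "a = (x, g)" "x \<in> U S" "g \<in> carrier (pts G S)" by (auto simp: D_carrier)
    note xT = U_res[OF S T phi a(2)] and gT = group_functorD(5)[OF G S T phi a(3)]
    show "res D S T \<phi> a \<in> carrier (pts D T)" using a xT gT by (simp add: D_res D_carrier)
    fix b assume "b \<in> carrier (pts D S)"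
    then obtain y h where b: "b = (y, h)" "y \<in> U S" "h \<in> carrier (pts G S)" by (auto simp: D_carrier)
    note yT = U_res[OF S T phi b(2)] and hT = group_functorD(5)[OF G S T phi b(3)]
    interpret GS: group "pts G S" by (rule group_functorD(1)[OF G S])
    interpret r: group_hom "W S" "W T" "rs S T \<phi>"
      by (intro group_hom.intro group_hom_axioms.intro W_res[OF S T phi] group_W S T)
    have gh: "g \<otimes>\<^bsub>pts G S\<^esub> h \<in> carrier (pts G S)" using a b by simp
    note c = U_W[OF S a(2)] U_W[OF S b(2)] alpha_W[OF S a(3)] alpha_W[OF S b(3)] alpha_W[OF S gh]
    have rg: "res G S T \<phi> (g \<otimes>\<^bsub>pts G S\<^esub> h) = res G S T \<phi> g \<otimes>\<^bsub>pts G T\<^esub> res G S T \<phi> h"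
      using hom_mult[OF group_functorD(2)[OF G S T phi] a(3) b(3)] .
    show "res D S T \<phi> (a \<otimes>\<^bsub>pts D S\<^esub> b) = res D S T \<phi> a \<otimes>\<^bsub>pts D T\<^esub> res D S T \<phi> b"
      using c by (simp add: a(1) b(1) D_mult[OF S a(2,3) b(2,3)] D_res D_mult[OF T xT gT yT hT] rg[symmetric]
          alpha_res[OF S T phi a(3)] alpha_res[OF S T phi b(3)] alpha_res[OF S T phi gh])
  qed
  fix R :: "('k, 's) module" and \<psi> a assume R: "algebra K R" and psi: "\<psi> \<in> alg_hom K T R" and "a \<in> carrier (pts D S)"
  then obtain x g where a: "a = (x, g)" "x \<in> U S" "g \<in> carrier (pts G S)" by (auto simp: D_carrier)
  show "res D S R (compose (carrier S) \<psi> \<phi>) a = res D T R \<psi> (res D S T \<phi> a)"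
    unfolding a(1) D_res using res_comp[OF mQ S T R phi psi W_End[OF U_W[OF S a(2)]]] group_functorD(4)[OF G S T R phi psi a(3)] by simp
qed

section \<open>Extensions of the action and splittings\<close>

text \<open>The splitting is \<open>g \<mapsto> (\<tau>(g) \<alpha>(g)\<^sup>-\<^sup>1, g)\<close>.\<close>

lemma action_extends_imp_diamond_split:
  assumes "action_extends K G N Q \<rho> V \<sigma>" shows "diamond_split K G N Q \<rho> V \<alpha>"
proof -
  obtain \<tau> where tau: "group_morphism K G (GL K Q) \<tau>" and tN: "\<And>S n. algebra K S \<Longrightarrow> n \<in> N S \<Longrightarrow> \<tau> S n = \<rho> S n"
    and tV: "agrees_on K G Q V \<sigma> \<tau>"
    using assms unfolding action_extends_def by blast
  note t = scheme_morphismD[OF group_morphismD(1)[OF tau]]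
  have lo: "lies_over S g (\<tau> S g)" if S: "algebra K S" and g: "g \<in> carrier (pts G S)" for S g
    unfolding lies_over_def
  proof (intro conjI allI impI ballI)
    show "\<tau> S g \<in> carrier (W S)" by (rule t(1)[OF S g])
    show "\<tau> S g (incl S v) = incl S (\<sigma> S g v)" if "v \<in> carrier (VB S)" for v
      using tV S g that unfolding agrees_on_def by blast
    fix T \<phi> n assume T: "algebra K T" and phi: "\<phi> \<in> alg_hom K S T" and n: "n \<in> N T"
    interpret GT: group "pts G T" by (rule group_functorD(1)[OF G T])
    interpret WT: group "W T" by (rule group_W[OF T])
    let ?g = "res G S T \<phi> g"
    have gT: "?g \<in> carrier (pts G T)" by (rule group_functorD(5)[OF G S T phi g])
    note nc = N_sub[OF T n] and n' = conj_N[OF T gT n]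
    have "\<tau> T ?g \<otimes>\<^bsub>W T\<^esub> \<tau> T n = \<tau> T (?g \<otimes>\<^bsub>pts G T\<^esub> n \<otimes>\<^bsub>pts G T\<^esub> inv\<^bsub>pts G T\<^esub> ?g) \<otimes>\<^bsub>W T\<^esub> \<tau> T ?g"
      using group_morphismD(3)[OF tau T gT nc] group_morphismD(3)[OF tau T N_sub[OF T n'] gT] gT nc
      by (simp add: GT.m_assoc)
    then show "rs S T \<phi> (\<tau> S g) \<otimes>\<^bsub>W T\<^esub> \<rho> T n = \<rho> T (?g \<otimes>\<^bsub>pts G T\<^esub> n \<otimes>\<^bsub>pts G T\<^esub> inv\<^bsub>pts G T\<^esub> ?g) \<otimes>\<^bsub>W T\<^esub> rs S T \<phi> (\<tau> S g)"
      using tN[OF T n] tN[OF T n'] t(2)[OF S T phi g] by simp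
  qed
  define s where "s S g = (\<tau> S g \<otimes>\<^bsub>W S\<^esub> inv\<^bsub>W S\<^esub> (\<alpha> S g), g)" for S g
  have sc: "\<tau> S g \<otimes>\<^bsub>W S\<^esub> inv\<^bsub>W S\<^esub> (\<alpha> S g) \<in> U S" if "algebra K S" "g \<in> carrier (pts G S)" for S g
    using lies_over_UE[OF that lo[OF that]] .
  have "group_morphism K G D s"
    unfolding group_morphism_def scheme_morphism_def hom_def
  proof (intro conjI allI impI ballI CollectI Pi_I; (elim conjE)?)
    fix S :: "('k, 's) module" and g assume S: "algebra K S" and g: "g \<in> carrier (pts G S)"
    show "s S g \<in> carrier (pts D S)" "s S g \<in> carrier (pts D S)" using sc[OF S g] g by (simp_all add: s_def D_carrier)
    fix h assume h: "h \<in> carrier (pts G S)"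
    interpret WS: group "W S" by (rule group_W[OF S])
    show "s S (g \<otimes>\<^bsub>pts G S\<^esub> h) = s S g \<otimes>\<^bsub>pts D S\<^esub> s S h"
      using t(1)[OF S g] t(1)[OF S h] alpha_W[OF S g] alpha_W[OF S h]
      by (simp add: s_def D_mult[OF S sc[OF S g] g sc[OF S h] h] WS.m_assoc group_morphismD(3)[OF tau S g h])
  next
    fix S T :: "('k, 's) module" and \<phi> g assume S: "algebra K S" and T: "algebra K T" and phi: "\<phi> \<in> alg_hom K S T" and g: "g \<in> carrier (pts G S)"
    interpret r: group_hom "W S" "W T" "rs S T \<phi>"
      by (intro group_hom.intro group_hom_axioms.intro W_res[OF S T phi] group_W S T)
    show "s T (res G S T \<phi> g) = res D S T \<phi> (s S g)"
      using t(1)[OF S g] alpha_W[OF S g] by (simp add: s_def D_res t(2)[OF S T phi g] alpha_res[OF S T phi g])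
  qed
  moreover have "s S n = iota K Q S n" if S: "algebra K S" and n: "n \<in> N S" for S n
  proof -
    interpret WS: group "W S" by (rule group_W[OF S])
    show ?thesis using rho_W[OF S n] by (simp add: s_def iota_def tN[OF S n] alpha_N[OF S n])
  qed
  ultimately show ?thesis unfolding diamond_split_def splits_def by (intro exI[of _ s]) (auto simp: s_def)
qed

text \<open>A splitting \<open>g \<mapsto> (x\<^sub>g, g)\<close> yields the action \<open>\<tau>(g) = x\<^sub>g \<alpha>(g)\<close>.\<close>

lemma diamond_split_imp_action_extends:
  assumes "diamond_split K G N Q \<rho> V \<alpha>" shows "action_extends K G N Q \<rho> V \<sigma>"
proof -
  obtain s where s: "group_morphism K G D s" and sp: "\<And>S g. algebra K S \<Longrightarrow> g \<in> carrier (pts G S) \<Longrightarrow> snd (s S g) = g"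
    and sN: "\<And>S n. algebra K S \<Longrightarrow> n \<in> N S \<Longrightarrow> s S n = iota K Q S n"
    using assms unfolding diamond_split_def splits_def by blast
  note s' = scheme_morphismD[OF group_morphismD(1)[OF s]]
  define x where "x S g = fst (s S g)" for S g
  have sx: "s S g = (x S g, g)" if "algebra K S" "g \<in> carrier (pts G S)" for S g
    using sp[OF that] by (simp add: x_def prod_eq_iff)
  have xU: "x S g \<in> U S" if "algebra K S" "g \<in> carrier (pts G S)" for S g
    using s'(1)[OF that] sx[OF that] by (simp add: D_carrier)
  define \<tau> where "\<tau> S g = x S g \<otimes>\<^bsub>W S\<^esub> \<alpha> S g" for S g
  have lo: "lies_over S g (\<tau> S g)" if "algebra K S" "g \<in> carrier (pts G S)" for S g
    unfolding \<tau>_def by (rule lies_over_UI[OF that xU[OF that]])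
  have "group_morphism K G (GL K Q) \<tau>"
    unfolding group_morphism_def scheme_morphism_def hom_def
  proof (intro conjI allI impI ballI CollectI Pi_I; (elim conjE)?)
    fix S :: "('k, 's) module" and g assume S: "algebra K S" and g: "g \<in> carrier (pts G S)"
    show "\<tau> S g \<in> carrier (W S)" "\<tau> S g \<in> carrier (W S)" by (rule lies_overD(1)[OF lo[OF S g]])+
    fix h assume h: "h \<in> carrier (pts G S)"
    interpret WS: group "W S" by (rule group_W[OF S])
    interpret GS: group "pts G S" by (rule group_functorD(1)[OF G S])
    have gh: "g \<otimes>\<^bsub>pts G S\<^esub> h \<in> carrier (pts G S)" using g h by simp
    have "x S (g \<otimes>\<^bsub>pts G S\<^esub> h) = \<tau> S g \<otimes>\<^bsub>W S\<^esub> \<tau> S h \<otimes>\<^bsub>W S\<^esub> inv\<^bsub>W S\<^esub> (\<alpha> S (g \<otimes>\<^bsub>pts G S\<^esub> h))"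
      using group_morphismD(3)[OF s S g h] by (simp add: sx[OF S g] sx[OF S h] sx[OF S gh] D_mult[OF S xU[OF S g] g xU[OF S h] h] \<tau>_def)
    then show "\<tau> S (g \<otimes>\<^bsub>pts G S\<^esub> h) = \<tau> S g \<otimes>\<^bsub>W S\<^esub> \<tau> S h"
      using lies_overD(1)[OF lo[OF S g]] lies_overD(1)[OF lo[OF S h]] alpha_W[OF S gh]
      unfolding \<tau>_def[of S "g \<otimes>\<^bsub>pts G S\<^esub> h"] by (simp add: WS.m_assoc)
  next
    fix S T :: "('k, 's) module" and \<phi> g assume S: "algebra K S" and T: "algebra K T" and phi: "\<phi> \<in> alg_hom K S T" and g: "g \<in> carrier (pts G S)"
    have gT: "res G S T \<phi> g \<in> carrier (pts G T)" by (rule group_functorD(5)[OF G S T phi g])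
    have "x T (res G S T \<phi> g) = rs S T \<phi> (x S g)"
      using s'(2)[OF S T phi g] by (simp add: sx[OF S g] sx[OF T gT] D_res)
    then show "\<tau> T (res G S T \<phi> g) = rs S T \<phi> (\<tau> S g)"
      unfolding \<tau>_def using hom_mult[OF W_res[OF S T phi] U_W[OF S xU[OF S g]] alpha_W[OF S g]] alpha_res[OF S T phi g] by simp
  qed
  moreover have "\<tau> S n = \<rho> S n" if S: "algebra K S" and n: "n \<in> N S" for S n
  proof -
    interpret WS: group "W S" by (rule group_W[OF S])
    show ?thesis using sN[OF S n] rho_W[OF S n] by (simp add: \<tau>_def x_def iota_def alpha_N[OF S n])
  qed
  moreover have "agrees_on K G Q V \<sigma> \<tau>"
    unfolding agrees_on_def using lies_overD(3)[OF lo] by blast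
  ultimately show ?thesis unfolding action_extends_def by blast
qed

end

section \<open>Splittings of the quotient by \<open>N\<close>\<close>

context stable_pair begin

lemma D_snd: "snd (a \<otimes>\<^bsub>pts D S\<^esub> b) = snd a \<otimes>\<^bsub>pts G S\<^esub> snd b"
  by (simp add: G_diamond_def split: prod.splits)

lemma D_snd_closed: "a \<in> carrier (pts D S) \<Longrightarrow> snd a \<in> carrier (pts G S)"
  by (auto simp: D_carrier)

lemma D_snd_res: "snd (res D S T \<phi> a) = res G S T \<phi> (snd a)"
  by (cases a) (simp add: D_res)

lemma D_snd_morphism: "group_morphism K D G (\<lambda>S. snd)"
  unfolding group_morphism_def scheme_morphism_def hom_def
  by (auto simp: D_snd D_snd_res D_snd_closed)

lemma iota_D: "algebra K S \<Longrightarrow> n \<in> N S \<Longrightarrow> iota K Q S n \<in> carrier (pts D S)"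
proof -
  assume S: "algebra K S" and n: "n \<in> N S"
  interpret D: group "pts D S" by (rule group_D[OF S])
  have "\<one>\<^bsub>W S\<^esub> \<in> U S" using D.one_closed by (simp add: D_one D_carrier)
  then show ?thesis using N_sub[OF S n] by (simp add: iota_def D_carrier)
qed

text \<open>\<open>G\<^sup>\<diamond>\<close> is a subfunctor of \<open>G\<^sup>\<diamond>/\<iota>(N) \<times> G\<close>, because the kernel \<open>\<iota>(N)\<close> of the first projection meets the
  kernel of the second trivially.\<close>

lemma D_inj:
  assumes \<Gamma>: "group_functor K \<Gamma>" and q: "is_quotient K D (\<lambda>S. iota K Q S ` N S) \<Gamma> \<pi>" and S: "algebra K S"
    and a: "a \<in> carrier (pts D S)" and b: "b \<in> carrier (pts D S)" and eq: "\<pi> S a = \<pi> S b" "snd a = snd b"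
  shows "a = b"
proof -
  interpret D: group "pts D S" by (rule group_D[OF S])
  interpret GS: group "pts G S" by (rule group_functorD(1)[OF G S])
  let ?c = "inv\<^bsub>pts D S\<^esub> a \<otimes>\<^bsub>pts D S\<^esub> b"
  have b_eq: "b = a \<otimes>\<^bsub>pts D S\<^esub> ?c" using a b by (simp add: D.m_assoc[symmetric])
  obtain n where n: "n \<in> N S" "?c = iota K Q S n"
    using quotient_lift_diff[OF group_functor_D \<Gamma> q S a b eq(1)] by blast
  have "snd b = snd a \<otimes>\<^bsub>pts G S\<^esub> n" using b_eq n(2) D_snd[of S a ?c] by (simp add: iota_def)
  then have "n = \<one>\<^bsub>pts G S\<^esub>" using eq(2) D_snd_closed[OF a] N_sub[OF S n(1)] by simp
  then have "?c = \<one>\<^bsub>pts D S\<^esub>" using n(2) by (simp add: iota_def D_one)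
  then show "a = b" using b_eq a by simp
qed

text \<open>Both \<open>p\<close> and its section are induced by the universal property. That they compose to the identity of
  \<open>G/N\<close> can be checked on points of \<open>G\<close>.\<close>

lemma diamond_split_imp_quotient_split:
  assumes \<Gamma>1: "group_functor K \<Gamma>\<^sub>1" "represents K \<Gamma>\<^sub>1 C1 c1" and \<Gamma>2: "group_functor K \<Gamma>\<^sub>2" "represents K \<Gamma>\<^sub>2 C2 c2"
    and q1: "is_quotient K D (\<lambda>S. iota K Q S ` N S) \<Gamma>\<^sub>1 \<pi>\<^sub>1" and q2: "is_quotient K G N \<Gamma>\<^sub>2 \<pi>\<^sub>2"
    and split: "diamond_split K G N Q \<rho> V \<alpha>"
  shows "quotient_split K D \<Gamma>\<^sub>1 \<pi>\<^sub>1 \<Gamma>\<^sub>2 \<pi>\<^sub>2"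
proof -
  obtain s where s: "group_morphism K G D s" and sp: "\<And>S g. algebra K S \<Longrightarrow> g \<in> carrier (pts G S) \<Longrightarrow> snd (s S g) = g"
    and sN: "\<And>S n. algebra K S \<Longrightarrow> n \<in> N S \<Longrightarrow> s S n = iota K Q S n"
    using split unfolding diamond_split_def splits_def by blast
  have pi1: "group_morphism K D \<Gamma>\<^sub>1 \<pi>\<^sub>1" and pi2: "group_morphism K G \<Gamma>\<^sub>2 \<pi>\<^sub>2"
    using q1 q2 unfolding is_quotient_def by auto
  have "group_morphism K D \<Gamma>\<^sub>2 (\<lambda>S z. \<pi>\<^sub>2 S (snd z))"
    by (rule group_morphism_comp[OF D_snd_morphism pi2])
  moreover have "\<pi>\<^sub>2 S (snd z) = \<one>\<^bsub>pts \<Gamma>\<^sub>2 S\<^esub>" if "algebra K S" "z \<in> iota K Q S ` N S" for S z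
    using quotient_kernel(2)[OF q2 that(1)] that(2) by (auto simp: iota_def)
  ultimately obtain p where p: "group_morphism K \<Gamma>\<^sub>1 \<Gamma>\<^sub>2 p"
    and pp: "\<And>S z. algebra K S \<Longrightarrow> z \<in> carrier (pts D S) \<Longrightarrow> p S (\<pi>\<^sub>1 S z) = \<pi>\<^sub>2 S (snd z)"
    using quotient_universal[OF inf group_functor_D \<Gamma>1(1) q1 \<Gamma>2, of "\<lambda>S z. \<pi>\<^sub>2 S (snd z)"] by blast
  have "group_morphism K G \<Gamma>\<^sub>1 (\<lambda>S g. \<pi>\<^sub>1 S (s S g))"
    by (rule group_morphism_comp[OF s pi1])
  moreover have "\<pi>\<^sub>1 S (s S n) = \<one>\<^bsub>pts \<Gamma>\<^sub>1 S\<^esub>" if "algebra K S" "n \<in> N S" for S n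
    using quotient_kernel(2)[OF q1 that(1)] that(2) sN[OF that] by simp
  ultimately obtain t where t: "group_morphism K \<Gamma>\<^sub>2 \<Gamma>\<^sub>1 t"
    and tt: "\<And>S g. algebra K S \<Longrightarrow> g \<in> carrier (pts G S) \<Longrightarrow> t S (\<pi>\<^sub>2 S g) = \<pi>\<^sub>1 S (s S g)"
    using quotient_universal[OF inf G \<Gamma>2(1) q2 \<Gamma>1, of "\<lambda>S g. \<pi>\<^sub>1 S (s S g)"] by blast
  have "p S (t S y) = y" if S: "algebra K S" and y: "y \<in> carrier (pts \<Gamma>\<^sub>2 S)" for S y
  proof (rule quotient_epi[OF inf G \<Gamma>2(1) q2 \<Gamma>2 group_morphismD(1)[OF group_morphism_comp[OF t p]] _ _ S y])
    show "scheme_morphism K \<Gamma>\<^sub>2 \<Gamma>\<^sub>2 (\<lambda>S y. y)" by (auto simp: scheme_morphism_def)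
    show "p S (t S (\<pi>\<^sub>2 S g)) = \<pi>\<^sub>2 S g" if "algebra K S" "g \<in> carrier (pts G S)" for S g
      using tt[OF that] pp[OF that(1) scheme_morphismD(1)[OF group_morphismD(1)[OF s] that]] sp[OF that] by simp
  qed
  then show ?thesis unfolding quotient_split_def splits_def using p pp t by blast
qed

text \<open>
  \<open>G\<^sup>\<diamond>\<close> is the fibre product of \<open>G\<^sup>\<diamond>/\<iota>(N)\<close> and \<open>G\<close> over \<open>G/N\<close>. Over some \<open>T\<close> the point \<open>y\<close> lifts to \<open>d \<in> G\<^sup>\<diamond>(T)\<close>,
  and the image of \<open>d\<close> in \<open>G(T)\<close> differs from \<open>g\<close> by an element of \<open>N(T)\<close>, by which \<open>d\<close> can be corrected. The
  corrected lift is unique by \<open>D_inj\<close> and descends to \<open>S\<close>.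
\<close>

lemma fibre_product:
  assumes \<Gamma>1: "group_functor K \<Gamma>\<^sub>1" "represents K \<Gamma>\<^sub>1 C1 c1" and \<Gamma>2: "group_functor K \<Gamma>\<^sub>2" and GA: "represents K G A u"
    and q1: "is_quotient K D (\<lambda>S. iota K Q S ` N S) \<Gamma>\<^sub>1 \<pi>\<^sub>1" and q2: "is_quotient K G N \<Gamma>\<^sub>2 \<pi>\<^sub>2"
    and p: "group_morphism K \<Gamma>\<^sub>1 \<Gamma>\<^sub>2 p"
    and pp: "\<And>S z. algebra K S \<Longrightarrow> z \<in> carrier (pts D S) \<Longrightarrow> p S (\<pi>\<^sub>1 S z) = \<pi>\<^sub>2 S (snd z)"
    and S: "algebra K S" and y: "y \<in> carrier (pts \<Gamma>\<^sub>1 S)" and g: "g \<in> carrier (pts G S)" and yg: "p S y = \<pi>\<^sub>2 S g"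
  obtains z where "z \<in> carrier (pts D S)" "\<pi>\<^sub>1 S z = y" "snd z = g"
proof -
  have pi1: "group_morphism K D \<Gamma>\<^sub>1 \<pi>\<^sub>1" and ff1: "faithfully_flat_morphism K D \<Gamma>\<^sub>1 \<pi>\<^sub>1" and pi2: "group_morphism K G \<Gamma>\<^sub>2 \<pi>\<^sub>2"
    using q1 q2 unfolding is_quotient_def by auto
  note D = group_functor_D
  obtain A1 u1 where DA: "represents K D A1 u1" using ff1 unfolding faithfully_flat_morphism_def by blast
  note m1 = scheme_morphismD[OF group_morphismD(1)[OF pi1]] and m2 = scheme_morphismD[OF group_morphismD(1)[OF pi2]]
    and mp = scheme_morphismD[OF group_morphismD(1)[OF p]]
  obtain T i d where T: "algebra K T" and i: "i \<in> alg_hom K S T" "inj_on i (carrier S)"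
    and d: "d \<in> carrier (pts D T)" "\<pi>\<^sub>1 T d = res \<Gamma>\<^sub>1 S T i y"
    and desc: "\<And>t. t \<in> carrier T \<Longrightarrow> equalized K S T i (\<lambda>U f. f t) \<Longrightarrow> t \<in> i ` carrier S"
    using local_lifting[OF inf D \<Gamma>1(1) group_morphismD(1)[OF pi1] ff1 S y] by metis
  interpret GT: group "pts G T" by (rule group_functorD(1)[OF G T])
  interpret DT: group "pts D T" by (rule group_functorD(1)[OF D T])
  let ?g = "res G S T i g"
  have gT: "?g \<in> carrier (pts G T)" by (rule group_functorD(5)[OF G S T i(1) g])
  have sd: "snd d \<in> carrier (pts G T)" by (rule D_snd_closed[OF d(1)])
  have "\<pi>\<^sub>2 T (snd d) = \<pi>\<^sub>2 T ?g"
    using pp[OF T d(1)] d(2) mp(2)[OF S T i(1) y] yg m2(2)[OF S T i(1) g] by simp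
  then have n: "inv\<^bsub>pts G T\<^esub> (snd d) \<otimes>\<^bsub>pts G T\<^esub> ?g \<in> N T" (is "?n \<in> _")
    by (rule quotient_lift_diff[OF G \<Gamma>2 q2 T sd gT])
  define z where "z = d \<otimes>\<^bsub>pts D T\<^esub> iota K Q T ?n"
  have io: "iota K Q T ?n \<in> carrier (pts D T)" by (rule iota_D[OF T n])
  have zD: "z \<in> carrier (pts D T)" using d(1) io by (simp add: z_def)
  have zs: "snd z = ?g" using sd gT by (simp add: z_def D_snd) (simp add: iota_def GT.m_assoc[symmetric])
  have "\<pi>\<^sub>1 T (iota K Q T ?n) = \<one>\<^bsub>pts \<Gamma>\<^sub>1 T\<^esub>" using quotient_kernel(2)[OF q1 T] n by blast
  then have zy: "\<pi>\<^sub>1 T z = res \<Gamma>\<^sub>1 S T i y"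
    using group_morphismD(3)[OF pi1 T d(1) io] d(2) m1(1)[OF T d(1)] group.is_monoid[OF group_functorD(1)[OF \<Gamma>1(1) T]]
    by (simp add: z_def monoid.r_one)
  have "equalized K S T i (\<lambda>U f. res D T U f z)"
    unfolding equalized_def
  proof (intro allI impI, elim conjE)
    fix U :: "('k, 's) module" and f f'
    assume U: "algebra K U" "f \<in> alg_hom K T U" "f' \<in> alg_hom K T U" and e: "compose (carrier S) f i = compose (carrier S) f' i"
    have 1: "\<pi>\<^sub>1 U (res D T U f z) = res \<Gamma>\<^sub>1 S U (compose (carrier S) f i) y" if "f \<in> alg_hom K T U" for f
      using m1(2)[OF T U(1) that zD] zy group_functorD(4)[OF \<Gamma>1(1) S T U(1) i(1) that y] by simp
    have 2: "snd (res D T U f z) = res G S U (compose (carrier S) f i) g" if "f \<in> alg_hom K T U" for f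
      using zs group_functorD(4)[OF G S T U(1) i(1) that g] by (simp add: D_snd_res)
    show "res D T U f z = res D T U f' z"
      by (rule D_inj[OF \<Gamma>1(1) q1 U(1) group_functorD(5)[OF D T U(1,2) zD] group_functorD(5)[OF D T U(1,3) zD]])
        (simp_all only: 1[OF U(2)] 1[OF U(3)] 2[OF U(2)] 2[OF U(3)] e)
  qed
  then obtain w where w: "w \<in> carrier (pts D S)" "res D S T i w = z"
    using affine_descent[OF D DA S T i desc zD] by blast
  have "\<pi>\<^sub>1 S w = y"
    by (rule affine_res_inj[OF \<Gamma>1 S T i m1(1)[OF S w(1)] y]) (use m1(2)[OF S T i(1) w(1)] w(2) zy in simp)
  moreover have "snd w = g"
    by (rule affine_res_inj[OF G GA S T i D_snd_closed[OF w(1)] g]) (use D_snd_res[of S T i w] w(2) zs in simp)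
  ultimately show thesis using that w(1) by blast
qed

text \<open>With \<open>s : G/N \<rightarrow> G\<^sup>\<diamond>/\<iota>(N)\<close> the given splitting, \<open>g\<close> is sent to the unique point of \<open>G\<^sup>\<diamond>\<close> above
  \<open>s(gN)\<close> and \<open>g\<close>; uniqueness makes this natural and multiplicative.\<close>

lemma quotient_split_imp_diamond_split:
  assumes \<Gamma>1: "group_functor K \<Gamma>\<^sub>1" "represents K \<Gamma>\<^sub>1 C1 c1" and \<Gamma>2: "group_functor K \<Gamma>\<^sub>2" and GA: "represents K G A u"
    and q1: "is_quotient K D (\<lambda>S. iota K Q S ` N S) \<Gamma>\<^sub>1 \<pi>\<^sub>1" and q2: "is_quotient K G N \<Gamma>\<^sub>2 \<pi>\<^sub>2"
    and split: "quotient_split K D \<Gamma>\<^sub>1 \<pi>\<^sub>1 \<Gamma>\<^sub>2 \<pi>\<^sub>2"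
  shows "diamond_split K G N Q \<rho> V \<alpha>"
proof -
  have pi1: "group_morphism K D \<Gamma>\<^sub>1 \<pi>\<^sub>1" and pi2: "group_morphism K G \<Gamma>\<^sub>2 \<pi>\<^sub>2"
    using q1 q2 unfolding is_quotient_def by auto
  obtain p s where p: "group_morphism K \<Gamma>\<^sub>1 \<Gamma>\<^sub>2 p"
    and pp: "\<And>S z. algebra K S \<Longrightarrow> z \<in> carrier (pts D S) \<Longrightarrow> p S (\<pi>\<^sub>1 S z) = \<pi>\<^sub>2 S (snd z)"
    and s: "group_morphism K \<Gamma>\<^sub>2 \<Gamma>\<^sub>1 s" and ps: "\<And>S y. algebra K S \<Longrightarrow> y \<in> carrier (pts \<Gamma>\<^sub>2 S) \<Longrightarrow> p S (s S y) = y"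
    using split unfolding quotient_split_def splits_def by blast
  note D = group_functor_D
  define h where "h S g = s S (\<pi>\<^sub>2 S g)" for S g
  have h: "group_morphism K G \<Gamma>\<^sub>1 h" unfolding h_def by (rule group_morphism_comp[OF pi2 s])
  note m1 = scheme_morphismD[OF group_morphismD(1)[OF pi1]] and mh = scheme_morphismD[OF group_morphismD(1)[OF h]]
    and m2 = scheme_morphismD[OF group_morphismD(1)[OF pi2]]
  have ph: "p S (h S g) = \<pi>\<^sub>2 S g" if "algebra K S" "g \<in> carrier (pts G S)" for S g
    unfolding h_def using ps[OF that(1) m2(1)[OF that]] .
  have ex: "\<exists>z. z \<in> carrier (pts D S) \<and> \<pi>\<^sub>1 S z = h S g \<and> snd z = g" if "algebra K S" "g \<in> carrier (pts G S)" for S g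
    using fibre_product[OF \<Gamma>1 \<Gamma>2 GA q1 q2 p pp that(1) mh(1)[OF that] that(2) ph[OF that]] by metis
  define t where "t S g = (SOME z. z \<in> carrier (pts D S) \<and> \<pi>\<^sub>1 S z = h S g \<and> snd z = g)" for S g
  have t: "t S g \<in> carrier (pts D S)" "\<pi>\<^sub>1 S (t S g) = h S g" "snd (t S g) = g" if "algebra K S" "g \<in> carrier (pts G S)" for S g
    using someI_ex[OF ex[OF that], folded t_def] by auto
  have uniq: "z = t S (snd z)" if S: "algebra K S" and z: "z \<in> carrier (pts D S)" "\<pi>\<^sub>1 S z = h S (snd z)" for S z
    by (rule D_inj[OF \<Gamma>1(1) q1 S z(1) t(1)[OF S D_snd_closed[OF z(1)]]])
      (simp_all add: t[OF S D_snd_closed[OF z(1)]] z(2))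
  have "group_morphism K G D t"
    unfolding group_morphism_def scheme_morphism_def hom_def
  proof (intro conjI allI impI ballI CollectI Pi_I; (elim conjE)?)
    fix S :: "('k, 's) module" and g assume S: "algebra K S" and g: "g \<in> carrier (pts G S)"
    show "t S g \<in> carrier (pts D S)" "t S g \<in> carrier (pts D S)" by (rule t(1)[OF S g])+
    fix k assume k: "k \<in> carrier (pts G S)"
    interpret DS: group "pts D S" by (rule group_functorD(1)[OF D S])
    let ?z = "t S g \<otimes>\<^bsub>pts D S\<^esub> t S k"
    have sz: "snd ?z = g \<otimes>\<^bsub>pts G S\<^esub> k" using t(3)[OF S g] t(3)[OF S k] by (simp add: D_snd)
    have "?z = t S (snd ?z)"
      by (rule uniq[OF S]) (use t[OF S g] t[OF S k] sz group_morphismD(3)[OF pi1 S t(1)[OF S g] t(1)[OF S k]] group_morphismD(3)[OF h S g k] in simp_all)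
    then show "t S (g \<otimes>\<^bsub>pts G S\<^esub> k) = t S g \<otimes>\<^bsub>pts D S\<^esub> t S k" unfolding sz by simp
  next
    fix S T :: "('k, 's) module" and \<phi> g assume S: "algebra K S" and T: "algebra K T" and phi: "\<phi> \<in> alg_hom K S T" and g: "g \<in> carrier (pts G S)"
    let ?z = "res D S T \<phi> (t S g)"
    have sz: "snd ?z = res G S T \<phi> g" using t(3)[OF S g] by (simp add: D_snd_res)
    have "?z = t T (snd ?z)"
      by (rule uniq[OF T group_functorD(5)[OF D S T phi t(1)[OF S g]]])
        (simp add: sz m1(2)[OF S T phi t(1)[OF S g]] t(2)[OF S g] mh(2)[OF S T phi g])
    then show "t T (res G S T \<phi> g) = ?z" unfolding sz by simp
  qed
  moreover have "t S n = iota K Q S n" if S: "algebra K S" and n: "n \<in> N S" for S n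
  proof -
    have "\<pi>\<^sub>1 S (iota K Q S n) = \<one>\<^bsub>pts \<Gamma>\<^sub>1 S\<^esub>" using quotient_kernel(2)[OF q1 S] n by blast
    moreover have "h S n = \<one>\<^bsub>pts \<Gamma>\<^sub>1 S\<^esub>"
      unfolding h_def using quotient_kernel(2)[OF q2 S n] group_morphism_one[OF s \<Gamma>2 \<Gamma>1(1) S] by simp
    ultimately show ?thesis using uniq[OF S iota_D[OF S n]] by (simp add: iota_def)
  qed
  ultimately show ?thesis unfolding diamond_split_def splits_def using t(3) by blast
qed

end

theorem corollary3p7:
  fixes K :: "'k ring"
    and G :: "('k, 's, 'g) kgroup"
    and N :: "('k, 's) module \<Rightarrow> 'g set"
    and Q :: "('k, 'q) module"
    and \<rho> \<sigma> \<alpha> :: "('k, 's) module \<Rightarrow> 'g \<Rightarrow> ('q, 's) tens \<Rightarrow> ('q, 's) tens"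
    and V :: "'q set"
  assumes "algebraically_closed K"
    and universe: "carrier K \<lesssim> (UNIV :: 's set)"
    and "affine_algebraic_group K G" and "connected_group K G"
    and "closed_normal_subgroup K G N"
    and "finite_dimensional K Q"
    and "group_morphism K (subgroup_functor G N) (GL K Q) \<rho>"
    and "G_submodule K G N Q \<rho> V \<sigma>"
    and "socle K N Q \<rho> \<subseteq> V"
    and "strongly_stable K G N Q \<rho> V \<sigma> \<alpha>"
  shows "(action_extends K G N Q \<rho> V \<sigma> \<longleftrightarrow> diamond_split K G N Q \<rho> V \<alpha>) \<and>
    (\<forall>(\<Gamma>\<^sub>1 :: ('k, 's, 'x) kgroup) \<pi>\<^sub>1 (\<Gamma>\<^sub>2 :: ('k, 's, 'y) kgroup) \<pi>\<^sub>2.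
       is_quotient K (G_diamond K G N Q \<rho> V \<alpha>) (\<lambda>S. iota K Q S ` N S) \<Gamma>\<^sub>1 \<pi>\<^sub>1 \<and>
       is_quotient K G N \<Gamma>\<^sub>2 \<pi>\<^sub>2 \<longrightarrow>
       (diamond_split K G N Q \<rho> V \<alpha> \<longleftrightarrow>
        quotient_split K (G_diamond K G N Q \<rho> V \<alpha>) \<Gamma>\<^sub>1 \<pi>\<^sub>1 \<Gamma>\<^sub>2 \<pi>\<^sub>2))"
proof -
  interpret field K by (rule algebraically_closed.axioms(1)[OF assms(1)])
  have inf: "infinite (UNIV :: 's set)"
    using algebraically_closed_infinite[OF assms(1)] universe
    unfolding lepoll_def by (meson inj_on_finite)
  obtain A u where G: "group_functor K G" and A: "represents K G A u"
    using assms(3) unfolding affine_algebraic_group_def by blast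
  interpret stable_pair K G N Q \<rho> \<sigma> \<alpha> V
    by unfold_locales (fact inf G assms)+
  show ?thesis
  proof (intro conjI allI impI; (elim conjE)?)
    show "action_extends K G N Q \<rho> V \<sigma> \<longleftrightarrow> diamond_split K G N Q \<rho> V \<alpha>"
      using action_extends_imp_diamond_split diamond_split_imp_action_extends by blast
    fix \<Gamma>\<^sub>1 :: "('k, 's, 'x) kgroup" and \<Gamma>\<^sub>2 :: "('k, 's, 'y) kgroup" and \<pi>\<^sub>1 \<pi>\<^sub>2
    assume q: "is_quotient K (G_diamond K G N Q \<rho> V \<alpha>) (\<lambda>S. iota K Q S ` N S) \<Gamma>\<^sub>1 \<pi>\<^sub>1"
      "is_quotient K G N \<Gamma>\<^sub>2 \<pi>\<^sub>2"
    then obtain C1 c1 C2 c2 where \<Gamma>: "group_functor K \<Gamma>\<^sub>1" "represents K \<Gamma>\<^sub>1 C1 c1"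
      "group_functor K \<Gamma>\<^sub>2" "represents K \<Gamma>\<^sub>2 C2 c2"
      unfolding is_quotient_def affine_algebraic_group_def by blast
    show "diamond_split K G N Q \<rho> V \<alpha> \<longleftrightarrow> quotient_split K (G_diamond K G N Q \<rho> V \<alpha>) \<Gamma>\<^sub>1 \<pi>\<^sub>1 \<Gamma>\<^sub>2 \<pi>\<^sub>2"
      using diamond_split_imp_quotient_split[OF \<Gamma> q] quotient_split_imp_diamond_split[OF \<Gamma>(1-3) A q] by blast
  qed
qed

end
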